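(* Let $\{M_n\}_{n\ge 1}$ be an infinite sequence such that each $M_n$ is an orbital measure on $H(n)$, supported by a $U(n)$-orbit $\Omega_n\subset H(n)$. For $n=1,2,\dots$ pick a matrix $B_n\in\Omega_n$ and write the collection of its eigenvalues (with multiplicities; it does not depend on the choice of $B_n$) as a double sequence $\Lambda(n)=(\Lambda'(n),\Lambda''(n))$, where $$\Lambda'(n)=(\lambda'_1(n)\ge\lambda'_2(n)\ge\cdots\ge0),\qquad \Lambda''(n)=(\lambda''_1(n)\le\lambda''_2(n)\le\cdots\le0)$$ list the positive and the negative eigenvalues, respectively, in decreasing order of absolute value, both sequences being completed by zeros to infinite sequences with finitely many nonzero terms. (i) Suppose that the following limits exist: $$x'_k=\lim_{n\to\infty}\frac{\lambda'_k(n)}{n}\ge0,\qquad x''_k=\lim_{n\to\infty}\frac{\lambda''_k(n)}{n}\le0,\qquad k=1,2,\dots,$$ $$\gamma_1=\lim_{n\to\infty}\frac1n\sum_k(\lambda'_k(n)+\lambda''_k(n))=\lim_{n\to\infty}\frac1n\operatorname{tr}B_n,$$ $$\tilde\gamma_2=\lim_{n\to\infty}\frac1{n^2}\sum_k\big((\lambda'_k(n))^2+(\lambda''_k(n))^2\big)=\lim_{n\to\infty}\frac1{n^2}\operatorname{tr}(B_n^2).$$ Then the measures $M_n$, viewed as measures on $H$, weakly converge to an ergodic $U(\infty)$-invariant Borel probability measure $M$ on $H$ whose characteristic function $f$ is $$f(A)=\prod_{a\in\operatorname{Spec}(A)}F(a),\qquad A\in H(\infty),$$ where $$F(a)=e^{i\gamma_1a-\gamma_2a^2/2}\prod_k\frac{e^{-ix'_ka}}{1-ix'_ka}\prod_k\frac{e^{-ix''_ka}}{1-ix''_ka},\qquad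 a\in\mathbb R,$$ and $\gamma_2=\tilde\gamma_2-\sum_k((x'_k)^2+(x''_k)^2)$. (ii) Conversely, if the measures $M_n$, viewed as measures on $H$, weakly converge to a probability measure on $H$, then all the limits listed in (i) (namely $\lim\lambda'_k(n)/n$ and $\lim\lambda''_k(n)/n$ for every $k$, $\lim\frac1n\operatorname{tr}B_n$, and $\lim\frac1{n^2}\operatorname{tr}(B_n^2)$) exist.
   Context: $H(n)$ is the real vector space of $n\times n$ complex Hermitian matrices, embedded in $H(n+1)$ by $A\mapsto\begin{pmatrix}A&0\\0&0\end{pmatrix}$; $H(\infty)=\bigcup_n H(n)$ is the space of $\infty\times\infty$ Hermitian matrices with finitely many nonzero entries. $H=\varprojlim H(n)$ is the space of all $\infty\times\infty$ Hermitian matrices with the projective limit topology (the topology of entrywise convergence) defined by the projections $\theta_n:H\to H(n)$ onto upper left $n\times n$ corners; $H(n)\subset H(\infty)\subset H$. $U(\infty)=\bigcup_n U(n)$, where $U(n)$ is embedded in $U(n+1)$ by $u\mapsto\begin{pmatrix}u&0\\0&1\end{pmatrix}$; it acts on $H$ and $H(\infty)$ by conjugations $B\mapsto uBu^{-1}$. The characteristic function of a Borel probability measure $M$ on $H$ is $f(A)=\int_H e^{i\operatorname{tr}(AB)}M(dB)$, $A\in H(\infty)$. A $U(\infty)$-invariant Borel probability measure $M$ on $H$ is ergodic if every Borel set $Y\subset H$ with $M((u\cdot Y)\,\triangle\, Y)=0$ for all $u\in U(\infty)$ has $M(Y)\in\{0,1\}$. An orbital measure on $H(n)$ is the unique $U(n)$-invariant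 Borel probability measure supported by a $U(n)$-orbit (under conjugation) in $H(n)$; it is regarded as a measure on $H$ via $H(n)\subset H$. Weak convergence $M_n\Rightarrow M$ means $\int\psi\,dM_n\to\int\psi\,dM$ for all bounded continuous $\psi$ on $H$. $\operatorname{Spec}(A)$ is the collection $\{a_1,a_2,\dots,0,0,\dots\}$ of eigenvalues of $A$ with multiplicities (only finitely many are nonzero, and $F(0)=1$). *)

theory Defs
  imports "HOL-Probability.Probability" "Jordan_Normal_Form.Char_Poly"
begin

text \<open>
  Infinite matrices are functions; rows and columns are indexed from 0. The function type
  carries the product topology, i.e. the topology of entrywise convergence.
\<close>

type_synonym infmat = "nat \<Rightarrow> nat \<Rightarrow> complex"

text \<open>
  The sums in the product and in the trace range over the nonzero terms. They are meant for
  matrices where these are finitely many, which is the case for all products and traces used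
  below: with \<open>H(\<infinity>)\<close> the union of the spaces \<open>H(n)\<close> (\<open>herm n\<close> below),
  a row or column of an element of \<open>U(\<infinity>)\<close> or \<open>H(\<infinity>)\<close> is finitely supported, and so
  is the diagonal of \<open>A B\<close> for \<open>A \<in> H(\<infinity>)\<close> and arbitrary \<open>B\<close>.
\<close>

definition inf_mult :: "infmat \<Rightarrow> infmat \<Rightarrow> infmat" where
  "inf_mult A B = (\<lambda>i j. \<Sum>k | A i k * B k j \<noteq> 0. A i k * B k j)"

definition inf_trace :: "infmat \<Rightarrow> complex" where
  "inf_trace A = (\<Sum>i | A i i \<noteq> 0. A i i)"

definition inf_id :: infmat where
  "inf_id = (\<lambda>i j. if i = j then 1 else 0)"

definition inf_adjoint :: "infmat \<Rightarrow> infmat" where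
  "inf_adjoint A = (\<lambda>i j. cnj (A j i))"

definition herm_all :: "infmat set" where
  "herm_all = {A. inf_adjoint A = A}"

definition herm :: "nat \<Rightarrow> infmat set" where
  "herm n = {A \<in> herm_all. \<forall>i j. n \<le> i \<or> n \<le> j \<longrightarrow> A i j = 0}"

definition unitary_grp :: "nat \<Rightarrow> infmat set" where
  "unitary_grp n = {u. (\<forall>i j. n \<le> i \<or> n \<le> j \<longrightarrow> u i j = inf_id i j) \<and>
     inf_mult u (inf_adjoint u) = inf_id \<and> inf_mult (inf_adjoint u) u = inf_id}"

definition unitary_inf :: "infmat set" where
  "unitary_inf = (\<Union>n. unitary_grp n)"

text \<open>The inverse of a unitary matrix is its adjoint.\<close>

definition conj_act :: "infmat \<Rightarrow> infmat \<Rightarrow> infmat" where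
  "conj_act u B = inf_mult (inf_mult u B) (inf_adjoint u)"

definition borel_herm :: "infmat measure" where
  "borel_herm = restrict_space borel herm_all"

definition borel_prob_on_H :: "infmat measure \<Rightarrow> bool" where
  "borel_prob_on_H M \<longleftrightarrow> prob_space M \<and> space M = herm_all \<and> sets M = sets borel_herm"

definition unitary_invariant :: "infmat measure \<Rightarrow> bool" where
  "unitary_invariant M \<longleftrightarrow> (\<forall>u\<in>unitary_inf. distr M M (conj_act u) = M)"

definition ergodic_measure :: "infmat measure \<Rightarrow> bool" where
  "ergodic_measure M \<longleftrightarrow> borel_prob_on_H M \<and> unitary_invariant M \<and>
     (\<forall>Y\<in>sets M. (\<forall>u\<in>unitary_inf. measure M (sym_diff (conj_act u ` Y) Y) = 0) \<longrightarrow>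
        measure M Y = 0 \<or> measure M Y = 1)"

definition char_fun :: "infmat measure \<Rightarrow> infmat \<Rightarrow> complex" where
  "char_fun M A = (LINT B|M. exp (\<i> * inf_trace (inf_mult A B)))"

definition is_orbit :: "nat \<Rightarrow> infmat set \<Rightarrow> bool" where
  "is_orbit n \<Omega> \<longleftrightarrow> (\<exists>B\<in>herm n. \<Omega> = (\<lambda>u. conj_act u B) ` unitary_grp n)"

definition orbital_measure :: "nat \<Rightarrow> infmat set \<Rightarrow> infmat measure \<Rightarrow> bool" where
  "orbital_measure n \<Omega> M \<longleftrightarrow> is_orbit n \<Omega> \<and>
     prob_space M \<and> space M = herm n \<and> sets M = sets (restrict_space borel (herm n)) \<and>
     (\<forall>u\<in>unitary_grp n. distr M M (conj_act u) = M) \<and> measure M \<Omega> = 1"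

text \<open>A measure on \<open>H(n)\<close>, viewed as a measure on \<open>H\<close> by push-forward along the inclusion.\<close>

definition embed_measure_H :: "infmat measure \<Rightarrow> infmat measure" where
  "embed_measure_H M = distr M borel_herm (\<lambda>B. B)"

definition weakly_converges :: "(nat \<Rightarrow> infmat measure) \<Rightarrow> infmat measure \<Rightarrow> bool" where
  "weakly_converges Ms M \<longleftrightarrow>
     (\<forall>\<psi> :: infmat \<Rightarrow> real. continuous_on herm_all \<psi> \<and> bounded (\<psi> ` herm_all) \<longrightarrow>
        (\<lambda>n. LINT B|Ms n. \<psi> B) \<longlonglongrightarrow> (LINT B|M. \<psi> B))"

text \<open>
  The eigenvalues, with multiplicities, of the upper left \<open>n \<times> n\<close> corner. They are meant for
  \<open>A \<in> H(n)\<close>, where they are real and where enlarging \<open>n\<close> only adds zeros.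
  Hence a function on the union \<open>H(\<infinity>)\<close> given by a product over \<open>Spec(A)\<close> of values \<open>F(a)\<close>
  with \<open>F(0) = 1\<close> can be described on each \<open>H(n)\<close> by the product over \<open>spec_mset n A\<close>.
\<close>

definition spec_mset :: "nat \<Rightarrow> infmat \<Rightarrow> real multiset" where
  "spec_mset n A = image_mset Re (proots (char_poly (mat n n (\<lambda>(i, j). A i j))))"

text \<open>
  The sequences of positive and of negative eigenvalues, each in decreasing order of absolute
  value and completed by zeros; the first term has index 0.
\<close>

definition pad_zeros :: "real list \<Rightarrow> nat \<Rightarrow> real" where
  "pad_zeros xs k = (if k < length xs then xs ! k else 0)"

definition pos_eigs :: "nat \<Rightarrow> infmat \<Rightarrow> nat \<Rightarrow> real" where
  "pos_eigs n A = pad_zeros (rev (sorted_list_of_multiset {#x \<in># spec_mset n A. x > 0#}))"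

definition neg_eigs :: "nat \<Rightarrow> infmat \<Rightarrow> nat \<Rightarrow> real" where
  "neg_eigs n A = pad_zeros (sorted_list_of_multiset {#x \<in># spec_mset n A. x < 0#})"

definition F_factor :: "real \<Rightarrow> real \<Rightarrow> complex" where
  "F_factor x a = exp (- \<i> * of_real (x * a)) / (1 - \<i> * of_real (x * a))"

definition F_fun :: "real \<Rightarrow> real \<Rightarrow> (nat \<Rightarrow> real) \<Rightarrow> (nat \<Rightarrow> real) \<Rightarrow> real \<Rightarrow> complex" where
  "F_fun \<gamma>1 \<gamma>2 x' x'' a =
     exp (\<i> * of_real (\<gamma>1 * a) - of_real (\<gamma>2 * a\<^sup>2 / 2)) *
     (\<Prod>k. F_factor (x' k) a) * (\<Prod>k. F_factor (x'' k) a)"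

end

theory Submission
  imports Defs "HOL-Real_Asymp.Real_Asymp" "Jordan_Normal_Form.Schur_Decomposition" "Jordan_Normal_Form.Spectral_Radius"
begin

text \<open>
  Replace the first \<open>m\<close> rows of a random unitary matrix by independent Gaussian vectors: they are
  nearly orthonormal after division by \<open>sqrt n\<close>, so by unitary invariance the joint law of the
  first \<open>m\<close> diagonal entries under \<open>M n\<close> is close to that of the quadratic forms of \<open>B n / n\<close>
  in these vectors. Their characteristic functions are explicit products
  \<open>\<Prod>x. 1 / (1 - \<i> a x)\<close> over the scaled eigenvalues \<open>x\<close>. Such products converge to \<open>F\<close> under the
  assumptions of (i); conversely, from their convergence one recovers all power sums of the scaled
  eigenvalues, hence the limits in (ii). The limit measure is realized by
  a scalar matrix plus a Gaussian matrix plus a series of centered rank one Gaussian matrices. Since its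
  characteristic function is multiplicative over diagonal blocks, disjoint corners are
  independent; exchanging them by a block permutation gives ergodicity as in the
  Hewitt--Savage zero-one law.
\<close>

section \<open>Unitary conjugation and the spectrum\<close>

text \<open>Haar measure on U(n) is never constructed: an orbital measure enters only through its
  orbit and its invariance. A Gaussian frame is triangularized by finitely many Householder
  reflections, and invariance under each of them lets the triangular frame replace the original one.
  The comparison error is a small multiple of the size of the first entries, so these must be tight
  beforehand. In (i) tightness comes from second moments: averaging quadratic forms over Gaussian
  vectors bounds the variance of an entry by the second power sum. In (ii) only weak convergence is
  given; the comparison therefore assumes tightness of the first \<open>m \<times> m\<close> entries
  alone, and for \<open>m = 1\<close> the limit law of one diagonal entry supplies it. The limit
  measure is realized explicitly because the convergence criterion, Stone--Weierstrass for
  trigonometric polynomials with tightness, compares with a given limit and does not produce one.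
  The number of eigenvalues grows with \<open>n\<close> while only the scaled sum of squares stays
  bounded; limits over the spectrum are taken with weights of order at least two, and the trace is
  treated separately.\<close>

lemma inf_mult_eq_sum:
  assumes "finite S" "\<And>k. k \<notin> S \<Longrightarrow> A i k * B k j = 0"
  shows "inf_mult A B i j = (\<Sum>k\<in>S. A i k * B k j)"
  unfolding inf_mult_def using assms by (intro sum.mono_neutral_left) auto

lemma inf_trace_eq_sum:
  assumes "finite S" "\<And>i. i \<notin> S \<Longrightarrow> A i i = 0"
  shows "inf_trace A = (\<Sum>i\<in>S. A i i)"
  unfolding inf_trace_def using assms by (intro sum.mono_neutral_left) auto

lemma herm_all_cnj: "A \<in> herm_all \<Longrightarrow> cnj (A i j) = A j i"
  unfolding herm_all_def inf_adjoint_def by (auto dest: fun_cong)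

lemma herm_allI: "(\<And>i j. cnj (A i j) = A j i) \<Longrightarrow> A \<in> herm_all"
  unfolding herm_all_def inf_adjoint_def by auto

lemma hermD:
  assumes "A \<in> herm n"
  shows "A \<in> herm_all" "n \<le> i \<Longrightarrow> A i j = 0" "n \<le> j \<Longrightarrow> A i j = 0"
  using assms unfolding herm_def by auto

lemma herm_mono: "n \<le> m \<Longrightarrow> herm n \<subseteq> herm m"
  unfolding herm_def by force

lemma unitary_grp_outside:
  assumes "u \<in> unitary_grp n" "n \<le> i \<or> n \<le> j"
  shows "u i j = inf_id i j"
  using assms unfolding unitary_grp_def by auto

lemma unitary_grp_zero:
  assumes "u \<in> unitary_grp n" "n \<le> N" "i < N" "N \<le> k"
  shows "u i k = 0" "u k i = 0"
  using unitary_grp_outside[OF assms(1), of i k] unitary_grp_outside[OF assms(1), of k i] assms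
  by (auto simp: inf_id_def)

text \<open>Orthonormality of rows and columns is stated for every window \<open>N\<close> beyond
  \<open>n\<close>: there \<open>u\<close> continues as the identity, and a larger window treats
  indices inside and outside the block alike.\<close>

lemma unitary_grp_sums:
  assumes u: "u \<in> unitary_grp n" and N: "n \<le> N" "i < N" "j < N"
  shows "(\<Sum>k<N. u i k * cnj (u j k)) = (if i = j then 1 else 0)"
    and "(\<Sum>k<N. cnj (u k i) * u k j) = (if i = j then 1 else 0)"
proof -
  have "inf_mult u (inf_adjoint u) i j = (\<Sum>k<N. u i k * inf_adjoint u k j)"
    by (rule inf_mult_eq_sum) (auto simp: unitary_grp_zero[OF u N(1,2)])
  moreover have "inf_mult (inf_adjoint u) u i j = (\<Sum>k<N. inf_adjoint u i k * u k j)"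
    by (rule inf_mult_eq_sum) (auto simp: unitary_grp_zero[OF u N(1,3)])
  ultimately show "(\<Sum>k<N. u i k * cnj (u j k)) = (if i = j then 1 else 0)"
    and "(\<Sum>k<N. cnj (u k i) * u k j) = (if i = j then 1 else 0)"
    using u unfolding unitary_grp_def by (auto simp: inf_adjoint_def inf_id_def)
qed

lemma unitary_grpI:
  assumes out: "\<And>i j. n \<le> i \<or> n \<le> j \<Longrightarrow> u i j = inf_id i j"
    and 1: "\<And>i j N. n \<le> N \<Longrightarrow> i < N \<Longrightarrow> j < N \<Longrightarrow> (\<Sum>k<N. u i k * cnj (u j k)) = (if i = j then 1 else 0)"
    and 2: "\<And>i j N. n \<le> N \<Longrightarrow> i < N \<Longrightarrow> j < N \<Longrightarrow> (\<Sum>k<N. cnj (u k i) * u k j) = (if i = j then 1 else 0)"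
  shows "u \<in> unitary_grp n"
proof -
  have "inf_mult u (inf_adjoint u) i j = inf_id i j \<and> inf_mult (inf_adjoint u) u i j = inf_id i j" for i j
  proof -
    define N where "N = Suc (max n (max i j))"
    have N: "n \<le> N" "i < N" "j < N" by (auto simp: N_def)
    have z: "u i k = 0" "u k j = 0" if "N \<le> k" for k
      using out[of i k] out[of k j] that N by (auto simp: inf_id_def)
    have "inf_mult u (inf_adjoint u) i j = (\<Sum>k<N. u i k * inf_adjoint u k j)"
      by (rule inf_mult_eq_sum) (auto simp: z)
    moreover have "inf_mult (inf_adjoint u) u i j = (\<Sum>k<N. inf_adjoint u i k * u k j)"
      by (rule inf_mult_eq_sum) (auto simp: z)
    ultimately show ?thesis using 1[OF N] 2[OF N] by (auto simp: inf_adjoint_def inf_id_def)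
  qed
  thus ?thesis using out unfolding unitary_grp_def by auto
qed

lemma inf_adjoint_unitary: "u \<in> unitary_grp n \<Longrightarrow> inf_adjoint u \<in> unitary_grp n"
proof (rule unitary_grpI)
  assume u: "u \<in> unitary_grp n"
  show "inf_adjoint u i j = inf_id i j" if "n \<le> i \<or> n \<le> j" for i j
    using unitary_grp_outside[OF u, of j i] that by (auto simp: inf_adjoint_def inf_id_def)
  show "(\<Sum>k<N. inf_adjoint u i k * cnj (inf_adjoint u j k)) = (if i = j then 1 else 0)"
    if "n \<le> N" "i < N" "j < N" for i j N
    using unitary_grp_sums(2)[OF u that] by (simp add: inf_adjoint_def mult.commute)
  show "(\<Sum>k<N. cnj (inf_adjoint u k i) * inf_adjoint u k j) = (if i = j then 1 else 0)"
    if "n \<le> N" "i < N" "j < N" for i j N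
    using unitary_grp_sums(1)[OF u that] by (simp add: inf_adjoint_def mult.commute)
qed

lemma inf_adjoint_adjoint [simp]: "inf_adjoint (inf_adjoint u) = u"
  by (auto simp: inf_adjoint_def)

lemma unitary_grp_mono: "n \<le> m \<Longrightarrow> unitary_grp n \<subseteq> unitary_grp m"
  by (fastforce simp: unitary_grp_def)

lemma conj_act_eq:
  assumes u: "u \<in> unitary_grp n" and N: "n \<le> N" "i < N" "j < N"
  shows "conj_act u B i j = (\<Sum>l<N. (\<Sum>k<N. u i k * B k l) * cnj (u j l))"
proof -
  have "inf_mult u B i l = (\<Sum>k<N. u i k * B k l)" for l
    by (rule inf_mult_eq_sum) (auto simp: unitary_grp_zero[OF u N(1,2)])
  moreover have "conj_act u B i j = (\<Sum>l<N. inf_mult u B i l * inf_adjoint u l j)"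
    unfolding conj_act_def
    by (rule inf_mult_eq_sum) (auto simp: unitary_grp_zero[OF u N(1,3)] inf_adjoint_def)
  ultimately show ?thesis by (simp add: inf_adjoint_def)
qed

lemma conj_act_herm_all:
  assumes u: "u \<in> unitary_grp n" and B: "B \<in> herm_all"
  shows "conj_act u B \<in> herm_all"
proof (rule herm_allI)
  fix i j
  define N where "N = Suc (max n (max i j))"
  have N: "n \<le> N" "i < N" "j < N" by (auto simp: N_def)
  have "cnj (conj_act u B i j) = (\<Sum>l<N. \<Sum>k<N. cnj (u i k) * B l k * u j l)"
    by (simp add: conj_act_eq[OF u N] herm_all_cnj[OF B] sum_distrib_right)
  also have "\<dots> = conj_act u B j i"
    by (subst sum.swap) (simp add: conj_act_eq[OF u N(1,3,2)] sum_distrib_left sum_distrib_right mult_ac)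
  finally show "cnj (conj_act u B i j) = conj_act u B j i" .
qed

lemma conj_act_herm:
  assumes u: "u \<in> unitary_grp n" and B: "B \<in> herm n"
  shows "conj_act u B \<in> herm n"
proof -
  have H: "conj_act u B \<in> herm_all" using conj_act_herm_all[OF u hermD(1)[OF B]] .
  have z: "conj_act u B i j = 0" if "n \<le> i" for i j
  proof -
    define N where "N = Suc (max n (max i j))"
    have N: "n \<le> N" "i < N" "j < N" by (auto simp: N_def)
    have "u i k * B k l = 0" for k l
      using unitary_grp_outside[OF u, of i k] that hermD(2)[OF B, of k l] by (auto simp: inf_id_def)
    thus ?thesis by (simp add: conj_act_eq[OF u N])
  qed
  moreover have "conj_act u B i j = 0" if "n \<le> j" for i j
    using z[OF that, of i] herm_all_cnj[OF H, of j i] by simp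
  ultimately show ?thesis using H unfolding herm_def by auto
qed

section \<open>Truncation to finite matrices\<close>

definition corner_mat :: "nat \<Rightarrow> infmat \<Rightarrow> complex mat" where
  "corner_mat n A = mat n n (\<lambda>(i, j). A i j)"

lemma corner_mat_carrier [simp]: "corner_mat n A \<in> carrier_mat n n"
  "dim_row (corner_mat n A) = n" "dim_col (corner_mat n A) = n"
  by (auto simp: corner_mat_def)

lemma corner_mat_eq_iff: "corner_mat N A = corner_mat N B \<longleftrightarrow> (\<forall>i<N. \<forall>j<N. A i j = B i j)"
  by (auto simp: corner_mat_def mat_eq_iff)

text \<open>Truncation at \<open>N \<ge> n\<close> commutes with the conjugation, since
  \<open>u\<close> mixes no index below \<open>N\<close> with one above. Associativity and
  similarity can then be taken from finite matrices, while \<open>inf_mult\<close> is associative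
  only under finiteness conditions.\<close>

lemma corner_mat_conj_act:
  assumes u: "u \<in> unitary_grp n" and N: "n \<le> N"
  shows "corner_mat N (conj_act u B) = corner_mat N u * corner_mat N B * corner_mat N (inf_adjoint u)"
  by (rule eq_matI)
    (auto simp: corner_mat_def scalar_prod_def conj_act_eq[OF u N] inf_adjoint_def atLeast0LessThan)

lemma corner_mat_unitary:
  assumes u: "u \<in> unitary_grp n" and N: "n \<le> N"
  shows "corner_mat N u * corner_mat N (inf_adjoint u) = 1\<^sub>m N"
    "corner_mat N (inf_adjoint u) * corner_mat N u = 1\<^sub>m N"
  by (rule eq_matI; auto simp: corner_mat_def scalar_prod_def inf_adjoint_def atLeast0LessThan
    unitary_grp_sums[OF u N])+

lemma conj_act_inverse:
  assumes u: "u \<in> unitary_grp n"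
  shows "conj_act (inf_adjoint u) (conj_act u B) = B"
proof (intro ext)
  fix i j
  define N where "N = Suc (max n (max i j))"
  have N: "n \<le> N" "i < N" "j < N" by (auto simp: N_def)
  let ?U = "corner_mat N u" and ?V = "corner_mat N (inf_adjoint u)" and ?B = "corner_mat N B"
  have "corner_mat N (conj_act (inf_adjoint u) (conj_act u B)) = ?V * (?U * ?B * ?V) * ?U"
    using corner_mat_conj_act[OF inf_adjoint_unitary[OF u] N(1)] corner_mat_conj_act[OF u N(1)] by simp
  also have "?U * ?B * ?V = ?U * (?B * ?V)"
    by (rule assoc_mult_mat[of _ N N _ N _ N]) auto
  also have "?V * (?U * (?B * ?V)) = (?V * ?U) * (?B * ?V)"
    by (rule assoc_mult_mat[symmetric, of _ N N _ N _ N]) auto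
  also have "\<dots> = ?B * ?V" unfolding corner_mat_unitary[OF u N(1)] by (rule left_mult_one_mat[of _ N N]) auto
  also have "?B * ?V * ?U = ?B * (?V * ?U)"
    by (rule assoc_mult_mat[of _ N N _ N _ N]) auto
  also have "\<dots> = ?B" unfolding corner_mat_unitary[OF u N(1)] by (rule right_mult_one_mat[of _ N N]) auto
  finally show "conj_act (inf_adjoint u) (conj_act u B) i j = B i j"
    using N unfolding corner_mat_eq_iff by blast
qed

section \<open>The trace pairing and its invariance\<close>

lemma trace_pairing:
  assumes A: "A \<in> herm n" and N: "n \<le> N"
  shows "inf_trace (inf_mult A B) = (\<Sum>i<N. \<Sum>k<N. A i k * B k i)"
proof -
  have m: "inf_mult A B i j = (\<Sum>k<N. A i k * B k j)" for i j
    by (rule inf_mult_eq_sum) (use N in \<open>auto simp: hermD(3)[OF A]\<close>)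
  have "inf_trace (inf_mult A B) = (\<Sum>i<N. inf_mult A B i i)"
    by (rule inf_trace_eq_sum) (use N in \<open>auto simp: m hermD(2)[OF A]\<close>)
  thus ?thesis by (simp add: m)
qed

text \<open>Cyclicity of the trace. It holds for arbitrary \<open>B\<close> because \<open>A\<close>
  and \<open>u\<close> confine all sums to indices below \<open>n\<close>. A conjugation of the
  random matrix can thus be moved to the argument of the characteristic function.\<close>

lemma trace_pairing_conj_act:
  assumes A: "A \<in> herm m" and u: "u \<in> unitary_grp n" and mn: "m \<le> n"
  shows "inf_trace (inf_mult (conj_act (inf_adjoint u) A) B) = inf_trace (inf_mult A (conj_act u B))"
proof -
  have A': "A \<in> herm n" using A herm_mono[OF mn] by auto
  note C = conj_act_herm[OF inf_adjoint_unitary[OF u] A']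
  have e: "conj_act (inf_adjoint u) A l m = (\<Sum>k<n. (\<Sum>i<n. cnj (u i l) * A i k) * u k m)"
    if "l < n" "m < n" for l m
    by (subst conj_act_eq[OF inf_adjoint_unitary[OF u] order_refl that]) (simp add: inf_adjoint_def)
  have "inf_trace (inf_mult (conj_act (inf_adjoint u) A) B) =
    (\<Sum>l<n. \<Sum>m<n. (\<Sum>k<n. (\<Sum>i<n. cnj (u i l) * A i k) * u k m) * B m l)"
    by (simp add: trace_pairing[OF C order_refl] e)
  also have "\<dots> = (\<Sum>l<n. \<Sum>m<n. \<Sum>k<n. \<Sum>i<n. A i k * (u k m * B m l * cnj (u i l)))"
    by (simp add: sum_distrib_left sum_distrib_right mult_ac)
  also have "\<dots> = (\<Sum>l<n. \<Sum>k<n. \<Sum>m<n. \<Sum>i<n. A i k * (u k m * B m l * cnj (u i l)))"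
    by (subst (2) sum.swap) simp
  also have "\<dots> = (\<Sum>k<n. \<Sum>l<n. \<Sum>m<n. \<Sum>i<n. A i k * (u k m * B m l * cnj (u i l)))"
    by (rule sum.swap)
  also have "\<dots> = (\<Sum>k<n. \<Sum>l<n. \<Sum>i<n. \<Sum>m<n. A i k * (u k m * B m l * cnj (u i l)))"
    by (subst (3) sum.swap) simp
  also have "\<dots> = (\<Sum>k<n. \<Sum>i<n. \<Sum>l<n. \<Sum>m<n. A i k * (u k m * B m l * cnj (u i l)))"
    by (subst (2) sum.swap) simp
  also have "\<dots> = (\<Sum>i<n. \<Sum>k<n. \<Sum>l<n. \<Sum>m<n. A i k * (u k m * B m l * cnj (u i l)))"
    by (rule sum.swap)
  also have "\<dots> = inf_trace (inf_mult A (conj_act u B))"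
    by (simp add: trace_pairing[OF A' order_refl] conj_act_eq[OF u order_refl] sum_distrib_left
        sum_distrib_right mult_ac)
  finally show ?thesis .
qed

lemma trace_square_conj_act:
  assumes A: "A \<in> herm n" and u: "u \<in> unitary_grp n"
  shows "inf_trace (inf_mult (conj_act u A) (conj_act u A)) = inf_trace (inf_mult A A)"
  using trace_pairing_conj_act[OF conj_act_herm[OF u A] u order_refl, of A]
  by (simp add: conj_act_inverse[OF u])

lemma trace_conj_act:
  assumes A: "A \<in> herm n" and u: "u \<in> unitary_grp n"
  shows "inf_trace (conj_act u A) = inf_trace A"
proof -
  have "inf_trace (conj_act u A) = (\<Sum>i<n. \<Sum>l<n. (\<Sum>k<n. u i k * A k l) * cnj (u i l))"
    using hermD(2)[OF conj_act_herm[OF u A]]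
    by (subst inf_trace_eq_sum[of "{..<n}"]) (auto simp: conj_act_eq[OF u order_refl])
  also have "\<dots> = (\<Sum>i<n. \<Sum>l<n. \<Sum>k<n. A k l * (cnj (u i l) * u i k))"
    by (simp add: sum_distrib_left sum_distrib_right mult_ac)
  also have "\<dots> = (\<Sum>l<n. \<Sum>i<n. \<Sum>k<n. A k l * (cnj (u i l) * u i k))"
    by (rule sum.swap)
  also have "\<dots> = (\<Sum>l<n. \<Sum>k<n. \<Sum>i<n. A k l * (cnj (u i l) * u i k))"
    by (subst (2) sum.swap) simp
  also have "\<dots> = (\<Sum>l<n. \<Sum>k<n. if l = k then A k l else 0)"
    by (auto simp: sum_distrib_left[symmetric] unitary_grp_sums[OF u order_refl] if_distrib[of "(*) _"] cong: if_cong intro!: sum.cong)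
  also have "\<dots> = inf_trace A"
    using hermD(2)[OF A] by (subst inf_trace_eq_sum[of "{..<n}"]) auto
  finally show ?thesis .
qed

lemma spec_mset_conj_act:
  assumes u: "u \<in> unitary_grp n"
  shows "spec_mset n (conj_act u A) = spec_mset n A"
proof -
  have "similar_mat (corner_mat n (conj_act u A)) (corner_mat n A)"
    by (rule similar_matI[of _ _ "corner_mat n u" "corner_mat n (inf_adjoint u)" n])
      (use corner_mat_conj_act[OF u order_refl, of A] corner_mat_unitary[OF u order_refl] in auto)
  from char_poly_similar[OF this] show ?thesis
    unfolding spec_mset_def corner_mat_def by simp
qed

section \<open>Unitary diagonalization by Householder reflections\<close>

definition diagm :: "nat \<Rightarrow> (nat \<Rightarrow> real) \<Rightarrow> infmat" where
  "diagm n d = (\<lambda>i j. if i = j \<and> i < n then of_real (d i) else 0)"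

lemma diagm_herm: "diagm n d \<in> herm n"
  unfolding diagm_def herm_def by (auto intro!: herm_allI)

lemma proots_linear_prod: "proots (\<Prod>a\<leftarrow>xs. [:- a, 1:]) = mset (xs :: complex list)"
proof (induction xs)
  case (Cons a xs)
  have "(\<Prod>a\<leftarrow>xs. [:- a, 1:]) \<noteq> 0" by (auto simp: prod_list_zero_iff)
  thus ?case using Cons by (simp add: proots_mult del: mult_pCons_left)
qed simp

lemma spec_mset_diagm: "spec_mset n (diagm n d) = image_mset d (mset_set {..<n})"
proof -
  let ?A = "mat n n (\<lambda>(i, j). diagm n d i j)"
  have "char_poly ?A = (\<Prod>a\<leftarrow>diag_mat ?A. [:- a, 1:])"
    by (rule char_poly_upper_triangular[of _ n]) (auto simp: upper_triangular_def diagm_def)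
  hence "proots (char_poly ?A) = mset (diag_mat ?A)" by (simp add: proots_linear_prod)
  also have "diag_mat ?A = map (\<lambda>i. of_real (d i)) [0..<n]"
    by (auto simp: diag_mat_def diagm_def)
  finally have "spec_mset n (diagm n d) = image_mset d (mset [0..<n])"
    unfolding spec_mset_def by (simp add: image_mset.compositionality o_def)
  thus ?thesis by (simp only: mset_upt atLeast0LessThan)
qed

text \<open>The Householder reflection along the component of \<open>v\<close> in the coordinates from \<open>j\<close> on.\<close>

lemma householder:
  assumes j: "j < n"
  obtains u where "u \<in> unitary_grp n" "\<And>i k. i < j \<or> k < j \<Longrightarrow> u i k = inf_id i k"
    "\<And>i k. cnj (u k i) = u i k" "\<And>i. j < i \<Longrightarrow> i < n \<Longrightarrow> (\<Sum>k<n. u i k * v k) = 0"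
proof -
  define x where "x = (\<lambda>i. if j \<le> i \<and> i < n then v i else 0)"
  define r where "r = sqrt (\<Sum>i<n. (cmod (x i))\<^sup>2)"
  \<comment> \<open>The target of the reflection is \<open>\<alpha>\<close> times the j-th unit
    vector. A complex reflection reaches it only if the inner product of \<open>v\<close> with the
    target is real, which fixes the phase up to sign when \<open>v j\<close> is not 0; the minus
    sign makes \<open>s\<close> a sum of nonnegative terms.\<close>
  define \<alpha> where "\<alpha> = (if v j = 0 then of_real r else - sgn (v j) * of_real r)"
  define w where "w = (\<lambda>i. x i - (if i = j then \<alpha> else 0))"
  define s where "s = (\<Sum>i<n. (cmod (w i))\<^sup>2)"
  have r2: "r\<^sup>2 = (\<Sum>i<n. (cmod (x i))\<^sup>2)" unfolding r_def by (simp add: sum_nonneg)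
  have r0: "r \<ge> 0" unfolding r_def by (simp add: sum_nonneg)
  have na: "cmod \<alpha> = r" using r0 by (auto simp: \<alpha>_def norm_mult norm_sgn)
  have real: "cnj \<alpha> * v j = of_real (- r * cmod (v j))"
  proof (cases "v j = 0")
    case False
    have "cnj (sgn (v j)) * v j = of_real (cmod (v j))"
      using False by (simp add: sgn_eq mult.commute complex_norm_square[symmetric] power2_eq_square)
    thus ?thesis using False by (simp add: \<alpha>_def mult_ac)
  qed simp
  have w0: "w i = 0" if "n \<le> i \<or> i < j" for i using that j by (auto simp: w_def x_def)
  have wv: "cnj (w i) * v i = cnj (w i) * x i" for i
    using w0[of i] by (cases "j \<le> i \<and> i < n") (auto simp: x_def)
  have "(cmod (w i))\<^sup>2 = (cmod (x i))\<^sup>2 + (if i = j then r\<^sup>2 + 2 * r * cmod (v j) else 0)" if "i < n" for i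
  proof (cases "i = j")
    case True
    have "Re (x j * cnj \<alpha>) = - r * cmod (v j)"
      using real j by (simp add: x_def mult.commute)
    hence "(cmod (x j - \<alpha>))\<^sup>2 = (cmod (x j))\<^sup>2 + (cmod \<alpha>)\<^sup>2 + 2 * r * cmod (v j)"
      unfolding cmod_power2 by (simp add: power2_eq_square algebra_simps)
    thus ?thesis using True na by (simp add: w_def)
  qed (simp add: w_def)
  hence s: "s = 2 * r\<^sup>2 + 2 * r * cmod (v j)"
    unfolding s_def using j by (simp add: sum.distrib r2)
  have ip: "(\<Sum>k<n. cnj (w k) * v k) = of_real (s / 2)"
  proof -
    have "(\<Sum>k<n. cnj (w k) * v k) = (\<Sum>k<n. cnj (x k) * x k - (if k = j then cnj \<alpha> * v j else 0))"
      unfolding wv by (intro sum.cong) (use j in \<open>auto simp: w_def x_def algebra_simps\<close>)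
    also have "\<dots> = of_real (r\<^sup>2) + of_real (r * cmod (v j))"
      using j unfolding r2 sum_subtractf
      by (simp add: real complex_norm_square mult.commute del: of_real_power)
    finally show ?thesis by (simp add: s)
  qed
  \<comment> \<open>If \<open>s = 0\<close>, then \<open>v\<close> vanishes at the indices from
    \<open>j\<close> to \<open>n - 1\<close>, and \<open>u\<close> is the identity.\<close>
  define c where "c = (if s = 0 then 0 else 2 / s)"
  define u where "u = (\<lambda>i k. inf_id i k - of_real c * w i * cnj (w k))"
  have sw: "(\<Sum>k<N. cnj (w k) * w k) = of_real s" if "n \<le> N" for N
  proof -
    have "(\<Sum>k<N. cnj (w k) * w k) = (\<Sum>k<n. cnj (w k) * w k)"
      using that w0 by (intro sum.mono_neutral_right) auto
    thus ?thesis unfolding s_def of_real_sum by (simp add: complex_norm_square mult.commute del: of_real_power)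
  qed
  have sym: "cnj (u k i) = u i k" for i k by (auto simp: u_def inf_id_def)
  have orth: "(\<Sum>k<N. u i k * cnj (u l k)) = (if i = l then 1 else 0)" if N: "n \<le> N" "i < N" "l < N" for i l N
  proof -
    have "(\<Sum>k<N. u i k * cnj (u l k)) = (\<Sum>k<N. (if i = k then inf_id l k else 0)
       - of_real c * (if i = k then cnj (w l) * w k else 0) - of_real c * (if l = k then w i * cnj (w k) else 0)
       + of_real (c^2) * w i * cnj (w l) * (cnj (w k) * w k))"
      by (intro sum.cong) (auto simp: u_def inf_id_def algebra_simps power2_eq_square)
    also have "\<dots> = inf_id l i - of_real c * (cnj (w l) * w i) - of_real c * (w i * cnj (w l))
       + of_real (c^2) * w i * cnj (w l) * of_real s"
      using N by (simp add: sum.distrib sum_subtractf sum_distrib_left[symmetric] sw)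
    also have "of_real (c^2) * w i * cnj (w l) * of_real s = 2 * of_real c * w i * cnj (w l)"
      unfolding c_def by (auto simp: power2_eq_square)
    finally show ?thesis by (auto simp: inf_id_def)
  qed
  have "u \<in> unitary_grp n"
  proof (rule unitary_grpI)
    show "u i j = inf_id i j" if "n \<le> i \<or> n \<le> j" for i j using that w0 by (auto simp: u_def)
    show "(\<Sum>k<N. cnj (u k i) * u k l) = (if i = l then 1 else 0)" if "n \<le> N" "i < N" "l < N" for i l N
      using orth[OF that] by (simp add: sym)
  qed (use orth in auto)
  moreover have "(\<Sum>k<n. u i k * v k) = 0" if i: "j < i" "i < n" for i
  proof -
    have "(\<Sum>k<n. u i k * v k) = (\<Sum>k<n. (if i = k then v k else 0) - of_real c * w i * (cnj (w k) * v k))"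
      by (intro sum.cong) (auto simp: u_def inf_id_def algebra_simps)
    also have "\<dots> = v i - of_real c * w i * of_real (s / 2)"
      using i by (simp add: sum_subtractf sum_distrib_left[symmetric] ip)
    also have "\<dots> = v i - w i"
    proof (cases "s = 0")
      case True
      hence "w i = 0" using i unfolding s_def by (subst (asm) sum_nonneg_eq_0_iff) auto
      thus ?thesis by simp
    qed (simp add: c_def)
    finally show ?thesis using i by (simp add: w_def x_def)
  qed
  moreover have "u i k = inf_id i k" if "i < j \<or> k < j" for i k using that w0 by (auto simp: u_def)
  ultimately show thesis using that sym by blast
qed

text \<open>Chains of conjugations stand in for conjugation by one product: only invariants are
  carried along a chain, so closure of the unitary group under products never enters.\<close>

inductive ucong :: "nat \<Rightarrow> infmat \<Rightarrow> infmat \<Rightarrow> bool" for n A where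
  ucong_refl: "ucong n A A"
| ucong_step: "ucong n A C \<Longrightarrow> u \<in> unitary_grp n \<Longrightarrow> ucong n A (conj_act u C)"

lemma ucong_herm: "ucong n A C \<Longrightarrow> A \<in> herm n \<Longrightarrow> C \<in> herm n"
  by (induction rule: ucong.induct) (auto intro: conj_act_herm)

lemma ucong_spec_mset: "ucong n A C \<Longrightarrow> spec_mset n C = spec_mset n A"
  by (induction rule: ucong.induct) (auto simp: spec_mset_conj_act)

lemma ucong_trace: "ucong n A C \<Longrightarrow> A \<in> herm n \<Longrightarrow> inf_trace C = inf_trace A"
  by (induction rule: ucong.induct) (auto simp: trace_conj_act[OF ucong_herm])

lemma ucong_trace_square:
  "ucong n A C \<Longrightarrow> A \<in> herm n \<Longrightarrow> inf_trace (inf_mult C C) = inf_trace (inf_mult A A)"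
  by (induction rule: ucong.induct) (auto simp: trace_square_conj_act[OF ucong_herm])

text \<open>The eigenvector belongs to the lower right block starting at \<open>j\<close> and is
  padded by zeros; it exists because a nonempty complex matrix has nonempty spectrum.\<close>

lemma eigenvector_from:
  assumes j: "j < n"
  obtains v :: "nat \<Rightarrow> complex" and \<mu> where "\<And>i. i < j \<or> n \<le> i \<Longrightarrow> v i = 0" "\<exists>i<n. v i \<noteq> 0"
    "\<And>i. j \<le> i \<Longrightarrow> i < n \<Longrightarrow> (\<Sum>k<n. C i k * v k) = \<mu> * v i"
proof -
  define M where "M = mat (n - j) (n - j) (\<lambda>(p, q). C (p + j) (q + j) :: complex)"
  have M: "M \<in> carrier_mat (n - j) (n - j)" by (auto simp: M_def)
  obtain \<mu> where "\<mu> \<in> spectrum M" using spectrum_non_empty[OF M] j by auto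
  then obtain x where x: "eigenvector M x \<mu>" unfolding spectrum_def eigenvalue_def by auto
  hence dx: "dim_vec x = n - j" and x0: "x \<noteq> 0\<^sub>v (n - j)" and ev: "M *\<^sub>v x = \<mu> \<cdot>\<^sub>v x"
    by (auto simp: eigenvector_def M_def)
  define v where "v = (\<lambda>i. if j \<le> i \<and> i < n then x $ (i - j) else 0)"
  have "\<exists>p < n - j. x $ p \<noteq> 0"
    using x0 dx by (metis eq_vecI index_zero_vec(1,2))
  then obtain p where p: "p < n - j" "x $ p \<noteq> 0" by auto
  hence "p + j < n \<and> v (p + j) \<noteq> 0" by (auto simp: v_def)
  hence "\<exists>i<n. v i \<noteq> 0" by blast
  moreover have "v i = 0" if "i < j \<or> n \<le> i" for i using that by (auto simp: v_def)
  moreover have "(\<Sum>k<n. C i k * v k) = \<mu> * v i" if i: "j \<le> i" "i < n" for i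
  proof -
    have "(\<Sum>k<n. C i k * v k) = (\<Sum>k\<in>{j..<n}. C i k * v k)"
      by (rule sum.mono_neutral_right) (auto simp: v_def)
    also have "\<dots> = (\<Sum>q<n - j. C i (q + j) * v (q + j))"
      using j by (intro sum.reindex_bij_witness[of _ "\<lambda>q. q + j" "\<lambda>k. k - j"]) auto
    also have "\<dots> = (M *\<^sub>v x) $ (i - j)"
      using i dx by (auto simp: M_def v_def scalar_prod_def atLeast0LessThan intro!: sum.cong)
    also have "\<dots> = \<mu> * v i" unfolding ev using i dx by (simp add: v_def)
    finally show ?thesis .
  qed
  ultimately show thesis by (intro that[of v \<mu>])
qed

text \<open>Induction over the number of rows and columns already diagonal. The reflection that
  turns an eigenvector of the remaining block into a multiple of the j-th unit vector makes that
  unit vector an eigenvector of the conjugated matrix, so column \<open>j\<close> becomes diagonal.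
  Row \<open>j\<close> follows by Hermitian symmetry, and the earlier rows survive because
  \<open>u\<close> is the identity there.\<close>

lemma ucong_diagonal_steps:
  assumes A: "A \<in> herm n"
  shows "j \<le> n \<Longrightarrow> \<exists>C. ucong n A C \<and> (\<forall>i k. i \<noteq> k \<and> (i < j \<or> k < j) \<longrightarrow> C i k = 0)"
proof (induction j)
  case 0
  show ?case using ucong.ucong_refl by auto
next
  case (Suc j)
  then obtain C where C: "ucong n A C" and d: "\<And>i k. i \<noteq> k \<Longrightarrow> i < j \<or> k < j \<Longrightarrow> C i k = 0" by auto
  have CH: "C \<in> herm n" using ucong_herm[OF C A] .
  have j: "j < n" using Suc by simp
  obtain v \<mu> where v: "\<And>i. i < j \<or> n \<le> i \<Longrightarrow> v i = 0" "\<exists>i<n. v i \<noteq> 0"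
    and ev: "\<And>i. j \<le> i \<Longrightarrow> i < n \<Longrightarrow> (\<Sum>k<n. C i k * v k) = \<mu> * v i"
    by (rule eigenvector_from[OF j, of C]) (rule that)
  obtain u where u: "u \<in> unitary_grp n" and uid: "\<And>i k. i < j \<or> k < j \<Longrightarrow> u i k = inf_id i k"
    and sym: "\<And>i k. cnj (u k i) = u i k" and ann: "\<And>i. j < i \<Longrightarrow> i < n \<Longrightarrow> (\<Sum>k<n. u i k * v k) = 0"
    by (rule householder[OF j, of v]) (rule that)
  define \<alpha> where "\<alpha> = (\<Sum>k<n. u j k * v k)"
  have uv: "(\<Sum>k<n. u i k * v k) = (if i = j then \<alpha> else 0)" if "i < n" for i
  proof (cases "i < j")
    case True
    have "(\<Sum>k<n. u i k * v k) = (\<Sum>k<n. if i = k then v k else 0)"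
      using uid[of i] True by (intro sum.cong) (auto simp: inf_id_def)
    thus ?thesis using True v j by auto
  next
    case False
    thus ?thesis using ann[of i] that by (auto simp: \<alpha>_def)
  qed
  \<comment> \<open>\<open>u\<close> is self-adjoint and unitary, hence its own inverse; applying it
    once more to \<open>uv\<close> recovers \<open>v\<close> as a multiple of column
    \<open>j\<close>.\<close>
  have vu: "v l = \<alpha> * u l j" if l: "l < n" for l
  proof -
    have "(\<Sum>i<n. u l i * (\<Sum>k<n. u i k * v k)) = (\<Sum>i<n. \<Sum>k<n. u l i * cnj (u k i) * v k)"
      by (simp add: sum_distrib_left sym mult_ac)
    also have "\<dots> = (\<Sum>k<n. (\<Sum>i<n. u l i * cnj (u k i)) * v k)"
      by (subst sum.swap) (simp add: sum_distrib_right)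
    also have "\<dots> = (\<Sum>k<n. if l = k then v k else 0)"
      using unitary_grp_sums(1)[OF u order_refl l] by (intro sum.cong) auto
    also have "\<dots> = v l" using l by simp
    finally have "v l = (\<Sum>i<n. u l i * (if i = j then \<alpha> else 0))" using uv by simp
    also have "\<dots> = (\<Sum>i<n. if i = j then \<alpha> * u l j else 0)" by (intro sum.cong) auto
    finally show ?thesis using j by simp
  qed
  have a0: "\<alpha> \<noteq> 0" using v(2) vu by auto
  have ev': "(\<Sum>k<n. C i k * v k) = \<mu> * v i" if "i < n" for i
  proof (cases "i < j")
    case True
    have "C i k * v k = 0" for k using d[of i k] True v(1)[of k] by (cases "i = k") auto
    thus ?thesis using True v(1) by simp
  qed (use ev that in auto)
  let ?C = "conj_act u C"
  have H: "?C \<in> herm n" using conj_act_herm[OF u CH] .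
  have col: "?C i j = 0" if i: "i < n" "i \<noteq> j" for i
  proof -
    have "\<alpha> * ?C i j = (\<Sum>l<n. \<Sum>k<n. u i k * (C k l * v l))"
      using vu sym[of j] unfolding conj_act_eq[OF u order_refl i(1) j]
      by (simp add: sum_distrib_left sum_distrib_right sym mult_ac)
    also have "\<dots> = (\<Sum>k<n. u i k * (\<mu> * v k))"
      by (subst sum.swap) (simp add: sum_distrib_left[symmetric] ev')
    also have "\<dots> = \<mu> * (\<Sum>k<n. u i k * v k)" by (simp add: sum_distrib_left mult_ac)
    finally show ?thesis using uv[OF i(1)] i a0 by simp
  qed
  have row: "?C i k = 0" if i: "i < j" "i \<noteq> k" "k < n" for i k
  proof -
    have "(\<Sum>p<n. u i p * C p l) = C i l" for l
    proof -
      have "(\<Sum>p<n. u i p * C p l) = (\<Sum>p<n. if i = p then C p l else 0)"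
        using uid[of i] i by (intro sum.cong) (auto simp: inf_id_def)
      thus ?thesis using i j by simp
    qed
    hence "?C i k = (\<Sum>l<n. C i l * cnj (u k l))"
      using i j by (subst conj_act_eq[OF u order_refl]) auto
    also have "\<dots> = 0"
    proof (rule sum.neutral, safe)
      fix l assume "l < n"
      show "C i l * cnj (u k l) = 0"
        using d[of i l] i uid[of k i] by (cases "l = i") (auto simp: inf_id_def)
    qed
    finally show ?thesis .
  qed
  have row': "?C i k = 0" if "i \<noteq> k" "i < Suc j" for i k
  proof (cases "k < n")
    case True
    show ?thesis
    proof (cases "i = j")
      case True
      thus ?thesis using col[of k] that \<open>k < n\<close> herm_all_cnj[OF hermD(1)[OF H], of k i] by simp
    qed (use row[of i k] True that in auto)
  qed (use hermD(3)[OF H] in auto)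
  moreover have "?C i k = 0" if "i \<noteq> k" "k < Suc j" for i k
    using row'[of k i] that herm_all_cnj[OF hermD(1)[OF H], of k i] by simp
  ultimately show ?case using ucong.ucong_step[OF C u] by blast
qed

text \<open>The spectral theorem in the form used throughout: spectrum, trace and trace of the
  square are invariant along \<open>ucong\<close> and explicit for \<open>diagm\<close>.\<close>

lemma ucong_diagonal:
  assumes A: "A \<in> herm n"
  obtains d where "ucong n A (diagm n d)"
proof -
  obtain C where C: "ucong n A C" and z: "\<And>i k. i \<noteq> k \<Longrightarrow> i < n \<or> k < n \<Longrightarrow> C i k = 0"
    using ucong_diagonal_steps[OF A order_refl] by auto
  have H: "C \<in> herm n" using ucong_herm[OF C A] .
  have "C = diagm n (\<lambda>i. Re (C i i))"
  proof (intro ext)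
    fix i k
    have "C i i \<in> \<real>" using herm_all_cnj[OF hermD(1)[OF H], of i i] by (simp add: Reals_cnj_iff)
    thus "C i k = diagm n (\<lambda>i. Re (C i i)) i k"
      using z[of i k] hermD(2)[OF H, of i k] by (cases "i < n") (auto simp: diagm_def)
  qed
  thus thesis using that C by metis
qed

section \<open>Characteristic functions on spaces with a separating family of linear forms\<close>

text \<open>Instantiated twice, for linear forms on complex sequences and on infinite matrices.
  Closure under sums and multiples makes the trigonometric functions of these forms an algebra, as
  Stone--Weierstrass requires.\<close>

locale separating_family =
  fixes L :: "('a::t2_space \<Rightarrow> real) set"
  assumes cont: "l \<in> L \<Longrightarrow> continuous_on UNIV l"
    and zero: "(\<lambda>_. 0) \<in> L"
    and plus: "l \<in> L \<Longrightarrow> m \<in> L \<Longrightarrow> (\<lambda>x. l x + m x) \<in> L"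
    and scale: "l \<in> L \<Longrightarrow> (\<lambda>x. c * l x) \<in> L"
    and separates: "x \<noteq> y \<Longrightarrow> \<exists>l\<in>L. l x \<noteq> l y"
begin

inductive trig :: "('a \<Rightarrow> real) \<Rightarrow> bool" where
  cos: "l \<in> L \<Longrightarrow> trig (\<lambda>x. c * cos (l x))"
| sin: "l \<in> L \<Longrightarrow> trig (\<lambda>x. c * sin (l x))"
| add: "trig p \<Longrightarrow> trig q \<Longrightarrow> trig (\<lambda>x. p x + q x)"

lemma diff: "l \<in> L \<Longrightarrow> m \<in> L \<Longrightarrow> (\<lambda>x. l x - m x) \<in> L"
  using plus[of l "\<lambda>x. (-1) * m x"] scale[of m "-1"] by simp

lemma trig_const: "trig (\<lambda>_. c)"
  using trig.cos[OF zero, of c] by simp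

lemma trig_mult_cos: "trig p \<Longrightarrow> l \<in> L \<Longrightarrow> trig (\<lambda>x. p x * (c * cos (l x)))"
proof (induction rule: trig.induct)
  case (cos m d)
  have "trig (\<lambda>x. (c * d / 2) * cos (m x + l x) + (c * d / 2) * cos (m x - l x))"
    using cos by (intro trig.intros plus diff)
  moreover have "(\<lambda>x. (c * d / 2) * cos (m x + l x) + (c * d / 2) * cos (m x - l x)) = (\<lambda>x. d * cos (m x) * (c * cos (l x)))"
    by (rule ext) (simp add: cos_add cos_diff sin_add sin_diff field_simps)
  ultimately show ?case by simp
next
  case (sin m d)
  have "trig (\<lambda>x. (c * d / 2) * sin (m x + l x) + (c * d / 2) * sin (m x - l x))"
    using sin by (intro trig.intros plus diff)
  moreover have "(\<lambda>x. (c * d / 2) * sin (m x + l x) + (c * d / 2) * sin (m x - l x)) = (\<lambda>x. d * sin (m x) * (c * cos (l x)))"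
    by (rule ext) (simp add: cos_add cos_diff sin_add sin_diff field_simps)
  ultimately show ?case by simp
next
  case (add p q)
  thus ?case using trig.add[of "\<lambda>x. p x * (c * cos (l x))" "\<lambda>x. q x * (c * cos (l x))"]
    by (simp add: algebra_simps)
qed

lemma trig_mult_sin: "trig p \<Longrightarrow> l \<in> L \<Longrightarrow> trig (\<lambda>x. p x * (c * sin (l x)))"
proof (induction rule: trig.induct)
  case (cos m d)
  have "trig (\<lambda>x. (c * d / 2) * sin (m x + l x) + (- (c * d / 2)) * sin (m x - l x))"
    using cos by (intro trig.intros plus diff)
  moreover have "(\<lambda>x. (c * d / 2) * sin (m x + l x) + (- (c * d / 2)) * sin (m x - l x)) = (\<lambda>x. d * cos (m x) * (c * sin (l x)))"
    by (rule ext) (simp add: cos_add cos_diff sin_add sin_diff field_simps)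
  ultimately show ?case by simp
next
  case (sin m d)
  have "trig (\<lambda>x. (c * d / 2) * cos (m x - l x) + (- (c * d / 2)) * cos (m x + l x))"
    using sin by (intro trig.intros plus diff)
  moreover have "(\<lambda>x. (c * d / 2) * cos (m x - l x) + (- (c * d / 2)) * cos (m x + l x)) = (\<lambda>x. d * sin (m x) * (c * sin (l x)))"
    by (rule ext) (simp add: cos_add cos_diff sin_add sin_diff field_simps)
  ultimately show ?case by simp
next
  case (add p q)
  thus ?case using trig.add[of "\<lambda>x. p x * (c * sin (l x))" "\<lambda>x. q x * (c * sin (l x))"]
    by (simp add: algebra_simps)
qed

lemma trig_mult: "trig q \<Longrightarrow> trig p \<Longrightarrow> trig (\<lambda>x. p x * q x)"
proof (induction rule: trig.induct)
  case (add q r)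
  thus ?case using trig.add[of "\<lambda>x. p x * q x" "\<lambda>x. p x * r x"] by (simp add: algebra_simps)
qed (auto intro: trig_mult_cos trig_mult_sin)

lemma trig_continuous: "trig p \<Longrightarrow> continuous_on UNIV p"
  by (induction rule: trig.induct) (auto intro!: continuous_on_add continuous_on_mult continuous_on_const continuous_on_cos continuous_on_sin intro: cont)

lemma trig_bounded: "trig p \<Longrightarrow> \<exists>r>0. \<forall>x. \<bar>p x\<bar> \<le> r"
proof (induction rule: trig.induct)
  case (cos l c)
  have "\<bar>c * cos (l x)\<bar> \<le> \<bar>c\<bar> + 1" for x
    using mult_left_mono[OF abs_cos_le_one[of "l x"], of "\<bar>c\<bar>"] by (simp add: abs_mult)
  thus ?case by (intro exI[of _ "\<bar>c\<bar> + 1"]) auto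
next
  case (sin l c)
  have "\<bar>c * sin (l x)\<bar> \<le> \<bar>c\<bar> + 1" for x
    using mult_left_mono[OF abs_sin_le_one[of "l x"], of "\<bar>c\<bar>"] by (simp add: abs_mult)
  thus ?case by (intro exI[of _ "\<bar>c\<bar> + 1"]) auto
next
  case (add p q)
  then obtain r s where "r > 0" "s > 0" "\<forall>x. \<bar>p x\<bar> \<le> r" "\<forall>x. \<bar>q x\<bar> \<le> s" by auto
  thus ?case by (intro exI[of _ "r + s"]) (auto intro: order_trans[OF abs_triangle_ineq] add_mono)
qed

lemma trig_polynomial: "real_polynomial_function P \<Longrightarrow> trig p \<Longrightarrow> trig (\<lambda>x. P (p x))"
proof (induction rule: real_polynomial_function.induct)
  case (linear f)
  then obtain c where "f = (\<lambda>x. x * c)" using real_bounded_linear by auto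
  thus ?case using trig_mult[OF trig_const[of c], of p] linear by simp
qed (auto intro: trig_const trig.add trig_mult)

lemma trig_function_ring: "compact K \<Longrightarrow> function_ring_on {p. trig p} K"
proof unfold_locales
  fix x y :: 'a assume "x \<noteq> y"
  then obtain l where l: "l \<in> L" "l x \<noteq> l y" using separates by blast
  \<comment> \<open>Scaling the separating form to a difference of exactly 1 prevents the two values
    from differing by a period: equal sines and cosines would force
    \<open>cos 1 = 1\<close>.\<close>
  define m where "m = (\<lambda>z. inverse (l x - l y) * l z)"
  have m: "m \<in> L" unfolding m_def by (rule scale[OF l(1)])
  have d: "m x - m y = 1" using l(2) by (simp add: m_def right_diff_distrib[symmetric])
  show "\<exists>f\<in>{p. trig p}. f x \<noteq> f y"
  proof (rule ccontr)
    assume "\<not> ?thesis"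
    hence "cos (m x) = cos (m y)" "sin (m x) = sin (m y)"
      using trig.cos[OF m, of 1] trig.sin[OF m, of 1] by auto
    hence "cos (m x - m y) = 1" by (simp add: cos_diff power2_eq_square[symmetric])
    moreover have "cos (1::real) < 1" using cos_monotone_0_pi[of 0 1] pi_gt3 by simp
    ultimately show False by (simp add: d)
  qed
qed (auto intro: trig.add trig_mult trig_const continuous_on_subset[OF trig_continuous])

lemma borel_bounded_integrable:
  assumes "prob_space M" "sets M = sets borel" "continuous_on UNIV f" "\<And>x. \<bar>f x\<bar> \<le> r"
  shows "integrable M (f :: 'a \<Rightarrow> real)"
proof -
  interpret prob_space M by fact
  have "f \<in> borel_measurable M"
    using borel_measurable_continuous_onI[OF assms(3)] measurable_cong_sets[OF assms(2) refl] by blast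
  thus ?thesis using assms(4) by (intro integrable_const_bound[of _ r]) auto
qed

text \<open>Stone--Weierstrass gives no control off \<open>K\<close>, where \<open>p\<close> may be
  much larger than \<open>C\<close>. Composing \<open>p\<close> with a polynomial that is close to
  truncation at level \<open>C\<close> on the range of \<open>p\<close> restores a global bound
  without leaving the algebra.\<close>

lemma trig_approx:
  fixes \<psi> :: "'a \<Rightarrow> real"
  assumes K: "compact K" and c: "continuous_on UNIV \<psi>" and b: "\<And>x. \<bar>\<psi> x\<bar> \<le> C"
    and e: "0 < \<epsilon>"
  obtains q where "trig q" "\<And>x. x \<in> K \<Longrightarrow> \<bar>\<psi> x - q x\<bar> \<le> 2 * \<epsilon>" "\<And>x. \<bar>q x\<bar> \<le> C + \<epsilon>"
proof -
  interpret R: function_ring_on "{p. trig p}" K using trig_function_ring[OF K] .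
  have "\<exists>g\<in>{p. trig p}. \<forall>x\<in>K. \<bar>\<psi> x - g x\<bar> < \<epsilon>"
    using R.Stone_Weierstrass_basic[OF continuous_on_subset[OF c] e] by simp
  then obtain p where p: "trig p" "\<And>x. x \<in> K \<Longrightarrow> \<bar>\<psi> x - p x\<bar> < \<epsilon>" by auto
  obtain r where r: "\<And>x. \<bar>p x\<bar> \<le> r" using trig_bounded[OF p(1)] by blast
  define clip where "clip = (\<lambda>t. max (- C) (min C t))"
  have C0: "C \<ge> 0" using b[of undefined] by linarith
  have cc: "continuous_on {- r..r} clip" unfolding clip_def by (intro continuous_intros)
  obtain P where P: "real_polynomial_function P" "\<And>t. t \<in> {- r..r} \<Longrightarrow> \<bar>clip t - P t\<bar> < \<epsilon>"
    using Stone_Weierstrass_real_polynomial_function[OF compact_Icc cc e] by blast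
  have near: "\<bar>clip (p x) - P (p x)\<bar> < \<epsilon>" for x using P(2)[of "p x"] r[of x] by (auto simp: abs_le_iff)
  have "\<bar>P (p x)\<bar> \<le> C + \<epsilon>" for x
    using near[of x] C0 unfolding clip_def by (auto simp: max_def min_def split: if_splits)
  moreover have "\<bar>\<psi> x - P (p x)\<bar> \<le> 2 * \<epsilon>" if "x \<in> K" for x
  proof -
    have "\<bar>clip (\<psi> x) - clip (p x)\<bar> \<le> \<bar>\<psi> x - p x\<bar>" unfolding clip_def by (auto simp: max_def min_def)
    moreover have "clip (\<psi> x) = \<psi> x" using b[of x] unfolding clip_def by (auto simp: max_def min_def abs_le_iff)
    ultimately show ?thesis using p(2)[OF that] near[of x] by linarith
  qed
  ultimately show thesis using that[of "\<lambda>x. P (p x)"] trig_polynomial[OF P(1) p(1)] by blast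
qed

text \<open>On \<open>K\<close> the integrands differ by at most \<open>2 * \<epsilon>\<close>; the
  complement has mass at most \<open>\<epsilon>\<close>, and there the difference is at most
  \<open>2 * C + \<epsilon>\<close>. Since \<open>\<epsilon> < 1\<close>, this adds up to the stated
  constant.\<close>

lemma integral_near_of_tight:
  fixes \<psi> q :: "'a \<Rightarrow> real"
  assumes M: "prob_space M" "sets M = sets borel" and K: "compact K" "measure M K \<ge> 1 - \<epsilon>"
    and \<psi>: "continuous_on UNIV \<psi>" "\<And>x. \<bar>\<psi> x\<bar> \<le> C" and q: "continuous_on UNIV q" "\<And>x. \<bar>q x\<bar> \<le> C + \<epsilon>"
    and near: "\<And>x. x \<in> K \<Longrightarrow> \<bar>\<psi> x - q x\<bar> \<le> 2 * \<epsilon>" and e: "0 < \<epsilon>" "\<epsilon> < 1"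
  shows "\<bar>(\<integral>x. \<psi> x \<partial>M) - (\<integral>x. q x \<partial>M)\<bar> \<le> (2 * C + 3) * \<epsilon>"
proof -
  interpret prob_space M by fact
  have i: "integrable M \<psi>" "integrable M q"
    using borel_bounded_integrable[OF M] \<psi> q by blast+
  have Km: "K \<in> sets M" using M K by (simp add: borel_closed compact_imp_closed)
  have sp: "space M = UNIV" using sets_eq_imp_space_eq[OF M(2)] by simp
  have Kc: "UNIV - K \<in> sets M" using sets.compl_sets[OF Km] sp by simp
  have Ki: "integrable M (indicator (UNIV - K) :: 'a \<Rightarrow> real)"
    using Kc by (intro integrable_real_indicator) (auto simp: emeasure_eq_measure)
  have P1: "measure M UNIV = 1" using prob_space sp by simp
  have pt: "\<bar>\<psi> x - q x\<bar> \<le> 2 * \<epsilon> + (2 * C + \<epsilon>) * indicator (UNIV - K) x" for x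
  proof (cases "x \<in> K")
    case False
    thus ?thesis using \<psi>(2)[of x] q(2)[of x] e abs_triangle_ineq4[of "\<psi> x" "q x"] by simp
  qed (use near in simp)
  have "\<bar>(\<integral>x. \<psi> x \<partial>M) - (\<integral>x. q x \<partial>M)\<bar> = \<bar>\<integral>x. \<psi> x - q x \<partial>M\<bar>" using i by simp
  also have "\<dots> \<le> (\<integral>x. \<bar>\<psi> x - q x\<bar> \<partial>M)" using integral_abs_bound[of M "\<lambda>x. \<psi> x - q x"] by simp
  also have "\<dots> \<le> (\<integral>x. 2 * \<epsilon> + (2 * C + \<epsilon>) * indicator (UNIV - K) x \<partial>M)"
  proof (rule integral_mono)
    show "integrable M (\<lambda>x. 2 * \<epsilon> + (2 * C + \<epsilon>) * indicator (UNIV - K) x)"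
      using Ki by (intro Bochner_Integration.integrable_add integrable_mult_right) auto
  qed (use i pt in auto)
  also have "\<dots> = 2 * \<epsilon> + (2 * C + \<epsilon>) * measure M (UNIV - K)"
    using Ki Kc sp P1 by (subst Bochner_Integration.integral_add) auto
  also have "measure M (UNIV - K) = 1 - measure M K" using prob_compl[OF Km] sp by simp
  also have "2 * \<epsilon> + (2 * C + \<epsilon>) * (1 - measure M K) \<le> 2 * \<epsilon> + (2 * C + \<epsilon>) * \<epsilon>"
  proof -
    have "0 \<le> 2 * C + \<epsilon>" using \<psi>(2)[of undefined] e by linarith
    thus ?thesis using K(2) by (intro add_left_mono mult_left_mono) auto
  qed
  also have "\<dots> \<le> (2 * C + 3) * \<epsilon>"
    using mult_left_mono[of \<epsilon> 1 \<epsilon>] e by (simp add: algebra_simps)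
  finally show ?thesis .
qed

lemma trig_integral_tendsto:
  assumes M: "\<And>n. prob_space (M n)" "\<And>n. sets (M n) = sets borel" and N: "prob_space N" "sets N = sets borel"
    and ch: "\<And>l. l \<in> L \<Longrightarrow> (\<lambda>n. \<integral>x. iexp (l x) \<partial>M n) \<longlonglongrightarrow> (\<integral>x. iexp (l x) \<partial>N)"
  shows "trig p \<Longrightarrow> (\<lambda>n. \<integral>x. p x \<partial>M n) \<longlonglongrightarrow> (\<integral>x. p x \<partial>N)"
proof (induction rule: trig.induct)
  case (cos l c)
  have i: "integrable Q (\<lambda>x. iexp (l x))" if "prob_space Q" "sets Q = sets borel" for Q
  proof -
    interpret prob_space Q by fact
    have "l \<in> borel_measurable Q"
      using borel_measurable_continuous_onI[OF cont[OF cos]] measurable_cong_sets[OF that(2) refl] by blast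
    thus ?thesis by (intro integrable_const_bound[of _ 1]) auto
  qed
  have "Re (\<integral>x. iexp (l x) \<partial>Q) = (\<integral>x. cos (l x) \<partial>Q)" if "prob_space Q" "sets Q = sets borel" for Q
    by (subst integral_Re[symmetric, OF i[OF that]]) (simp add: Re_exp)
  hence "(\<lambda>n. \<integral>x. cos (l x) \<partial>M n) \<longlonglongrightarrow> (\<integral>x. cos (l x) \<partial>N)"
    using tendsto_Re[OF ch[OF cos]] M N by simp
  thus ?case by (auto intro: tendsto_intros)
next
  case (sin l c)
  have i: "integrable Q (\<lambda>x. iexp (l x))" if "prob_space Q" "sets Q = sets borel" for Q
  proof -
    interpret prob_space Q by fact
    have "l \<in> borel_measurable Q"
      using borel_measurable_continuous_onI[OF cont[OF sin]] measurable_cong_sets[OF that(2) refl] by blast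
    thus ?thesis by (intro integrable_const_bound[of _ 1]) auto
  qed
  have "Im (\<integral>x. iexp (l x) \<partial>Q) = (\<integral>x. sin (l x) \<partial>Q)" if "prob_space Q" "sets Q = sets borel" for Q
    by (subst integral_Im[symmetric, OF i[OF that]]) (simp add: Im_exp)
  hence "(\<lambda>n. \<integral>x. sin (l x) \<partial>M n) \<longlonglongrightarrow> (\<integral>x. sin (l x) \<partial>N)"
    using tendsto_Im[OF ch[OF sin]] M N by simp
  thus ?case by (auto intro: tendsto_intros)
next
  case (add p q)
  have i: "integrable Q f" if "prob_space Q" "sets Q = sets borel" "trig f" for Q f
    using trig_bounded[OF that(3)] borel_bounded_integrable[OF that(1,2) trig_continuous[OF that(3)]] by blast
  have "(\<integral>x. p x + q x \<partial>Q) = (\<integral>x. p x \<partial>Q) + (\<integral>x. q x \<partial>Q)" if "prob_space Q" "sets Q = sets borel" for Q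
    by (intro Bochner_Integration.integral_add i that add)
  thus ?case using tendsto_add[OF add.IH] M N by simp
qed

text \<open>The limit measure is part of the data. A compact set common to the whole sequence and to
  the limit replaces a compactness argument in the space of measures.\<close>

theorem weak_convergence_of_char:
  fixes \<psi> :: "'a \<Rightarrow> real"
  assumes M: "\<And>n. prob_space (M n)" "\<And>n. sets (M n) = sets borel" and N: "prob_space N" "sets N = sets borel"
    and ch: "\<And>l. l \<in> L \<Longrightarrow> (\<lambda>n. \<integral>x. iexp (l x) \<partial>M n) \<longlonglongrightarrow> (\<integral>x. iexp (l x) \<partial>N)"
    and tight: "\<And>\<epsilon>. 0 < \<epsilon> \<Longrightarrow> \<exists>K. compact K \<and> (\<forall>n. measure (M n) K \<ge> 1 - \<epsilon>) \<and> measure N K \<ge> 1 - \<epsilon>"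
    and \<psi>: "continuous_on UNIV \<psi>" "\<And>x. \<bar>\<psi> x\<bar> \<le> C"
  shows "(\<lambda>n. \<integral>x. \<psi> x \<partial>M n) \<longlonglongrightarrow> (\<integral>x. \<psi> x \<partial>N)"
proof (rule LIMSEQ_I)
  fix r :: real assume r: "0 < r"
  have C0: "C \<ge> 0" using \<psi>(2)[of undefined] by linarith
  \<comment> \<open>Two comparisons with the trigonometric approximant, each costing
    \<open>(2 * C + 3) * \<epsilon>\<close>, and one \<open>\<epsilon>\<close> for the convergence
    of its integrals have to fit into \<open>r\<close>.\<close>
  define \<epsilon> where "\<epsilon> = min (1/2) (r / (2 * (2 * C + 3) + 1))"
  have e: "0 < \<epsilon>" "\<epsilon> < 1" using r C0 by (auto simp: \<epsilon>_def)
  have "(2 * (2 * C + 3) + 1) * \<epsilon> \<le> r"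
  proof -
    have "\<epsilon> \<le> r / (2 * (2 * C + 3) + 1)" by (simp add: \<epsilon>_def)
    thus ?thesis using C0 by (simp add: pos_le_divide_eq mult.commute)
  qed
  hence er: "2 * ((2 * C + 3) * \<epsilon>) + \<epsilon> \<le> r" by (simp add: algebra_simps)
  obtain K where K: "compact K" "\<And>n. measure (M n) K \<ge> 1 - \<epsilon>" "measure N K \<ge> 1 - \<epsilon>"
    using tight[OF e(1)] by blast
  obtain q where q: "trig q" "\<And>x. x \<in> K \<Longrightarrow> \<bar>\<psi> x - q x\<bar> \<le> 2 * \<epsilon>" "\<And>x. \<bar>q x\<bar> \<le> C + \<epsilon>"
    using trig_approx[OF K(1) \<psi> e(1)] by blast
  note near = integral_near_of_tight[OF _ _ K(1) _ \<psi> trig_continuous[OF q(1)] q(3) q(2) e]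
  have "(\<lambda>n. \<integral>x. q x \<partial>M n) \<longlonglongrightarrow> (\<integral>x. q x \<partial>N)" by (rule trig_integral_tendsto[OF M N ch q(1)])
  from LIMSEQ_D[OF this e(1)] obtain n0 where n0: "\<And>n. n \<ge> n0 \<Longrightarrow> \<bar>(\<integral>x. q x \<partial>M n) - (\<integral>x. q x \<partial>N)\<bar> < \<epsilon>" by auto
  have "norm ((\<integral>x. \<psi> x \<partial>M n) - (\<integral>x. \<psi> x \<partial>N)) < r" if "n \<ge> n0" for n
    using n0[OF that] near[OF M(1)[of n] M(2)[of n] K(2)[of n]] near[OF N K(3)] er unfolding real_norm_def by linarith
  thus "\<exists>no. \<forall>n\<ge>no. norm ((\<integral>x. \<psi> x \<partial>M n) - (\<integral>x. \<psi> x \<partial>N)) < r" by blast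
qed

end

text \<open>Closed sets are an intersection-stable generator, and the indicator of a nonempty closed
  set is the pointwise limit of truncated linear functions of the distance to it.\<close>

lemma measure_eqI_continuous:
  fixes M N :: "'a::metric_space measure"
  assumes M: "prob_space M" "sets M = sets borel" and N: "prob_space N" "sets N = sets borel"
    and eq: "\<And>\<psi> :: 'a \<Rightarrow> real. continuous_on UNIV \<psi> \<Longrightarrow> (\<And>x. \<bar>\<psi> x\<bar> \<le> 1) \<Longrightarrow> (\<integral>x. \<psi> x \<partial>M) = (\<integral>x. \<psi> x \<partial>N)"
  shows "M = N"
proof (rule measure_eqI_generator_eq[where E = "Collect closed" and \<Omega> = UNIV and A = "\<lambda>_. UNIV"])
  interpret M: prob_space M by fact
  interpret N: prob_space N by fact
  show "Int_stable (Collect closed :: 'a set set)" by (auto simp: Int_stable_def)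
  show "sets M = sigma_sets UNIV (Collect closed)" "sets N = sigma_sets UNIV (Collect closed)"
    using M N by (auto simp: borel_eq_closed)
  fix F :: "'a set" assume "F \<in> Collect closed"
  hence F: "closed F" by simp
  show "emeasure M F = emeasure N F"
  \<comment> \<open>The distance to the empty set is 0 by convention, so the functions
    \<open>g n\<close> would be constantly 1 for it; this case is kept apart.\<close>
  proof (cases "F = {}")
    case False
    define g where "g = (\<lambda>n x. max 0 (1 - real n * infdist x F))"
    have gc: "continuous_on UNIV (g n)" for n unfolding g_def by (intro continuous_intros)
    have gb: "\<bar>g n x\<bar> \<le> 1" for n x using infdist_nonneg[of x F] by (auto simp: g_def max_def)
    have gl: "(\<lambda>n. g n x) \<longlonglongrightarrow> indicator F x" for x
    proof (cases "x \<in> F")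
      case True
      thus ?thesis by (simp add: g_def)
    next
      case x: False
      have d: "infdist x F > 0" using F False x infdist_pos_not_in_closed by blast
      obtain n0 :: nat where n0: "1 / infdist x F < n0" using reals_Archimedean2 by blast
      have "g n x = 0" if "n \<ge> n0" for n
      proof -
        have "1 / infdist x F < real n" using n0 that by linarith
        thus ?thesis using d by (auto simp: g_def field_simps max_def)
      qed
      hence "eventually (\<lambda>n. 0 = g n x) sequentially" by (auto simp: eventually_sequentially)
      thus ?thesis using x by (simp add: tendsto_eventually)
    qed
    have lim: "(\<lambda>n. \<integral>x. g n x \<partial>Q) \<longlonglongrightarrow> measure Q F" if "prob_space Q" "sets Q = sets borel" for Q
    proof -
      interpret Q: prob_space Q by fact
      have Fm: "F \<in> sets Q" using that F by (simp add: borel_closed)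
      have gm: "g n \<in> borel_measurable Q" for n
        using borel_measurable_continuous_onI[OF gc] measurable_cong_sets[OF that(2) refl] by blast
      have "(\<lambda>n. \<integral>x. g n x \<partial>Q) \<longlonglongrightarrow> (\<integral>x. indicator F x \<partial>Q)"
        by (rule integral_dominated_convergence[where w = "\<lambda>_. 1"]) (use Fm gm gl gb in auto)
      thus ?thesis using Fm by simp
    qed
    have "measure M F = measure N F"
      using LIMSEQ_unique[OF lim[OF M]] lim[OF N] eq[OF gc gb] by simp
    thus ?thesis by (simp add: M.emeasure_eq_measure N.emeasure_eq_measure)
  qed simp
next
  interpret M: prob_space M by fact
  show "emeasure M ((\<lambda>_. UNIV) i) \<noteq> \<infinity>" for i :: nat using M.emeasure_finite by simp
qed auto

text \<open>Inner regularity of finite measures on Polish spaces, read as tightness of a single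
  measure.\<close>

lemma prob_tight:
  fixes M :: "'a::polish_space measure"
  assumes M: "prob_space M" "sets M = sets borel" and e: "0 < \<epsilon>"
  obtains K where "compact K" "measure M K \<ge> 1 - \<epsilon>"
proof -
  interpret prob_space M by fact
  have sp: "space M = UNIV" using sets_eq_imp_space_eq[OF M(2)] by simp
  have "emeasure M UNIV = (SUP K \<in> {K. K \<subseteq> UNIV \<and> compact K}. emeasure M K)"
    by (rule inner_regular[OF M(2)]) auto
  hence "ennreal (1 - \<epsilon>) < (SUP K \<in> {K. K \<subseteq> UNIV \<and> compact K}. emeasure M K)"
    using emeasure_space_1 sp e by (simp add: ennreal_less_one_iff)
  then obtain K where "compact K" "ennreal (1 - \<epsilon>) < emeasure M K" unfolding less_SUP_iff by auto
  moreover have "1 - \<epsilon> \<le> measure M K"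
    using calculation(2) ennreal_leI[of "measure M K" "1 - \<epsilon>"] by (force simp: emeasure_eq_measure)
  ultimately show thesis using that by blast
qed


text \<open>The convergence theorem is applied to a constant sequence: each of the two measures is
  tight, and a constant sequence of integrals can converge only to its own value.\<close>

lemma measure_eq_of_char:
  fixes L :: "('a::polish_space \<Rightarrow> real) set"
  assumes "separating_family L" and M: "prob_space M" "sets M = sets borel" and N: "prob_space N" "sets N = sets borel"
    and ch: "\<And>l. l \<in> L \<Longrightarrow> (\<integral>x. iexp (l x) \<partial>M) = (\<integral>x. iexp (l x) \<partial>N)"
  shows "M = N"
proof (rule measure_eqI_continuous[OF M N])
  interpret separating_family L by fact
  fix \<psi> :: "'a \<Rightarrow> real" assume \<psi>: "continuous_on UNIV \<psi>" "\<And>x. \<bar>\<psi> x\<bar> \<le> 1"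
  have "(\<lambda>n::nat. \<integral>x. \<psi> x \<partial>M) \<longlonglongrightarrow> (\<integral>x. \<psi> x \<partial>N)"
  proof (rule weak_convergence_of_char[OF M N _ _ \<psi>])
    fix \<epsilon> :: real assume e: "0 < \<epsilon>"
    obtain K1 where K1: "compact K1" "measure M K1 \<ge> 1 - \<epsilon>" using prob_tight[OF M e] by blast
    obtain K2 where K2: "compact K2" "measure N K2 \<ge> 1 - \<epsilon>" using prob_tight[OF N e] by blast
    interpret M: prob_space M by fact
    interpret N: prob_space N by fact
    have "measure M K1 \<le> measure M (K1 \<union> K2)" "measure N K2 \<le> measure N (K1 \<union> K2)"
      using K1 K2 M N by (auto intro!: M.finite_measure_mono N.finite_measure_mono simp: borel_closed compact_imp_closed)
    thus "\<exists>K. compact K \<and> (\<forall>n::nat. measure M K \<ge> 1 - \<epsilon>) \<and> measure N K \<ge> 1 - \<epsilon>"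
      using K1 K2 by (intro exI[of _ "K1 \<union> K2"]) (auto intro: compact_Un)
  qed (simp add: ch)
  thus "(\<integral>x. \<psi> x \<partial>M) = (\<integral>x. \<psi> x \<partial>N)" by (simp add: LIMSEQ_const_iff)
qed

section \<open>Gaussian integrals\<close>

lemma integral_prod_pair:
  fixes f :: "'a \<Rightarrow> 'c::{real_normed_field,banach,second_countable_topology}" and g :: "'b \<Rightarrow> 'c"
  assumes "prob_space M" "prob_space N" and f: "integrable M f" and g: "integrable N g"
  shows "integrable (M \<Otimes>\<^sub>M N) (\<lambda>z. f (fst z) * g (snd z))"
    and "(\<integral>z. f (fst z) * g (snd z) \<partial>(M \<Otimes>\<^sub>M N)) = (\<integral>x. f x \<partial>M) * (\<integral>y. g y \<partial>N)"
proof -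
  interpret M: prob_space M by fact
  interpret N: prob_space N by fact
  interpret P: pair_sigma_finite M N ..
  have [measurable]: "f \<in> borel_measurable M" "g \<in> borel_measurable N" using f g by auto
  show i: "integrable (M \<Otimes>\<^sub>M N) (\<lambda>z. f (fst z) * g (snd z))"
    by (rule P.Fubini_integrable) (use f g in \<open>auto simp: norm_mult\<close>)
  show "(\<integral>z. f (fst z) * g (snd z) \<partial>(M \<Otimes>\<^sub>M N)) = (\<integral>x. f x \<partial>M) * (\<integral>y. g y \<partial>N)"
    using P.integral_fst'[OF i] f g by simp
qed

text \<open>The integrand involves the coordinates in \<open>J\<close> only, so the infinite product
  can be replaced by its restriction to \<open>J\<close>, where the integral factors.\<close>

lemma integral_prod_PiM:
  fixes f :: "'i \<Rightarrow> 'a \<Rightarrow> 'c::{real_normed_field,banach,second_countable_topology}"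
  assumes R: "prob_space R" and J: "finite J" and f: "\<And>j. j \<in> J \<Longrightarrow> integrable R (f j)"
  shows "integrable (PiM UNIV (\<lambda>_::'i. R)) (\<lambda>\<omega>. \<Prod>j\<in>J. f j (\<omega> j))"
    and "(\<integral>\<omega>. (\<Prod>j\<in>J. f j (\<omega> j)) \<partial>PiM UNIV (\<lambda>_::'i. R)) = (\<Prod>j\<in>J. \<integral>x. f j x \<partial>R)"
proof -
  interpret R: prob_space R by fact
  interpret product_prob_space "\<lambda>_::'i. R" UNIV ..
  let ?P = "PiM UNIV (\<lambda>_::'i. R)" and ?PJ = "PiM J (\<lambda>_::'i. R)"
  have d: "distr ?P ?PJ (\<lambda>x. restrict x J) = ?PJ" using J by (intro distr_PiM_restrict_finite) auto
  have m: "(\<lambda>x. restrict x J) \<in> measurable ?P ?PJ" by (intro measurable_restrict_subset) auto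
  have i: "integrable ?PJ (\<lambda>x. \<Prod>j\<in>J. f j (x j))" by (rule product_integrable_prod[OF J f])
  have e: "(\<Prod>j\<in>J. f j (restrict x J j)) = (\<Prod>j\<in>J. f j (x j))" for x by (intro prod.cong) auto
  have "integrable (distr ?P ?PJ (\<lambda>x. restrict x J)) (\<lambda>x. \<Prod>j\<in>J. f j (x j))" using i d by simp
  from integrable_distr[OF m this] show "integrable ?P (\<lambda>\<omega>. \<Prod>j\<in>J. f j (\<omega> j))" by (simp add: e)
  have "(\<integral>x. (\<Prod>j\<in>J. f j (x j)) \<partial>?PJ) = (\<integral>x. (\<Prod>j\<in>J. f j (x j)) \<partial>distr ?P ?PJ (\<lambda>x. restrict x J))"
    by (simp add: d)
  also have "\<dots> = (\<integral>\<omega>. (\<Prod>j\<in>J. f j (\<omega> j)) \<partial>?P)"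
    by (subst integral_distr[OF m borel_measurable_integrable[OF i]]) (simp add: e)
  finally show "(\<integral>\<omega>. (\<Prod>j\<in>J. f j (\<omega> j)) \<partial>?P) = (\<Prod>j\<in>J. \<integral>x. f j x \<partial>R)"
    using product_integral_prod[OF J f] by simp
qed

text \<open>Differentiation under the integral sign: \<open>g\<close> is 1-Lipschitz, so the
  difference quotients are dominated by \<open>\<bar>T\<bar>\<close>.\<close>

lemma has_real_derivative_integral_scale:
  fixes T :: "'a \<Rightarrow> real"
  assumes N: "prob_space N" and T: "integrable N T"
    and g: "\<And>t. (g has_real_derivative g' t) (at t)" "\<And>t. \<bar>g' t\<bar> \<le> 1" "continuous_on UNIV g'" "\<And>t. \<bar>g t\<bar> \<le> 1"
  shows "((\<lambda>s. \<integral>x. g (s * T x) \<partial>N) has_real_derivative (\<integral>x. T x * g' (s * T x) \<partial>N)) (at s)"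
proof -
  interpret prob_space N by fact
  have [measurable]: "T \<in> borel_measurable N" using T by simp
  have gc: "continuous_on UNIV g" using g(1) by (meson DERIV_isCont continuous_at_imp_continuous_on)
  have [measurable]: "g \<in> borel_measurable borel" "g' \<in> borel_measurable borel"
    using gc g(3) by (auto intro: borel_measurable_continuous_onI)
  have lip: "\<bar>g a - g b\<bar> \<le> \<bar>a - b\<bar>" for a b
    using field_differentiable_bound[of UNIV g g' 1 a b] g(1,2) by auto
  have ig: "integrable N (\<lambda>x. g (t * T x))" for t
    using g(4) by (intro integrable_const_bound[of _ 1]) auto
  show ?thesis unfolding has_field_derivative_iff tendsto_at_iff_sequentially comp_def
  proof safe
    fix t :: "nat \<Rightarrow> real" assume t: "\<forall>i. t i \<in> UNIV - {s}" "t \<longlonglongrightarrow> s"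
    have "(\<lambda>i. \<integral>x. (g (t i * T x) - g (s * T x)) / (t i - s) \<partial>N) \<longlonglongrightarrow> (\<integral>x. T x * g' (s * T x) \<partial>N)"
    proof (rule integral_dominated_convergence[where w = "\<lambda>x. \<bar>T x\<bar>"])
      show "AE x in N. (\<lambda>i. (g (t i * T x) - g (s * T x)) / (t i - s)) \<longlonglongrightarrow> T x * g' (s * T x)"
      proof (rule AE_I2)
        fix x
        have "((\<lambda>s. g (s * T x)) has_real_derivative T x * g' (s * T x)) (at s)"
        proof -
          have "((\<lambda>s. s * T x) has_real_derivative T x) (at s)" by (auto intro!: derivative_eq_intros)
          from DERIV_chain2[OF g(1) this] show ?thesis by (simp add: mult.commute)
        qed
        thus "(\<lambda>i. (g (t i * T x) - g (s * T x)) / (t i - s)) \<longlonglongrightarrow> T x * g' (s * T x)"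
          using t unfolding has_field_derivative_iff tendsto_at_iff_sequentially comp_def by blast
      qed
      show "AE x in N. norm ((g (t i * T x) - g (s * T x)) / (t i - s)) \<le> \<bar>T x\<bar>" for i
      proof (rule AE_I2)
        fix x
        have "t i - s \<noteq> 0" using t by auto
        thus "norm ((g (t i * T x) - g (s * T x)) / (t i - s)) \<le> \<bar>T x\<bar>"
          using lip[of "t i * T x" "s * T x"]
          by (simp add: abs_divide pos_divide_le_eq abs_mult[symmetric] algebra_simps)
      qed
    qed (use T in auto)
    moreover have e: "(\<integral>x. (g (t i * T x) - g (s * T x)) / (t i - s) \<partial>N) =
        ((\<integral>x. g (t i * T x) \<partial>N) - (\<integral>x. g (s * T x) \<partial>N)) / (t i - s)" for i
      using ig by simp
    ultimately show "(\<lambda>i. ((\<integral>x. g (t i * T x) \<partial>N) - (\<integral>x. g (s * T x) \<partial>N)) / (t i - s))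
        \<longlonglongrightarrow> (\<integral>x. T x * g' (s * T x) \<partial>N)" by (simp only: e)
  qed
qed

lemma has_vector_derivative_char:
  fixes T :: "'a \<Rightarrow> real"
  assumes N: "prob_space N" and T: "integrable N T"
  shows "((\<lambda>s. \<integral>x. iexp (s * T x) \<partial>N) has_vector_derivative (\<integral>x. \<i> * T x * iexp (s * T x) \<partial>N)) (at s)"
proof -
  interpret prob_space N by fact
  have [measurable]: "T \<in> borel_measurable N" using T by simp
  have i1: "integrable N (\<lambda>x. iexp (s * T x))" for s by (intro integrable_const_bound[of _ 1]) auto
  have i2: "integrable N (\<lambda>x. \<i> * T x * iexp (s * T x))" for s
    by (rule Bochner_Integration.integrable_bound[OF T]) (auto simp: norm_mult)
  have r: "Re (\<integral>x. iexp (s * T x) \<partial>N) = (\<integral>x. cos (s * T x) \<partial>N)"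
    "Im (\<integral>x. iexp (s * T x) \<partial>N) = (\<integral>x. sin (s * T x) \<partial>N)" for s
    by (rule trans[OF integral_Re[OF i1, symmetric]], simp add: Re_exp del: integral_Re)
      (rule trans[OF integral_Im[OF i1, symmetric]], simp add: Im_exp del: integral_Im)
  have d: "Re (\<integral>x. \<i> * T x * iexp (s * T x) \<partial>N) = (\<integral>x. T x * (- sin (s * T x)) \<partial>N)"
    "Im (\<integral>x. \<i> * T x * iexp (s * T x) \<partial>N) = (\<integral>x. T x * cos (s * T x) \<partial>N)"
    by (rule trans[OF integral_Re[OF i2, symmetric]], simp add: Re_exp Im_exp del: integral_Re)
      (rule trans[OF integral_Im[OF i2, symmetric]], simp add: Re_exp Im_exp del: integral_Im)
  have "((\<lambda>s. \<integral>x. cos (s * T x) \<partial>N) has_real_derivative (\<integral>x. T x * (- sin (s * T x)) \<partial>N)) (at s)"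
    by (rule has_real_derivative_integral_scale[OF N T, where g' = "\<lambda>t. - sin t"])
      (auto intro!: derivative_eq_intros continuous_intros)
  moreover have "((\<lambda>s. \<integral>x. sin (s * T x) \<partial>N) has_real_derivative (\<integral>x. T x * cos (s * T x) \<partial>N)) (at s)"
    by (rule has_real_derivative_integral_scale[OF N T])
      (auto intro!: derivative_eq_intros continuous_intros)
  ultimately show ?thesis
    unfolding has_vector_derivative_complex_iff r d by simp
qed

lemma integral_pair_components:
  fixes f :: "_ \<Rightarrow> 'c::{real_normed_field,banach,second_countable_topology}"
  assumes M: "prob_space M" and N: "prob_space N"
  shows "integrable M f \<Longrightarrow> integrable (M \<Otimes>\<^sub>M N) (\<lambda>z. f (fst z))"
    "integrable M f \<Longrightarrow> (\<integral>z. f (fst z) \<partial>(M \<Otimes>\<^sub>M N)) = (\<integral>x. f x \<partial>M)"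
    "integrable N g \<Longrightarrow> integrable (M \<Otimes>\<^sub>M N) (\<lambda>z. g (snd z) :: 'c)"
    "integrable N g \<Longrightarrow> (\<integral>z. g (snd z) \<partial>(M \<Otimes>\<^sub>M N)) = (\<integral>x. g x \<partial>N)"
proof -
  interpret M: prob_space M by fact
  interpret N: prob_space N by fact
  show "integrable M f \<Longrightarrow> integrable (M \<Otimes>\<^sub>M N) (\<lambda>z. f (fst z))"
    "integrable M f \<Longrightarrow> (\<integral>z. f (fst z) \<partial>(M \<Otimes>\<^sub>M N)) = (\<integral>x. f x \<partial>M)"
    using integral_prod_pair[OF M N, of f "\<lambda>_. 1"] by (simp_all add: N.prob_space)
  show "integrable N g \<Longrightarrow> integrable (M \<Otimes>\<^sub>M N) (\<lambda>z. g (snd z) :: 'c)"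
    "integrable N g \<Longrightarrow> (\<integral>z. g (snd z) \<partial>(M \<Otimes>\<^sub>M N)) = (\<integral>x. g x \<partial>N)"
    using integral_prod_pair[OF M N, of "\<lambda>_. 1" g] by (simp_all add: M.prob_space)
qed

lemma normal_prob: "prob_space std_normal_distribution"
  using real_dist_normal_dist unfolding real_distribution_def by simp

text \<open>Gaussian integration by parts, with \<open>F x = x * exp (- (1 - \<i> s) x\<^sup>2 / 2)\<close>.\<close>

lemma normal_square_char_stein:
  "(1 - \<i> * of_real s) * (\<integral>x. of_real (x\<^sup>2) * iexp (s * (x\<^sup>2 / 2)) \<partial>std_normal_distribution) =
   (\<integral>x. iexp (s * (x\<^sup>2 / 2)) \<partial>std_normal_distribution)"
proof -
  interpret prob_space std_normal_distribution by (rule normal_prob)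
  define c where "c = 1 - \<i> * of_real s"
  define F where "F = (\<lambda>x::real. of_real x * exp (- c * of_real (x\<^sup>2) / 2))"
  define f where "f = (\<lambda>x::real. (1 - c * of_real (x\<^sup>2)) * exp (- c * of_real (x\<^sup>2) / 2))"
  have ne: "norm (exp (- c * of_real (x\<^sup>2) / 2)) = exp (- (x\<^sup>2 / 2))" for x :: real
    by (simp add: c_def)
  \<comment> \<open>Up to the factor \<open>sqrt (2 * pi)\<close>, the derivative of
    \<open>F\<close> is the Gaussian density times the difference of the two integrands in the
    claim. That its Lebesgue integral vanishes is therefore the claim.\<close>
  have dens: "f x = of_real (sqrt (2 * pi)) * (std_normal_density x *\<^sub>R ((1 - c * of_real (x\<^sup>2)) * iexp (s * (x\<^sup>2 / 2))))" for x
  proof -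
    have "exp (- c * of_real (x\<^sup>2) / 2) = of_real (exp (- x\<^sup>2 / 2)) * iexp (s * (x\<^sup>2 / 2))"
    proof -
      have "- c * of_real (x\<^sup>2) / 2 = of_real (- x\<^sup>2 / 2) + \<i> * of_real (s * (x\<^sup>2 / 2))"
        by (simp add: c_def field_simps)
      thus ?thesis by (simp only: exp_add exp_of_real)
    qed
    thus ?thesis by (simp add: f_def std_normal_density_def scaleR_conv_of_real)
  qed
  have m2: "integrable std_normal_distribution (\<lambda>x. x\<^sup>2)" by (rule integrable_std_normal_distribution_moment)
  have i1: "integrable std_normal_distribution (\<lambda>x. iexp (s * (x\<^sup>2 / 2)))"
    by (intro integrable_const_bound[of _ 1]) auto
  have i2: "integrable std_normal_distribution (\<lambda>x. of_real (x\<^sup>2) * iexp (s * (x\<^sup>2 / 2)))"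
    by (rule Bochner_Integration.integrable_bound[OF m2]) (auto simp: norm_mult norm_power)
  have i3: "integrable std_normal_distribution (\<lambda>x. (1 - c * of_real (x\<^sup>2)) * iexp (s * (x\<^sup>2 / 2)))"
    using Bochner_Integration.integrable_diff[OF i1 integrable_mult_right[OF i2, of c]] by (simp add: algebra_simps)
  have fi: "integrable lborel f"
  proof -
    have "integrable lborel (\<lambda>x. std_normal_density x *\<^sub>R ((1 - c * of_real (x\<^sup>2)) * iexp (s * (x\<^sup>2 / 2))))"
      using i3 by (subst (asm) integrable_density) (auto simp: normal_density_nonneg)
    thus ?thesis unfolding dens[abs_def] by (rule integrable_mult_right)
  qed
  have "(LBINT x=-\<infinity>..\<infinity>. f x) = 0 - 0"
  proof (rule interval_integral_FTC_integrable[where F = F])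
    show "(F has_vector_derivative f x) (at x)" for x :: real
      unfolding F_def f_def
      by (rule has_vector_derivative_eq_rhs, rule has_vector_derivative_real_field[where f = "\<lambda>x. x * exp (- c * x\<^sup>2 / 2)", simplified of_real_power[symmetric]])
       (auto intro!: derivative_eq_intros simp: algebra_simps power2_eq_square)
    show "isCont f x" for x :: real unfolding f_def by (intro continuous_intros) auto
    show "set_integrable lborel (einterval (-\<infinity>) \<infinity>) f" using fi by (simp add: einterval_eq set_integrable_def)
    have n: "norm (F x) = \<bar>x\<bar> * exp (- (x\<^sup>2 / 2))" for x by (simp only: F_def norm_mult ne norm_of_real)
    have "(F \<longlongrightarrow> 0) at_top" "(F \<longlongrightarrow> 0) at_bot"
      by (rule tendsto_norm_zero_cancel, unfold n, real_asymp)+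
    thus "((F \<circ> real_of_ereal) \<longlongrightarrow> 0) (at_right (-\<infinity>))" "((F \<circ> real_of_ereal) \<longlongrightarrow> 0) (at_left \<infinity>)"
      by (simp_all add: ereal_tendsto_simps)
  qed auto
  hence "integral\<^sup>L lborel f = 0"
    by (simp add: interval_lebesgue_integral_def set_lebesgue_integral_def einterval_eq)
  hence "(\<integral>x. std_normal_density x *\<^sub>R ((1 - c * of_real (x\<^sup>2)) * iexp (s * (x\<^sup>2 / 2))) \<partial>lborel) = 0"
    unfolding dens[abs_def] by (subst (asm) integral_mult_right_zero) simp
  hence "(\<integral>x. (1 - c * of_real (x\<^sup>2)) * iexp (s * (x\<^sup>2 / 2)) \<partial>std_normal_distribution) = 0"
    by (subst integral_density) (auto simp: normal_density_nonneg)
  hence "(\<integral>x. iexp (s * (x\<^sup>2 / 2)) - c * (of_real (x\<^sup>2) * iexp (s * (x\<^sup>2 / 2))) \<partial>std_normal_distribution) = 0"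
    by (simp add: algebra_simps)
  thus ?thesis using i1 i2
    by (subst (asm) Bochner_Integration.integral_diff) (auto simp: c_def)
qed

text \<open>Integration by parts turns the derivative of the integral \<open>\<phi>\<close> into the
  equation \<open>\<phi>' s = \<i> / 2 * \<phi> s / (1 - \<i> * s)\<close>, along which the square
  of \<open>\<phi> s\<close> times \<open>1 - \<i> * s\<close> is constant. Squaring avoids choosing
  a branch of the root, and the square is what the two real coordinates of a complex Gaussian
  produce.\<close>

lemma normal_square_char:
  "(\<integral>x. iexp (s * (x\<^sup>2 / 2)) \<partial>std_normal_distribution)\<^sup>2 = 1 / (1 - \<i> * of_real s)"
proof -
  interpret prob_space std_normal_distribution by (rule normal_prob)
  define \<phi> where "\<phi> = (\<lambda>s. \<integral>x. iexp (s * (x\<^sup>2 / 2)) \<partial>std_normal_distribution)"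
  have T: "integrable std_normal_distribution (\<lambda>x. x\<^sup>2 / 2)"
    using integrable_std_normal_distribution_moment[of 2] by simp
  have nz: "1 - \<i> * of_real t \<noteq> 0" for t by (auto simp: complex_eq_iff)
  have d: "(\<phi> has_vector_derivative (\<i> / 2 * \<phi> t / (1 - \<i> * of_real t))) (at t)" for t
  proof -
    have "(\<integral>x. \<i> * of_real (x\<^sup>2 / 2) * iexp (t * (x\<^sup>2 / 2)) \<partial>std_normal_distribution) =
      (\<integral>x. \<i> / 2 * (of_real (x\<^sup>2) * iexp (t * (x\<^sup>2 / 2))) \<partial>std_normal_distribution)"
      by (simp add: mult_ac)
    also have "\<dots> = \<i> / 2 * (\<phi> t / (1 - \<i> * of_real t))"
      unfolding integral_mult_right_zero \<phi>_def normal_square_char_stein[symmetric] using nz[of t] by simp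
    finally have eq: "(\<integral>x. \<i> * of_real (x\<^sup>2 / 2) * iexp (t * (x\<^sup>2 / 2)) \<partial>std_normal_distribution) =
      \<i> / 2 * (\<phi> t / (1 - \<i> * of_real t))" .
    show ?thesis using has_vector_derivative_char[OF normal_prob T, of t]
      unfolding eq by (simp only: \<phi>_def times_divide_eq_right)
  qed
  have "((\<lambda>t. (\<phi> t * \<phi> t) * (1 - \<i> * of_real t)) has_vector_derivative 0) (at t)" for t
  proof -
    have alg: "(p * p) * (- \<i>) + (p * (\<i> / 2 * p / c) + (\<i> / 2 * p / c) * p) * c = 0" if "c \<noteq> 0" for p c :: complex
      using that by (simp add: field_simps)
    have d2: "((\<lambda>t. 1 - \<i> * of_real t) has_vector_derivative - \<i>) (at t)"
      by (auto intro!: derivative_eq_intros)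
    show ?thesis using has_vector_derivative_mult[OF has_vector_derivative_mult[OF d d] d2]
      unfolding alg[OF nz] .
  qed
  hence "\<exists>k. \<forall>t\<in>UNIV. (\<phi> t * \<phi> t) * (1 - \<i> * of_real t) = k"
    by (metis (mono_tags, lifting) convex_UNIV has_vector_derivative_at_within has_vector_derivative_zero_constant)
  then obtain k where k: "\<And>t. (\<phi> t * \<phi> t) * (1 - \<i> * of_real t) = k" by blast
  have "\<phi> 0 = 1" by (simp add: \<phi>_def prob_space[simplified])
  hence "k = 1" using k[of 0] by simp
  hence "(\<phi> s)\<^sup>2 = 1 / (1 - \<i> * of_real s)"
    using k[of s] nz[of s] by (simp add: power2_eq_square eq_divide_eq)
  thus ?thesis by (simp only: \<phi>_def)
qed

section \<open>The standard complex Gaussian variable\<close>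

definition cgauss :: "complex measure" where
  "cgauss = distr (std_normal_distribution \<Otimes>\<^sub>M std_normal_distribution) borel
     (\<lambda>z. Complex (fst z / sqrt 2) (snd z / sqrt 2))"

lemma Complex_measurable [measurable]:
  "f \<in> borel_measurable M \<Longrightarrow> g \<in> borel_measurable M \<Longrightarrow> (\<lambda>x. Complex (f x) (g x)) \<in> borel_measurable M"
  by (simp add: borel_measurable_complex_iff)

lemma sets_cgauss [simp, measurable_cong]: "sets cgauss = sets borel"
  by (simp add: cgauss_def)

lemma space_cgauss [simp]: "space cgauss = UNIV"
  by (simp add: cgauss_def)

lemma prob_space_cgauss: "prob_space cgauss"
proof -
  interpret prob_space std_normal_distribution by (rule normal_prob)
  interpret P: pair_prob_space std_normal_distribution std_normal_distribution ..
  show ?thesis unfolding cgauss_def by (rule P.prob_space_distr) measurable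
qed

lemma cgauss_integral:
  fixes f :: "complex \<Rightarrow> 'b::{banach,second_countable_topology}"
  assumes [measurable]: "f \<in> borel_measurable borel"
  shows "(\<integral>z. f z \<partial>cgauss) = (\<integral>z. f (Complex (fst z / sqrt 2) (snd z / sqrt 2)) \<partial>(std_normal_distribution \<Otimes>\<^sub>M std_normal_distribution))"
    and "integrable cgauss f \<longleftrightarrow> integrable (std_normal_distribution \<Otimes>\<^sub>M std_normal_distribution) (\<lambda>z. f (Complex (fst z / sqrt 2) (snd z / sqrt 2)))"
  unfolding cgauss_def by (auto simp: integral_distr integrable_distr_eq)

text \<open>Real and imaginary part have variance 1/2, which normalizes the mean of
  \<open>(cmod z)\<^sup>2\<close> to 1 and accounts for the 4 in the exponent.\<close>

lemma cgauss_char: "(\<integral>z. iexp (Re (c * z)) \<partial>cgauss) = of_real (exp (- (cmod c)\<^sup>2 / 4))"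
proof -
  interpret prob_space std_normal_distribution by (rule normal_prob)
  have ch: "(\<integral>x. iexp (t * x) \<partial>std_normal_distribution) = of_real (exp (- (t\<^sup>2) / 2))" for t
    using fun_cong[OF char_std_normal_distribution, of t] unfolding char_def by simp
  have "(\<integral>z. iexp (Re (c * z)) \<partial>cgauss) = (\<integral>z. iexp (Re c / sqrt 2 * fst z) * iexp (- Im c / sqrt 2 * snd z) \<partial>(std_normal_distribution \<Otimes>\<^sub>M std_normal_distribution))"
    by (subst cgauss_integral) (auto simp: exp_add[symmetric] algebra_simps diff_divide_distrib)
  also have "\<dots> = (\<integral>x. iexp (Re c / sqrt 2 * x) \<partial>std_normal_distribution) * (\<integral>y. iexp (- Im c / sqrt 2 * y) \<partial>std_normal_distribution)"
    by (rule integral_prod_pair(2)[OF normal_prob normal_prob]; intro integrable_const_bound[of _ 1]) auto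
  also have "\<dots> = of_real (exp (- (cmod c)\<^sup>2 / 4))"
    unfolding ch of_real_mult[symmetric] exp_add[symmetric] cmod_power2
    by (simp add: power_divide field_simps)
  finally show ?thesis .
qed

text \<open>The squared modulus has the exponential law with mean 1, as a sum of two independent
  halves of squared normal variables. This is the source of the denominators in
  \<open>F_factor\<close>.\<close>

lemma cgauss_square_char: "(\<integral>z. iexp (s * (cmod z)\<^sup>2) \<partial>cgauss) = 1 / (1 - \<i> * of_real s)"
proof -
  interpret prob_space std_normal_distribution by (rule normal_prob)
  have "(\<integral>z. iexp (s * (cmod z)\<^sup>2) \<partial>cgauss) = (\<integral>z. iexp (s * ((fst z)\<^sup>2 / 2)) * iexp (s * ((snd z)\<^sup>2 / 2)) \<partial>(std_normal_distribution \<Otimes>\<^sub>M std_normal_distribution))"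
    by (subst cgauss_integral) (auto simp: exp_add[symmetric] cmod_power2 power_divide algebra_simps)
  also have "\<dots> = (\<integral>x. iexp (s * (x\<^sup>2 / 2)) \<partial>std_normal_distribution) * (\<integral>y. iexp (s * (y\<^sup>2 / 2)) \<partial>std_normal_distribution)"
    by (rule integral_prod_pair(2)[OF normal_prob normal_prob]; intro integrable_const_bound[of _ 1]) auto
  finally show ?thesis using normal_square_char[of s] by (simp only: power2_eq_square)
qed

lemma normal_moments:
  "(\<integral>x. x \<partial>std_normal_distribution) = 0" "(\<integral>x. x\<^sup>2 \<partial>std_normal_distribution) = 1"
  "(\<integral>x. x ^ 4 \<partial>std_normal_distribution) = 3"
  using integral_std_normal_distribution_moment_odd[of 1] std_normal_distribution_even_moments(1)[of 1]
    std_normal_distribution_even_moments(1)[of 2]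
  by (simp_all add: fact_numeral)

text \<open>The fourth moment is what gives \<open>(cmod z)\<^sup>2 - 1\<close> variance 1, so that
  centered squares of independent coordinates are orthonormal.\<close>

lemma cgauss_moments:
  "integrable cgauss (\<lambda>z. z)" "(\<integral>z. z \<partial>cgauss) = 0"
  "integrable cgauss (\<lambda>z. (cmod z)\<^sup>2)" "(\<integral>z. (cmod z)\<^sup>2 \<partial>cgauss) = 1"
  "integrable cgauss (\<lambda>z. (cmod z) ^ 4)" "(\<integral>z. (cmod z) ^ 4 \<partial>cgauss) = 2"
proof -
  interpret prob_space std_normal_distribution by (rule normal_prob)
  let ?N = std_normal_distribution
  note pr = integral_prod_pair[OF normal_prob normal_prob]
  have i: "integrable ?N (\<lambda>x. x ^ k)" for k by (rule integrable_std_normal_distribution_moment)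
  have ic: "integrable ?N (\<lambda>x. complex_of_real x)" using i[of 1] by simp
  note co = integral_pair_components[OF normal_prob normal_prob]
  have a: "integrable (?N \<Otimes>\<^sub>M ?N) (\<lambda>z. complex_of_real (fst z))" "integrable (?N \<Otimes>\<^sub>M ?N) (\<lambda>z. complex_of_real (snd z))"
    "(\<integral>z. complex_of_real (fst z) \<partial>(?N \<Otimes>\<^sub>M ?N)) = 0" "(\<integral>z. complex_of_real (snd z) \<partial>(?N \<Otimes>\<^sub>M ?N)) = 0"
    using co(1,3)[OF ic] co(2,4)[OF ic] by (simp_all add: normal_moments)
  have e1: "Complex (fst z / sqrt 2) (snd z / sqrt 2) =
    of_real (1 / sqrt 2) * of_real (fst z) + \<i> * of_real (1 / sqrt 2) * of_real (snd z)" for z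
    by (auto simp: complex_eq_iff)
  have "integrable (?N \<Otimes>\<^sub>M ?N) (\<lambda>z. Complex (fst z / sqrt 2) (snd z / sqrt 2))"
    unfolding e1 by (intro Bochner_Integration.integrable_add integrable_mult_right a)
  thus "integrable cgauss (\<lambda>z. z)" by (subst cgauss_integral(2)) auto
  have "(\<integral>z. Complex (fst z / sqrt 2) (snd z / sqrt 2) \<partial>(?N \<Otimes>\<^sub>M ?N)) = 0"
    unfolding e1 using a by simp
  thus "(\<integral>z. z \<partial>cgauss) = 0" by (subst cgauss_integral(1)) auto
  have s2: "(cmod (Complex (x / sqrt 2) (y / sqrt 2)))\<^sup>2 = 1 / 2 * x\<^sup>2 + 1 / 2 * y\<^sup>2" for x y
    by (simp add: cmod_power2 power_divide add_divide_distrib)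
  have b: "integrable (?N \<Otimes>\<^sub>M ?N) (\<lambda>z. (fst z) ^ k)" "integrable (?N \<Otimes>\<^sub>M ?N) (\<lambda>z. (snd z) ^ k)"
    "(\<integral>z. (fst z) ^ k \<partial>(?N \<Otimes>\<^sub>M ?N)) = (\<integral>x. x ^ k \<partial>?N)" "(\<integral>z. (snd z) ^ k \<partial>(?N \<Otimes>\<^sub>M ?N)) = (\<integral>x. x ^ k \<partial>?N)" for k
    using co(1,3)[OF i] co(2,4)[OF i] by simp_all
  have "integrable (?N \<Otimes>\<^sub>M ?N) (\<lambda>z. (cmod (Complex (fst z / sqrt 2) (snd z / sqrt 2)))\<^sup>2)"
    unfolding s2 by (intro Bochner_Integration.integrable_add integrable_mult_right b)
  thus "integrable cgauss (\<lambda>z. (cmod z)\<^sup>2)" by (subst cgauss_integral(2)) auto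
  have "(\<integral>z. (cmod (Complex (fst z / sqrt 2) (snd z / sqrt 2)))\<^sup>2 \<partial>(?N \<Otimes>\<^sub>M ?N)) = 1"
    unfolding s2 by (subst Bochner_Integration.integral_add)
      (auto intro!: integrable_mult_right b simp: b(3,4) normal_moments)
  thus "(\<integral>z. (cmod z)\<^sup>2 \<partial>cgauss) = 1" by (subst cgauss_integral(1)) auto
  note c = pr[OF i[of 2] i[of 2]]
  have s4: "(cmod (Complex (x / sqrt 2) (y / sqrt 2))) ^ 4 = 1 / 4 * x ^ 4 + (1 / 4 * y ^ 4 + 1 / 2 * (x\<^sup>2 * y\<^sup>2))" for x y
  proof -
    have "(cmod (Complex (x / sqrt 2) (y / sqrt 2))) ^ 4 = ((cmod (Complex (x / sqrt 2) (y / sqrt 2)))\<^sup>2)\<^sup>2"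
      by simp
    thus ?thesis unfolding s2 by (simp add: power2_eq_square power4_eq_xxxx field_simps)
  qed
  have "integrable (?N \<Otimes>\<^sub>M ?N) (\<lambda>z. (cmod (Complex (fst z / sqrt 2) (snd z / sqrt 2))) ^ 4)"
    unfolding s4 by (intro Bochner_Integration.integrable_add integrable_mult_right b c)
  thus "integrable cgauss (\<lambda>z. (cmod z) ^ 4)" by (subst cgauss_integral(2)) auto
  have "(\<integral>z. (cmod (Complex (fst z / sqrt 2) (snd z / sqrt 2))) ^ 4 \<partial>(?N \<Otimes>\<^sub>M ?N)) = 2"
    unfolding s4 by (subst Bochner_Integration.integral_add | intro Bochner_Integration.integrable_add integrable_mult_right b c)+
      (simp add: b(3,4) c normal_moments)
  thus "(\<integral>z. (cmod z) ^ 4 \<partial>cgauss) = 2" by (subst cgauss_integral(1)) auto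
qed

section \<open>Gaussian vectors and quadratic forms\<close>

lemma iexp_integrable:
  assumes M: "prob_space M" and f: "f \<in> borel_measurable M"
  shows "integrable M (\<lambda>x. iexp (f x))"
proof -
  interpret prob_space M by fact
  have "iexp \<in> borel_measurable borel"
    by (intro borel_measurable_continuous_onI continuous_intros)
  from measurable_compose[OF f this] show ?thesis
    by (intro integrable_const_bound[of _ 1] AE_I2) (simp_all only: norm_exp_i_times order_refl)
qed

lemma PiM_one:
  fixes f :: "'a \<Rightarrow> 'c::{real_normed_field,banach,second_countable_topology}"
  assumes "prob_space R" "integrable R f"
  shows "integrable (PiM UNIV (\<lambda>_::'i. R)) (\<lambda>\<omega>. f (\<omega> i))"
    "(\<integral>\<omega>. f (\<omega> i) \<partial>PiM UNIV (\<lambda>_::'i. R)) = (\<integral>x. f x \<partial>R)"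
  using integral_prod_PiM[OF assms(1), of "{i}" "\<lambda>_. f"] assms(2) by simp_all

lemma PiM_two:
  fixes f g :: "'a \<Rightarrow> 'c::{real_normed_field,banach,second_countable_topology}"
  assumes "prob_space R" "integrable R f" "integrable R g" "i \<noteq> j"
  shows "integrable (PiM UNIV (\<lambda>_::'i. R)) (\<lambda>\<omega>. f (\<omega> i) * g (\<omega> j))"
    "(\<integral>\<omega>. f (\<omega> i) * g (\<omega> j) \<partial>PiM UNIV (\<lambda>_::'i. R)) = (\<integral>x. f x \<partial>R) * (\<integral>x. g x \<partial>R)"
  using integral_prod_PiM[OF assms(1), of "{i, j}" "\<lambda>k. if k = i then f else g"] assms(2-)
  by simp_all

text \<open>Pythagoras for square integrable functions. It serves three purposes: Gram matrices of
  Gaussian vectors, variances of quadratic forms in them, and the entries of the rank one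
  series.\<close>

lemma orthonormal_sum_square:
  fixes X :: "'b \<Rightarrow> 'a \<Rightarrow> complex"
  assumes fin: "finite I"
    and i: "\<And>p q. p \<in> I \<Longrightarrow> q \<in> I \<Longrightarrow> integrable M (\<lambda>x. X p x * cnj (X q x))"
    and o: "\<And>p q. p \<in> I \<Longrightarrow> q \<in> I \<Longrightarrow> (\<integral>x. X p x * cnj (X q x) \<partial>M) = (if p = q then 1 else 0)"
  shows "integrable M (\<lambda>x. (cmod (\<Sum>p\<in>I. c p * X p x))\<^sup>2)"
    "(\<integral>x. (cmod (\<Sum>p\<in>I. c p * X p x))\<^sup>2 \<partial>M) = (\<Sum>p\<in>I. (cmod (c p))\<^sup>2)"
proof -
  have e: "complex_of_real ((cmod (\<Sum>p\<in>I. c p * X p x))\<^sup>2) =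
    (\<Sum>p\<in>I. \<Sum>q\<in>I. c p * cnj (c q) * (X p x * cnj (X q x)))" for x
    by (simp add: complex_norm_square sum_product mult_ac del: of_real_power)
  have ii: "integrable M (\<lambda>x. \<Sum>p\<in>I. \<Sum>q\<in>I. c p * cnj (c q) * (X p x * cnj (X q x)))"
    by (intro Bochner_Integration.integrable_sum integrable_mult_right i)
  hence "integrable M (\<lambda>x. Re (\<Sum>p\<in>I. \<Sum>q\<in>I. c p * cnj (c q) * (X p x * cnj (X q x))))"
    by (rule integrable_Re)
  thus i1: "integrable M (\<lambda>x. (cmod (\<Sum>p\<in>I. c p * X p x))\<^sup>2)" unfolding e[symmetric] Re_complex_of_real .
  have "complex_of_real (\<integral>x. (cmod (\<Sum>p\<in>I. c p * X p x))\<^sup>2 \<partial>M) =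
    (\<integral>x. (\<Sum>p\<in>I. \<Sum>q\<in>I. c p * cnj (c q) * (X p x * cnj (X q x))) \<partial>M)"
    unfolding e[symmetric] by (rule integral_complex_of_real[symmetric])
  also have "\<dots> = (\<Sum>p\<in>I. \<Sum>q\<in>I. c p * cnj (c q) * (if p = q then 1 else 0))"
    by (simp add: i o)
  also have "\<dots> = (\<Sum>p\<in>I. c p * cnj (c p))"
    using fin by (simp add: if_distrib cong: if_cong)
  also have "\<dots> = complex_of_real (\<Sum>p\<in>I. (cmod (c p))\<^sup>2)"
    unfolding of_real_sum complex_norm_square ..
  finally show "(\<integral>x. (cmod (\<Sum>p\<in>I. c p * X p x))\<^sup>2 \<partial>M) = (\<Sum>p\<in>I. (cmod (c p))\<^sup>2)"
    unfolding of_real_eq_iff .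
qed

lemma measurable_cgauss [simp]: "measurable cgauss M = measurable borel M"
  by (rule measurable_cong_sets) auto

section \<open>Independent Gaussian coordinates and their unitary invariance\<close>

definition gvec :: "(nat \<Rightarrow> complex) measure" where
  "gvec = PiM UNIV (\<lambda>_. cgauss)"

lemma sets_gvec [simp, measurable_cong]: "sets gvec = sets borel"
  unfolding gvec_def sets_PiM_equal_borel[symmetric] by (rule sets_PiM_cong) auto

lemma measurable_gvec [simp]: "measurable gvec M = measurable borel M"
  by (rule measurable_cong_sets) auto

lemma space_gvec [simp]: "space gvec = UNIV"
  unfolding gvec_def by (simp add: space_PiM)

lemma prob_space_gvec: "prob_space gvec"
  unfolding gvec_def by (rule prob_space_PiM) (rule prob_space_cgauss)

lemma coordinate_measurable [measurable]: "(\<lambda>g. g i) \<in> borel_measurable (borel :: ('i::countable \<Rightarrow> 'b::second_countable_topology) measure)"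
  by (intro borel_measurable_continuous_onI continuous_on_product_coordinates)

lemma gvec_linear_char:
  "(\<integral>g. iexp (Re (\<Sum>j<n. c j * g j)) \<partial>gvec) = of_real (exp (- (\<Sum>j<n. (cmod (c j))\<^sup>2) / 4))"
proof -
  interpret prob_space cgauss by (rule prob_space_cgauss)
  have ii: "integrable cgauss (\<lambda>z. iexp (Re (c j * z)))" for j
    by (rule iexp_integrable[OF prob_space_cgauss]) simp
  have "(\<integral>g. iexp (Re (\<Sum>j<n. c j * g j)) \<partial>gvec) = (\<integral>g. (\<Prod>j<n. iexp (Re (c j * g j))) \<partial>gvec)"
    by (simp add: exp_sum sum_distrib_left del: times_complex.simps)
  also have "\<dots> = (\<Prod>j<n. \<integral>z. iexp (Re (c j * z)) \<partial>cgauss)"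
    unfolding gvec_def by (rule integral_prod_PiM(2)[OF prob_space_cgauss finite_lessThan ii])
  also have "\<dots> = (\<Prod>j<n. of_real (exp (- (cmod (c j))\<^sup>2 / 4)))" by (simp only: cgauss_char)
  also have "\<dots> = of_real (exp (- (\<Sum>j<n. (cmod (c j))\<^sup>2) / 4))"
    by (simp add: exp_sum sum_negf[symmetric] sum_divide_distrib flip: of_real_prod)
  finally show ?thesis .
qed

definition vec_family :: "((nat \<Rightarrow> complex) \<Rightarrow> real) set" where
  "vec_family = {l. \<exists>n c. l = (\<lambda>g. Re (\<Sum>j<n. c j * g j))}"

lemma sum_truncate: "n \<le> (N::nat) \<Longrightarrow> (\<Sum>j<N. (if j < n then c j else 0) * g j) = (\<Sum>j<n. c j * (g j :: complex))"
  by (intro sum.mono_neutral_cong_right) auto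

lemma vec_familyI: "(\<lambda>g. Re (\<Sum>j<n. c j * g j)) \<in> vec_family"
  unfolding vec_family_def by blast

text \<open>Padding the coefficients by zeros lets a form share one window with a unitary matrix or
  with a second form.\<close>

lemma vec_family_ge:
  assumes "l \<in> vec_family"
  obtains N c where "N \<ge> m" "l = (\<lambda>g. Re (\<Sum>j<N. c j * g j))"
proof -
  obtain n c where l: "l = (\<lambda>g. Re (\<Sum>j<n. c j * g j))" using assms by (auto simp: vec_family_def)
  show thesis
    by (rule that[of "max n m" "\<lambda>j. if j < n then c j else 0"]) (simp_all add: l sum_truncate)
qed

lemma separating_vec_family: "separating_family vec_family"
proof
  fix l m assume l: "l \<in> vec_family" and "m \<in> vec_family"
  then obtain n c where m: "m = (\<lambda>g. Re (\<Sum>j<n. c j * g j))" by (auto simp: vec_family_def)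
  obtain N d where N: "N \<ge> n" "l = (\<lambda>g. Re (\<Sum>j<N. d j * g j))" by (rule vec_family_ge[OF l, of n]) (rule that)
  have "(\<lambda>g. l g + m g) = (\<lambda>g. Re (\<Sum>j<N. (d j + (if j < n then c j else 0)) * g j))"
    using sum_truncate[OF N(1), of c] by (simp add: N(2) m distrib_right sum.distrib del: times_complex.simps Re_sum)
  thus "(\<lambda>g. l g + m g) \<in> vec_family" by (simp only: vec_familyI)
next
  fix l c assume "l \<in> vec_family"
  then obtain n d where "l = (\<lambda>g. Re (\<Sum>j<n. d j * g j))" by (auto simp: vec_family_def)
  hence "(\<lambda>g. c * l g) = (\<lambda>g. Re (\<Sum>j<n. (of_real c * d j) * g j))"
    by (simp add: sum_distrib_left mult.assoc right_diff_distrib)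
  thus "(\<lambda>g. c * l g) \<in> vec_family" by (simp only: vec_familyI)
next
  fix x y :: "nat \<Rightarrow> complex" assume "x \<noteq> y"
  then obtain i where i: "x i \<noteq> y i" by auto
  have s: "(\<lambda>g. Re (\<Sum>j<Suc i. (if j = i then c else 0) * g j)) = (\<lambda>g. Re (c * g i))" for c
    by (simp del: times_complex.simps Re_sum)
  have "(\<lambda>g. Re (c * g i)) \<in> vec_family" for c unfolding s[symmetric] by (rule vec_familyI)
  from this[of 1] this[of "-\<i>"] have "(\<lambda>g. Re (g i)) \<in> vec_family" "(\<lambda>g. Im (g i)) \<in> vec_family" by simp_all
  thus "\<exists>l\<in>vec_family. l x \<noteq> l y" using i by (metis (no_types, lifting) complex_eqI)
qed (auto simp: vec_family_def intro!: continuous_intros exI[of _ 0] continuous_on_product_coordinates)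

definition vec_act :: "nat \<Rightarrow> infmat \<Rightarrow> (nat \<Rightarrow> complex) \<Rightarrow> nat \<Rightarrow> complex" where
  "vec_act n u v = (\<lambda>i. if i < n then \<Sum>k<n. u i k * v k else v i)"

lemma vec_act_eq:
  assumes u: "u \<in> unitary_grp n" and N: "n \<le> N" "i < N"
  shows "vec_act n u v i = (\<Sum>k<N. u i k * v k)"
proof (cases "i < n")
  case True
  have "(\<Sum>k<N. u i k * v k) = (\<Sum>k<n. u i k * v k)"
    by (intro sum.mono_neutral_right) (use True N unitary_grp_zero(1)[OF u order_refl True] in auto)
  thus ?thesis using True by (simp add: vec_act_def)
next
  case False
  have "(\<Sum>k<N. u i k * v k) = (\<Sum>k<N. if i = k then v k else 0)"
    using unitary_grp_outside[OF u, of i] False by (intro sum.cong) (auto simp: inf_id_def)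
  thus ?thesis using False N by (simp add: vec_act_def)
qed

lemma vec_act_measurable [simp]: "vec_act n u \<in> borel_measurable borel"
  unfolding vec_act_def
proof (intro borel_measurable_continuous_onI continuous_on_coordinatewise_then_product)
  show "continuous_on UNIV (\<lambda>v. if i < n then \<Sum>k<n. u i k * v k else v i)" for i
    by (cases "i < n") (auto intro!: continuous_intros continuous_on_product_coordinates)
qed

text \<open>The characteristic function sees a linear form only through the norm of its
  coefficients. Composition with \<open>u\<close> replaces the coefficients \<open>c\<close> by
  \<open>d\<close>, and orthonormality of the rows of \<open>u\<close> preserves the norm.\<close>

lemma gvec_unitary_invariant:
  assumes u: "u \<in> unitary_grp n"
  shows "distr gvec borel (vec_act n u) = gvec"
proof (rule measure_eq_of_char[OF separating_vec_family])
  interpret prob_space gvec by (rule prob_space_gvec)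
  have m: "vec_act n u \<in> borel_measurable gvec" by simp
  show "prob_space (distr gvec borel (vec_act n u))" by (rule prob_space_distr[OF m])
  fix l assume l: "l \<in> vec_family"
  obtain N c where N: "N \<ge> n" "l = (\<lambda>g. Re (\<Sum>j<N. c j * g j))" by (rule vec_family_ge[OF l, of n]) (rule that)
  define d where "d = (\<lambda>k. \<Sum>j<N. c j * u j k)"
  have ld: "l (vec_act n u g) = Re (\<Sum>k<N. d k * g k)" for g
  proof -
    have "(\<Sum>j<N. c j * vec_act n u g j) = (\<Sum>j<N. \<Sum>k<N. c j * u j k * g k)"
      by (simp add: vec_act_eq[OF u N(1)] sum_distrib_left mult.assoc)
    also have "\<dots> = (\<Sum>k<N. d k * g k)" by (subst sum.swap) (simp add: d_def sum_distrib_right)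
    finally show ?thesis unfolding N(2) by (rule arg_cong)
  qed
  have "complex_of_real (\<Sum>k<N. (cmod (d k))\<^sup>2) = (\<Sum>k<N. \<Sum>j<N. \<Sum>l<N. c j * cnj (c l) * (u j k * cnj (u l k)))"
    unfolding d_def of_real_sum complex_norm_square cnj_sum sum_product
    by (auto intro!: sum.cong simp: mult_ac)
  also have "\<dots> = (\<Sum>j<N. \<Sum>k<N. \<Sum>l<N. c j * cnj (c l) * (u j k * cnj (u l k)))" by (rule sum.swap)
  also have "\<dots> = (\<Sum>j<N. \<Sum>l<N. \<Sum>k<N. c j * cnj (c l) * (u j k * cnj (u l k)))"
    by (subst (2) sum.swap) simp
  also have "\<dots> = (\<Sum>j<N. \<Sum>l<N. if j = l then c j * cnj (c l) else 0)"
  proof (intro sum.cong)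
    fix j l assume "j \<in> {..<N}" "l \<in> {..<N}"
    thus "(\<Sum>k<N. c j * cnj (c l) * (u j k * cnj (u l k))) = (if j = l then c j * cnj (c l) else 0)"
      using unitary_grp_sums(1)[OF u N(1), of j l] by (simp add: sum_distrib_left[symmetric])
  qed auto
  also have "\<dots> = (\<Sum>j<N. c j * cnj (c j))" by simp
  also have "\<dots> = complex_of_real (\<Sum>j<N. (cmod (c j))\<^sup>2)"
    unfolding of_real_sum complex_norm_square ..
  finally have norm: "(\<Sum>k<N. (cmod (d k))\<^sup>2) = (\<Sum>j<N. (cmod (c j))\<^sup>2)" unfolding of_real_eq_iff .
  have lm: "(\<lambda>g. iexp (l g)) \<in> borel_measurable borel"
    using separating_family.cont[OF separating_vec_family l]
    by (intro borel_measurable_continuous_onI continuous_intros)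
  have "(\<integral>g. iexp (l g) \<partial>distr gvec borel (vec_act n u)) = (\<integral>g. iexp (l (vec_act n u g)) \<partial>gvec)"
    by (rule integral_distr[OF m lm])
  also have "\<dots> = of_real (exp (- (\<Sum>k<N. (cmod (d k))\<^sup>2) / 4))" unfolding ld by (rule gvec_linear_char)
  also have "\<dots> = (\<integral>g. iexp (l g) \<partial>gvec)" unfolding norm N(2) by (rule gvec_linear_char[symmetric])
  finally show "(\<integral>g. iexp (l g) \<partial>distr gvec borel (vec_act n u)) = (\<integral>g. iexp (l g) \<partial>gvec)" .
qed (auto simp: prob_space_gvec)

section \<open>Quadratic forms in a Gaussian vector\<close>

definition qf :: "nat \<Rightarrow> infmat \<Rightarrow> (nat \<Rightarrow> complex) \<Rightarrow> complex" where
  "qf n B v = (\<Sum>p<n. \<Sum>q<n. cnj (v p) * B p q * v q)"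

lemma qf_real: 
  assumes B: "B \<in> herm_all"
  shows "qf n B v = of_real (Re (qf n B v))"
proof -
  have "cnj (qf n B v) = (\<Sum>p<n. \<Sum>q<n. cnj (v q) * B q p * v p)"
    by (simp add: qf_def herm_all_cnj[OF B] mult_ac)
  also have "\<dots> = qf n B v" unfolding qf_def by (rule sum.swap)
  finally show ?thesis by (metis Reals_cnj_iff of_real_Re)
qed

lemma qf_conj_act:
  assumes u: "u \<in> unitary_grp n"
  shows "qf n (conj_act u A) v = qf n A (vec_act n (inf_adjoint u) v)"
proof -
  have w: "vec_act n (inf_adjoint u) v k = (\<Sum>p<n. cnj (u p k) * v p)" if "k < n" for k
    using that by (simp add: vec_act_def inf_adjoint_def)
  have "qf n (conj_act u A) v = (\<Sum>p<n. \<Sum>q<n. \<Sum>l<n. \<Sum>k<n. cnj (v p) * u p k * A k l * cnj (u q l) * v q)"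
    by (simp add: qf_def conj_act_eq[OF u order_refl] sum_distrib_left sum_distrib_right mult_ac)
  also have "\<dots> = (\<Sum>p<n. \<Sum>l<n. \<Sum>q<n. \<Sum>k<n. cnj (v p) * u p k * A k l * cnj (u q l) * v q)"
    by (subst (2) sum.swap) simp
  also have "\<dots> = (\<Sum>p<n. \<Sum>l<n. \<Sum>k<n. \<Sum>q<n. cnj (v p) * u p k * A k l * cnj (u q l) * v q)"
    by (subst (3) sum.swap) simp
  also have "\<dots> = (\<Sum>p<n. \<Sum>k<n. \<Sum>l<n. \<Sum>q<n. cnj (v p) * u p k * A k l * cnj (u q l) * v q)"
    by (subst (2) sum.swap) simp
  also have "\<dots> = (\<Sum>k<n. \<Sum>p<n. \<Sum>l<n. \<Sum>q<n. cnj (v p) * u p k * A k l * cnj (u q l) * v q)"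
    by (rule sum.swap)
  also have "\<dots> = (\<Sum>k<n. \<Sum>l<n. \<Sum>p<n. \<Sum>q<n. cnj (v p) * u p k * A k l * cnj (u q l) * v q)"
    by (subst (2) sum.swap) simp
  also have "\<dots> = qf n A (vec_act n (inf_adjoint u) v)"
    unfolding qf_def
  proof (intro sum.cong refl)
    fix k l assume kl: "k \<in> {..<n}" "l \<in> {..<n}"
    have "cnj (vec_act n (inf_adjoint u) v k) * A k l * vec_act n (inf_adjoint u) v l =
      A k l * ((\<Sum>p<n. cnj (v p) * u p k) * (\<Sum>q<n. cnj (u q l) * v q))"
      using kl by (simp add: w mult_ac)
    also have "\<dots> = (\<Sum>p<n. \<Sum>q<n. cnj (v p) * u p k * A k l * cnj (u q l) * v q)"
      unfolding sum_product by (simp add: sum_distrib_left mult_ac)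
    finally show "(\<Sum>p<n. \<Sum>q<n. cnj (v p) * u p k * A k l * cnj (u q l) * v q) =
      cnj (vec_act n (inf_adjoint u) v k) * A k l * vec_act n (inf_adjoint u) v l" ..
  qed
  finally show ?thesis .
qed

lemma qf_measurable [simp]: "qf n B \<in> borel_measurable borel"
  unfolding qf_def by (intro borel_measurable_continuous_onI) (auto intro!: continuous_intros continuous_on_product_coordinates)

lemma qf_diagm: "qf n (diagm n d) v = of_real (\<Sum>p<n. d p * (cmod (v p))\<^sup>2)"
proof -
  have "qf n (diagm n d) v = (\<Sum>p<n. \<Sum>q<n. if p = q then cnj (v p) * of_real (d p) * v p else 0)"
    unfolding qf_def by (intro sum.cong) (auto simp: diagm_def)
  thus ?thesis by (simp add: complex_norm_square mult_ac del: of_real_power)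
qed

text \<open>Conjugating the matrix amounts to rotating the Gaussian vector, whose law does not
  change; a quadratic form may therefore be studied through the diagonalized matrix.\<close>

lemma qf_distr_ucong:
  assumes "ucong n A C"
  shows "distr gvec borel (qf n C) = distr gvec borel (qf n A)"
  using assms
proof (induction rule: ucong.induct)
  case (ucong_step C u)
  have "distr gvec borel (qf n (conj_act u C)) = distr gvec borel (qf n C \<circ> vec_act n (inf_adjoint u))"
  proof -
    have "qf n (conj_act u C) = qf n C \<circ> vec_act n (inf_adjoint u)"
      by (rule ext) (simp add: qf_conj_act[OF ucong_step(2)])
    thus ?thesis by simp
  qed
  also have "\<dots> = distr (distr gvec borel (vec_act n (inf_adjoint u))) borel (qf n C)"
    by (rule distr_distr[symmetric]) auto
  also have "\<dots> = distr gvec borel (qf n C)"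
    using gvec_unitary_invariant[OF inf_adjoint_unitary[OF ucong_step(2)]] by simp
  finally show ?case using ucong_step.IH by simp
qed simp

lemma prod_mset_image_mset_set: "(\<Prod>x\<in>#image_mset f (mset_set A). g x) = (\<Prod>i\<in>A. g (f i))"
  by (simp add: image_mset.compositionality o_def prod_unfold_prod_mset)

text \<open>After diagonalization the form is a sum of independent exponential variables weighted by
  the eigenvalues.\<close>

lemma gvec_qf_char:
  assumes A: "A \<in> herm n"
  shows "(\<integral>g. iexp (s * Re (qf n A g)) \<partial>gvec) = (\<Prod>a\<in>#spec_mset n A. 1 / (1 - \<i> * of_real (s * a)))"
proof -
  interpret prob_space cgauss by (rule prob_space_cgauss)
  obtain d where d: "ucong n A (diagm n d)" by (rule ucong_diagonal[OF A])
  have ii: "integrable cgauss (\<lambda>z. iexp (s * d p * (cmod z)\<^sup>2))" for p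
    by (rule iexp_integrable[OF prob_space_cgauss]) simp
  have im: "(\<lambda>z. iexp (s * Re z)) \<in> borel_measurable borel"
    by (intro borel_measurable_continuous_onI continuous_intros)
  have e: "(\<integral>g. iexp (s * Re (qf n C g)) \<partial>gvec) = (\<integral>z. iexp (s * Re z) \<partial>distr gvec borel (qf n C))" for C
    by (rule integral_distr[symmetric, OF _ im]) simp
  have "(\<integral>g. iexp (s * Re (qf n A g)) \<partial>gvec) = (\<integral>g. iexp (s * Re (qf n (diagm n d) g)) \<partial>gvec)"
    unfolding e qf_distr_ucong[OF d] ..
  also have "\<dots> = (\<integral>g. (\<Prod>p<n. iexp (s * d p * (cmod (g p))\<^sup>2)) \<partial>gvec)"
    unfolding qf_diagm Re_complex_of_real sum_distrib_left
    unfolding of_real_sum sum_distrib_left exp_sum[OF finite_lessThan] mult.assoc ..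
  also have "\<dots> = (\<Prod>p<n. \<integral>z. iexp (s * d p * (cmod z)\<^sup>2) \<partial>cgauss)"
    unfolding gvec_def by (rule integral_prod_PiM(2)[OF prob_space_cgauss finite_lessThan ii])
  also have "\<dots> = (\<Prod>p<n. 1 / (1 - \<i> * of_real (s * d p)))" by (simp only: cgauss_square_char)
  also have "\<dots> = (\<Prod>a\<in>#spec_mset n A. 1 / (1 - \<i> * of_real (s * a)))"
    unfolding ucong_spec_mset[OF d, symmetric] spec_mset_diagm prod_mset_image_mset_set ..
  finally show ?thesis .
qed

lemma gvec_centered_orthonormal:
  "integrable gvec (\<lambda>g. (of_real ((cmod (g p))\<^sup>2 - 1)) * cnj (of_real ((cmod (g q))\<^sup>2 - 1)))"
  "(\<integral>g. (of_real ((cmod (g p))\<^sup>2 - 1)) * cnj (of_real ((cmod (g q))\<^sup>2 - 1)) \<partial>gvec) = (if p = q then 1 else 0 :: complex)"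
proof -
  interpret prob_space cgauss by (rule prob_space_cgauss)
  note m = cgauss_moments
  have i1: "integrable cgauss (\<lambda>z. (cmod z)\<^sup>2 - 1)" using m by simp
  have v1: "(\<integral>z. (cmod z)\<^sup>2 - 1 \<partial>cgauss) = 0" using m by (simp add: prob_space[simplified])
  have e: "((cmod z)\<^sup>2 - 1) * ((cmod z)\<^sup>2 - 1) = (cmod z) ^ 4 - 2 * (cmod z)\<^sup>2 + 1" for z
    by (simp add: power2_eq_square power4_eq_xxxx algebra_simps)
  have i2: "integrable cgauss (\<lambda>z. ((cmod z)\<^sup>2 - 1) * ((cmod z)\<^sup>2 - 1))" unfolding e using m by simp
  have v2: "(\<integral>z. ((cmod z)\<^sup>2 - 1) * ((cmod z)\<^sup>2 - 1) \<partial>cgauss) = 1" unfolding e using m by (simp add: prob_space[simplified])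
  have "integrable gvec (\<lambda>g. ((cmod (g p))\<^sup>2 - 1) * ((cmod (g q))\<^sup>2 - 1)) \<and>
    (\<integral>g. ((cmod (g p))\<^sup>2 - 1) * ((cmod (g q))\<^sup>2 - 1) \<partial>gvec) = (if p = q then 1 else 0)"
  proof (cases "p = q")
    case True
    thus ?thesis using PiM_one[OF prob_space_cgauss i2, of p] v2 by (simp add: gvec_def)
  next
    case False
    thus ?thesis using PiM_two[OF prob_space_cgauss i1 i1 False] v1 by (simp add: gvec_def)
  qed
  moreover have "(of_real ((cmod (g p))\<^sup>2 - 1)) * cnj (of_real ((cmod (g q))\<^sup>2 - 1)) =
    complex_of_real (((cmod (g p))\<^sup>2 - 1) * ((cmod (g q))\<^sup>2 - 1))" for g :: "nat \<Rightarrow> complex" by simp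
  ultimately show "integrable gvec (\<lambda>g. (of_real ((cmod (g p))\<^sup>2 - 1)) * cnj (of_real ((cmod (g q))\<^sup>2 - 1)))"
    "(\<integral>g. (of_real ((cmod (g p))\<^sup>2 - 1)) * cnj (of_real ((cmod (g q))\<^sup>2 - 1)) \<partial>gvec) = (if p = q then 1 else 0 :: complex)"
    by (simp_all only: complex_of_real_integrable_eq integral_complex_of_real) auto
qed

lemma gvec_coordinate_orthonormal:
  "integrable gvec (\<lambda>g. g p * cnj (g q))" "(\<integral>g. g p * cnj (g q) \<partial>gvec) = (if p = q then 1 else 0)"
proof -
  note m = cgauss_moments
  have i1: "integrable cgauss (\<lambda>z. cnj z)" "(\<integral>z. cnj z \<partial>cgauss) = 0" using m by simp_all
  have e: "z * cnj z = of_real ((cmod z)\<^sup>2)" for z by (simp add: complex_norm_square del: of_real_power)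
  have i2: "integrable cgauss (\<lambda>z. z * cnj z)" "(\<integral>z. z * cnj z \<partial>cgauss) = 1"
    unfolding e integral_complex_of_real complex_of_real_integrable_eq using m by simp_all
  have "integrable gvec (\<lambda>g. g p * cnj (g q)) \<and> (\<integral>g. g p * cnj (g q) \<partial>gvec) = (if p = q then 1 else 0)"
  proof (cases "p = q")
    case True
    thus ?thesis using PiM_one[OF prob_space_cgauss i2(1), of p] i2(2) by (simp add: gvec_def)
  next
    case False
    thus ?thesis using PiM_two[OF prob_space_cgauss m(1) i1(1) False] m(2) by (simp add: gvec_def)
  qed
  thus "integrable gvec (\<lambda>g. g p * cnj (g q))" "(\<integral>g. g p * cnj (g q) \<partial>gvec) = (if p = q then 1 else 0)" by auto
qed

section \<open>Gaussian frames and their Gram matrices\<close>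

definition gmat :: "(nat \<Rightarrow> nat \<Rightarrow> complex) measure" where
  "gmat = PiM UNIV (\<lambda>_. gvec)"

lemma sets_gmat [simp, measurable_cong]: "sets gmat = sets borel"
  unfolding gmat_def sets_PiM_equal_borel[symmetric] by (rule sets_PiM_cong) auto

lemma space_gmat [simp]: "space gmat = UNIV"
  unfolding gmat_def by (simp add: space_PiM)

lemma prob_space_gmat: "prob_space gmat"
  unfolding gmat_def by (rule prob_space_PiM) (rule prob_space_gvec)

text \<open>An entry of the rescaled Gram matrix minus the identity is an average of
  \<open>n\<close> orthonormal variables: centered squares on the diagonal, products of independent
  coordinates off it. The second moment \<open>1 / n\<close> is the quantitative form of near
  orthonormality.\<close>

lemma gmat_gram:
  fixes n :: nat
  assumes n: "n > 0"
  defines "\<Gamma> \<equiv> \<lambda>\<omega> j k. (\<Sum>p<n. cnj (\<omega> j p) * \<omega> k p) / of_nat n - (if j = k then 1 else 0 :: complex)"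
  shows "integrable gmat (\<lambda>\<omega>. (cmod (\<Gamma> \<omega> j k))\<^sup>2)" "(\<integral>\<omega>. (cmod (\<Gamma> \<omega> j k))\<^sup>2 \<partial>gmat) = 1 / n"
proof -
  define X where "X = (\<lambda>p (\<omega> :: nat \<Rightarrow> nat \<Rightarrow> complex). if j = k then of_real ((cmod (\<omega> j p))\<^sup>2 - 1) else cnj (\<omega> j p) * \<omega> k p :: complex)"
  have G: "\<Gamma> \<omega> j k = (\<Sum>p<n. 1 / of_nat n * X p \<omega>)" for \<omega>
  proof (cases "j = k")
    case True
    have "cnj z * z = of_real ((cmod z)\<^sup>2 - 1) + 1" for z
      by (simp add: complex_norm_square mult.commute del: of_real_power)
    thus ?thesis using True n by (simp add: \<Gamma>_def X_def sum_divide_distrib[symmetric] sum_subtractf diff_divide_distrib)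
  qed (simp add: \<Gamma>_def X_def sum_divide_distrib)
  have o: "integrable gmat (\<lambda>\<omega>. X p \<omega> * cnj (X q \<omega>)) \<and> (\<integral>\<omega>. X p \<omega> * cnj (X q \<omega>) \<partial>gmat) = (if p = q then 1 else 0)" for p q
  proof (cases "j = k")
    case True
    thus ?thesis
      using PiM_one[OF prob_space_gvec gvec_centered_orthonormal(1)[of p q], of j] gvec_centered_orthonormal(2)[of p q]
      by (simp add: X_def gmat_def)
  next
    case False
    have i: "integrable gvec (\<lambda>g. cnj (g p) * g q)" "(\<integral>g. cnj (g p) * g q \<partial>gvec) = (if p = q then 1 else 0)"
      using gvec_coordinate_orthonormal[of q p] by (simp_all add: mult.commute eq_commute)
    have "X p \<omega> * cnj (X q \<omega>) = (cnj (\<omega> j p) * \<omega> j q) * (\<omega> k p * cnj (\<omega> k q))" for \<omega>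
      using False by (simp add: X_def)
    thus ?thesis using PiM_two[OF prob_space_gvec i(1) gvec_coordinate_orthonormal(1)[of p q] False]
      i(2) gvec_coordinate_orthonormal(2)[of p q] by (simp add: gmat_def)
  qed
  show "integrable gmat (\<lambda>\<omega>. (cmod (\<Gamma> \<omega> j k))\<^sup>2)"
    unfolding G by (rule orthonormal_sum_square(1)) (use o in auto)
  have "(\<integral>\<omega>. (cmod (\<Gamma> \<omega> j k))\<^sup>2 \<partial>gmat) = (\<Sum>p<n. (cmod (1 / of_nat n))\<^sup>2)"
    unfolding G by (rule orthonormal_sum_square(2)) (use o in auto)
  also have "\<dots> = 1 / n" using n by (simp add: norm_divide power2_eq_square)
  finally show "(\<integral>\<omega>. (cmod (\<Gamma> \<omega> j k))\<^sup>2 \<partial>gmat) = 1 / n" .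
qed

text \<open>With \<open>s\<close> the squared norm, whose mean is \<open>n\<close>, the pointwise
  bound \<open>s\<^sup>2 \<ge> 2 * n * s - n\<^sup>2\<close> is integrated. The extended integral
  matches the form in which second moments are handled later.\<close>

lemma gvec_norm_fourth: "(\<integral>\<^sup>+g. ennreal ((\<Sum>p<n. (cmod (g p))\<^sup>2)\<^sup>2) \<partial>gvec) \<ge> ennreal ((real n)\<^sup>2)"
proof -
  interpret prob_space gvec by (rule prob_space_gvec)
  have i: "integrable gvec (\<lambda>g. (cmod (g p))\<^sup>2)" "(\<integral>g. (cmod (g p))\<^sup>2 \<partial>gvec) = 1" for p
    using PiM_one[OF prob_space_cgauss cgauss_moments(3), of p] cgauss_moments(4) by (simp_all add: gvec_def)
  have s: "(\<integral>g. (2 * real n * (\<Sum>p<n. (cmod (g p))\<^sup>2) - (real n)\<^sup>2) \<partial>gvec) = (real n)\<^sup>2"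
    using i by (simp add: prob_space[simplified] power2_eq_square)
  let ?f = "\<lambda>g::nat \<Rightarrow> complex. 2 * real n * (\<Sum>p<n. (cmod (g p))\<^sup>2) - (real n)\<^sup>2"
  have fi: "integrable gvec ?f" using i by simp
  \<comment> \<open>The lower bound may be negative, while the extended integral sees nonnegative
    functions only; hence the maximum with 0.\<close>
  have mi: "integrable gvec (\<lambda>g. max 0 (?f g))" using fi by (intro integrable_max) auto
  have "(\<integral>g. ?f g \<partial>gvec) \<le> (\<integral>g. max 0 (?f g) \<partial>gvec)"
    by (rule integral_mono[OF fi mi]) simp
  hence "(real n)\<^sup>2 \<le> (\<integral>g. max 0 (?f g) \<partial>gvec)" unfolding s .
  hence "ennreal ((real n)\<^sup>2) \<le> (\<integral>\<^sup>+g. ennreal (max 0 (?f g)) \<partial>gvec)"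
    by (subst nn_integral_eq_integral[OF mi]) (auto intro: ennreal_leI)
  also have "\<dots> \<le> (\<integral>\<^sup>+g. ennreal ((\<Sum>p<n. (cmod (g p))\<^sup>2)\<^sup>2) \<partial>gvec)"
  proof (intro nn_integral_mono ennreal_leI max.boundedI)
    fix g :: "nat \<Rightarrow> complex"
    have "0 \<le> ((\<Sum>p<n. (cmod (g p))\<^sup>2) - real n)\<^sup>2" by simp
    thus "?f g \<le> (\<Sum>p<n. (cmod (g p))\<^sup>2)\<^sup>2"
      unfolding power2_diff by (simp add: mult_ac)
  qed simp
  finally show ?thesis .
qed

text \<open>For trace 0 the diagonalized form is a combination of the orthonormal centered squares,
  and the squared coefficients add up to the trace of the square.\<close>

lemma gvec_qf_variance:
  assumes A: "A \<in> herm n" and tr: "inf_trace A = 0"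
  shows "(\<integral>\<^sup>+g. ennreal ((Re (qf n A g))\<^sup>2) \<partial>gvec) = ennreal (Re (inf_trace (inf_mult A A)))"
proof -
  obtain d where d: "ucong n A (diagm n d)" by (rule ucong_diagonal[OF A])
  let ?D = "diagm n d"
  have e: "(\<integral>\<^sup>+g. ennreal ((Re (qf n C g))\<^sup>2) \<partial>gvec) = (\<integral>\<^sup>+z. ennreal ((Re z)\<^sup>2) \<partial>distr gvec borel (qf n C))" for C
    by (rule nn_integral_distr[symmetric]) (simp_all)
  have "inf_trace ?D = (\<Sum>i<n. of_real (d i))"
    by (subst inf_trace_eq_sum[of "{..<n}"]) (auto simp: diagm_def)
  hence s0: "(\<Sum>i<n. d i) = 0" using ucong_trace[OF d A] tr
    by (metis of_real_eq_0_iff of_real_sum)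
  have "inf_trace (inf_mult ?D ?D) = of_real (\<Sum>i<n. (d i)\<^sup>2)"
    by (subst trace_pairing[OF diagm_herm order_refl]) (simp add: diagm_def if_distrib power2_eq_square cong: if_cong)
  hence t2: "Re (inf_trace (inf_mult A A)) = (\<Sum>i<n. (d i)\<^sup>2)" using ucong_trace_square[OF d A] by simp
  have q: "(Re (qf n ?D g))\<^sup>2 = (cmod (\<Sum>p<n. of_real (d p) * of_real ((cmod (g p))\<^sup>2 - 1)))\<^sup>2" for g
  proof -
    have "(\<Sum>p<n. of_real (d p) * complex_of_real ((cmod (g p))\<^sup>2 - 1)) = of_real (\<Sum>p<n. d p * (cmod (g p))\<^sup>2 - d p)"
      by (simp add: algebra_simps)
    also have "\<dots> = of_real (\<Sum>p<n. d p * (cmod (g p))\<^sup>2)" by (simp add: sum_subtractf s0)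
    finally show ?thesis unfolding qf_diagm by (simp only: norm_of_real power2_abs Re_complex_of_real)
  qed
  note on = orthonormal_sum_square[of "{..<n}" gvec "\<lambda>p g. of_real ((cmod (g p))\<^sup>2 - 1)" "\<lambda>p. of_real (d p)",
      OF finite_lessThan gvec_centered_orthonormal]
  have "(\<integral>\<^sup>+g. ennreal ((Re (qf n A g))\<^sup>2) \<partial>gvec) = (\<integral>\<^sup>+g. ennreal ((Re (qf n ?D g))\<^sup>2) \<partial>gvec)"
    unfolding e qf_distr_ucong[OF d] ..
  also have "\<dots> = ennreal (\<Sum>p<n. (cmod (of_real (d p)))\<^sup>2)"
    unfolding q on(2)[symmetric] by (rule nn_integral_eq_integral[OF on(1)]) auto
  finally show ?thesis using t2 by simp
qed

section \<open>Products over the scaled spectrum\<close>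

definition char_mset :: "real multiset \<Rightarrow> real \<Rightarrow> complex" where
  "char_mset \<sigma> a = (\<Prod>x\<in>#\<sigma>. 1 / (1 - \<i> * of_real (a * x)))"

definition psum :: "nat \<Rightarrow> real multiset \<Rightarrow> real" where
  "psum r \<sigma> = (\<Sum>x\<in>#\<sigma>. x ^ r)"

definition log_rem :: "nat \<Rightarrow> real \<Rightarrow> complex" where
  "log_rem J s = - Ln (1 - \<i> * of_real s) - (\<Sum>r=1..<J. (\<i> * of_real s) ^ r / of_nat r)"

lemma one_minus_i_nonzero: "1 - \<i> * of_real s \<noteq> 0"
  by (auto simp: complex_eq_iff)

text \<open>The Taylor remainder of \<open>- Ln (1 - z)\<close> has derivative
  \<open>z ^ (J - 1) / (1 - z)\<close>, and on the imaginary axis \<open>1 - z\<close> has modulus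
  at least 1. The bound thus holds for every \<open>s\<close>, also beyond the radius of convergence
  of the series.\<close>

lemma log_rem_bound:
  assumes J: "J \<ge> 1"
  shows "cmod (log_rem J s) \<le> \<bar>s\<bar> ^ J"
proof -
  define g where "g = (\<lambda>z. - Ln (1 - z) - (\<Sum>r=1..<J. z ^ r / of_nat r) :: complex)"
  let ?S = "closed_segment 0 (\<i> * of_real s)"
  have Re0: "Re z = 0" and le: "cmod z \<le> \<bar>s\<bar>" if zS: "z \<in> ?S" for z
  proof -
    obtain u where u: "0 \<le> u" "u \<le> 1" "z = (1 - u) *\<^sub>R 0 + u *\<^sub>R (\<i> * of_real s)"
      using zS unfolding in_segment by blast
    thus "Re z = 0" by simp
    have "cmod z = u * \<bar>s\<bar>" using u by (simp add: norm_mult)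
    thus "cmod z \<le> \<bar>s\<bar>" using mult_right_mono[OF u(2), of "\<bar>s\<bar>"] by simp
  qed
  have d: "(g has_field_derivative z ^ (J - 1) / (1 - z)) (at z within ?S)" if z: "z \<in> ?S" for z
  proof -
    have R: "Re (1 - z) = 1" using Re0[OF z] by simp
    have n1: "1 - z \<notin> \<real>\<^sub>\<le>\<^sub>0" using R by (auto simp: complex_nonpos_Reals_iff)
    have n0: "1 - z \<noteq> 0" using R by auto
    have "(\<Sum>r=1..<J. of_nat r * z ^ (r - 1) / of_nat r) = (\<Sum>r<J-1. z ^ r)"
      by (rule sum.reindex_bij_witness[of _ Suc "\<lambda>r. r - 1"]) auto
    also have "\<dots> = (1 - z ^ (J - 1)) / (1 - z)" using n0 sum_gp_strict[of z "J - 1"] by auto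
    finally have e: "(\<Sum>r=1..<J. of_nat r * z ^ (r - 1) / of_nat r) = (1 - z ^ (J - 1)) / (1 - z)" .
    have "((\<lambda>z. - Ln (1 - z)) has_field_derivative 1 / (1 - z)) (at z within ?S)"
      using n1 n0 by (auto intro!: derivative_eq_intros simp: divide_inverse)
    moreover have "((\<lambda>z. \<Sum>r=1..<J. z ^ r / of_nat r) has_field_derivative (\<Sum>r=1..<J. of_nat r * z ^ (r - 1) / of_nat r)) (at z within ?S)"
      by (auto intro!: derivative_eq_intros)
    ultimately have "(g has_field_derivative 1 / (1 - z) - (1 - z ^ (J - 1)) / (1 - z)) (at z within ?S)"
      unfolding g_def e by (rule DERIV_diff)
    thus ?thesis by (simp add: diff_divide_distrib[symmetric])
  qed
  have b: "cmod (z ^ (J - 1) / (1 - z)) \<le> \<bar>s\<bar> ^ (J - 1)" if z: "z \<in> ?S" for z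
  proof -
    have "1 \<le> cmod (1 - z)" using abs_Re_le_cmod[of "1 - z"] Re0[OF z] by simp
    hence "cmod (z ^ (J - 1) / (1 - z)) \<le> cmod z ^ (J - 1)"
      by (simp add: norm_divide norm_power divide_le_eq mult_left_le mult_ge1_I)
        (metis mult_left_mono mult.right_neutral norm_ge_zero zero_le_power)
    also have "\<dots> \<le> \<bar>s\<bar> ^ (J - 1)" using le[OF z] by (intro power_mono) auto
    finally show ?thesis .
  qed
  have "cmod (g (\<i> * of_real s) - g 0) \<le> \<bar>s\<bar> ^ (J - 1) * cmod (\<i> * of_real s - 0)"
    by (rule field_differentiable_bound[OF convex_closed_segment d b]) auto
  moreover have "g 0 = 0" unfolding g_def by (simp add: sum.neutral)
  moreover have "g (\<i> * of_real s) = log_rem J s" by (simp add: g_def log_rem_def)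
  ultimately show ?thesis using J by (simp add: norm_mult power_Suc2[symmetric] del: power_Suc)
qed

lemma char_mset_exp: "char_mset \<sigma> a = exp (\<Sum>x\<in>#\<sigma>. - Ln (1 - \<i> * of_real (a * x)))"
proof (induction \<sigma>)
  case (add x \<sigma>)
  have "1 / (1 - \<i> * of_real (a * x)) = exp (- Ln (1 - \<i> * of_real (a * x)))"
    using one_minus_i_nonzero[of "a * x"] by (simp add: exp_minus inverse_eq_divide del: of_real_mult)
  thus ?case using add by (simp add: char_mset_def mult_exp_exp del: of_real_mult)
qed (simp add: char_mset_def)

text \<open>Power sums of the spectrum are the Taylor coefficients in \<open>a\<close> of the
  logarithm of the product. Both directions of the theorem rest on this expansion.\<close>

lemma log_char_mset:
  "(\<Sum>x\<in>#\<sigma>. - Ln (1 - \<i> * of_real (a * x))) =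
   (\<Sum>r=1..<J. (\<i> * of_real a) ^ r / of_nat r * of_real (psum r \<sigma>)) + (\<Sum>x\<in>#\<sigma>. log_rem J (a * x))"
proof (induction \<sigma>)
  case (add x \<sigma>)
  have "(\<Sum>r=1..<J. (\<i> * of_real a) ^ r / of_nat r * of_real (psum r (add_mset x \<sigma>))) =
     (\<Sum>r=1..<J. (\<i> * of_real (a * x)) ^ r / of_nat r) + (\<Sum>r=1..<J. (\<i> * of_real a) ^ r / of_nat r * of_real (psum r \<sigma>))"
    unfolding sum.distrib[symmetric]
    by (auto intro!: sum.cong simp: psum_def power_mult_distrib algebra_simps add_divide_distrib)
  thus ?case using add by (simp add: log_rem_def del: of_real_mult)
qed (simp add: psum_def)

lemma norm_sum_mset_le:
  fixes f :: "'a \<Rightarrow> 'b::real_normed_vector"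
  shows "(\<And>x. x \<in># \<sigma> \<Longrightarrow> norm (f x) \<le> g x) \<Longrightarrow> norm (\<Sum>x\<in>#\<sigma>. f x) \<le> (\<Sum>x\<in>#\<sigma>. g x)"
proof (induction \<sigma>)
  case (add x \<sigma>)
  hence "norm (\<Sum>x\<in>#\<sigma>. f x) \<le> (\<Sum>x\<in>#\<sigma>. g x)" "norm (f x) \<le> g x" by simp_all
  thus ?case by (simp add: norm_triangle_le add_mono)
qed simp

lemma psum_mono_square: "x \<in># \<sigma> \<Longrightarrow> x\<^sup>2 \<le> psum 2 \<sigma>"
proof (induction \<sigma>)
  case (add y \<sigma>)
  have "0 \<le> psum 2 \<sigma>" unfolding psum_def by (induction \<sigma>) auto
  thus ?case using add by (auto simp: psum_def intro: add_increasing)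
qed simp

lemma mset_bounded:
  assumes "psum 2 \<sigma> \<le> C" "1 \<le> C" "x \<in># \<sigma>"
  shows "\<bar>x\<bar> \<le> C"
proof -
  have "x\<^sup>2 \<le> C" using psum_mono_square[OF assms(3)] assms(1) by simp
  also have "C \<le> C\<^sup>2" using assms(2) by (simp add: power2_eq_square)
  finally show ?thesis using assms(2) by (simp add: abs_le_square_iff[symmetric])
qed

lemma sum_mset_weighted_le:
  assumes C: "psum 2 \<sigma> \<le> C" and e: "\<And>x. x \<in># \<sigma> \<Longrightarrow> \<bar>h x\<bar> \<le> e" and e0: "0 \<le> e"
  shows "\<bar>\<Sum>x\<in>#\<sigma>. x\<^sup>2 * h x\<bar> \<le> e * C"
proof -
  have "norm (\<Sum>x\<in>#\<sigma>. x\<^sup>2 * h x) \<le> (\<Sum>x\<in>#\<sigma>. e * x\<^sup>2)"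
    using e by (intro norm_sum_mset_le) (simp add: abs_mult mult.commute mult_right_mono)
  also have "\<dots> = e * psum 2 \<sigma>" by (simp add: psum_def sum_mset_distrib_left image_mset.compositionality comp_def)
  also have "\<dots> \<le> e * C" using C e0 by (intro mult_left_mono)
  finally show ?thesis by simp
qed

text \<open>Two of the \<open>J\<close> factors of \<open>x\<close> are absorbed by the second power
  sum and the others by \<open>\<bar>x\<bar> \<le> C\<close>, so the number of eigenvalues does not
  enter.\<close>

lemma log_rem_mset_bound:
  assumes C: "psum 2 \<sigma> \<le> C" "1 \<le> C" and J: "J \<ge> 2"
  shows "cmod (\<Sum>x\<in>#\<sigma>. log_rem J (a * x)) \<le> \<bar>a\<bar> ^ J * C ^ (J - 1)"
proof -
  have "cmod (\<Sum>x\<in>#\<sigma>. log_rem J (a * x)) \<le> (\<Sum>x\<in>#\<sigma>. x\<^sup>2 * (\<bar>a\<bar> ^ J * \<bar>x\<bar> ^ (J - 2)))"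
  proof (rule norm_sum_mset_le)
    fix x
    have "cmod (log_rem J (a * x)) \<le> \<bar>a * x\<bar> ^ J" using J by (intro log_rem_bound) auto
    also have "\<dots> = \<bar>a\<bar> ^ J * \<bar>x\<bar> ^ (2 + (J - 2))"
      by (subst le_add_diff_inverse[OF J]) (simp add: abs_mult power_mult_distrib)
    also have "\<dots> = x\<^sup>2 * (\<bar>a\<bar> ^ J * \<bar>x\<bar> ^ (J - 2))" unfolding power_add by simp
    finally show "cmod (log_rem J (a * x)) \<le> x\<^sup>2 * (\<bar>a\<bar> ^ J * \<bar>x\<bar> ^ (J - 2))" .
  qed
  also have "\<dots> \<le> \<bar>\<Sum>x\<in>#\<sigma>. x\<^sup>2 * (\<bar>a\<bar> ^ J * \<bar>x\<bar> ^ (J - 2))\<bar>" by simp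
  also have "\<dots> \<le> \<bar>a\<bar> ^ J * C ^ (J - 2) * C"
  proof (rule sum_mset_weighted_le[OF C(1)])
    fix x assume "x \<in># \<sigma>"
    thus "\<bar>\<bar>a\<bar> ^ J * \<bar>x\<bar> ^ (J - 2)\<bar> \<le> \<bar>a\<bar> ^ J * C ^ (J - 2)"
      using mset_bounded[OF C] by (simp add: abs_mult power_mono mult_left_mono)
  qed (use C in simp)
  also have "\<dots> = \<bar>a\<bar> ^ J * C ^ (J - 1)"
  proof -
    have "C ^ (J - 2) * C = C ^ Suc (J - 2)" by simp
    also have "Suc (J - 2) = J - 1" using J by simp
    finally show ?thesis by simp
  qed
  finally show ?thesis .
qed

section \<open>From convergence of the products back to the spectrum\<close>

lemma convergent_of_approx:
  fixes w :: "nat \<Rightarrow> 'a::banach"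
  assumes "\<And>\<epsilon>. 0 < \<epsilon> \<Longrightarrow> \<exists>v. convergent v \<and> (\<forall>n. norm (w n - v n) \<le> \<epsilon>)"
  shows "convergent w"
proof -
  have "Cauchy w"
  proof (rule CauchyI)
    fix e :: real assume e: "0 < e"
    then obtain v where v: "convergent v" "\<And>n. norm (w n - v n) \<le> e / 4" using assms[of "e / 4"] by auto
    obtain N where N: "\<And>m n. m \<ge> N \<Longrightarrow> n \<ge> N \<Longrightarrow> norm (v m - v n) < e / 4"
      using CauchyD[OF convergent_Cauchy[OF v(1)], of "e / 4"] e by auto
    have "norm (w m - w n) < e" if "m \<ge> N" "n \<ge> N" for m n
    proof -
      have "w m - w n = (w m - v m) + (v m - v n) + (v n - w n)" by simp
      hence "norm (w m - w n) \<le> norm (w m - v m) + norm (v m - v n) + norm (v n - w n)"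
        by (metis norm_triangle_ineq norm_triangle_le add_right_mono)
      thus ?thesis using v(2)[of m] v(2)[of n] N[OF that] e by (simp add: norm_minus_commute)
    qed
    thus "\<exists>M. \<forall>m\<ge>M. \<forall>n\<ge>M. norm (w m - w n) < e" by blast
  qed
  thus ?thesis by (rule Cauchy_convergent)
qed

text \<open>Convergence passes from the products to their logarithms only if no jump between
  branches occurs. For small \<open>a\<close> the logarithms have modulus at most 1, so
  \<open>Ln\<close> inverts the exponential; the exponentials then have real part at least
  \<open>exp (-1) * cos 1\<close>, which keeps their limit off the cut.\<close>

lemma log_char_convergent:
  assumes C: "\<And>n. psum 2 (\<sigma> n) \<le> C" "1 \<le> C" and c1: "\<And>n. \<bar>psum 1 (\<sigma> n)\<bar> \<le> C"
    and a: "\<bar>a\<bar> \<le> 1 / (2 * C)" and lim: "convergent (\<lambda>n. char_mset (\<sigma> n) a)"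
  shows "convergent (\<lambda>n. \<Sum>x\<in>#\<sigma> n. - Ln (1 - \<i> * of_real (a * x)))"
proof -
  define l where "l = (\<lambda>n. \<Sum>x\<in>#\<sigma> n. - Ln (1 - \<i> * of_real (a * x)))"
  have l1: "cmod (l n) \<le> 1" for n
  proof -
    have aC: "\<bar>a\<bar> * C \<le> 1 / 2" using a C(2) by (simp add: field_simps)
    have "l n = \<i> * of_real a * of_real (psum 1 (\<sigma> n)) + (\<Sum>x\<in>#\<sigma> n. log_rem 2 (a * x))"
      unfolding l_def log_char_mset[of a _ 2] by (simp add: numeral_2_eq_2)
    hence "cmod (l n) \<le> \<bar>a\<bar> * \<bar>psum 1 (\<sigma> n)\<bar> + cmod (\<Sum>x\<in>#\<sigma> n. log_rem 2 (a * x))"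
      using norm_triangle_ineq[of "\<i> * of_real a * of_real (psum 1 (\<sigma> n))" "\<Sum>x\<in>#\<sigma> n. log_rem 2 (a * x)"]
      by (simp add: norm_mult)
    also have "\<dots> \<le> \<bar>a\<bar> * C + \<bar>a\<bar> ^ 2 * C ^ (2 - 1)"
      by (intro add_mono mult_left_mono c1 log_rem_mset_bound C) auto
    also have "\<dots> = \<bar>a\<bar> * C * (1 + \<bar>a\<bar>)" by (simp add: power2_eq_square algebra_simps)
    also have "\<dots> \<le> 1 / 2 * (1 + 1)"
    proof (rule mult_mono[OF aC])
      have "\<bar>a\<bar> * 1 \<le> \<bar>a\<bar> * C" using C(2) by (intro mult_left_mono) auto
      thus "1 + \<bar>a\<bar> \<le> 1 + 1" using aC by simp
    qed auto
    finally show ?thesis by simp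
  qed
  have e: "char_mset (\<sigma> n) a = exp (l n)" for n unfolding l_def by (rule char_mset_exp)
  have Ln: "Ln (exp (l n)) = l n" for n
  proof (rule Ln_exp)
    have "\<bar>Im (l n)\<bar> \<le> 1" using abs_Im_le_cmod[of "l n"] l1[of n] by linarith
    thus "- pi < Im (l n)" "Im (l n) \<le> pi" using pi_gt3 by linarith+
  qed
  obtain f where f: "(\<lambda>n. exp (l n)) \<longlonglongrightarrow> f" using lim unfolding e convergent_def by auto
  have re: "Re (exp (l n)) \<ge> exp (-1) * cos 1" for n
  proof -
    have "\<bar>Re (l n)\<bar> \<le> 1" "\<bar>Im (l n)\<bar> \<le> 1"
      using abs_Re_le_cmod[of "l n"] abs_Im_le_cmod[of "l n"] l1[of n] by linarith+
    hence "exp (-1) \<le> exp (Re (l n))" "cos 1 \<le> cos \<bar>Im (l n)\<bar>"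
      using pi_gt3 by (simp, intro cos_monotone_0_pi_le) auto
    moreover have "0 \<le> cos (1::real)" using cos_gt_zero_pi[of 1] pi_gt3 by simp
    ultimately show ?thesis unfolding Re_exp cos_abs_real by (intro mult_mono) auto
  qed
  have "exp (-1) * cos 1 \<le> Re f"
    by (rule LIMSEQ_le_const[OF tendsto_Re[OF f]]) (use re in auto)
  moreover have "0 < exp (-1) * cos (1::real)" using cos_gt_zero_pi[of 1] pi_gt3 by simp
  ultimately have "f \<notin> \<real>\<^sub>\<le>\<^sub>0" by (auto simp: complex_nonpos_Reals_iff)
  hence "(\<lambda>n. Ln (exp (l n))) \<longlonglongrightarrow> Ln f" by (intro tendsto_Ln f)
  thus ?thesis unfolding Ln l_def[symmetric] convergent_def by blast
qed

lemma convergent_sum_fin: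
  "(\<And>i. i \<in> I \<Longrightarrow> convergent (f i)) \<Longrightarrow> convergent (\<lambda>n. \<Sum>i\<in>I. f i n :: 'a::real_normed_vector)"
  by (induction I rule: infinite_finite_induct) (auto intro: convergent_add convergent_const)

text \<open>Strong induction on \<open>r\<close>. After subtracting the lower order terms and
  dividing by the coefficient of degree \<open>r\<close>, the logarithm differs from the power sum
  by a remainder of order \<open>a\<close>. A small fixed \<open>a\<close> thus gives an
  approximation uniform in \<open>n\<close>, and the limit function never has to be
  differentiated.\<close>

lemma psum_convergent:
  assumes C: "\<And>n. psum 2 (\<sigma> n) \<le> C" "1 \<le> C" and c1: "\<And>n. \<bar>psum 1 (\<sigma> n)\<bar> \<le> C"
    and lim: "\<And>a. convergent (\<lambda>n. char_mset (\<sigma> n) a)"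
  shows "r \<ge> 1 \<Longrightarrow> convergent (\<lambda>n. psum r (\<sigma> n))"
proof (induction r rule: less_induct)
  case (less r)
  have "convergent (\<lambda>n. complex_of_real (psum r (\<sigma> n)))"
  proof (rule convergent_of_approx)
    fix \<epsilon> :: real assume e: "0 < \<epsilon>"
    \<comment> \<open>The first bound makes the logarithms converge, the second makes the remainder
      \<open>r * a * C ^ r\<close> at most \<open>\<epsilon>\<close>.\<close>
    define a where "a = min (1 / (2 * C)) (\<epsilon> / (r * C ^ r))"
    have r: "r > 0" using less.prems by simp
    have a0: "a > 0" "\<bar>a\<bar> \<le> 1 / (2 * C)" using C(2) e r by (auto simp: a_def)
    have ae: "r * a * C ^ r \<le> \<epsilon>"
    proof -
      have "a \<le> \<epsilon> / (r * C ^ r)" by (simp add: a_def)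
      moreover have "0 < real r * C ^ r" using r C(2) by simp
      ultimately show ?thesis by (simp add: pos_le_divide_eq mult_ac)
    qed
    define k where "k = (\<i> * complex_of_real a) ^ r / of_nat r"
    have k0: "k \<noteq> 0" using a0 r by (simp add: k_def)
    define l where "l = (\<lambda>n. \<Sum>x\<in>#\<sigma> n. - Ln (1 - \<i> * of_real (a * x)))"
    define v where "v = (\<lambda>n. (l n - (\<Sum>s=1..<r. (\<i> * of_real a) ^ s / of_nat s * of_real (psum s (\<sigma> n)))) / k)"
    have lc: "convergent l" unfolding l_def by (rule log_char_convergent[OF C c1 a0(2) lim])
    have "convergent (\<lambda>n. complex_of_real (psum s (\<sigma> n)))" if "s \<in> {1..<r}" for s
      using less.IH[of s] that unfolding convergent_def by (auto intro: tendsto_of_real)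
    hence "convergent (\<lambda>n. \<Sum>s=1..<r. (\<i> * of_real a) ^ s / of_nat s * of_real (psum s (\<sigma> n)))"
      by (intro convergent_sum_fin convergent_mult convergent_const) auto
    from convergent_diff[OF lc this] have "convergent v"
      unfolding v_def divide_inverse by (intro convergent_mult convergent_const)
    moreover have "norm (of_real (psum r (\<sigma> n)) - v n) \<le> \<epsilon>" for n
    proof -
      have "l n = (\<Sum>s=1..<Suc r. (\<i> * of_real a) ^ s / of_nat s * of_real (psum s (\<sigma> n))) + (\<Sum>x\<in>#\<sigma> n. log_rem (Suc r) (a * x))"
        unfolding l_def by (rule log_char_mset)
      also have "(\<Sum>s=1..<Suc r. (\<i> * of_real a) ^ s / of_nat s * complex_of_real (psum s (\<sigma> n))) =
        (\<Sum>s=1..<r. (\<i> * of_real a) ^ s / of_nat s * of_real (psum s (\<sigma> n))) + k * of_real (psum r (\<sigma> n))"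
        using less.prems by (simp add: k_def)
      finally have "v n = of_real (psum r (\<sigma> n)) + (\<Sum>x\<in>#\<sigma> n. log_rem (Suc r) (a * x)) / k"
        unfolding v_def using k0 by (simp add: field_simps)
      hence "norm (of_real (psum r (\<sigma> n)) - v n) = cmod (\<Sum>x\<in>#\<sigma> n. log_rem (Suc r) (a * x)) / cmod k"
        by (simp add: norm_divide)
      also have "\<dots> \<le> (\<bar>a\<bar> ^ Suc r * C ^ (Suc r - 1)) / cmod k"
        using less.prems by (intro divide_right_mono log_rem_mset_bound C) auto
      also have "\<dots> = r * a * C ^ r" using a0 r by (simp add: k_def norm_divide norm_mult norm_power)
      finally show ?thesis using ae by simp
    qed
    ultimately show "\<exists>v. convergent v \<and> (\<forall>n. norm (complex_of_real (psum r (\<sigma> n)) - v n) \<le> \<epsilon>)" by blast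
  qed
  thus ?case unfolding convergent_def using tendsto_Re by force
qed

text \<open>For polynomial \<open>q\<close> the sums are combinations of power sums of degree at
  least 2. The weight \<open>x\<^sup>2\<close> turns a uniform error of polynomial approximation
  into a bounded total error, however many eigenvalues there are.\<close>

lemma weighted_convergent:
  assumes C: "\<And>n. psum 2 (\<sigma> n) \<le> C" "1 \<le> C" and c: "\<And>r. r \<ge> 1 \<Longrightarrow> convergent (\<lambda>n. psum r (\<sigma> n))"
    and q: "continuous_on UNIV q"
  shows "convergent (\<lambda>n. \<Sum>x\<in>#\<sigma> n. x\<^sup>2 * q x)"
proof (rule convergent_of_approx)
  fix \<epsilon> :: real assume e: "0 < \<epsilon>"
  have "0 < \<epsilon> / C" using e C(2) by simp
  then obtain P where P: "real_polynomial_function P" "\<And>x. x \<in> {-C..C} \<Longrightarrow> \<bar>q x - P x\<bar> < \<epsilon> / C"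
    using Stone_Weierstrass_real_polynomial_function[OF compact_Icc continuous_on_subset[OF q]] by blast
  obtain b m where b: "P = (\<lambda>x. \<Sum>i\<le>m. b i * x ^ i)"
    using P(1) real_polynomial_function_iff_sum by blast
  have "(\<Sum>x\<in>#\<sigma> n. x\<^sup>2 * P x) = (\<Sum>i\<le>m. b i * psum (i + 2) (\<sigma> n))" for n
  proof -
    have "(\<Sum>x\<in>#\<sigma>. x\<^sup>2 * P x) = (\<Sum>i\<le>m. b i * psum (i + 2) \<sigma>)" for \<sigma>
    proof (induction \<sigma>)
      case (add x \<sigma>)
      have "x\<^sup>2 * P x = (\<Sum>i\<le>m. b i * x ^ (i + 2))"
        by (simp add: b sum_distrib_left power_add power2_eq_square mult_ac)
      thus ?case using add by (simp add: psum_def sum.distrib distrib_left)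
    qed (simp add: psum_def)
    thus ?thesis .
  qed
  moreover have "convergent (\<lambda>n. \<Sum>i\<le>m. b i * psum (i + 2) (\<sigma> n))"
    by (intro convergent_sum_fin convergent_mult convergent_const c) auto
  ultimately have "convergent (\<lambda>n. \<Sum>x\<in>#\<sigma> n. x\<^sup>2 * P x)" by simp
  moreover have "norm ((\<Sum>x\<in>#\<sigma> n. x\<^sup>2 * q x) - (\<Sum>x\<in>#\<sigma> n. x\<^sup>2 * P x)) \<le> \<epsilon>" for n
  proof -
    have "(\<Sum>x\<in>#\<sigma>. x\<^sup>2 * q x) - (\<Sum>x\<in>#\<sigma>. x\<^sup>2 * P x) = (\<Sum>x\<in>#\<sigma>. x\<^sup>2 * (q x - P x))" for \<sigma>
      by (induction \<sigma>) (auto simp: algebra_simps)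
    moreover have "\<bar>\<Sum>x\<in>#\<sigma> n. x\<^sup>2 * (q x - P x)\<bar> \<le> \<epsilon> / C * C"
    proof (rule sum_mset_weighted_le[OF C(1)])
      fix x assume "x \<in># \<sigma> n"
      hence "\<bar>x\<bar> \<le> C" by (rule mset_bounded[OF C])
      thus "\<bar>q x - P x\<bar> \<le> \<epsilon> / C" using P(2)[of x] by (simp add: abs_le_iff less_imp_le)
    qed (use e C in simp)
    ultimately show ?thesis using C(2) by simp
  qed
  ultimately show "\<exists>v. convergent v \<and> (\<forall>n. norm ((\<Sum>x\<in>#\<sigma> n. x\<^sup>2 * q x) - v n) \<le> \<epsilon>)" by blast
qed

text \<open>By compactness there is a cluster point \<open>l\<close>. If the sequence did not
  converge to it, it would infinitely often be \<open>\<epsilon>\<close> away on one side and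
  infinitely often within \<open>\<epsilon> / 2\<close> of \<open>l\<close>, which crosses a fixed
  gap.\<close>

lemma convergent_of_no_crossing:
  fixes w :: "nat \<Rightarrow> real"
  assumes b: "\<And>n. \<bar>w n\<bar> \<le> C"
    and nc: "\<And>d e. d < e \<Longrightarrow> \<not> ((\<exists>\<^sub>F n in sequentially. w n \<le> d) \<and> (\<exists>\<^sub>F n in sequentially. e \<le> w n))"
  shows "convergent w"
proof -
  have "\<forall>n. w n \<in> {-C..C}" using b by (auto simp: abs_le_iff intro: minus_le_iff[THEN iffD1])
  then obtain l r where r: "strict_mono (r :: nat \<Rightarrow> nat)" "(w \<circ> r) \<longlonglongrightarrow> l"
    using compact_imp_seq_compact[OF compact_Icc, of "-C" C] unfolding seq_compact_def by blast
  have near: "\<exists>\<^sub>F n in sequentially. \<bar>w n - l\<bar> < \<epsilon>" if "0 < \<epsilon>" for \<epsilon>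
  proof -
    have "\<forall>\<^sub>F k in sequentially. \<bar>w (r k) - l\<bar> < \<epsilon>"
      using tendstoD[OF r(2) that] by (simp add: dist_real_def)
    hence "\<exists>\<^sub>F k in sequentially. \<bar>w (r k) - l\<bar> < \<epsilon>" by (intro eventually_frequently) auto
    thus ?thesis unfolding frequently_sequentially using strict_mono_imp_increasing[OF r(1)]
      by (meson order_trans)
  qed
  have "w \<longlonglongrightarrow> l"
  proof (rule tendstoI, rule ccontr)
    fix \<epsilon> :: real assume e: "0 < \<epsilon>"
    assume "\<not> (\<forall>\<^sub>F n in sequentially. dist (w n) l < \<epsilon>)"
    hence "\<exists>\<^sub>F n in sequentially. w n \<le> l - \<epsilon> \<or> l + \<epsilon> \<le> w n"
      unfolding not_eventually by (rule frequently_elim1) (auto simp: dist_real_def abs_if split: if_splits)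
    hence "(\<exists>\<^sub>F n in sequentially. w n \<le> l - \<epsilon>) \<or> (\<exists>\<^sub>F n in sequentially. l + \<epsilon> \<le> w n)"
      by (rule frequently_disj_iff[THEN iffD1])
    moreover have "\<exists>\<^sub>F n in sequentially. l - \<epsilon> / 2 \<le> w n" "\<exists>\<^sub>F n in sequentially. w n \<le> l + \<epsilon> / 2"
      by (rule frequently_elim1[OF near[OF half_gt_zero[OF e]]], linarith)+
    ultimately show False using nc[of "l - \<epsilon>" "l - \<epsilon> / 2"] nc[of "l + \<epsilon> / 2" "l + \<epsilon>"] e by auto
  qed
  thus ?thesis unfolding convergent_def by blast
qed

text \<open>Induction on \<open>k\<close>: the contributions of the first \<open>k\<close> sequences
  converge and are subtracted from the convergent sums. By monotonicity the remaining tail is 0 when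
  the k-th value is at most \<open>d\<close>, and at least \<open>e\<^sup>2 * (e - d)\<close> when
  that value is at least \<open>e\<close>; a convergent tail cannot do both infinitely
  often.\<close>

lemma ordered_convergent:
  fixes P :: "nat \<Rightarrow> nat \<Rightarrow> real"
  assumes P0: "\<And>n k. 0 \<le> P n k" and dec: "\<And>n j k. j \<le> k \<Longrightarrow> P n k \<le> P n j" and C: "\<And>n k. P n k \<le> C"
    and s: "\<And>n d. 0 \<le> d \<Longrightarrow> summable (\<lambda>k. (P n k)\<^sup>2 * max 0 (P n k - d))"
    and T: "\<And>d. 0 \<le> d \<Longrightarrow> convergent (\<lambda>n. \<Sum>k. (P n k)\<^sup>2 * max 0 (P n k - d))"
  shows "convergent (\<lambda>n. P n k)"
proof (induction k rule: less_induct)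
  case (less k)
  show ?case
  proof (rule convergent_of_no_crossing[where C = C])
    show "\<bar>P n k\<bar> \<le> C" for n using P0[of n k] C[of n k] by simp
  next
    fix d e :: real assume de: "d < e"
    show "\<not> ((\<exists>\<^sub>F n in sequentially. P n k \<le> d) \<and> (\<exists>\<^sub>F n in sequentially. e \<le> P n k))"
    proof
    assume f: "(\<exists>\<^sub>F n in sequentially. P n k \<le> d) \<and> (\<exists>\<^sub>F n in sequentially. e \<le> P n k)"
    have d0: "0 \<le> d"
    proof -
      obtain n where "P n k \<le> d" using f by (meson frequently_ex)
      thus ?thesis using P0[of n k] by linarith
    qed
    define h where "h = (\<lambda>t. t\<^sup>2 * max 0 (t - d))"
    have hc: "continuous_on UNIV h" unfolding h_def by (intro continuous_intros)
    define S where "S = (\<lambda>n. (\<Sum>j. h (P n j)) - (\<Sum>j<k. h (P n j)))"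
    have "convergent (\<lambda>n. h (P n j))" if jk: "j < k" for j
    proof -
      obtain l where "(\<lambda>n. P n j) \<longlonglongrightarrow> l" using less[OF jk] unfolding convergent_def by blast
      from continuous_on_tendsto_compose[OF hc this] show ?thesis unfolding convergent_def by auto
    qed
    hence "convergent S" unfolding S_def using T[OF d0]
      by (intro convergent_diff convergent_sum_fin) (auto simp: h_def)
    then obtain L where L: "S \<longlonglongrightarrow> L" unfolding convergent_def by blast
    have S: "S n = (\<Sum>j. h (P n (j + k)))" "summable (\<lambda>j. h (P n (j + k)))" for n
    proof -
      have hs: "summable (\<lambda>j. h (P n j))" using s[OF d0, of n] by (simp add: h_def)
      show "S n = (\<Sum>j. h (P n (j + k)))" unfolding S_def by (rule suminf_minus_initial_segment[OF hs, symmetric])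
      show "summable (\<lambda>j. h (P n (j + k)))" by (rule summable_ignore_initial_segment[OF hs])
    qed
    have small: "S n = 0" if "P n k \<le> d" for n
    proof -
      have "h (P n (j + k)) = 0" for j using dec[of k "j + k" n] that by (simp add: h_def max_absorb1)
      thus ?thesis unfolding S(1) by simp
    qed
    have large: "S n \<ge> e\<^sup>2 * (e - d)" if "e \<le> P n k" for n
    proof -
      have h0: "0 \<le> h t" for t by (simp add: h_def)
      have "e\<^sup>2 * (e - d) \<le> h (P n k)"
        unfolding h_def using that de d0 by (intro mult_mono power_mono) auto
      also have "\<dots> = (\<Sum>j\<in>{0}. h (P n (j + k)))" by simp
      also have "\<dots> \<le> S n" unfolding S(1) by (rule sum_le_suminf[OF S(2)]) (use h0 in auto)
      finally show ?thesis .
    qed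
    define t where "t = e\<^sup>2 * (e - d)"
    have t: "t > 0" using de d0 by (simp add: t_def)
    have z: "\<exists>\<^sub>F n in sequentially. S n = 0"
      by (rule frequently_elim1[OF conjunct1[OF f] small])
    have p: "\<exists>\<^sub>F n in sequentially. t \<le> S n"
      unfolding t_def by (rule frequently_elim1[OF conjunct2[OF f] large])
    have ev: "\<forall>\<^sub>F n in sequentially. \<bar>S n - L\<bar> < t / 2"
      using tendstoD[OF L, of "t / 2"] t by (simp add: dist_real_def)
    obtain m where "S m = 0" "\<bar>S m - L\<bar> < t / 2"
      using frequently_ex[OF frequently_eventually_frequently[OF z ev]] by blast
    moreover obtain m' where "t \<le> S m'" "\<bar>S m' - L\<bar> < t / 2"
      using frequently_ex[OF frequently_eventually_frequently[OF p ev]] by blast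
    ultimately show False by linarith
    qed
  qed
qed


section \<open>Eigenvalue sequences as sums over the spectrum\<close>

lemma pad_zeros_sums:
  fixes g :: "real \<Rightarrow> 'a::real_normed_vector"
  assumes "g 0 = 0"
  shows "(\<lambda>k. g (pad_zeros xs k)) sums (\<Sum>x\<in>#mset xs. g x)"
proof -
  have "(\<lambda>k. g (pad_zeros xs k)) sums (\<Sum>k<length xs. g (pad_zeros xs k))"
    by (rule sums_finite) (auto simp: pad_zeros_def assms)
  also have "(\<Sum>k<length xs. g (pad_zeros xs k)) = sum_list (map g xs)"
    by (simp add: sum_list_sum_nth pad_zeros_def atLeast0LessThan)
  also have "\<dots> = (\<Sum>x\<in>#mset xs. g x)" by (simp flip: sum_mset_sum_list mset_map)
  finally show ?thesis .
qed

lemma pos_eigs_sums: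
  fixes g :: "real \<Rightarrow> 'a::real_normed_vector"
  shows "g 0 = 0 \<Longrightarrow> (\<lambda>k. g (pos_eigs n B k)) sums (\<Sum>x\<in>#{#x \<in># spec_mset n B. x > 0#}. g x)"
  using pad_zeros_sums[of g "rev (sorted_list_of_multiset {#x \<in># spec_mset n B. x > 0#})"]
  by (simp add: pos_eigs_def)

lemma neg_eigs_sums:
  fixes g :: "real \<Rightarrow> 'a::real_normed_vector"
  shows "g 0 = 0 \<Longrightarrow> (\<lambda>k. g (neg_eigs n B k)) sums (\<Sum>x\<in>#{#x \<in># spec_mset n B. x < 0#}. g x)"
  using pad_zeros_sums[of g "sorted_list_of_multiset {#x \<in># spec_mset n B. x < 0#}"]
  by (simp add: neg_eigs_def)

lemma sum_mset_pos_neg: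
  fixes g :: "real \<Rightarrow> 'a::comm_monoid_add"
  assumes "g 0 = 0"
  shows "(\<Sum>x\<in>#\<sigma>. g x) = (\<Sum>x\<in>#{#x \<in># \<sigma>. x > 0#}. g x) + (\<Sum>x\<in>#{#x \<in># \<sigma>. x < 0#}. g x)"
proof (induction \<sigma>)
  case (add x \<sigma>)
  thus ?case using assms by (cases x "0 :: real" rule: linorder_cases) (auto simp: ac_simps)
qed simp

lemma spec_sum:
  fixes g :: "real \<Rightarrow> 'a::real_normed_vector"
  assumes "g 0 = 0"
  shows "(\<Sum>x\<in>#spec_mset n B. g x) = (\<Sum>k. g (pos_eigs n B k)) + (\<Sum>k. g (neg_eigs n B k))"
  unfolding sum_mset_pos_neg[of g "spec_mset n B", OF assms]
  using pos_eigs_sums[of g n B, OF assms] neg_eigs_sums[of g n B, OF assms] by (simp add: sums_iff)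

lemma pos_eigs_nonneg: "0 \<le> pos_eigs n B k"
proof -
  have "\<forall>x\<in>set (rev (sorted_list_of_multiset {#x \<in># spec_mset n B. x > 0#})). 0 \<le> x" by auto
  thus ?thesis unfolding pos_eigs_def pad_zeros_def by (auto simp del: set_rev dest: nth_mem)
qed

lemma neg_eigs_nonpos: "neg_eigs n B k \<le> 0"
proof -
  have "\<forall>x\<in>set (sorted_list_of_multiset {#x \<in># spec_mset n B. x < 0#}). x \<le> 0" by auto
  thus ?thesis unfolding neg_eigs_def pad_zeros_def by (auto simp del: set_sorted_list_of_multiset dest: nth_mem)
qed

lemma pos_eigs_decreasing: assumes "j \<le> k" shows "pos_eigs n B k \<le> pos_eigs n B j"
proof (cases "k < size {#x \<in># spec_mset n B. x > 0#}")
  case True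
  let ?xs = "sorted_list_of_multiset {#x \<in># spec_mset n B. x > 0#}"
  have l: "length ?xs = size {#x \<in># spec_mset n B. x > 0#}" by (metis mset_sorted_list_of_multiset size_mset)
  have s: "sorted ?xs" by simp
  show ?thesis using True assms l sorted_nth_mono[OF s, of "length ?xs - Suc k" "length ?xs - Suc j"]
    by (simp add: pos_eigs_def pad_zeros_def rev_nth)
next
  case False
  have l: "length (sorted_list_of_multiset {#x \<in># spec_mset n B. x > 0#}) = size {#x \<in># spec_mset n B. x > 0#}"
    by (metis mset_sorted_list_of_multiset size_mset)
  have "pos_eigs n B k = 0" using False l by (simp add: pos_eigs_def pad_zeros_def)
  thus ?thesis using pos_eigs_nonneg[of n B j] by simp
qed

lemma neg_eigs_increasing: assumes "j \<le> k" shows "neg_eigs n B j \<le> neg_eigs n B k"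
proof (cases "k < size {#x \<in># spec_mset n B. x < 0#}")
  case True
  let ?xs = "sorted_list_of_multiset {#x \<in># spec_mset n B. x < 0#}"
  have l: "length ?xs = size {#x \<in># spec_mset n B. x < 0#}" by (metis mset_sorted_list_of_multiset size_mset)
  have s: "sorted ?xs" by simp
  show ?thesis using True assms l sorted_nth_mono[OF s, of j k]
    by (simp add: neg_eigs_def pad_zeros_def)
next
  case False
  have l: "length (sorted_list_of_multiset {#x \<in># spec_mset n B. x < 0#}) = size {#x \<in># spec_mset n B. x < 0#}"
    by (metis mset_sorted_list_of_multiset size_mset)
  have "neg_eigs n B k = 0" using False l by (simp add: neg_eigs_def pad_zeros_def)
  thus ?thesis using neg_eigs_nonpos[of n B j] by simp
qed

definition scaled_spec :: "nat \<Rightarrow> infmat \<Rightarrow> real multiset" where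
  "scaled_spec n B = image_mset (\<lambda>x. x / real n) (spec_mset n B)"

lemma scaled_spec_sum:
  fixes g :: "real \<Rightarrow> 'a::real_normed_vector"
  assumes g: "g 0 = 0"
  shows "(\<Sum>x\<in>#scaled_spec n B. g x) = (\<Sum>k. g (pos_eigs n B k / n)) + (\<Sum>k. g (neg_eigs n B k / n))"
    "summable (\<lambda>k. g (pos_eigs n B k / n))" "summable (\<lambda>k. g (neg_eigs n B k / n))"
  using spec_sum[of "\<lambda>x. g (x / n)" n B] pos_eigs_sums[of "\<lambda>x. g (x / n)" n B] neg_eigs_sums[of "\<lambda>x. g (x / n)" n B] g
  by (auto simp: scaled_spec_def image_mset.compositionality o_def sums_iff)

lemma psum_scaled:
  assumes r: "r \<ge> 1"
  shows "psum r (scaled_spec n B) = (\<Sum>k. pos_eigs n B k ^ r + neg_eigs n B k ^ r) / real n ^ r"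
proof -
  have s: "summable (\<lambda>k. pos_eigs n B k ^ r)" "summable (\<lambda>k. neg_eigs n B k ^ r)"
    using pos_eigs_sums[of "\<lambda>x. x ^ r" n B] neg_eigs_sums[of "\<lambda>x. x ^ r" n B] r by (auto simp: sums_iff)
  have "psum r (scaled_spec n B) = (\<Sum>x\<in>#spec_mset n B. x ^ r / real n ^ r)"
    by (simp add: psum_def scaled_spec_def image_mset.compositionality o_def power_divide)
  also have "\<dots> = (\<Sum>x\<in>#spec_mset n B. x ^ r) / real n ^ r"
    by (simp add: divide_inverse sum_mset_distrib_right image_mset.compositionality o_def)
  also have "(\<Sum>x\<in>#spec_mset n B. x ^ r) = (\<Sum>k. pos_eigs n B k ^ r + neg_eigs n B k ^ r)"
    using spec_sum[of "\<lambda>x. x ^ r" n B] r suminf_add[OF s] by simp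
  finally show ?thesis .
qed

text \<open>The test functions \<open>x\<^sup>2 * max 0 (x - d)\<close> vanish on negative
  eigenvalues and their mirror images on positive ones, so a sum over the whole spectrum sees only
  one of the two ordered sequences.\<close>

theorem eigenvalue_limits_of_char:
  assumes C: "\<And>n. psum 2 (scaled_spec n (B n)) \<le> C" "1 \<le> C" and c1: "\<And>n. \<bar>psum 1 (scaled_spec n (B n))\<bar> \<le> C"
    and lim: "\<And>a. convergent (\<lambda>n. char_mset (scaled_spec n (B n)) a)"
  shows "convergent (\<lambda>n. pos_eigs n (B n) k / real n)" "convergent (\<lambda>n. neg_eigs n (B n) k / real n)"
    "convergent (\<lambda>n. psum 1 (scaled_spec n (B n)))" "convergent (\<lambda>n. psum 2 (scaled_spec n (B n)))"
proof -
  define \<sigma> where "\<sigma> = (\<lambda>n. scaled_spec n (B n))"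
  have c: "convergent (\<lambda>n. psum r (\<sigma> n))" if "r \<ge> 1" for r
    using psum_convergent[of \<sigma> C] C c1 lim that unfolding \<sigma>_def by blast
  show "convergent (\<lambda>n. psum 1 (scaled_spec n (B n)))" "convergent (\<lambda>n. psum 2 (scaled_spec n (B n)))"
    using c[of 1] c[of 2] by (simp_all add: \<sigma>_def)
  have w: "convergent (\<lambda>n. \<Sum>x\<in>#\<sigma> n. x\<^sup>2 * q x)" if "continuous_on UNIV q" for q
    using weighted_convergent[OF _ C(2) c that] C(1) unfolding \<sigma>_def by blast
  have le: "x\<^sup>2 \<le> C \<Longrightarrow> x \<le> C" for x :: real
  proof -
    assume "x\<^sup>2 \<le> C"
    also have "C \<le> C\<^sup>2" using C(2) by (simp add: power2_eq_square)
    finally have "x\<^sup>2 \<le> C\<^sup>2" .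
    thus "x \<le> C" by (rule power2_le_imp_le) (use C(2) in simp)
  qed
  have sq: "summable (\<lambda>k. (pos_eigs n (B n) k / n)\<^sup>2)" "summable (\<lambda>k. (neg_eigs n (B n) k / n)\<^sup>2)"
    "(\<Sum>k. (pos_eigs n (B n) k / n)\<^sup>2) + (\<Sum>k. (neg_eigs n (B n) k / n)\<^sup>2) \<le> C" for n
    using scaled_spec_sum[of "\<lambda>x. x\<^sup>2" n "B n"] C(1)[of n] by (auto simp: psum_def)
  have sn: "0 \<le> (\<Sum>k. (pos_eigs n (B n) k / n)\<^sup>2)" "0 \<le> (\<Sum>k. (neg_eigs n (B n) k / n)\<^sup>2)" for n
    using sq by (auto intro!: suminf_nonneg)
  have pC: "pos_eigs n (B n) k / n \<le> C" for n k
    by (rule le) (use sum_le_suminf[OF sq(1), of "{k}" n] sq(3)[of n] sn[of n] in auto)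
  have nC: "- (neg_eigs n (B n) k / n) \<le> C" for n k
    by (rule le) (use sum_le_suminf[OF sq(2), of "{k}" n] sq(3)[of n] sn[of n] in auto)
  show "convergent (\<lambda>n. pos_eigs n (B n) k / real n)"
  proof (rule ordered_convergent[of "\<lambda>n k. pos_eigs n (B n) k / n" C])
    fix d :: real assume d: "0 \<le> d"
    let ?g = "\<lambda>x. x\<^sup>2 * max 0 (x - d)"
    have z: "?g (neg_eigs n (B n) k / n) = 0" for n k
    proof -
      have "neg_eigs n (B n) k / n \<le> 0" using neg_eigs_nonpos by (rule divide_nonpos_nonneg) simp
      thus ?thesis using d by (simp add: max_absorb1)
    qed
    have g0: "?g 0 = 0" by simp
    have e: "(\<Sum>x\<in>#\<sigma> n. ?g x) = (\<Sum>k. ?g (pos_eigs n (B n) k / n))" for n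
      using scaled_spec_sum(1)[of ?g n "B n", OF g0] by (simp only: \<sigma>_def z suminf_zero add_0_right)
    show "convergent (\<lambda>n. \<Sum>k. ?g (pos_eigs n (B n) k / n))"
    proof -
      have "continuous_on UNIV (\<lambda>x::real. max 0 (x - d))" by (intro continuous_intros)
      from w[OF this, unfolded e] show ?thesis .
    qed
    show "summable (\<lambda>k. ?g (pos_eigs n (B n) k / n))" for n
      by (rule scaled_spec_sum(2)) simp
  next
    show "0 \<le> pos_eigs n (B n) k / n" for n k
      using pos_eigs_nonneg by (rule divide_nonneg_nonneg) simp
    show "pos_eigs n (B n) k / n \<le> pos_eigs n (B n) j / n" if "j \<le> k" for n j k
      using pos_eigs_decreasing[OF that] by (rule divide_right_mono) simp
  qed (rule pC)
  have "convergent (\<lambda>n. - (neg_eigs n (B n) k / real n))"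
  proof (rule ordered_convergent[of "\<lambda>n k. - (neg_eigs n (B n) k / n)" C])
    fix d :: real assume d: "0 \<le> d"
    let ?g = "\<lambda>x. x\<^sup>2 * max 0 (- x - d)"
    have z: "?g (pos_eigs n (B n) k / n) = 0" for n k
    proof -
      have "0 \<le> pos_eigs n (B n) k / n" using pos_eigs_nonneg by (rule divide_nonneg_nonneg) simp
      thus ?thesis using d by (simp add: max_absorb1)
    qed
    have g0: "?g 0 = 0" using d by simp
    have e: "(\<Sum>x\<in>#\<sigma> n. ?g x) = (\<Sum>k. ?g (neg_eigs n (B n) k / n))" for n
      using scaled_spec_sum(1)[of ?g n "B n", OF g0] by (simp only: \<sigma>_def z suminf_zero add_0_left)
    have "continuous_on UNIV (\<lambda>x::real. max 0 (- x - d))" by (intro continuous_intros)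
    from w[OF this, unfolded e]
    show "convergent (\<lambda>n. \<Sum>k. (- (neg_eigs n (B n) k / n))\<^sup>2 * max 0 (- (neg_eigs n (B n) k / n) - d))"
      by (simp only: power2_minus)
    show "summable (\<lambda>k. (- (neg_eigs n (B n) k / n))\<^sup>2 * max 0 (- (neg_eigs n (B n) k / n) - d))" for n
      using scaled_spec_sum(3)[of ?g n "B n", OF g0] by (simp only: power2_minus)
  next
    show "0 \<le> - (neg_eigs n (B n) k / n)" for n k
      using divide_nonpos_nonneg[OF neg_eigs_nonpos, of "real n"] by simp
    show "- (neg_eigs n (B n) k / n) \<le> - (neg_eigs n (B n) j / n)" if "j \<le> k" for n j k
      using divide_right_mono[OF neg_eigs_increasing[OF that], of "real n"] by simp
  qed (rule nC)
  hence "convergent (\<lambda>n. - (- (neg_eigs n (B n) k / real n)))" by (rule convergent_minus_iff[THEN iffD1])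
  thus "convergent (\<lambda>n. neg_eigs n (B n) k / real n)" by simp
qed

text \<open>Monotonicity and the bound on the sum of squares give
  \<open>(P n k)\<^sup>2 \<le> C / (k + 1)\<close>, so third order remainders are dominated by a
  multiple of \<open>(k + 1) powr (-3/2)\<close> and their sum passes to the limit termwise. In
  degrees 1 and 2 no such domination is available: mass may escape into many small eigenvalues, and
  \<open>\<gamma>1\<close> and \<open>\<gamma>2\<close> record it.\<close>

lemma char_mset_limit_half:
  fixes P :: "nat \<Rightarrow> nat \<Rightarrow> real"
  assumes dec: "\<And>n j k. j \<le> k \<Longrightarrow> \<bar>P n k\<bar> \<le> \<bar>P n j\<bar>" and s: "\<And>n. summable (\<lambda>k. (P n k)\<^sup>2)"
    and C: "\<And>n. (\<Sum>k. (P n k)\<^sup>2) \<le> C" and x: "\<And>k. (\<lambda>n. P n k) \<longlonglongrightarrow> x k"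
  shows "(\<lambda>n. \<Sum>k. log_rem 3 (a * P n k)) \<longlonglongrightarrow> (\<Sum>k. log_rem 3 (a * x k))"
    "summable (\<lambda>k. log_rem 3 (a * x k))" "summable (\<lambda>k. (x k)\<^sup>2)"
proof -
  have C0: "0 \<le> C" using C[of 0] suminf_nonneg[OF s[of 0]] by simp
  have part: "(\<Sum>j<k. (P n j)\<^sup>2) \<le> C" for n k
    using sum_le_suminf[OF s[of n], of "{..<k}"] C[of n] by simp
  have sq: "(P n k)\<^sup>2 \<le> C / real (Suc k)" for n k
  proof -
    have "real (Suc k) * (P n k)\<^sup>2 = (\<Sum>j<Suc k. (P n k)\<^sup>2)" by simp
    also have "\<dots> \<le> (\<Sum>j<Suc k. (P n j)\<^sup>2)"
      by (intro sum_mono) (use dec in \<open>auto simp: abs_le_square_iff\<close>)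
    finally show ?thesis using part[of n "Suc k"] by (simp add: pos_le_divide_eq mult.commute del: sum.lessThan_Suc of_nat_Suc)
  qed
  define b where "b = (\<lambda>k. \<bar>a\<bar> ^ 3 * (C powr (3/2)) * real (Suc k) powr (-3/2))"
  have bound: "norm (log_rem 3 (a * P n k)) \<le> b k" for n k
  proof -
    have "\<bar>P n k\<bar> = sqrt ((P n k)\<^sup>2)" by simp
    also have "\<dots> \<le> sqrt (C / real (Suc k))" using sq by (intro real_sqrt_le_mono)
    finally have "\<bar>P n k\<bar> ^ 3 \<le> sqrt (C / real (Suc k)) ^ 3" by (intro power_mono) auto
    also have "\<dots> = (C / real (Suc k)) powr (3/2)"
    proof (cases "C = 0")
      case False
      hence pos: "0 < C / real (Suc k)" using C0 by simp
      hence "sqrt (C / real (Suc k)) ^ 3 = ((C / real (Suc k)) powr (1 / 2)) powr 3"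
        by (simp add: powr_half_sqrt del: of_nat_Suc)
      thus ?thesis by (simp add: powr_powr del: of_nat_Suc)
    qed simp
    also have "\<dots> = C powr (3/2) * real (Suc k) powr (-3/2)"
      using C0 by (simp add: powr_divide powr_minus_divide del: of_nat_Suc)
    finally have p3: "\<bar>P n k\<bar> ^ 3 \<le> C powr (3/2) * real (Suc k) powr (-3/2)" .
    have "norm (log_rem 3 (a * P n k)) \<le> \<bar>a * P n k\<bar> ^ 3" by (rule log_rem_bound) simp
    also have "\<dots> = \<bar>a\<bar> ^ 3 * \<bar>P n k\<bar> ^ 3" by (simp add: abs_mult power_mult_distrib)
    also have "\<dots> \<le> b k" unfolding b_def mult.assoc using p3 by (intro mult_left_mono) auto
    finally show ?thesis .
  qed
  have bs: "summable b"
  proof -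
    have "summable (\<lambda>k. real (Suc k) powr (-3/2))"
      using summable_Suc_iff[of "\<lambda>k. real k powr (-3/2)"] by (simp add: summable_real_powr_iff del: of_nat_Suc)
    thus ?thesis unfolding b_def by (rule summable_mult)
  qed
  have cont: "isCont (log_rem 3) s" for s
    unfolding log_rem_def by (intro continuous_intros) (auto simp: complex_nonpos_Reals_iff)
  have lim: "(\<lambda>n. log_rem 3 (a * P n k)) \<longlonglongrightarrow> log_rem 3 (a * x k)" for k
    by (rule isCont_tendsto_compose[OF cont]) (intro tendsto_intros x)
  have T: "eventually (\<lambda>n. summable (\<lambda>k. norm (log_rem 3 (a * P n k)))) sequentially \<and>
     summable (\<lambda>k. norm (log_rem 3 (a * x k))) \<and>
     (\<lambda>n. \<Sum>k. log_rem 3 (a * P n k)) \<longlonglongrightarrow> (\<Sum>k. log_rem 3 (a * x k))"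
  proof (rule tannerys_theorem[OF lim _ bs])
    show "\<forall>\<^sub>F (k, n) in sequentially \<times>\<^sub>F sequentially. norm (log_rem 3 (a * P n k)) \<le> b k"
      by (rule always_eventually) (simp add: bound split_beta)
  qed simp
  show "(\<lambda>n. \<Sum>k. log_rem 3 (a * P n k)) \<longlonglongrightarrow> (\<Sum>k. log_rem 3 (a * x k))" using T by blast
  show "summable (\<lambda>k. log_rem 3 (a * x k))" by (rule summable_norm_cancel) (use T in blast)
  show "summable (\<lambda>k. (x k)\<^sup>2)"
  proof (rule summableI_nonneg_bounded[of _ C])
    fix K
    have "(\<lambda>n. \<Sum>k<K. (P n k)\<^sup>2) \<longlonglongrightarrow> (\<Sum>k<K. (x k)\<^sup>2)" by (intro tendsto_intros x)
    thus "(\<Sum>k<K. (x k)\<^sup>2) \<le> C" by (rule LIMSEQ_le_const2) (use part in auto)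
  qed simp
qed

text \<open>The exponential in \<open>F_factor\<close> cancels the first order term of the
  logarithm, which leaves the third order remainder and an explicit quadratic term; both are
  summable.\<close>

lemma F_factor_prodinf:
  assumes r: "summable (\<lambda>k. log_rem 3 (a * x k))" and s: "summable (\<lambda>k. (x k)\<^sup>2)"
  shows "convergent_prod (\<lambda>k. F_factor (x k) a)"
    "(\<Prod>k. F_factor (x k) a) = exp ((\<Sum>k. log_rem 3 (a * x k)) - of_real (a\<^sup>2 / 2 * (\<Sum>k. (x k)\<^sup>2)))"
    "(\<lambda>K. \<Prod>k<K. F_factor (x k) a) \<longlonglongrightarrow> (\<Prod>k. F_factor (x k) a)"
proof -
  define t where "t = (\<lambda>k. log_rem 3 (a * x k) - of_real (a\<^sup>2 / 2 * (x k)\<^sup>2))"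
  have F: "F_factor (x k) a = exp (t k)" for k
  proof -
    have "t k = - \<i> * of_real (x k * a) - Ln (1 - \<i> * of_real (x k * a))"
      by (simp add: t_def log_rem_def numeral_3_eq_3 numeral_2_eq_2 power2_eq_square mult_ac)
    thus ?thesis using one_minus_i_nonzero[of "x k * a"] by (simp add: F_factor_def exp_diff)
  qed
  have ts: "t sums ((\<Sum>k. log_rem 3 (a * x k)) - of_real (a\<^sup>2 / 2 * (\<Sum>k. (x k)\<^sup>2)))"
    unfolding t_def by (intro sums_diff summable_sums r sums_of_real sums_mult s)
  have lim: "(\<lambda>K. \<Prod>k<K. F_factor (x k) a) \<longlonglongrightarrow> exp ((\<Sum>k. log_rem 3 (a * x k)) - of_real (a\<^sup>2 / 2 * (\<Sum>k. (x k)\<^sup>2)))"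
    unfolding F exp_sum[OF finite_lessThan, symmetric] using ts unfolding sums_def by (intro tendsto_intros)
  hence lim': "(\<lambda>K. \<Prod>k\<le>K. F_factor (x k) a) \<longlonglongrightarrow> exp ((\<Sum>k. log_rem 3 (a * x k)) - of_real (a\<^sup>2 / 2 * (\<Sum>k. (x k)\<^sup>2)))"
    by (rule LIMSEQ_lessThan_iff_atMost[THEN iffD1])
  show "convergent_prod (\<lambda>k. F_factor (x k) a)"
    using lim' by (subst convergent_prod_iff_nz_lim) (auto simp: F)
  show v: "(\<Prod>k. F_factor (x k) a) = exp ((\<Sum>k. log_rem 3 (a * x k)) - of_real (a\<^sup>2 / 2 * (\<Sum>k. (x k)\<^sup>2)))"
    by (rule prodinf_eq_prod_lim[OF lim']) simp
  show "(\<lambda>K. \<Prod>k<K. F_factor (x k) a) \<longlonglongrightarrow> (\<Prod>k. F_factor (x k) a)" unfolding v by (rule lim)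
qed

text \<open>The logarithm splits into two power sums, convergent by assumption, and the third order
  remainders over positive and negative eigenvalues. The quadratic terms hidden in the infinite
  products are compensated by the sum of squares subtracted in \<open>\<gamma>2\<close>; the result
  is nonnegative because every finite partial sum of the limit squares is bounded by the limit of
  the second power sums.\<close>

theorem char_mset_limit:
  assumes x': "\<And>k. (\<lambda>n. pos_eigs n (B n) k / real n) \<longlonglongrightarrow> x' k"
    and x'': "\<And>k. (\<lambda>n. neg_eigs n (B n) k / real n) \<longlonglongrightarrow> x'' k"
    and g1: "(\<lambda>n. psum 1 (scaled_spec n (B n))) \<longlonglongrightarrow> \<gamma>1"
    and g2: "(\<lambda>n. psum 2 (scaled_spec n (B n))) \<longlonglongrightarrow> \<gamma>2t"
  shows "x' k \<ge> 0" "x'' k \<le> 0" "summable (\<lambda>k. (x' k)\<^sup>2)" "summable (\<lambda>k. (x'' k)\<^sup>2)"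
    "summable (\<lambda>k. log_rem 3 (a * x' k))" "summable (\<lambda>k. log_rem 3 (a * x'' k))"
    "(\<lambda>n. char_mset (scaled_spec n (B n)) a) \<longlonglongrightarrow>
       F_fun \<gamma>1 (\<gamma>2t - (\<Sum>k. (x' k)\<^sup>2 + (x'' k)\<^sup>2)) x' x'' a"
    "(\<Sum>k. (x' k)\<^sup>2 + (x'' k)\<^sup>2) \<le> \<gamma>2t"
proof -
  show "x' k \<ge> 0" by (rule LIMSEQ_le_const[OF x']) (auto intro!: divide_nonneg_nonneg pos_eigs_nonneg)
  show "x'' k \<le> 0" by (rule LIMSEQ_le_const2[OF x'']) (auto intro!: divide_nonpos_nonneg neg_eigs_nonpos)
  obtain C where C: "\<And>n. \<bar>psum 2 (scaled_spec n (B n))\<bar> \<le> C"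
    using convergent_imp_Bseq[OF convergentI[OF g2]] unfolding Bseq_def by auto
  have ss: "summable (\<lambda>k. (pos_eigs n (B n) k / n)\<^sup>2)" "summable (\<lambda>k. (neg_eigs n (B n) k / n)\<^sup>2)"
    "psum 2 (scaled_spec n (B n)) = (\<Sum>k. (pos_eigs n (B n) k / n)\<^sup>2) + (\<Sum>k. (neg_eigs n (B n) k / n)\<^sup>2)" for n
    using scaled_spec_sum[of "\<lambda>x. x\<^sup>2" n "B n"] by (simp_all add: psum_def)
  have b: "(\<Sum>k. (pos_eigs n (B n) k / n)\<^sup>2) \<le> C" "(\<Sum>k. (neg_eigs n (B n) k / n)\<^sup>2) \<le> C" for n
    using C[of n] suminf_nonneg[OF ss(1)[of n]] suminf_nonneg[OF ss(2)[of n]] unfolding ss(3) by auto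
  have d1: "\<bar>pos_eigs n (B n) k / n\<bar> \<le> \<bar>pos_eigs n (B n) j / n\<bar>" if "j \<le> k" for n j k
    using pos_eigs_decreasing[OF that, of n "B n"] pos_eigs_nonneg[of n "B n" k] pos_eigs_nonneg[of n "B n" j]
    by (simp add: abs_divide divide_right_mono)
  have d2: "\<bar>neg_eigs n (B n) k / n\<bar> \<le> \<bar>neg_eigs n (B n) j / n\<bar>" if "j \<le> k" for n j k
    using neg_eigs_increasing[OF that, of n "B n"] neg_eigs_nonpos[of n "B n" k] neg_eigs_nonpos[of n "B n" j]
    by (simp add: abs_divide divide_right_mono)
  note p = char_mset_limit_half[of "\<lambda>n k. pos_eigs n (B n) k / n", OF d1 ss(1) b(1) x']
  note q = char_mset_limit_half[of "\<lambda>n k. neg_eigs n (B n) k / n", OF d2 ss(2) b(2) x'']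
  show "summable (\<lambda>k. (x' k)\<^sup>2)" by (rule p(3))
  show "summable (\<lambda>k. (x'' k)\<^sup>2)" by (rule q(3))
  show "summable (\<lambda>k. log_rem 3 (a * x' k))" by (rule p(2))
  show "summable (\<lambda>k. log_rem 3 (a * x'' k))" by (rule q(2))
  have sum2: "(\<Sum>k. (x' k)\<^sup>2 + (x'' k)\<^sup>2) = (\<Sum>k. (x' k)\<^sup>2) + (\<Sum>k. (x'' k)\<^sup>2)"
    by (rule suminf_add[symmetric, OF p(3) q(3)])
  have r0: "log_rem 3 0 = 0" by (simp add: log_rem_def numeral_3_eq_3)
  have "(\<lambda>n. \<i> * of_real a * of_real (psum 1 (scaled_spec n (B n))) + (\<i> * of_real a)\<^sup>2 / 2 * of_real (psum 2 (scaled_spec n (B n)))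
     + ((\<Sum>k. log_rem 3 (a * (pos_eigs n (B n) k / n))) + (\<Sum>k. log_rem 3 (a * (neg_eigs n (B n) k / n)))))
     \<longlonglongrightarrow> \<i> * of_real a * of_real \<gamma>1 + (\<i> * of_real a)\<^sup>2 / 2 * of_real \<gamma>2t
     + ((\<Sum>k. log_rem 3 (a * x' k)) + (\<Sum>k. log_rem 3 (a * x'' k)))"
    by (intro tendsto_intros g1 g2 p(1) q(1))
  moreover have "char_mset (scaled_spec n (B n)) a = exp (\<i> * of_real a * of_real (psum 1 (scaled_spec n (B n))) + (\<i> * of_real a)\<^sup>2 / 2 * of_real (psum 2 (scaled_spec n (B n)))
     + ((\<Sum>k. log_rem 3 (a * (pos_eigs n (B n) k / n))) + (\<Sum>k. log_rem 3 (a * (neg_eigs n (B n) k / n)))))" for n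
    unfolding char_mset_exp log_char_mset[of a _ 3]
    using scaled_spec_sum(1)[of "\<lambda>x. log_rem 3 (a * x)" n "B n"] r0
    by (simp add: numeral_3_eq_3 numeral_2_eq_2 del: power_Suc)
  ultimately have "(\<lambda>n. char_mset (scaled_spec n (B n)) a) \<longlonglongrightarrow> exp (\<i> * of_real a * of_real \<gamma>1 + (\<i> * of_real a)\<^sup>2 / 2 * of_real \<gamma>2t
     + ((\<Sum>k. log_rem 3 (a * x' k)) + (\<Sum>k. log_rem 3 (a * x'' k))))"
    by (simp only:) (rule tendsto_exp)
  also have "exp (\<i> * of_real a * of_real \<gamma>1 + (\<i> * of_real a)\<^sup>2 / 2 * of_real \<gamma>2t
     + ((\<Sum>k. log_rem 3 (a * x' k)) + (\<Sum>k. log_rem 3 (a * x'' k)))) = F_fun \<gamma>1 (\<gamma>2t - (\<Sum>k. (x' k)\<^sup>2 + (x'' k)\<^sup>2)) x' x'' a"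
  proof -
    have fp: "(\<Prod>k. F_factor (x' k) a) = exp ((\<Sum>k. log_rem 3 (a * x' k)) - of_real (a\<^sup>2 / 2 * (\<Sum>k. (x' k)\<^sup>2)))"
      by (rule F_factor_prodinf(2)[OF p(2) p(3)])
    have fq: "(\<Prod>k. F_factor (x'' k) a) = exp ((\<Sum>k. log_rem 3 (a * x'' k)) - of_real (a\<^sup>2 / 2 * (\<Sum>k. (x'' k)\<^sup>2)))"
      by (rule F_factor_prodinf(2)[OF q(2) q(3)])
    show ?thesis unfolding F_fun_def fp fq mult_exp_exp sum2
      by (rule arg_cong[of _ _ exp]) (simp add: power_mult_distrib field_simps)
  qed
  finally show "(\<lambda>n. char_mset (scaled_spec n (B n)) a) \<longlonglongrightarrow>
       F_fun \<gamma>1 (\<gamma>2t - (\<Sum>k. (x' k)\<^sup>2 + (x'' k)\<^sup>2)) x' x'' a" .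
  show "(\<Sum>k. (x' k)\<^sup>2 + (x'' k)\<^sup>2) \<le> \<gamma>2t"
  proof (rule suminf_le_const[OF summable_add[OF p(3) q(3)]])
    fix K
    have "(\<lambda>n. \<Sum>k<K. (pos_eigs n (B n) k / n)\<^sup>2 + (neg_eigs n (B n) k / n)\<^sup>2) \<longlonglongrightarrow> (\<Sum>k<K. (x' k)\<^sup>2 + (x'' k)\<^sup>2)"
      by (intro tendsto_intros x' x'')
    thus "(\<Sum>k<K. (x' k)\<^sup>2 + (x'' k)\<^sup>2) \<le> \<gamma>2t"
    proof (rule LIMSEQ_le[OF _ g2], intro exI allI impI)
      fix n
      show "(\<Sum>k<K. (pos_eigs n (B n) k / n)\<^sup>2 + (neg_eigs n (B n) k / n)\<^sup>2) \<le> psum 2 (scaled_spec n (B n))"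
        unfolding ss(3) sum.distrib by (intro add_mono sum_le_suminf ss) auto
    qed
  qed
qed

section \<open>Orbital measures\<close>

text \<open>Traces and spectrum are invariant along the chain to the diagonal form, where both
  identities are sums over the diagonal.\<close>

lemma inf_trace_spec:
  assumes A: "A \<in> herm n"
  shows "inf_trace A = of_real (\<Sum>x\<in>#spec_mset n A. x)"
    "inf_trace (inf_mult A A) = of_real (\<Sum>x\<in>#spec_mset n A. x\<^sup>2)"
proof -
  obtain d where d: "ucong n A (diagm n d)" by (rule ucong_diagonal[OF A])
  let ?D = "diagm n d"
  have s: "(\<Sum>x\<in>#spec_mset n A. f x) = (\<Sum>i<n. f (d i))" for f :: "real \<Rightarrow> real"
    unfolding ucong_spec_mset[OF d, symmetric] spec_mset_diagm
    by (simp add: image_mset.compositionality o_def sum_unfold_sum_mset)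
  have "inf_trace ?D = (\<Sum>i<n. of_real (d i))"
    by (subst inf_trace_eq_sum[of "{..<n}"]) (auto simp: diagm_def)
  thus "inf_trace A = of_real (\<Sum>x\<in>#spec_mset n A. x)"
    using ucong_trace[OF d A] s[of "\<lambda>x. x"] by simp
  have "inf_trace (inf_mult ?D ?D) = (\<Sum>i<n. \<Sum>k<n. if i = k then of_real ((d i)\<^sup>2) else 0)"
    unfolding trace_pairing[OF diagm_herm order_refl]
    by (intro sum.cong) (auto simp: diagm_def power2_eq_square)
  thus "inf_trace (inf_mult A A) = of_real (\<Sum>x\<in>#spec_mset n A. x\<^sup>2)"
    using ucong_trace_square[OF d A] s[of "\<lambda>x. x\<^sup>2"] by simp
qed

lemma sum_mset_divide: "(\<Sum>x\<in>#\<sigma>. f x / c) = (\<Sum>x\<in>#\<sigma>. f x) / (c :: real)"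
  by (induction \<sigma>) (auto simp: add_divide_distrib)

lemma psum_scaled_trace:
  assumes A: "A \<in> herm n"
  shows "of_real (psum 1 (scaled_spec n A)) = inf_trace A / of_nat n"
    "of_real (psum 2 (scaled_spec n A)) = inf_trace (inf_mult A A) / (of_nat n)\<^sup>2"
proof -
  have 1: "psum 1 (scaled_spec n A) = (\<Sum>x\<in>#spec_mset n A. x) / n"
    by (simp add: psum_def scaled_spec_def image_mset.compositionality o_def sum_mset_divide[of "\<lambda>x. x", simplified])
  have 2: "psum 2 (scaled_spec n A) = (\<Sum>x\<in>#spec_mset n A. x\<^sup>2) / (real n)\<^sup>2"
    by (simp add: psum_def scaled_spec_def image_mset.compositionality o_def power_divide sum_mset_divide)
  show "of_real (psum 1 (scaled_spec n A)) = inf_trace A / of_nat n"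
    "of_real (psum 2 (scaled_spec n A)) = inf_trace (inf_mult A A) / (of_nat n)\<^sup>2"
    unfolding 1 2 inf_trace_spec[OF A] by simp_all
qed

lemma conj_act_measurable [simp]:
  assumes u: "u \<in> unitary_grp n"
  shows "conj_act u \<in> borel_measurable borel"
proof (intro borel_measurable_continuous_onI continuous_on_coordinatewise_then_product)
  fix i j
  define N where "N = Suc (max n (max i j))"
  have N: "n \<le> N" "i < N" "j < N" by (auto simp: N_def)
  have c: "continuous_on UNIV (\<lambda>B :: infmat. B k l)" for k l
    by (rule continuous_on_product_then_coordinatewise[OF continuous_on_product_coordinates])
  show "continuous_on UNIV (\<lambda>B. conj_act u B i j)"
    unfolding conj_act_eq[OF u N] by (intro continuous_intros c)
qed

lemma entry_measurable [simp]: "(\<lambda>B :: infmat. B k l) \<in> borel_measurable borel"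
  by (intro borel_measurable_continuous_onI
      continuous_on_product_then_coordinatewise[OF continuous_on_product_coordinates])

locale orbital =
  fixes n :: nat and \<Omega> :: "infmat set" and M :: "infmat measure" and B :: infmat
  assumes n: "n \<ge> 1" and orb: "orbital_measure n \<Omega> M" and B: "B \<in> \<Omega>"
begin

sublocale prob_space M
  using orb unfolding orbital_measure_def by simp

lemma sets_M: "sets M = sets (restrict_space borel (herm n))" and space_M: "space M = herm n"
  using orb unfolding orbital_measure_def by auto

lemma orbit_spec:
  assumes C: "C \<in> \<Omega>"
  shows "C \<in> herm n" "spec_mset n C = spec_mset n B" "inf_trace C = inf_trace B"
    "inf_trace (inf_mult C C) = inf_trace (inf_mult B B)"
proof -
  obtain D where D: "D \<in> herm n" "\<Omega> = (\<lambda>u. conj_act u D) ` unitary_grp n"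
    using orb unfolding orbital_measure_def is_orbit_def by auto
  have u: "ucong n D X" if "X \<in> \<Omega>" for X
    using that D(2) ucong.ucong_step[OF ucong.ucong_refl] by blast
  show "C \<in> herm n" "spec_mset n C = spec_mset n B" "inf_trace C = inf_trace B"
    "inf_trace (inf_mult C C) = inf_trace (inf_mult B B)"
    using u[OF C] u[OF B] D(1) ucong_herm ucong_spec_mset ucong_trace ucong_trace_square by metis+
qed

lemma AE_orbit: "AE C in M. C \<in> \<Omega>"
  using orb unfolding orbital_measure_def by (intro AE_prob_1) simp

lemma measurable_M: "f \<in> measurable borel N \<Longrightarrow> f \<in> measurable M N"
  using measurable_restrict_space1[of f borel N "herm n"] measurable_cong_sets[OF sets_M refl] by blast

lemma conj_act_M: "u \<in> unitary_grp n \<Longrightarrow> conj_act u \<in> measurable M M"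
proof -
  assume u: "u \<in> unitary_grp n"
  have "conj_act u \<in> measurable M (restrict_space borel (herm n))"
    by (rule measurable_restrict_space2[OF _ measurable_M]) (use u conj_act_herm[OF u] in \<open>auto simp: space_M\<close>)
  thus ?thesis using measurable_cong_sets[OF refl sets_M] by blast
qed

lemma invariant: "u \<in> unitary_grp n \<Longrightarrow> distr M M (conj_act u) = M"
  using orb unfolding orbital_measure_def by blast

lemma integral_invariant:
  fixes f :: "infmat \<Rightarrow> 'b::{banach,second_countable_topology}"
  assumes u: "u \<in> unitary_grp n" and f: "f \<in> borel_measurable borel"
  shows "(\<integral>C. f (conj_act u C) \<partial>M) = (\<integral>C. f C \<partial>M)"
  using integral_distr[OF conj_act_M[OF u] measurable_M[OF f]] invariant[OF u] by simp

lemma nn_integral_invariant: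
  assumes u: "u \<in> unitary_grp n" and f: "f \<in> borel_measurable borel"
  shows "(\<integral>\<^sup>+C. f (conj_act u C) \<partial>M) = (\<integral>\<^sup>+C. f C \<partial>M)"
proof -
  have "f \<in> borel_measurable (distr M M (conj_act u))" unfolding invariant[OF u] by (rule measurable_M[OF f])
  from nn_integral_distr[OF conj_act_M[OF u] this] show ?thesis unfolding invariant[OF u] by (rule sym)
qed

end

lemma qf_matrix_measurable [simp]: "(\<lambda>C. qf n C v) \<in> borel_measurable borel"
  unfolding qf_def by (intro borel_measurable_sum borel_measurable_times borel_measurable_const entry_measurable)

lemma Re_qf_measurable: "(\<lambda>C. Re (qf n C v)) \<in> borel_measurable borel"
  by (rule measurable_compose[OF qf_matrix_measurable]) simp

section \<open>Triangularization of a frame\<close>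

inductive vreach :: "nat \<Rightarrow> (nat \<Rightarrow> nat \<Rightarrow> complex) \<Rightarrow> (nat \<Rightarrow> nat \<Rightarrow> complex) \<Rightarrow> bool" for n v where
  vreach_refl: "vreach n v v"
| vreach_step: "vreach n v w \<Longrightarrow> u \<in> unitary_grp n \<Longrightarrow> vreach n v (\<lambda>j. vec_act n u (w j))"

lemma vec_act_inner:
  assumes u: "u \<in> unitary_grp n"
  shows "(\<Sum>p<n. cnj (vec_act n u x p) * vec_act n u y p) = (\<Sum>p<n. cnj (x p) * y p)"
proof -
  have "(\<Sum>p<n. cnj (vec_act n u x p) * vec_act n u y p) =
    (\<Sum>p<n. \<Sum>k<n. \<Sum>l<n. cnj (x k) * y l * (cnj (u p k) * u p l))"
    by (simp add: vec_act_def sum_product) (simp add: mult_ac)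
  also have "\<dots> = (\<Sum>k<n. \<Sum>p<n. \<Sum>l<n. cnj (x k) * y l * (cnj (u p k) * u p l))" by (rule sum.swap)
  also have "\<dots> = (\<Sum>k<n. \<Sum>l<n. \<Sum>p<n. cnj (x k) * y l * (cnj (u p k) * u p l))"
    by (subst (2) sum.swap) simp
  also have "\<dots> = (\<Sum>k<n. \<Sum>l<n. if k = l then cnj (x k) * y l else 0)"
  proof (intro sum.cong)
    fix k l assume "k \<in> {..<n}" "l \<in> {..<n}"
    thus "(\<Sum>p<n. cnj (x k) * y l * (cnj (u p k) * u p l)) = (if k = l then cnj (x k) * y l else 0)"
      using unitary_grp_sums(2)[OF u order_refl, of k l] by (simp add: sum_distrib_left[symmetric])
  qed auto
  finally show ?thesis by simp
qed

lemma vreach_gram: "vreach n v w \<Longrightarrow> (\<Sum>p<n. cnj (w j p) * w k p) = (\<Sum>p<n. cnj (v j p) * v k p)"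
  by (induction rule: vreach.induct) (simp_all add: vec_act_inner)

text \<open>QR decomposition by reflections. Among the first \<open>n\<close> coordinates, the
  vectors already treated are supported on indices below \<open>k\<close>, where the next reflection
  is the identity, so their zeros persist.\<close>

lemma vreach_triangular_steps:
  "k \<le> n \<Longrightarrow> \<exists>w. vreach n v w \<and> (\<forall>j<k. \<forall>i. j < i \<and> i < n \<longrightarrow> w j i = 0)"
proof (induction k)
  case 0
  show ?case using vreach.vreach_refl by blast
next
  case (Suc k)
  then obtain w where w: "vreach n v w" and z: "\<And>j i. j < k \<Longrightarrow> j < i \<Longrightarrow> i < n \<Longrightarrow> w j i = 0" by auto
  have k: "k < n" using Suc.prems by simp
  obtain u where u: "u \<in> unitary_grp n" and uid: "\<And>i l. i < k \<or> l < k \<Longrightarrow> u i l = inf_id i l"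
    and "\<And>i l. cnj (u l i) = u i l" and ann: "\<And>i. k < i \<Longrightarrow> i < n \<Longrightarrow> (\<Sum>l<n. u i l * w k l) = 0"
    by (rule householder[OF k, of "w k"]) (rule that)
  have "vec_act n u (w j) i = 0" if ji: "j < Suc k" "j < i" "i < n" for j i
  proof (cases "j = k")
    case True
    thus ?thesis using ann[of i] ji by (simp add: vec_act_def)
  next
    case False
    hence j: "j < k" using ji by simp
    have "u i l * w j l = 0" if "l < n" for l
    proof (cases "j < l")
      case True
      thus ?thesis using z[OF j] that by simp
    next
      case False
      thus ?thesis using uid[of i l] j ji by (auto simp: inf_id_def)
    qed
    hence "(\<Sum>l<n. u i l * w j l) = 0" by (intro sum.neutral) blast
    thus ?thesis using ji by (simp add: vec_act_def)
  qed
  thus ?case using vreach.vreach_step[OF w u] by blast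
qed

text \<open>By contradiction, along a sequence whose Gram matrices tend to the identity.
  Triangularity determines the vectors in the limit up to phases only, which suffices: the
  conclusion concerns products \<open>cnj (S j p) * S j q\<close>, in which the phase of a vector
  cancels.\<close>

lemma triangular_near_orthonormal:
  fixes m :: nat and \<epsilon> :: real
  assumes e: "0 < \<epsilon>"
  shows "\<exists>\<delta>>0. \<forall>S :: nat \<Rightarrow> nat \<Rightarrow> complex. (\<forall>j<m. \<forall>i>j. S j i = 0) \<longrightarrow>
    (\<forall>j<m. \<forall>k<m. cmod ((\<Sum>p<m. cnj (S j p) * S k p) - (if j = k then 1 else 0)) \<le> \<delta>) \<longrightarrow>
    (\<forall>j<m. \<forall>p<m. \<forall>q<m. cmod (cnj (S j p) * S j q - (if p = j \<and> q = j then 1 else 0)) \<le> \<epsilon>)"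
proof (rule ccontr)
  assume neg: "\<not> ?thesis"
  define U where "U = (\<lambda>S :: nat \<Rightarrow> nat \<Rightarrow> complex. \<forall>j<m. \<forall>i>j. S j i = 0)"
  define Gr where "Gr = (\<lambda>(S :: nat \<Rightarrow> nat \<Rightarrow> complex) \<delta>. \<forall>j<m. \<forall>k<m. cmod ((\<Sum>p<m. cnj (S j p) * S k p) - (if j = k then 1 else 0)) \<le> \<delta>)"
  define K where "K = (\<lambda>S :: nat \<Rightarrow> nat \<Rightarrow> complex. \<forall>j<m. \<forall>p<m. \<forall>q<m. cmod (cnj (S j p) * S j q - (if p = j \<and> q = j then 1 else 0)) \<le> \<epsilon>)"
  have neg': "\<not> (\<exists>\<delta>>0. \<forall>S. U S \<longrightarrow> Gr S \<delta> \<longrightarrow> K S)"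
    using neg unfolding U_def Gr_def K_def .
  have "\<forall>N. \<exists>S. U S \<and> Gr S (1 / real (Suc N)) \<and> \<not> K S"
  proof
    fix N
    have "0 < 1 / real (Suc N)" by simp
    thus "\<exists>S. U S \<and> Gr S (1 / real (Suc N)) \<and> \<not> K S" using neg' by blast
  qed
  from choice[OF this] obtain S where S: "\<And>N. U (S N) \<and> Gr (S N) (1 / real (Suc N)) \<and> \<not> K (S N)" by blast
  have tri: "S N j i = 0" if "j < m" "j < i" for N j i
    using S[of N] that unfolding U_def by blast
  have gram: "cmod ((\<Sum>p<m. cnj (S N j p) * S N k p) - (if j = k then 1 else 0)) \<le> 1 / real (Suc N)"
    if "j < m" "k < m" for N j k
    using S[of N] that unfolding Gr_def by blast
  have bad: "\<exists>j<m. \<exists>p<m. \<exists>q<m. \<epsilon> < cmod (cnj (S N j p) * S N j q - (if p = j \<and> q = j then 1 else 0))" for N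
    using S[of N] unfolding K_def not_all not_imp not_le by blast
  have G: "(\<lambda>N. (\<Sum>p<m. cnj (S N j p) * S N k p) - (if j = k then 1 else 0)) \<longlonglongrightarrow> 0" if "j < m" "k < m" for j k
    by (rule Lim_null_comparison[OF _ LIMSEQ_inverse_real_of_nat])
      (use gram[OF that] in \<open>auto simp: inverse_eq_divide\<close>)
  \<comment> \<open>Induction over columns. Once the entries below the diagonal in the columns
    before \<open>p\<close> tend to 0, the Gram entry of \<open>p\<close> and \<open>j\<close>
    reduces to \<open>cnj (S N p p) * S N j p\<close>. For \<open>j = p\<close> this gives modulus 1
    in the limit; for \<open>j > p\<close>, division by the diagonal entry gives 0.\<close>
  have main: "p < m \<Longrightarrow> (\<lambda>N. cmod (S N p p)) \<longlonglongrightarrow> 1 \<and> (\<forall>j<m. p < j \<longrightarrow> (\<lambda>N. cmod (S N j p)) \<longlonglongrightarrow> 0)" for p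
  proof (induction p rule: less_induct)
    case (less p)
    have E: "(\<lambda>N. cnj (S N p p) * S N j p) \<longlonglongrightarrow> (if p = j then 1 else 0)" if j: "j < m" "p \<le> j" for j
    proof -
      have split: "(\<Sum>l<m. cnj (S N p l) * S N j l) = (\<Sum>l<p. cnj (S N p l) * S N j l) + cnj (S N p p) * S N j p" for N
      proof -
        have "(\<Sum>l<m. cnj (S N p l) * S N j l) = (\<Sum>l<Suc p. cnj (S N p l) * S N j l)"
          by (rule sum.mono_neutral_right) (use less.prems tri[OF less.prems] in \<open>auto simp: not_less\<close>)
        thus ?thesis by simp
      qed
      have "(\<lambda>N. cnj (S N p l) * S N j l) \<longlonglongrightarrow> 0" if l: "l < p" for l
      proof -
        have "(\<lambda>N. cmod (S N p l)) \<longlonglongrightarrow> 0" "(\<lambda>N. cmod (S N j l)) \<longlonglongrightarrow> 0"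
          using less.IH[OF l] less.prems l j by auto
        hence "(\<lambda>N. cmod (S N p l) * cmod (S N j l)) \<longlonglongrightarrow> 0 * 0" by (rule tendsto_mult)
        hence "(\<lambda>N. norm (cnj (S N p l) * S N j l)) \<longlonglongrightarrow> 0" by (simp add: norm_mult)
        thus ?thesis by (rule tendsto_norm_zero_cancel)
      qed
      hence s0: "(\<lambda>N. \<Sum>l<p. cnj (S N p l) * S N j l) \<longlonglongrightarrow> 0" by (intro tendsto_null_sum) auto
      have "(\<lambda>N. ((\<Sum>l<m. cnj (S N p l) * S N j l) - (if p = j then 1 else 0)) - (\<Sum>l<p. cnj (S N p l) * S N j l) + (if p = j then 1 else 0)) \<longlonglongrightarrow> 0 - 0 + (if p = j then 1 else 0)"
        by (intro tendsto_intros G less.prems j s0)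
      thus ?thesis unfolding split by simp
    qed
    have "(\<lambda>N. sqrt (cmod (cnj (S N p p) * S N p p))) \<longlonglongrightarrow> sqrt (cmod 1)"
      using E[OF less.prems order_refl] by (intro tendsto_intros) simp
    hence d: "(\<lambda>N. cmod (S N p p)) \<longlonglongrightarrow> 1" by (simp add: norm_mult)
    moreover have "(\<lambda>N. cmod (S N j p)) \<longlonglongrightarrow> 0" if j: "j < m" "p < j" for j
    proof -
      have "(\<lambda>N. cmod (cnj (S N p p) * S N j p) / cmod (S N p p)) \<longlonglongrightarrow> 0 / 1"
        using E[of j] j d by (intro tendsto_divide tendsto_norm_zero) auto
      moreover have "\<forall>\<^sub>F N in sequentially. cmod (cnj (S N p p) * S N j p) / cmod (S N p p) = cmod (S N j p)"
        using order_tendstoD(1)[OF d, of 0] by (auto elim!: eventually_mono simp: norm_mult)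
      ultimately show ?thesis by (simp add: tendsto_cong)
    qed
    ultimately show ?case by blast
  qed
  have lim: "(\<lambda>N. cmod (cnj (S N j p) * S N j q - (if p = j \<and> q = j then 1 else 0))) \<longlonglongrightarrow> 0"
    if "j < m" "p < m" "q < m" for j p q
  proof -
    have z: "(\<lambda>N. cmod (S N j r)) \<longlonglongrightarrow> (if r = j then 1 else 0)" if "r < m" for r
      using main[of r] main[of j] tri[OF \<open>j < m\<close>, of r] that \<open>j < m\<close>
      by (cases r j rule: linorder_cases) auto
    show ?thesis
    proof (cases "p = j \<and> q = j")
      case True
      have "(\<lambda>N. cmod (of_real ((cmod (S N j j))\<^sup>2) - 1)) \<longlonglongrightarrow> cmod (of_real (1\<^sup>2) - 1)"
        using z[OF \<open>j < m\<close>] by (intro tendsto_intros) simp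
      thus ?thesis using True by (simp add: complex_norm_square mult.commute del: of_real_power)
    next
      case False
      have "(\<lambda>N. cmod (S N j p) * cmod (S N j q)) \<longlonglongrightarrow> (if p = j then 1 else 0) * (if q = j then 1 else 0)"
        by (intro tendsto_mult z that)
      thus ?thesis using False by (auto simp: norm_mult split: if_splits)
    qed
  qed
  have "\<forall>\<^sub>F N in sequentially. \<forall>j\<in>{..<m}. \<forall>p\<in>{..<m}. \<forall>q\<in>{..<m}. cmod (cnj (S N j p) * S N j q - (if p = j \<and> q = j then 1 else 0)) < \<epsilon>"
    by (intro eventually_ball_finite finite_lessThan ballI order_tendstoD(2)[OF lim e]) auto
  from eventually_happens'[OF sequentially_bot this]
  obtain N where N: "\<forall>j\<in>{..<m}. \<forall>p\<in>{..<m}. \<forall>q\<in>{..<m}. cmod (cnj (S N j p) * S N j q - (if p = j \<and> q = j then 1 else 0)) < \<epsilon>"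
    by (elim exE)
  obtain j p q where "j < m" "p < m" "q < m" "\<epsilon> < cmod (cnj (S N j p) * S N j q - (if p = j \<and> q = j then 1 else 0))"
    using bad[of N] by (elim exE conjE)
  moreover have "cmod (cnj (S N j p) * S N j q - (if p = j \<and> q = j then 1 else 0)) < \<epsilon>"
    using N calculation(1-3) by blast
  ultimately show False by linarith
qed

lemma iexp_measurable: "iexp \<in> borel_measurable borel"
  by (intro borel_measurable_continuous_onI continuous_intros)

text \<open>Rotating the vectors has the same effect as conjugating the matrix, and the orbital
  measure is invariant under conjugation.\<close>

lemma (in orbital) vreach_integral:
  assumes "vreach n v w"
  shows "(\<integral>C. iexp (\<Sum>j<m. a j * Re (qf n C (w j))) \<partial>M) = (\<integral>C. iexp (\<Sum>j<m. a j * Re (qf n C (v j))) \<partial>M)"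
  using assms
proof (induction rule: vreach.induct)
  case (vreach_step w u)
  let ?f = "\<lambda>C. iexp (\<Sum>j<m. a j * Re (qf n C (w j)))"
  have "(\<lambda>C. \<Sum>j<m. a j * Re (qf n C (w j))) \<in> borel_measurable borel"
    by (intro borel_measurable_sum borel_measurable_times borel_measurable_const Re_qf_measurable)
  from measurable_compose[OF this iexp_measurable] have f: "?f \<in> borel_measurable borel" .
  have q: "qf n (conj_act (inf_adjoint u) C) x = qf n C (vec_act n u x)" for C x
    using qf_conj_act[OF inf_adjoint_unitary[OF vreach_step(2)], of C x] by simp
  show ?case using integral_invariant[OF inf_adjoint_unitary[OF vreach_step(2)] f]
    unfolding q vreach_step.IH .
qed (rule HOL.refl)

section \<open>Comparison with Gaussian vectors\<close>

lemma iexp_lipschitz: "cmod (iexp x - iexp y) \<le> \<bar>x - y\<bar>"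
proof -
  have "iexp x - iexp y = iexp y * (iexp (x - y) - 1)"
    by (simp add: right_diff_distrib exp_add[symmetric] algebra_simps)
  hence "cmod (iexp x - iexp y) = cmod (iexp (x - y) - 1)" by (simp add: norm_mult norm_exp_i_times del: of_real_diff)
  also have "\<dots> \<le> \<bar>x - y\<bar>" using iexp_approx1[of "x - y" 0] by simp
  finally show ?thesis .
qed

lemma iexp_diff_le_2: "cmod (iexp x - iexp y) \<le> 2"
  using norm_triangle_ineq4[of "iexp x" "iexp y"] unfolding norm_exp_i_times by simp

context orbital
begin

lemma pair_qf_measurable:
  "(\<lambda>z. Re (qf n (fst z) (snd z j))) \<in> borel_measurable (M \<Otimes>\<^sub>M gmat)"
proof -
  have g: "(\<lambda>\<omega>. \<omega> j p) \<in> borel_measurable gmat" for p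
    using entry_measurable[of j p] measurable_cong_sets[OF sets_gmat refl] by blast
  have f: "(\<lambda>z. fst z p q) \<in> borel_measurable (M \<Otimes>\<^sub>M gmat)" for p q
    by (rule measurable_compose[OF measurable_fst measurable_M[OF entry_measurable]])
  have s: "(\<lambda>z. snd z j p) \<in> borel_measurable (M \<Otimes>\<^sub>M gmat)" for p
    by (rule measurable_compose[OF measurable_snd g])
  have "cnj \<in> borel_measurable borel" by (intro borel_measurable_continuous_onI continuous_intros)
  from measurable_compose[OF s this]
  have c: "(\<lambda>z. cnj (snd z j p)) \<in> borel_measurable (M \<Otimes>\<^sub>M gmat)" for p .
  have "(\<lambda>z. qf n (fst z) (snd z j)) \<in> borel_measurable (M \<Otimes>\<^sub>M gmat)"
    unfolding qf_def by (intro borel_measurable_sum borel_measurable_times f s c)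
  thus ?thesis by (rule measurable_compose) simp
qed

text \<open>For a fixed matrix of the orbit the Gaussian integral depends on the spectrum only, so
  it is constant on the orbit; Fubini allows it to be evaluated first.\<close>

lemma gaussian_average:
  "(\<integral>\<omega>. (\<integral>C. iexp (\<Sum>j<m. a j / n * Re (qf n C (\<omega> j))) \<partial>M) \<partial>gmat) = (\<Prod>j<m. char_mset (scaled_spec n B) (a j))"
proof -
  interpret G: prob_space gmat by (rule prob_space_gmat)
  interpret P: pair_prob_space M gmat ..
  let ?f = "\<lambda>C \<omega>. iexp (\<Sum>j<m. a j / n * Re (qf n C (\<omega> j)))"
  have fm: "(\<lambda>z. \<Sum>j<m. a j / n * Re (qf n (fst z) (snd z j))) \<in> borel_measurable (M \<Otimes>\<^sub>M gmat)"
    by (intro borel_measurable_sum borel_measurable_times borel_measurable_const pair_qf_measurable)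
  have fi: "integrable (M \<Otimes>\<^sub>M gmat) (case_prod ?f)"
    using iexp_integrable[OF P.prob_space_axioms fm] by (simp add: case_prod_unfold)
  have inner: "(\<integral>\<omega>. ?f C \<omega> \<partial>gmat) = (\<Prod>j<m. char_mset (scaled_spec n B) (a j))" if C: "C \<in> \<Omega>" for C
  proof -
    have ii: "integrable gvec (\<lambda>g. iexp (a j / n * Re (qf n C g)))" for j
    proof (rule iexp_integrable[OF prob_space_gvec])
      have "Re \<in> borel_measurable borel" by simp
      from measurable_compose[OF qf_measurable this]
      show "(\<lambda>g. a j / n * Re (qf n C g)) \<in> borel_measurable gvec"
        unfolding measurable_gvec by (intro borel_measurable_times borel_measurable_const)
    qed
    have "(\<integral>\<omega>. ?f C \<omega> \<partial>gmat) = (\<integral>\<omega>. (\<Prod>j<m. iexp (a j / n * Re (qf n C (\<omega> j)))) \<partial>gmat)"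
      unfolding of_real_sum sum_distrib_left exp_sum[OF finite_lessThan] ..
    also have "\<dots> = (\<Prod>j<m. \<integral>g. iexp (a j / n * Re (qf n C g)) \<partial>gvec)"
      unfolding gmat_def by (rule integral_prod_PiM(2)[OF prob_space_gvec finite_lessThan ii])
    also have "\<dots> = (\<Prod>j<m. char_mset (scaled_spec n B) (a j))"
      unfolding gvec_qf_char[OF orbit_spec(1)[OF C]] orbit_spec(2)[OF C]
      by (simp add: char_mset_def scaled_spec_def image_mset.compositionality o_def)
    finally show ?thesis .
  qed
  have "(\<integral>\<omega>. (\<integral>C. ?f C \<omega> \<partial>M) \<partial>gmat) = (\<integral>C. (\<integral>\<omega>. ?f C \<omega> \<partial>gmat) \<partial>M)"
    by (rule P.Fubini_integral[OF fi])
  also have "\<dots> = (\<integral>C. (\<Prod>j<m. char_mset (scaled_spec n B) (a j)) \<partial>M)"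
  proof (rule integral_cong_AE)
    show "(\<lambda>C. \<integral>\<omega>. ?f C \<omega> \<partial>gmat) \<in> borel_measurable M"
      using fi by (intro G.borel_measurable_lebesgue_integral) auto
    show "AE C in M. (\<integral>\<omega>. ?f C \<omega> \<partial>gmat) = (\<Prod>j<m. char_mset (scaled_spec n B) (a j))"
      using AE_orbit by eventually_elim (rule inner)
  qed simp
  also have "\<dots> = (\<Prod>j<m. char_mset (scaled_spec n B) (a j))" by (simp add: prob_space)
  finally show ?thesis .
qed

lemma gaussian_slice_measurable:
  "(\<lambda>\<omega>. \<integral>C. iexp (\<Sum>j<m. a j / n * Re (qf n C (\<omega> j))) \<partial>M) \<in> borel_measurable gmat"
proof -
  interpret G: prob_space gmat by (rule prob_space_gmat)
  interpret P: pair_prob_space M gmat ..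
  have fm: "(\<lambda>z. \<Sum>j<m. a j / n * Re (qf n (fst z) (snd z j))) \<in> borel_measurable (M \<Otimes>\<^sub>M gmat)"
    by (intro borel_measurable_sum borel_measurable_times borel_measurable_const pair_qf_measurable)
  have fi: "integrable (M \<Otimes>\<^sub>M gmat) (\<lambda>(C, \<omega>). iexp (\<Sum>j<m. a j / n * Re (qf n C (\<omega> j))))"
    using iexp_integrable[OF P.prob_space_axioms fm] by (simp add: case_prod_unfold)
  from P.integrable_snd[OF fi] show ?thesis by (rule borel_measurable_integrable)
qed

text \<open>Triangularizing the frame \<open>\<omega>\<close> by an element of \<open>U(n)\<close> replaces it, if it is nearly
  orthonormal after rescaling, by nearly the first \<open>m\<close> coordinate vectors up to phases, and
  the phases cancel.\<close>

lemma gaussian_slice_near: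
  assumes mn: "m \<le> n" and R: "0 \<le> R" and e: "0 \<le> \<epsilon>"
    and tri: "\<And>S :: nat \<Rightarrow> nat \<Rightarrow> complex. (\<forall>j<m. \<forall>i>j. S j i = 0) \<Longrightarrow>
      (\<forall>j<m. \<forall>k<m. cmod ((\<Sum>p<m. cnj (S j p) * S k p) - (if j = k then 1 else 0)) \<le> \<delta>) \<Longrightarrow>
      (\<forall>j<m. \<forall>p<m. \<forall>q<m. cmod (cnj (S j p) * S j q - (if p = j \<and> q = j then 1 else 0)) \<le> \<epsilon>)"
    and gram: "\<And>j k. j < m \<Longrightarrow> k < m \<Longrightarrow>
      cmod ((\<Sum>p<n. cnj (\<omega> j p) * \<omega> k p) / of_nat n - (if j = k then 1 else 0)) \<le> \<delta>"
  shows "cmod ((\<integral>C. iexp (\<Sum>j<m. a j / n * Re (qf n C (\<omega> j))) \<partial>M) - (\<integral>C. iexp (\<Sum>j<m. a j * Re (C j j)) \<partial>M))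
    \<le> (real m)\<^sup>2 * ((\<Sum>j<m. \<bar>a j\<bar>) * \<epsilon> * R) + 2 * (\<Sum>p<m. \<Sum>q<m. prob {C \<in> space M. R < cmod (C p q)})"
proof -
  obtain T where T: "vreach n \<omega> T" and tz: "\<And>j i. j < m \<Longrightarrow> j < i \<Longrightarrow> i < n \<Longrightarrow> T j i = 0"
    using vreach_triangular_steps[OF mn, of \<omega>] by auto
  \<comment> \<open>Division by \<open>sqrt n\<close> brings the Gram matrix near the identity and
    turns \<open>qf n C (T j) / n\<close> into a form with coefficients
    \<open>cnj (S j p) * S j q\<close>. By triangularity only indices below \<open>m\<close>
    contribute.\<close>
  define S where "S = (\<lambda>j i. if i < n then T j i / of_real (sqrt n) else 0)"
  have sn: "complex_of_real (sqrt n) * of_real (sqrt n) = of_nat n"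
    unfolding of_real_mult[symmetric] by simp
  have SS: "cnj (S j p) * S k q = cnj (T j p) * T k q / of_nat n" if "p < n" "q < n" for j k p q
    using that unfolding sn[symmetric] by (simp add: S_def)
  have S0: "\<forall>j<m. \<forall>i>j. S j i = 0" using tz by (auto simp: S_def)
  have red: "(\<Sum>p<n. cnj (T j p) * T k p) / of_nat n = (\<Sum>p<m. cnj (S j p) * S k p)" if "j < m" "k < m" for j k
  proof -
    have "(\<Sum>p<n. cnj (T j p) * T k p) / of_nat n = (\<Sum>p<n. cnj (S j p) * S k p)"
      by (simp add: SS sum_divide_distrib)
    also have "\<dots> = (\<Sum>p<m. cnj (S j p) * S k p)"
      by (rule sum.mono_neutral_right) (use mn S0 that in \<open>auto simp: not_less\<close>)
    finally show ?thesis .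
  qed
  have small: "\<forall>j<m. \<forall>p<m. \<forall>q<m. cmod (cnj (S j p) * S j q - (if p = j \<and> q = j then 1 else 0)) \<le> \<epsilon>"
  proof (rule tri[OF S0], intro allI impI)
    fix j k assume "j < m" "k < m"
    thus "cmod ((\<Sum>p<m. cnj (S j p) * S k p) - (if j = k then 1 else 0)) \<le> \<delta>"
      using gram[of j k] unfolding red[symmetric, OF \<open>j < m\<close> \<open>k < m\<close>] vreach_gram[OF T] by simp
  qed
  define x where "x = (\<lambda>C. \<Sum>j<m. a j / n * Re (qf n C (T j)))"
  define y where "y = (\<lambda>C :: infmat. \<Sum>j<m. a j * Re (C j j))"
  define A where "A = (\<Sum>j<m. \<bar>a j\<bar>)"
  have qfT: "qf n C (T j) / of_nat n = (\<Sum>p<m. \<Sum>q<m. cnj (S j p) * S j q * C p q)" if j: "j < m" for C j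
  proof -
    have "qf n C (T j) / of_nat n = (\<Sum>p<n. \<Sum>q<n. cnj (S j p) * S j q * C p q)"
    proof -
      have "cnj (T j p) * C p q * T j q / of_nat n = cnj (S j p) * S j q * C p q" if "p < n" "q < n" for p q
        unfolding SS[OF that] by simp
      thus ?thesis unfolding qf_def sum_divide_distrib by (intro sum.cong refl) auto
    qed
    also have "\<dots> = (\<Sum>p<m. \<Sum>q<n. cnj (S j p) * S j q * C p q)"
      by (rule sum.mono_neutral_right) (use mn S0 j in \<open>auto simp: not_less\<close>)
    also have "\<dots> = (\<Sum>p<m. \<Sum>q<m. cnj (S j p) * S j q * C p q)"
      by (intro sum.cong refl sum.mono_neutral_right) (use mn S0 j in \<open>auto simp: not_less\<close>)
    finally show ?thesis .
  qed
  have diff: "\<bar>x C - y C\<bar> \<le> (\<Sum>p<m. \<Sum>q<m. A * \<epsilon> * cmod (C p q))" for C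
  proof -
    have e1: "a j / n * Re (qf n C (T j)) - a j * Re (C j j) =
      a j * Re (\<Sum>p<m. \<Sum>q<m. (cnj (S j p) * S j q - (if p = j \<and> q = j then 1 else 0)) * C p q)" if j: "j < m" for j
    proof -
      have "(\<Sum>p<m. \<Sum>q<m. (if p = j \<and> q = j then 1 else 0) * C p q) = (\<Sum>p<m. if p = j then C j j else 0)"
        using j by (intro sum.cong) (auto simp: if_distrib[of "\<lambda>x. x * _"] cong: if_cong)
      also have "\<dots> = C j j" using j by simp
      finally have "(\<Sum>p<m. \<Sum>q<m. (cnj (S j p) * S j q - (if p = j \<and> q = j then 1 else 0)) * C p q) = qf n C (T j) / of_nat n - C j j"
        unfolding qfT[OF j] left_diff_distrib sum_subtractf by simp
      thus ?thesis by (simp add: right_diff_distrib)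
    qed
    have "x C - y C = (\<Sum>j<m. a j / n * Re (qf n C (T j)) - a j * Re (C j j))" by (simp add: x_def y_def sum_subtractf)
    also have "\<dots> = (\<Sum>j<m. a j * Re (\<Sum>p<m. \<Sum>q<m. (cnj (S j p) * S j q - (if p = j \<and> q = j then 1 else 0)) * C p q))"
      by (intro sum.cong refl e1) simp
    finally have "\<bar>x C - y C\<bar> \<le> (\<Sum>j<m. \<bar>a j * Re (\<Sum>p<m. \<Sum>q<m. (cnj (S j p) * S j q - (if p = j \<and> q = j then 1 else 0)) * C p q)\<bar>)"
      by (simp only: sum_abs)
    also have "\<dots> \<le> (\<Sum>j<m. \<bar>a j\<bar> * (\<Sum>p<m. \<Sum>q<m. \<epsilon> * cmod (C p q)))"
    proof (rule sum_mono)
      fix j assume j: "j \<in> {..<m}"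
      have "\<bar>Re (\<Sum>p<m. \<Sum>q<m. (cnj (S j p) * S j q - (if p = j \<and> q = j then 1 else 0)) * C p q)\<bar>
        \<le> cmod (\<Sum>p<m. \<Sum>q<m. (cnj (S j p) * S j q - (if p = j \<and> q = j then 1 else 0)) * C p q)"
        by (rule abs_Re_le_cmod)
      also have "\<dots> \<le> (\<Sum>p<m. \<Sum>q<m. \<epsilon> * cmod (C p q))"
        using small j by (intro sum_norm_le) (simp add: norm_mult mult_right_mono)
      finally show "\<bar>a j * Re (\<Sum>p<m. \<Sum>q<m. (cnj (S j p) * S j q - (if p = j \<and> q = j then 1 else 0)) * C p q)\<bar>
        \<le> \<bar>a j\<bar> * (\<Sum>p<m. \<Sum>q<m. \<epsilon> * cmod (C p q))"
        unfolding abs_mult by (rule mult_left_mono) simp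
    qed
    also have "\<dots> = (\<Sum>p<m. \<Sum>q<m. A * \<epsilon> * cmod (C p q))"
      unfolding sum_distrib_right[symmetric] A_def[symmetric] by (simp add: sum_distrib_left mult.assoc)
    finally show ?thesis .
  qed
  have A0: "0 \<le> A" by (simp add: A_def sum_nonneg)
  let ?I = "\<lambda>p q C. indicator {C \<in> space M. R < cmod (C p q)} C :: real"
  have em: "(\<lambda>C. C p q) \<in> borel_measurable M" for p q by (rule measurable_M[OF entry_measurable])
  have Im: "{C \<in> space M. R < cmod (C p q)} \<in> sets M" for p q
    using em[of p q] by measurable
  \<comment> \<open>If all entries of the corner are at most \<open>R\<close> in modulus, the
    Lipschitz bound applies. Otherwise one of the indicators is 1, and twice their sum dominates the
    trivial bound 2.\<close>
  have pt: "cmod (iexp (x C) - iexp (y C)) \<le> (real m)\<^sup>2 * (A * \<epsilon> * R) + 2 * (\<Sum>p<m. \<Sum>q<m. ?I p q C)" if C: "C \<in> space M" for C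
  proof (cases "\<forall>p<m. \<forall>q<m. cmod (C p q) \<le> R")
    case True
    have "cmod (iexp (x C) - iexp (y C)) \<le> (\<Sum>p<m. \<Sum>q<m. A * \<epsilon> * cmod (C p q))"
      using iexp_lipschitz diff by (rule order_trans)
    also have "\<dots> \<le> (\<Sum>p<m. \<Sum>q<m. A * \<epsilon> * R)"
      using True A0 e by (intro sum_mono mult_left_mono) auto
    also have "\<dots> = (real m)\<^sup>2 * (A * \<epsilon> * R)" by (simp add: power2_eq_square)
    finally show ?thesis by (simp add: sum_nonneg add_increasing2)
  next
    case False
    then obtain p q where pq: "p < m" "q < m" "R < cmod (C p q)" by (auto simp: not_le)
    have "1 = ?I p q C" using C pq by simp
    also have "\<dots> \<le> (\<Sum>q<m. ?I p q C)" using pq by (intro member_le_sum) auto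
    also have "\<dots> \<le> (\<Sum>p<m. \<Sum>q<m. ?I p q C)"
      using pq by (intro member_le_sum[where f = "\<lambda>p. \<Sum>q<m. ?I p q C"]) (auto intro: sum_nonneg)
    finally have "2 \<le> 2 * (\<Sum>p<m. \<Sum>q<m. ?I p q C)" by simp
    moreover have "0 \<le> (real m)\<^sup>2 * (A * \<epsilon> * R)" using A0 e R by simp
    ultimately show ?thesis using iexp_diff_le_2[of "x C" "y C"] by linarith
  qed
  have xm: "x \<in> borel_measurable M" unfolding x_def
    by (intro measurable_M borel_measurable_sum borel_measurable_times borel_measurable_const Re_qf_measurable)
  have ym: "y \<in> borel_measurable M" unfolding y_def
    by (intro borel_measurable_sum borel_measurable_times borel_measurable_const measurable_compose[OF em]) simp
  have xi: "integrable M (\<lambda>C. iexp (x C))" by (rule iexp_integrable[OF prob_space_axioms xm])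
  have yi: "integrable M (\<lambda>C. iexp (y C))" by (rule iexp_integrable[OF prob_space_axioms ym])
  have Ii: "integrable M (\<lambda>C. ?I p q C)" for p q
    by (rule integrable_real_indicator[OF Im]) (simp only: emeasure_eq_measure infinity_ennreal_def ennreal_less_top)
  have "(\<integral>C. iexp (\<Sum>j<m. a j / n * Re (qf n C (\<omega> j))) \<partial>M) = (\<integral>C. iexp (x C) \<partial>M)"
    unfolding x_def by (rule vreach_integral[OF T, symmetric])
  hence "cmod ((\<integral>C. iexp (\<Sum>j<m. a j / n * Re (qf n C (\<omega> j))) \<partial>M) - (\<integral>C. iexp (y C) \<partial>M)) = cmod (\<integral>C. iexp (x C) - iexp (y C) \<partial>M)"
    using xi yi by simp
  also have "\<dots> \<le> (\<integral>C. cmod (iexp (x C) - iexp (y C)) \<partial>M)" by (rule integral_norm_bound)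
  also have "\<dots> \<le> (\<integral>C. (real m)\<^sup>2 * (A * \<epsilon> * R) + 2 * (\<Sum>p<m. \<Sum>q<m. ?I p q C) \<partial>M)"
  proof (rule integral_mono)
    show "integrable M (\<lambda>C. cmod (iexp (x C) - iexp (y C)))"
      by (intro integrable_norm Bochner_Integration.integrable_diff xi yi)
    show "integrable M (\<lambda>C. (real m)\<^sup>2 * (A * \<epsilon> * R) + 2 * (\<Sum>p<m. \<Sum>q<m. ?I p q C))"
      by (intro Bochner_Integration.integrable_add integrable_mult_right Bochner_Integration.integrable_sum Ii) simp
  qed (rule pt)
  also have "\<dots> = (real m)\<^sup>2 * (A * \<epsilon> * R) + 2 * (\<Sum>p<m. \<Sum>q<m. prob {C \<in> space M. R < cmod (C p q)})"
  proof -
    have i2: "integrable M (\<lambda>C. 2 * (\<Sum>p<m. \<Sum>q<m. ?I p q C))"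
      by (intro integrable_mult_right Bochner_Integration.integrable_sum Ii)
    have "(\<integral>C. (real m)\<^sup>2 * (A * \<epsilon> * R) + 2 * (\<Sum>p<m. \<Sum>q<m. ?I p q C) \<partial>M) =
      (\<integral>C. (real m)\<^sup>2 * (A * \<epsilon> * R) \<partial>M) + (\<integral>C. 2 * (\<Sum>p<m. \<Sum>q<m. ?I p q C) \<partial>M)"
      by (rule Bochner_Integration.integral_add[OF integrable_const i2])
    also have "(\<integral>C. (real m)\<^sup>2 * (A * \<epsilon> * R) \<partial>M) = (real m)\<^sup>2 * (A * \<epsilon> * R)"
      unfolding lebesgue_integral_const prob_space by simp
    also have "(\<integral>C. 2 * (\<Sum>p<m. \<Sum>q<m. ?I p q C) \<partial>M) = 2 * (\<integral>C. (\<Sum>p<m. \<Sum>q<m. ?I p q C) \<partial>M)"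
      by (rule integral_mult_right_zero)
    also have "(\<integral>C. (\<Sum>p<m. \<Sum>q<m. ?I p q C) \<partial>M) = (\<Sum>p<m. \<integral>C. (\<Sum>q<m. ?I p q C) \<partial>M)"
      by (intro Bochner_Integration.integral_sum Bochner_Integration.integrable_sum Ii)
    also have "\<dots> = (\<Sum>p<m. \<Sum>q<m. \<integral>C. ?I p q C \<partial>M)"
      by (intro sum.cong Bochner_Integration.integral_sum Ii HOL.refl)
    also have "(\<Sum>p<m. \<Sum>q<m. \<integral>C. ?I p q C \<partial>M) = (\<Sum>p<m. \<Sum>q<m. prob {C \<in> space M. R < cmod (C p q)})"
    proof (intro sum.cong HOL.refl)
      fix p q
      have "{C \<in> space M. R < cmod (C p q)} \<inter> space M = {C \<in> space M. R < cmod (C p q)}" by blast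
      with Bochner_Integration.integral_indicator[of M "{C \<in> space M. R < cmod (C p q)}"]
      show "(\<integral>C. ?I p q C \<partial>M) = prob {C \<in> space M. R < cmod (C p q)}" by (simp only:)
    qed
    finally show ?thesis .
  qed
  finally show ?thesis unfolding y_def A_def .
qed

end

text \<open>Tightness is required only for entries with indices below \<open>m\<close>. In the
  converse direction the single entry \<open>C 0 0\<close> is all that is controlled at first, and
  \<open>m = 1\<close> can then be used.\<close>

theorem orbital_char_limit:
  fixes m :: nat
  assumes orb: "\<And>n. n \<ge> 1 \<Longrightarrow> orbital n (\<Omega> n) (M n) (B n)"
    and tight: "\<And>p q \<eta>. p < m \<Longrightarrow> q < m \<Longrightarrow> 0 < \<eta> \<Longrightarrow>
      \<exists>R. \<forall>\<^sub>F n in sequentially. measure (M n) {C \<in> space (M n). R < cmod (C p q)} \<le> \<eta>"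
  shows "(\<lambda>n. (\<integral>C. iexp (\<Sum>j<m. a j * Re (C j j)) \<partial>M n) - (\<Prod>j<m. char_mset (scaled_spec n (B n)) (a j))) \<longlonglongrightarrow> 0"
proof (rule LIMSEQ_I)
  fix \<eta> :: real assume \<eta>: "0 < \<eta>"
  \<comment> \<open>Error budget: the tails of the entries contribute
    \<open>2 * m\<^sup>2 * \<eta>' \<le> \<eta> / 4\<close>, the Lipschitz term
    \<open>\<eta> / 4\<close>, and frames far from orthonormal less than \<open>\<eta> / 2\<close>.
    The added 1 covers \<open>m = 0\<close>.\<close>
  define \<eta>' where "\<eta>' = \<eta> / (8 * ((real m)\<^sup>2 + 1))"
  have \<eta>': "0 < \<eta>'" using \<eta> by (simp add: \<eta>'_def add_nonneg_pos)
  have cancel: "y * (\<eta> / (c * y)) = \<eta> / c" if "0 < y" for y c :: real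
    using that by simp
  define A where "A = (\<Sum>j<m. \<bar>a j\<bar>)"
  have A0: "0 \<le> A" by (simp add: A_def sum_nonneg)
  define Q where "Q = (\<lambda>p q R. \<forall>\<^sub>F n in sequentially. measure (M n) {C \<in> space (M n). R < cmod (C p q)} \<le> \<eta>')"
  define R where "R = (\<lambda>p q. SOME R. Q p q R)"
  have R: "\<forall>\<^sub>F n in sequentially. measure (M n) {C \<in> space (M n). R p q < cmod (C p q)} \<le> \<eta>'" if "p < m" "q < m" for p q
  proof -
    have "\<exists>R. Q p q R" using tight[OF that \<eta>'] unfolding Q_def .
    hence "Q p q (R p q)" unfolding R_def by (rule someI_ex)
    thus ?thesis unfolding Q_def .
  qed
  define R0 where "R0 = (\<Sum>p<m. \<Sum>q<m. \<bar>R p q\<bar>)"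
  have R00: "0 \<le> R0" unfolding R0_def by (intro sum_nonneg) simp
  have RR0: "R p q \<le> R0" if "p < m" "q < m" for p q
  proof -
    have "R p q \<le> \<bar>R p q\<bar>" by simp
    also have "\<dots> \<le> (\<Sum>q<m. \<bar>R p q\<bar>)" using that by (intro member_le_sum) auto
    also have "\<dots> \<le> R0" unfolding R0_def
      using that by (intro member_le_sum[where f = "\<lambda>p. \<Sum>q<m. \<bar>R p q\<bar>"]) (auto intro: sum_nonneg)
    finally show ?thesis .
  qed
  have ev: "\<forall>\<^sub>F n in sequentially. measure (M n) {C \<in> space (M n). R0 < cmod (C p q)} \<le> \<eta>'" if pq: "p < m" "q < m" for p q
    using R[OF pq] eventually_ge_at_top[of 1]
  proof eventually_elim
    case (elim n)
    interpret orbital n "\<Omega> n" "M n" "B n" by (rule orb[OF elim(2)])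
    have em: "(\<lambda>C. C p q) \<in> borel_measurable (M n)" by (rule measurable_M[OF entry_measurable])
    have "{C \<in> space (M n). R p q < cmod (C p q)} \<in> sets (M n)" using em by measurable
    hence "measure (M n) {C \<in> space (M n). R0 < cmod (C p q)} \<le> measure (M n) {C \<in> space (M n). R p q < cmod (C p q)}"
      by (rule finite_measure_mono[rotated]) (use RR0[OF pq] in auto)
    thus ?case using elim(1) by linarith
  qed
  have "\<forall>\<^sub>F n in sequentially. \<forall>p\<in>{..<m}. \<forall>q\<in>{..<m}. measure (M n) {C \<in> space (M n). R0 < cmod (C p q)} \<le> \<eta>'"
    by (intro eventually_ball_finite finite_lessThan ballI ev) auto
  then obtain n0 where n0: "\<And>n p q. n \<ge> n0 \<Longrightarrow> p < m \<Longrightarrow> q < m \<Longrightarrow> measure (M n) {C \<in> space (M n). R0 < cmod (C p q)} \<le> \<eta>'"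
    unfolding eventually_sequentially by blast
  define \<epsilon> where "\<epsilon> = \<eta> / (4 * ((real m)\<^sup>2 * (A * R0) + 1))"
  have mAR: "0 \<le> (real m)\<^sup>2 * (A * R0)" using A0 R00 by simp
  have e: "0 < \<epsilon>" using \<eta> mAR by (simp add: \<epsilon>_def)
  have eb: "(real m)\<^sup>2 * (A * \<epsilon> * R0) \<le> \<eta> / 4"
  proof -
    have "((real m)\<^sup>2 * (A * R0) + 1) * \<epsilon> = \<eta> / 4"
      unfolding \<epsilon>_def by (rule cancel) (use mAR in linarith)
    moreover have "(real m)\<^sup>2 * (A * \<epsilon> * R0) \<le> ((real m)\<^sup>2 * (A * R0) + 1) * \<epsilon>" using e by (simp add: algebra_simps)
    ultimately show ?thesis by simp
  qed
  obtain \<delta> where \<delta>: "0 < \<delta>" and tri: "\<forall>S :: nat \<Rightarrow> nat \<Rightarrow> complex. (\<forall>j<m. \<forall>i>j. S j i = 0) \<longrightarrow>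
    (\<forall>j<m. \<forall>k<m. cmod ((\<Sum>p<m. cnj (S j p) * S k p) - (if j = k then 1 else 0)) \<le> \<delta>) \<longrightarrow>
    (\<forall>j<m. \<forall>p<m. \<forall>q<m. cmod (cnj (S j p) * S j q - (if p = j \<and> q = j then 1 else 0)) \<le> \<epsilon>)"
    using triangular_near_orthonormal[OF e, of m] by blast
  \<comment> \<open>When a Gram entry deviates by more than \<open>\<delta>\<close>,
    \<open>k\<close> times its square is at least 2, the trivial bound for the difference. The mean
    of the resulting correction is \<open>k * m\<^sup>2 / n\<close>.\<close>
  define k where "k = 2 / \<delta>\<^sup>2"
  have k0: "0 < k" using \<delta> by (simp add: k_def)
  obtain n1 :: nat where n1: "4 * (k * (real m)\<^sup>2) / \<eta> < n1" using reals_Archimedean2 by blast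
  have main: "norm ((\<integral>C. iexp (\<Sum>j<m. a j * Re (C j j)) \<partial>M n) - (\<Prod>j<m. char_mset (scaled_spec n (B n)) (a j)) - 0) < \<eta>"
    if n: "n \<ge> Suc (n0 + m + n1)" for n
  proof -
    have n': "1 \<le> n" "m \<le> n" "n0 \<le> n" "n1 \<le> n" "0 < n" using n by simp_all
    interpret orbital n "\<Omega> n" "M n" "B n" by (rule orb[OF n'(1)])
    interpret G: prob_space gmat by (rule prob_space_gmat)
    define \<phi> where "\<phi> = (\<integral>C. iexp (\<Sum>j<m. a j * Re (C j j)) \<partial>M n)"
    define J where "J = (\<lambda>\<omega>. \<integral>C. iexp (\<Sum>j<m. a j / n * Re (qf n C (\<omega> j))) \<partial>M n)"
    define \<Gamma> where "\<Gamma> = (\<lambda>(\<omega> :: nat \<Rightarrow> nat \<Rightarrow> complex) j k. (\<Sum>p<n. cnj (\<omega> j p) * \<omega> k p) / of_nat n - (if j = k then 1 else 0 :: complex))"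
    have gi: "integrable gmat (\<lambda>\<omega>. (cmod (\<Gamma> \<omega> j k))\<^sup>2)" "(\<integral>\<omega>. (cmod (\<Gamma> \<omega> j k))\<^sup>2 \<partial>gmat) = 1 / n" for j k
      unfolding \<Gamma>_def by (rule gmat_gram[OF n'(5)])+
    have n1b: "norm (integral\<^sup>L (M n) (\<lambda>C. iexp (f C))) \<le> 1" for f
    proof -
      have "norm (integral\<^sup>L (M n) (\<lambda>C. iexp (f C))) \<le> (\<integral>C. norm (iexp (f C)) \<partial>M n)" by (rule integral_norm_bound)
      also have "\<dots> = 1" unfolding norm_exp_i_times lebesgue_integral_const prob_space by simp
      finally show ?thesis .
    qed
    have two: "cmod (J \<omega> - \<phi>) \<le> 2" for \<omega>
    proof -
      have "cmod (J \<omega>) \<le> 1" unfolding J_def by (rule n1b)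
      moreover have "cmod \<phi> \<le> 1" unfolding \<phi>_def by (rule n1b)
      ultimately show ?thesis using norm_triangle_ineq4[of "J \<omega>" \<phi>] by linarith
    qed
    have pt: "cmod (J \<omega> - \<phi>) \<le> \<eta> / 2 + k * (\<Sum>i<m. \<Sum>j<m. (cmod (\<Gamma> \<omega> i j))\<^sup>2)" for \<omega>
    proof (cases "\<forall>i<m. \<forall>j<m. cmod (\<Gamma> \<omega> i j) \<le> \<delta>")
      case True
      have "cmod (J \<omega> - \<phi>) \<le> (real m)\<^sup>2 * ((\<Sum>j<m. \<bar>a j\<bar>) * \<epsilon> * R0) + 2 * (\<Sum>p<m. \<Sum>q<m. prob {C \<in> space (M n). R0 < cmod (C p q)})"
        unfolding J_def \<phi>_def
      proof (rule gaussian_slice_near[OF n'(2) R00 less_imp_le[OF e]])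
        show "cmod ((\<Sum>p<n. cnj (\<omega> j p) * \<omega> k p) / of_nat n - (if j = k then 1 else 0)) \<le> \<delta>" if "j < m" "k < m" for j k
          using True that unfolding \<Gamma>_def by blast
      qed (use tri in blast)
      also have "\<dots> \<le> \<eta> / 4 + 2 * (\<Sum>p<m. \<Sum>q<m. \<eta>')"
        using eb n0[OF n'(3)] by (intro add_mono mult_left_mono sum_mono) (auto simp: A_def)
      also have "2 * (\<Sum>p<m. \<Sum>q<m. \<eta>') = 2 * ((real m)\<^sup>2 * \<eta>')" by (simp add: power2_eq_square)
      also have "(real m)\<^sup>2 * \<eta>' \<le> \<eta> / 8"
      proof -
        have "((real m)\<^sup>2 + 1) * \<eta>' = \<eta> / 8"
          unfolding \<eta>'_def by (rule cancel) (simp add: add_nonneg_pos)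
        thus ?thesis using \<eta>' by (simp add: algebra_simps)
      qed
      finally have "cmod (J \<omega> - \<phi>) \<le> \<eta> / 2" by simp
      moreover have "0 \<le> k * (\<Sum>i<m. \<Sum>j<m. (cmod (\<Gamma> \<omega> i j))\<^sup>2)" using k0 by (simp add: sum_nonneg)
      ultimately show ?thesis by linarith
    next
      case False
      then obtain i j where ij: "i < m" "j < m" "\<delta> < cmod (\<Gamma> \<omega> i j)" by (auto simp: not_le)
      have "\<delta>\<^sup>2 \<le> (cmod (\<Gamma> \<omega> i j))\<^sup>2" using ij \<delta> by (intro power_mono) auto
      also have "\<dots> \<le> (\<Sum>j<m. (cmod (\<Gamma> \<omega> i j))\<^sup>2)"
        using ij by (intro member_le_sum[where f = "\<lambda>j. (cmod (\<Gamma> \<omega> i j))\<^sup>2"]) auto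
      also have "\<dots> \<le> (\<Sum>i<m. \<Sum>j<m. (cmod (\<Gamma> \<omega> i j))\<^sup>2)"
        using ij by (intro member_le_sum[where f = "\<lambda>i. \<Sum>j<m. (cmod (\<Gamma> \<omega> i j))\<^sup>2"]) (auto intro: sum_nonneg)
      finally have "k * \<delta>\<^sup>2 \<le> k * (\<Sum>i<m. \<Sum>j<m. (cmod (\<Gamma> \<omega> i j))\<^sup>2)" using k0 by (intro mult_left_mono) auto
      moreover have "k * \<delta>\<^sup>2 = 2" using \<delta> by (simp add: k_def)
      ultimately show ?thesis using two[of \<omega>] \<eta> by linarith
    qed
    have Jm: "J \<in> borel_measurable gmat" unfolding J_def by (rule gaussian_slice_measurable)
    have Ji: "integrable gmat J"
      by (rule G.integrable_const_bound[OF _ Jm, of 1]) (rule AE_I2, unfold J_def, rule n1b)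
    have Gi: "integrable gmat (\<lambda>\<omega>. k * (\<Sum>i<m. \<Sum>j<m. (cmod (\<Gamma> \<omega> i j))\<^sup>2))"
      by (intro integrable_mult_right Bochner_Integration.integrable_sum gi)
    have "(\<integral>\<omega>. J \<omega> \<partial>gmat) - \<phi> = (\<integral>\<omega>. J \<omega> - \<phi> \<partial>gmat)"
      using Ji by (subst Bochner_Integration.integral_diff) (simp_all add: G.prob_space[simplified])
    hence "cmod ((\<integral>\<omega>. J \<omega> \<partial>gmat) - \<phi>) \<le> (\<integral>\<omega>. cmod (J \<omega> - \<phi>) \<partial>gmat)" by simp
    also have "\<dots> \<le> (\<integral>\<omega>. \<eta> / 2 + k * (\<Sum>i<m. \<Sum>j<m. (cmod (\<Gamma> \<omega> i j))\<^sup>2) \<partial>gmat)"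
    proof (rule integral_mono)
      show "integrable gmat (\<lambda>\<omega>. cmod (J \<omega> - \<phi>))"
        by (intro integrable_norm Bochner_Integration.integrable_diff Ji) simp
      show "integrable gmat (\<lambda>\<omega>. \<eta> / 2 + k * (\<Sum>i<m. \<Sum>j<m. (cmod (\<Gamma> \<omega> i j))\<^sup>2))"
        by (intro Bochner_Integration.integrable_add Gi) simp
    qed (rule pt)
    also have "\<dots> = (\<integral>\<omega>. \<eta> / 2 \<partial>gmat) + (\<integral>\<omega>. k * (\<Sum>i<m. \<Sum>j<m. (cmod (\<Gamma> \<omega> i j))\<^sup>2) \<partial>gmat)"
      by (rule Bochner_Integration.integral_add[OF G.integrable_const Gi])
    also have "(\<integral>\<omega>. \<eta> / 2 \<partial>gmat) = \<eta> / 2" unfolding lebesgue_integral_const G.prob_space by simp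
    also have "(\<integral>\<omega>. k * (\<Sum>i<m. \<Sum>j<m. (cmod (\<Gamma> \<omega> i j))\<^sup>2) \<partial>gmat) = k * (\<integral>\<omega>. (\<Sum>i<m. \<Sum>j<m. (cmod (\<Gamma> \<omega> i j))\<^sup>2) \<partial>gmat)"
      by (rule integral_mult_right_zero)
    also have "(\<integral>\<omega>. (\<Sum>i<m. \<Sum>j<m. (cmod (\<Gamma> \<omega> i j))\<^sup>2) \<partial>gmat) = (\<Sum>i<m. \<integral>\<omega>. (\<Sum>j<m. (cmod (\<Gamma> \<omega> i j))\<^sup>2) \<partial>gmat)"
      by (intro Bochner_Integration.integral_sum Bochner_Integration.integrable_sum gi)
    also have "\<dots> = (\<Sum>i<m. \<Sum>j<m. 1 / real n)"
    proof (rule sum.cong[OF HOL.refl])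
      fix i
      have "(\<integral>\<omega>. (\<Sum>j<m. (cmod (\<Gamma> \<omega> i j))\<^sup>2) \<partial>gmat) = (\<Sum>j<m. \<integral>\<omega>. (cmod (\<Gamma> \<omega> i j))\<^sup>2 \<partial>gmat)"
        by (rule Bochner_Integration.integral_sum) (rule gi)
      thus "(\<integral>\<omega>. (\<Sum>j<m. (cmod (\<Gamma> \<omega> i j))\<^sup>2) \<partial>gmat) = (\<Sum>j<m. 1 / real n)" unfolding gi(2) .
    qed
    also have "\<eta> / 2 + k * (\<Sum>i<m. \<Sum>j<m. 1 / real n) = \<eta> / 2 + k * (real m)\<^sup>2 / n" by (simp add: power2_eq_square)
    also have "k * (real m)\<^sup>2 / n < \<eta> / 2"
    proof -
      have "4 * (k * (real m)\<^sup>2) / \<eta> < real n" using n1 n'(4) by linarith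
      hence "4 * (k * (real m)\<^sup>2) < real n * \<eta>" using \<eta> by (simp add: pos_divide_less_eq)
      moreover have "0 < real n * \<eta>" using \<eta> n'(5) by simp
      ultimately have "2 * (k * (real m)\<^sup>2) < real n * \<eta>" by linarith
      thus ?thesis using n'(5) by (simp add: pos_divide_less_eq mult.commute)
    qed
    finally have "cmod ((\<integral>\<omega>. J \<omega> \<partial>gmat) - \<phi>) < \<eta>" by simp
    moreover have "(\<integral>\<omega>. J \<omega> \<partial>gmat) = (\<Prod>j<m. char_mset (scaled_spec n (B n)) (a j))"
      unfolding J_def by (rule gaussian_average)
    ultimately show ?thesis unfolding \<phi>_def by (simp add: norm_minus_commute)
  qed
  thus "\<exists>no. \<forall>n\<ge>no. norm ((\<integral>C. iexp (\<Sum>j<m. a j * Re (C j j)) \<partial>M n) - (\<Prod>j<m. char_mset (scaled_spec n (B n)) (a j)) - 0) < \<eta>"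
    by blast
qed

section \<open>Second moments of the entries\<close>

context orbital
begin

text \<open>By unitary invariance a quadratic form in \<open>C\<close> has the law of \<open>C 0 0\<close> up to scaling.\<close>

lemma qf_second_moment:
  "(\<integral>\<^sup>+C. ennreal ((Re (qf n C v) - t * (\<Sum>p<n. (cmod (v p))\<^sup>2))\<^sup>2) \<partial>M) =
   ennreal ((\<Sum>p<n. (cmod (v p))\<^sup>2)\<^sup>2) * (\<integral>\<^sup>+C. ennreal ((Re (C 0 0) - t)\<^sup>2) \<partial>M)"
proof -
  have n0: "0 < n" using n by simp
  obtain u where u: "u \<in> unitary_grp n" and "\<And>i l. i < (0::nat) \<or> l < (0::nat) \<Longrightarrow> u i l = inf_id i l"
    and sym: "\<And>i l. cnj (u l i) = u i l" and ann: "\<And>i. 0 < i \<Longrightarrow> i < n \<Longrightarrow> (\<Sum>l<n. u i l * v l) = 0"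
    by (rule householder[OF n0, of v]) (rule that)
  have adj: "inf_adjoint u = u" by (auto simp: inf_adjoint_def sym)
  let ?w = "vec_act n u v"
  have w0: "?w i = 0" if "0 < i" "i < n" for i using ann[OF that] that by (simp add: vec_act_def)
  define s where "s = (\<Sum>p<n. (cmod (v p))\<^sup>2)"
  have nw: "(cmod (?w 0))\<^sup>2 = s"
  proof -
    have "complex_of_real s = (\<Sum>p<n. cnj (v p) * v p)"
      unfolding s_def of_real_sum complex_norm_square by (simp add: mult.commute)
    also have "\<dots> = (\<Sum>p<n. cnj (?w p) * ?w p)" by (rule vec_act_inner[OF u, symmetric])
    also have "\<dots> = (\<Sum>p\<in>{0}. cnj (?w p) * ?w p)"
      by (rule sum.mono_neutral_right) (use n0 w0 in auto)
    also have "\<dots> = complex_of_real ((cmod (?w 0))\<^sup>2)" unfolding complex_norm_square by (simp add: mult.commute)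
    finally show ?thesis unfolding of_real_eq_iff by simp
  qed
  have q: "qf n C ?w = of_real s * C 0 0" for C
  proof -
    have "qf n C ?w = (\<Sum>p\<in>{0}. \<Sum>q<n. cnj (?w p) * C p q * ?w q)"
      unfolding qf_def by (rule sum.mono_neutral_right) (use n0 w0 in auto)
    also have "\<dots> = (\<Sum>q<n. cnj (?w 0) * C 0 q * ?w q)" by simp
    also have "\<dots> = (\<Sum>q\<in>{0}. cnj (?w 0) * C 0 q * ?w q)"
      by (rule sum.mono_neutral_right) (use n0 w0 in auto)
    also have "\<dots> = of_real ((cmod (?w 0))\<^sup>2) * C 0 0" unfolding complex_norm_square by (simp add: mult_ac)
    finally show ?thesis unfolding nw .
  qed
  let ?f = "\<lambda>C. ennreal ((Re (qf n C v) - t * s)\<^sup>2)"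
  have fm: "?f \<in> borel_measurable borel"
    by (rule measurable_compose[OF Re_qf_measurable]) simp
  have cm: "(\<lambda>C. ennreal ((Re (C 0 0) - t)\<^sup>2)) \<in> borel_measurable M"
    by (rule measurable_M[OF measurable_compose[OF entry_measurable]]) simp
  have "(\<integral>\<^sup>+C. ?f C \<partial>M) = (\<integral>\<^sup>+C. ?f (conj_act u C) \<partial>M)" by (rule nn_integral_invariant[OF u fm, symmetric])
  also have "\<dots> = (\<integral>\<^sup>+C. ennreal (s\<^sup>2) * ennreal ((Re (C 0 0) - t)\<^sup>2) \<partial>M)"
  proof (rule nn_integral_cong)
    fix C
    have "(Re (qf n (conj_act u C) v) - t * s)\<^sup>2 = s\<^sup>2 * (Re (C 0 0) - t)\<^sup>2"
      unfolding qf_conj_act[OF u] adj q by (simp add: power2_eq_square algebra_simps)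
    thus "?f (conj_act u C) = ennreal (s\<^sup>2) * ennreal ((Re (C 0 0) - t)\<^sup>2)"
      by (simp add: ennreal_mult[symmetric])
  qed
  also have "\<dots> = ennreal (s\<^sup>2) * (\<integral>\<^sup>+C. ennreal ((Re (C 0 0) - t)\<^sup>2) \<partial>M)"
    by (rule nn_integral_cmult[OF cm])
  finally show ?thesis unfolding s_def .
qed

text \<open>The second moment identity for quadratic forms is averaged over a Gaussian
  \<open>v\<close>. On one side the mean fourth power of the norm is at least
  \<open>n\<^sup>2\<close>. On the other, for each matrix of the orbit, the Gaussian variance of the
  form is the trace of the square of its trace-free part, hence at most the trace of its square.
  Cancelling \<open>n\<^sup>2\<close> leaves the second power sum of the scaled spectrum.\<close>

lemma diagonal_variance:
  "(\<integral>\<^sup>+C. ennreal ((Re (C 0 0) - psum 1 (scaled_spec n B))\<^sup>2) \<partial>M) \<le> ennreal (psum 2 (scaled_spec n B))"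
proof -
  interpret G: prob_space gvec by (rule prob_space_gvec)
  interpret P: pair_prob_space M gvec ..
  define t where "t = psum 1 (scaled_spec n B)"
  define V where "V = (\<integral>\<^sup>+C. ennreal ((Re (C 0 0) - t)\<^sup>2) \<partial>M)"
  define s where "s = (\<lambda>g :: nat \<Rightarrow> complex. \<Sum>p<n. (cmod (g p))\<^sup>2)"
  let ?f = "\<lambda>C g. ennreal ((Re (qf n C g) - t * s g)\<^sup>2)"
  have n0: "real n > 0" using n by simp
  note sp = psum_scaled_trace[OF orbit_spec(1)[OF B]]
  have trB: "inf_trace B = of_real (n * t)" using sp(1) n0 by (simp add: t_def field_simps)
  have trB2: "inf_trace (inf_mult B B) = of_real ((real n)\<^sup>2 * psum 2 (scaled_spec n B))"
    using sp(2) n0 by (simp add: field_simps)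
  have inner: "(\<integral>\<^sup>+g. ?f C g \<partial>gvec) \<le> ennreal ((real n)\<^sup>2 * psum 2 (scaled_spec n B))" if C: "C \<in> \<Omega>" for C
  proof -
    \<comment> \<open>Every matrix of the orbit has trace \<open>n * t\<close>, so subtracting
      \<open>t\<close> on the diagonal removes the trace; the trace of the square drops by
      \<open>n * t\<^sup>2\<close>.\<close>
    define A where "A = (\<lambda>i j. C i j - (if i = j \<and> i < n then of_real t else 0))"
    have CH: "C \<in> herm n" by (rule orbit_spec(1)[OF C])
    have A: "A \<in> herm n"
      using CH herm_all_cnj[OF hermD(1)[OF CH]] unfolding herm_def by (auto simp: A_def intro!: herm_allI)
    have q: "Re (qf n A g) = Re (qf n C g) - t * s g" for g
    proof -
      have "(\<Sum>p<n. \<Sum>q<n. cnj (g p) * (if p = q \<and> p < n then of_real t else 0) * g q) = (\<Sum>p<n. \<Sum>q<n. if p = q then of_real t * of_real ((cmod (g p))\<^sup>2) else 0)"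
        by (intro sum.cong HOL.refl) (auto simp: complex_norm_square mult_ac simp del: of_real_power)
      also have "\<dots> = of_real (t * s g)" by (simp add: s_def sum_distrib_left)
      finally have "qf n A g = qf n C g - of_real (t * s g)"
        unfolding qf_def A_def right_diff_distrib left_diff_distrib sum_subtractf by simp
      thus ?thesis by simp
    qed
    have trC: "inf_trace C = (\<Sum>i<n. C i i)"
      by (rule inf_trace_eq_sum) (use hermD(2)[OF CH] in auto)
    have trA: "inf_trace A = 0"
    proof -
      have "inf_trace A = (\<Sum>i<n. A i i)" by (rule inf_trace_eq_sum) (use hermD(2)[OF A] in auto)
      also have "\<dots> = inf_trace C - of_real (n * t)" by (simp add: A_def sum_subtractf trC)
      finally show ?thesis using orbit_spec(3)[OF C] trB by simp
    qed
    have "inf_trace (inf_mult A A) = (\<Sum>i<n. \<Sum>k<n. C i k * C k i) - 2 * of_real t * (\<Sum>i<n. C i i) + of_real (n * t\<^sup>2)"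
    proof -
      have "inf_trace (inf_mult A A) = (\<Sum>i<n. \<Sum>k<n. A i k * A k i)" by (rule trace_pairing[OF A order_refl])
      also have "\<dots> = (\<Sum>i<n. \<Sum>k<n. C i k * C k i - (if i = k then 2 * of_real t * C i i - of_real (t\<^sup>2) else 0))"
        by (intro sum.cong HOL.refl) (auto simp: A_def algebra_simps power2_eq_square)
      also have "\<dots> = (\<Sum>i<n. \<Sum>k<n. C i k * C k i) - (\<Sum>i<n. 2 * of_real t * C i i - of_real (t\<^sup>2))"
        by (simp add: sum_subtractf)
      finally show ?thesis by (simp add: sum_subtractf sum_distrib_left)
    qed
    also have "(\<Sum>i<n. \<Sum>k<n. C i k * C k i) = inf_trace (inf_mult C C)" by (rule trace_pairing[OF CH order_refl, symmetric])
    also have "\<dots> = of_real ((real n)\<^sup>2 * psum 2 (scaled_spec n B))" using orbit_spec(4)[OF C] trB2 by simp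
    also have "(\<Sum>i<n. C i i) = of_real (n * t)" using trC orbit_spec(3)[OF C] trB by simp
    finally have "Re (inf_trace (inf_mult A A)) = (real n)\<^sup>2 * psum 2 (scaled_spec n B) - n * t\<^sup>2"
      by (simp add: power2_eq_square)
    hence "Re (inf_trace (inf_mult A A)) \<le> (real n)\<^sup>2 * psum 2 (scaled_spec n B)" by simp
    thus ?thesis using gvec_qf_variance[OF A trA] unfolding q by (simp add: ennreal_leI)
  qed
  have gm: "(\<lambda>g. g p) \<in> borel_measurable gvec" for p by (simp add: coordinate_measurable)
  have f: "(\<lambda>z. fst z p q) \<in> borel_measurable (M \<Otimes>\<^sub>M gvec)" for p q
    by (rule measurable_compose[OF measurable_fst measurable_M[OF entry_measurable]])
  have sm: "(\<lambda>z. snd z p) \<in> borel_measurable (M \<Otimes>\<^sub>M gvec)" for p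
    by (rule measurable_compose[OF measurable_snd gm])
  have "cnj \<in> borel_measurable borel" by (intro borel_measurable_continuous_onI continuous_intros)
  from measurable_compose[OF sm this] have c: "(\<lambda>z. cnj (snd z p)) \<in> borel_measurable (M \<Otimes>\<^sub>M gvec)" for p .
  have "(\<lambda>z. qf n (fst z) (snd z)) \<in> borel_measurable (M \<Otimes>\<^sub>M gvec)"
    unfolding qf_def by (intro borel_measurable_sum borel_measurable_times f sm c)
  hence r: "(\<lambda>z. Re (qf n (fst z) (snd z))) \<in> borel_measurable (M \<Otimes>\<^sub>M gvec)" by (rule measurable_compose) simp
  have "(\<lambda>z. cmod (snd z p)) \<in> borel_measurable (M \<Otimes>\<^sub>M gvec)" for p by (rule measurable_compose[OF sm]) simp
  hence "(\<lambda>z. s (snd z)) \<in> borel_measurable (M \<Otimes>\<^sub>M gvec)"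
    unfolding s_def by (intro borel_measurable_sum borel_measurable_power)
  hence "(\<lambda>z. (Re (qf n (fst z) (snd z)) - t * s (snd z))\<^sup>2) \<in> borel_measurable (M \<Otimes>\<^sub>M gvec)"
    by (intro borel_measurable_power borel_measurable_diff borel_measurable_times borel_measurable_const r)
  from measurable_compose[OF this measurable_ennreal] have fm: "case_prod ?f \<in> borel_measurable (M \<Otimes>\<^sub>M gvec)"
    by (simp only: case_prod_unfold)
  have s4m: "(\<lambda>g. ennreal ((s g)\<^sup>2)) \<in> borel_measurable gvec"
    unfolding s_def measurable_gvec
    by (intro measurable_compose[OF _ measurable_ennreal] borel_measurable_power borel_measurable_sum
        measurable_compose[OF coordinate_measurable borel_measurable_norm])
  have "ennreal ((real n)\<^sup>2) * V \<le> (\<integral>\<^sup>+g. ennreal ((s g)\<^sup>2) \<partial>gvec) * V"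
    using gvec_norm_fourth[of n] unfolding s_def by (rule mult_right_mono) simp
  also have "\<dots> = (\<integral>\<^sup>+g. ennreal ((s g)\<^sup>2) * V \<partial>gvec)" by (rule nn_integral_multc[OF s4m, symmetric])
  also have "\<dots> = (\<integral>\<^sup>+g. (\<integral>\<^sup>+C. ?f C g \<partial>M) \<partial>gvec)"
    unfolding s_def V_def qf_second_moment ..
  also have "\<dots> = (\<integral>\<^sup>+C. (\<integral>\<^sup>+g. ?f C g \<partial>gvec) \<partial>M)" by (rule P.Fubini'[OF fm])
  also have "\<dots> \<le> (\<integral>\<^sup>+C. ennreal ((real n)\<^sup>2 * psum 2 (scaled_spec n B)) \<partial>M)"
  proof (rule nn_integral_mono_AE)
    show "AE C in M. (\<integral>\<^sup>+g. ?f C g \<partial>gvec) \<le> ennreal ((real n)\<^sup>2 * psum 2 (scaled_spec n B))"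
      using AE_orbit by eventually_elim (rule inner)
  qed
  also have "\<dots> = ennreal ((real n)\<^sup>2) * ennreal (psum 2 (scaled_spec n B))"
    using emeasure_space_1 by (simp add: ennreal_mult')
  finally have "ennreal ((real n)\<^sup>2) * V \<le> ennreal ((real n)\<^sup>2) * ennreal (psum 2 (scaled_spec n B))" .
  hence "V \<le> ennreal (psum 2 (scaled_spec n B))"
    using n0 by (subst (asm) ennreal_mult_le_mult_iff) auto
  thus ?thesis unfolding V_def t_def .
qed

end

section \<open>Tightness and weak convergence\<close>

lemma psum_2_nonneg: "0 \<le> psum 2 \<sigma>"
  unfolding psum_def by (induction \<sigma>) auto

lemma qf_two:
  assumes "p < n" "q < n" "p \<noteq> q"
  shows "qf n C (\<lambda>i. if i = p then 1 else if i = q then z else 0) =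
    C p p + z * C p q + cnj z * C q p + cnj z * z * C q q"
proof -
  let ?v = "\<lambda>i. if i = p then 1 else if i = q then z else 0"
  have "qf n C ?v = (\<Sum>i\<in>{p, q}. \<Sum>j<n. cnj (?v i) * C i j * ?v j)"
    unfolding qf_def by (rule sum.mono_neutral_right) (use assms in auto)
  also have "\<dots> = (\<Sum>i\<in>{p, q}. \<Sum>j\<in>{p, q}. cnj (?v i) * C i j * ?v j)"
    by (rule sum.cong[OF HOL.refl], rule sum.mono_neutral_right) (use assms in auto)
  also have "\<dots> = C p p + z * C p q + cnj z * C q p + cnj z * z * C q q"
    using assms(3) by (simp add: algebra_simps)
  finally show ?thesis .
qed

lemma sum_norm_two:
  fixes p q n :: nat
  assumes "p < n" "q < n" "p \<noteq> q"
  shows "(\<Sum>i<n. (cmod (if i = p then 1 else if i = q then z else 0))\<^sup>2) = 1 + (cmod z)\<^sup>2"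
proof -
  have "(\<Sum>i<n. (cmod (if i = p then 1 else if i = q then z else 0))\<^sup>2) = (\<Sum>i\<in>{p, q}. (cmod (if i = p then 1 else if i = q then z else 0))\<^sup>2)"
    by (rule sum.mono_neutral_right) (use assms in auto)
  thus ?thesis using assms(3) by simp
qed

lemma square_combination_le: "(x - y - z)\<^sup>2 \<le> 3 * (x\<^sup>2 + y\<^sup>2 + z\<^sup>2)" for x y z :: real
proof -
  have "0 \<le> (x + y)\<^sup>2 + (x + z)\<^sup>2 + (y - z)\<^sup>2" by simp
  thus ?thesis by (simp add: power2_eq_square algebra_simps)
qed

lemma ennreal_combination:
  assumes "0 \<le> a" "0 \<le> b" "0 \<le> c" "0 \<le> d" "0 \<le> k"
  shows "ennreal (k * (a + (b + (2 * c + 2 * d)))) = ennreal k * (ennreal a + (ennreal b + (2 * ennreal c + 2 * ennreal d)))"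
proof -
  have "ennreal (k * (a + (b + (2 * c + 2 * d)))) = ennreal k * ennreal (a + (b + (2 * c + 2 * d)))"
    using assms by (intro ennreal_mult) auto
  also have "ennreal (a + (b + (2 * c + 2 * d))) = ennreal a + (ennreal b + (2 * ennreal c + 2 * ennreal d))"
    using assms by (simp add: ennreal_mult)
  finally show ?thesis .
qed

text \<open>Polarization: an off-diagonal entry is recovered from the forms in the vectors with
  entries 1 and \<open>z\<close>, for \<open>z = 1\<close> and \<open>z = \<i>\<close>, minus the
  diagonal forms. These vectors have squared norm 2, so their forms have second moment at most
  \<open>4 * c2\<close>, and \<open>3/4 * (4 + 4 + 2 + 2) = 9\<close>. The scaled trace
  \<open>t\<close> cancels off the diagonal and is present for diagonal entries.\<close>

lemma (in orbital) entry_second_moment: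
  assumes p: "p < n" and q: "q < n"
  shows "(\<integral>\<^sup>+C. ennreal ((cmod (C p q))\<^sup>2) \<partial>M) \<le>
    ennreal (9 * psum 2 (scaled_spec n B) + 2 * (psum 1 (scaled_spec n B))\<^sup>2)"
proof -
  define t where "t = psum 1 (scaled_spec n B)"
  define c2 where "c2 = psum 2 (scaled_spec n B)"
  have c20: "0 \<le> c2" unfolding c2_def by (rule psum_2_nonneg)
  define D where "D = (\<lambda>v C. Re (qf n C v) - t * (\<Sum>p<n. (cmod (v p))\<^sup>2))"
  have Dm: "(\<lambda>C. ennreal ((D v C)\<^sup>2)) \<in> borel_measurable M" for v
    unfolding D_def by (rule measurable_M[OF measurable_compose[OF Re_qf_measurable]]) simp
  have ID: "(\<integral>\<^sup>+C. ennreal ((D v C)\<^sup>2) \<partial>M) \<le> ennreal ((\<Sum>p<n. (cmod (v p))\<^sup>2)\<^sup>2 * c2)" for v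
  proof -
    have "(\<integral>\<^sup>+C. ennreal ((D v C)\<^sup>2) \<partial>M) \<le> ennreal ((\<Sum>p<n. (cmod (v p))\<^sup>2)\<^sup>2) * ennreal c2"
      unfolding D_def qf_second_moment c2_def using diagonal_variance
      by (intro mult_left_mono) (simp_all add: t_def)
    thus ?thesis using c20 by (simp add: ennreal_mult)
  qed
  let ?e = "\<lambda>p i. if i = p then 1 else 0 :: complex"
  have De: "D (?e p) C = Re (C p p) - t" if "p < n" for p C
  proof -
    have "qf n C (?e p) = (\<Sum>i\<in>{p}. \<Sum>j<n. cnj (?e p i) * C i j * ?e p j)"
      unfolding qf_def by (rule sum.mono_neutral_right) (use that in auto)
    also have "\<dots> = (\<Sum>i\<in>{p}. \<Sum>j\<in>{p}. cnj (?e p i) * C i j * ?e p j)"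
      by (rule sum.cong[OF HOL.refl], rule sum.mono_neutral_right) (use that in auto)
    also have "\<dots> = C p p" by simp
    finally have "qf n C (?e p) = C p p" .
    moreover have "(\<Sum>i<n. (cmod (?e p i))\<^sup>2) = (\<Sum>i\<in>{p}. (cmod (?e p i))\<^sup>2)"
      by (rule sum.mono_neutral_right) (use that in auto)
    ultimately show ?thesis by (simp add: D_def)
  qed
  have Ie: "(\<integral>\<^sup>+C. ennreal ((D (?e p) C)\<^sup>2) \<partial>M) \<le> ennreal c2" if "p < n" for p
  proof -
    have "(\<Sum>i<n. (cmod (?e p i))\<^sup>2) = (\<Sum>i\<in>{p}. (cmod (?e p i))\<^sup>2)"
      by (rule sum.mono_neutral_right) (use that in auto)
    thus ?thesis using ID[of "?e p"] by simp
  qed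
  have herm: "cnj (C i j) = C j i" if "C \<in> space M" for C i j
    using herm_all_cnj[OF hermD(1)] that unfolding space_M by blast
  have imD: "Im (C i i) = 0" if "C \<in> space M" for C i
    using herm[OF that, of i i] by (simp add: complex_eq_iff)
  show ?thesis
  proof (cases "p = q")
    case True
    have "(\<integral>\<^sup>+C. ennreal ((cmod (C p q))\<^sup>2) \<partial>M) \<le> (\<integral>\<^sup>+C. 2 * ennreal ((D (?e p) C)\<^sup>2) + ennreal (2 * t\<^sup>2) \<partial>M)"
    proof (rule nn_integral_mono)
      fix C assume C: "C \<in> space M"
      have "(cmod (C p q))\<^sup>2 = (Re (C p p))\<^sup>2" using imD[OF C, of p] True by (simp add: cmod_power2)
      also have "\<dots> \<le> 2 * (Re (C p p) - t)\<^sup>2 + 2 * t\<^sup>2"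
      proof -
        have "0 \<le> (Re (C p p) - 2 * t)\<^sup>2" by simp
        thus ?thesis by (simp add: power2_eq_square algebra_simps)
      qed
      finally have "(cmod (C p q))\<^sup>2 \<le> 2 * (D (?e p) C)\<^sup>2 + 2 * t\<^sup>2" unfolding De[OF p] .
      hence "ennreal ((cmod (C p q))\<^sup>2) \<le> ennreal (2 * (D (?e p) C)\<^sup>2 + 2 * t\<^sup>2)" by (rule ennreal_leI)
      also have "\<dots> = 2 * ennreal ((D (?e p) C)\<^sup>2) + ennreal (2 * t\<^sup>2)"
        by (simp add: ennreal_plus ennreal_mult del: ennreal_plus[symmetric])
      finally show "ennreal ((cmod (C p q))\<^sup>2) \<le> 2 * ennreal ((D (?e p) C)\<^sup>2) + ennreal (2 * t\<^sup>2)" .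
    qed
    also have "\<dots> = 2 * (\<integral>\<^sup>+C. ennreal ((D (?e p) C)\<^sup>2) \<partial>M) + ennreal (2 * t\<^sup>2)"
    proof -
      have m2: "(\<lambda>C. 2 * ennreal ((D (?e p) C)\<^sup>2)) \<in> borel_measurable M"
        using Dm[of "?e p"] by measurable
      show ?thesis
        by (simp only: nn_integral_add[OF m2 borel_measurable_const] nn_integral_cmult[OF Dm]
            nn_integral_const emeasure_space_1 mult_1_right)
    qed
    also have "\<dots> \<le> 2 * ennreal c2 + ennreal (2 * t\<^sup>2)"
      by (intro add_mono mult_left_mono Ie p) auto
    also have "\<dots> = ennreal (2 * c2 + 2 * t\<^sup>2)" using c20 by (simp add: ennreal_plus ennreal_mult)
    also have "\<dots> \<le> ennreal (9 * c2 + 2 * t\<^sup>2)" using c20 by (intro ennreal_leI) simp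
    finally show ?thesis unfolding c2_def t_def .
  next
    case False
    define v where "v = (\<lambda>z i. if i = p then 1 else if i = q then z else 0 :: complex)"
    have Iv: "(\<integral>\<^sup>+C. ennreal ((D (v z) C)\<^sup>2) \<partial>M) \<le> ennreal (4 * c2)" if "cmod z = 1" for z
      using ID[of "v z"] that unfolding v_def sum_norm_two[OF p q False] by simp
    have "(\<integral>\<^sup>+C. ennreal ((cmod (C p q))\<^sup>2) \<partial>M) \<le> (\<integral>\<^sup>+C. ennreal (3/4) * (ennreal ((D (v 1) C)\<^sup>2) + (ennreal ((D (v \<i>) C)\<^sup>2)
       + (2 * ennreal ((D (?e p) C)\<^sup>2) + 2 * ennreal ((D (?e q) C)\<^sup>2)))) \<partial>M)"
    proof (rule nn_integral_mono)
      fix C assume C: "C \<in> space M"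
      have qp: "C q p = cnj (C p q)" using herm[OF C, of p q] by simp
      have 1: "2 * Re (C p q) = D (v 1) C - D (?e p) C - D (?e q) C"
        unfolding De[OF p] De[OF q] unfolding D_def v_def qf_two[OF p q False] sum_norm_two[OF p q False] qp by simp
      have 2: "- 2 * Im (C p q) = D (v \<i>) C - D (?e p) C - D (?e q) C"
        unfolding De[OF p] De[OF q] unfolding D_def v_def qf_two[OF p q False] sum_norm_two[OF p q False] qp by simp
      have "4 * (cmod (C p q))\<^sup>2 = (2 * Re (C p q))\<^sup>2 + (- 2 * Im (C p q))\<^sup>2"
        by (simp add: cmod_power2 power_mult_distrib)
      also have "\<dots> \<le> 3 * ((D (v 1) C)\<^sup>2 + (D (?e p) C)\<^sup>2 + (D (?e q) C)\<^sup>2) + 3 * ((D (v \<i>) C)\<^sup>2 + (D (?e p) C)\<^sup>2 + (D (?e q) C)\<^sup>2)"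
        unfolding 1 2 by (intro add_mono square_combination_le)
      finally have "(cmod (C p q))\<^sup>2 \<le> 3/4 * ((D (v 1) C)\<^sup>2 + ((D (v \<i>) C)\<^sup>2 + (2 * (D (?e p) C)\<^sup>2 + 2 * (D (?e q) C)\<^sup>2)))" by simp
      hence "ennreal ((cmod (C p q))\<^sup>2) \<le> ennreal (3/4 * ((D (v 1) C)\<^sup>2 + ((D (v \<i>) C)\<^sup>2 + (2 * (D (?e p) C)\<^sup>2 + 2 * (D (?e q) C)\<^sup>2))))"
        by (rule ennreal_leI)
      also have "\<dots> = ennreal (3/4) * (ennreal ((D (v 1) C)\<^sup>2) + (ennreal ((D (v \<i>) C)\<^sup>2)
         + (2 * ennreal ((D (?e p) C)\<^sup>2) + 2 * ennreal ((D (?e q) C)\<^sup>2))))"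
        by (rule ennreal_combination) simp_all
      finally show "ennreal ((cmod (C p q))\<^sup>2) \<le> ennreal (3/4) * (ennreal ((D (v 1) C)\<^sup>2) + (ennreal ((D (v \<i>) C)\<^sup>2)
         + (2 * ennreal ((D (?e p) C)\<^sup>2) + 2 * ennreal ((D (?e q) C)\<^sup>2))))" .
    qed
    also have "\<dots> = ennreal (3/4) * ((\<integral>\<^sup>+C. ennreal ((D (v 1) C)\<^sup>2) \<partial>M) + ((\<integral>\<^sup>+C. ennreal ((D (v \<i>) C)\<^sup>2) \<partial>M)
       + (2 * (\<integral>\<^sup>+C. ennreal ((D (?e p) C)\<^sup>2) \<partial>M) + 2 * (\<integral>\<^sup>+C. ennreal ((D (?e q) C)\<^sup>2) \<partial>M))))"
    proof -
      have m2: "(\<lambda>C. 2 * ennreal ((D v C)\<^sup>2)) \<in> borel_measurable M" for v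
        using Dm[of v] by measurable
      have m3: "(\<lambda>C. 2 * ennreal ((D v C)\<^sup>2) + 2 * ennreal ((D w C)\<^sup>2)) \<in> borel_measurable M" for v w
        using m2[of v] m2[of w] by measurable
      have m4: "(\<lambda>C. ennreal ((D x C)\<^sup>2) + (2 * ennreal ((D v C)\<^sup>2) + 2 * ennreal ((D w C)\<^sup>2))) \<in> borel_measurable M" for v w x
        using Dm[of x] m3[of v w] by measurable
      have m5: "(\<lambda>C. ennreal ((D y C)\<^sup>2) + (ennreal ((D x C)\<^sup>2) + (2 * ennreal ((D v C)\<^sup>2) + 2 * ennreal ((D w C)\<^sup>2)))) \<in> borel_measurable M" for v w x y
        using Dm[of y] m4[of x v w] by measurable
      show ?thesis
        by (simp only: nn_integral_cmult[OF m5] nn_integral_add[OF Dm m4] nn_integral_add[OF Dm m3] nn_integral_add[OF m2 m2] nn_integral_cmult[OF Dm])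
    qed
    also have "\<dots> \<le> ennreal (3/4) * (ennreal (4 * c2) + (ennreal (4 * c2) + (2 * ennreal c2 + 2 * ennreal c2)))"
      by (intro add_mono mult_left_mono Iv Ie p q) auto
    also have "\<dots> = ennreal (3/4 * (4 * c2 + (4 * c2 + (2 * c2 + 2 * c2))))"
      by (rule ennreal_combination[symmetric]) (use c20 in simp_all)
    also have "\<dots> = ennreal (9 * c2)" by simp
    also have "\<dots> \<le> ennreal (9 * c2 + 2 * t\<^sup>2)" by (intro ennreal_leI) simp
    finally show ?thesis unfolding c2_def t_def .
  qed
qed

lemma (in prob_space) markov_second_moment:
  assumes f: "f \<in> borel_measurable M" and K: "(\<integral>\<^sup>+x. ennreal ((f x)\<^sup>2) \<partial>M) \<le> ennreal K" "0 \<le> K" and R: "0 < R"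
  shows "prob {x \<in> space M. R < f x} \<le> K / R\<^sup>2"
proof -
  let ?S = "{x \<in> space M. R < f x}"
  have S: "?S \<in> sets M" using f by measurable
  have "ennreal (R\<^sup>2) * emeasure M ?S = (\<integral>\<^sup>+x. ennreal (R\<^sup>2) * indicator ?S x \<partial>M)"
    by (rule nn_integral_cmult_indicator[OF S, symmetric])
  also have "\<dots> \<le> (\<integral>\<^sup>+x. ennreal ((f x)\<^sup>2) \<partial>M)"
    by (rule nn_integral_mono) (use R in \<open>auto simp: indicator_def intro!: ennreal_leI power_mono\<close>)
  also have "\<dots> \<le> ennreal K" by (rule K)
  finally have "ennreal (R\<^sup>2 * prob ?S) \<le> ennreal K" by (simp add: emeasure_eq_measure ennreal_mult)
  hence "R\<^sup>2 * prob ?S \<le> K" using K(2) by (subst (asm) ennreal_le_iff)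
  thus ?thesis using R by (simp add: pos_le_divide_eq mult.commute)
qed

lemma (in orbital) entry_tail:
  assumes K: "9 * psum 2 (scaled_spec n B) + 2 * (psum 1 (scaled_spec n B))\<^sup>2 \<le> K" "0 \<le> K" and R: "0 < R"
  shows "prob {C \<in> space M. R < cmod (C p q)} \<le> K / R\<^sup>2"
proof (cases "p < n \<and> q < n")
  case True
  show ?thesis
  proof (rule markov_second_moment[OF _ _ K(2) R])
    show "(\<lambda>C. cmod (C p q)) \<in> borel_measurable M"
      by (rule measurable_M[OF measurable_compose[OF entry_measurable borel_measurable_norm]])
    show "(\<integral>\<^sup>+C. ennreal ((cmod (C p q))\<^sup>2) \<partial>M) \<le> ennreal K"
      by (rule order_trans[OF entry_second_moment]) (use True K in \<open>auto intro: ennreal_leI\<close>)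
  qed
next
  case False
  have z: "C p q = 0" if "C \<in> space M" for C
    using False hermD(2,3)[of C n] that unfolding space_M by (auto simp: not_less)
  have "\<not> R < cmod (C p q)" if "C \<in> space M" for C using R z[OF that] by simp
  hence e: "{C \<in> space M. R < cmod (C p q)} = {}" by blast
  show ?thesis unfolding e using K R by simp
qed

section \<open>Measures on Hermitian matrices and their characteristic functions\<close>

definition mat_family :: "(infmat \<Rightarrow> real) set" where
  "mat_family = {l. \<exists>n c. l = (\<lambda>B. Re (\<Sum>p<n. \<Sum>q<n. c p q * B p q))}"

lemma mat_familyI: "(\<lambda>B. Re (\<Sum>p<n. \<Sum>q<n. c p q * B p q)) \<in> mat_family"
  unfolding mat_family_def by blast

lemma sum_truncate2:
  fixes n N :: nat
  assumes "n \<le> N"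
  shows "(\<Sum>p<N. \<Sum>q<N. (if p < n \<and> q < n then c p q else 0) * B p q) = (\<Sum>p<n. \<Sum>q<n. c p q * (B p q :: complex))"
proof -
  have "(\<Sum>p<N. \<Sum>q<N. (if p < n \<and> q < n then c p q else 0) * B p q) = (\<Sum>p<n. \<Sum>q<N. (if p < n \<and> q < n then c p q else 0) * B p q)"
    by (rule sum.mono_neutral_right) (use assms in auto)
  also have "\<dots> = (\<Sum>p<n. \<Sum>q<n. c p q * B p q)"
    by (rule sum.cong[OF HOL.refl], rule sum.mono_neutral_cong_right) (use assms in auto)
  finally show ?thesis .
qed

lemma separating_mat_family: "separating_family mat_family"
proof
  have c: "continuous_on UNIV (\<lambda>B :: infmat. B k l)" for k l
    by (rule continuous_on_product_then_coordinatewise[OF continuous_on_product_coordinates])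
  show "continuous_on UNIV l" if "l \<in> mat_family" for l
    using that unfolding mat_family_def by (auto intro!: continuous_intros c)
  show "(\<lambda>_. 0) \<in> mat_family" using mat_familyI[where n = 0] by simp
next
  fix l m assume "l \<in> mat_family" "m \<in> mat_family"
  then obtain n1 c1 n2 c2 where l: "l = (\<lambda>B. Re (\<Sum>p<n1. \<Sum>q<n1. c1 p q * B p q))"
    and m: "m = (\<lambda>B. Re (\<Sum>p<n2. \<Sum>q<n2. c2 p q * B p q))" unfolding mat_family_def by blast
  let ?N = "max n1 n2"
  let ?c = "\<lambda>p q. (if p < n1 \<and> q < n1 then c1 p q else 0) + (if p < n2 \<and> q < n2 then c2 p q else 0)"
  have "l B + m B = Re (\<Sum>p<?N. \<Sum>q<?N. ?c p q * B p q)" for B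
    unfolding l m distrib_right sum.distrib plus_complex.sel
    by (simp only: sum_truncate2[OF max.cobounded1] sum_truncate2[OF max.cobounded2])
  hence "(\<lambda>B. l B + m B) = (\<lambda>B. Re (\<Sum>p<?N. \<Sum>q<?N. ?c p q * B p q))" by (rule ext)
  thus "(\<lambda>B. l B + m B) \<in> mat_family" by (simp only: mat_familyI)
next
  fix l r assume "l \<in> mat_family"
  then obtain n c where l: "l = (\<lambda>B. Re (\<Sum>p<n. \<Sum>q<n. c p q * B p q))" unfolding mat_family_def by blast
  have "r * l B = Re (\<Sum>p<n. \<Sum>q<n. (of_real r * c p q) * B p q)" for B
  proof -
    have "(\<Sum>p<n. \<Sum>q<n. (of_real r * c p q) * B p q) = of_real r * (\<Sum>p<n. \<Sum>q<n. c p q * B p q)"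
      by (simp only: sum_distrib_left mult.assoc)
    moreover have "Re (of_real r * z) = r * Re z" for z by simp
    ultimately show ?thesis unfolding l by (simp only:)
  qed
  hence "(\<lambda>B. r * l B) = (\<lambda>B. Re (\<Sum>p<n. \<Sum>q<n. (of_real r * c p q) * B p q))" by (rule ext)
  thus "(\<lambda>B. r * l B) \<in> mat_family" by (simp only: mat_familyI)
next
  fix x y :: infmat assume "x \<noteq> y"
  then obtain i j where ij: "x i j \<noteq> y i j" by (auto simp: fun_eq_iff)
  have s: "(\<Sum>p<Suc (max i j). \<Sum>q<Suc (max i j). (if p = i \<and> q = j then c else 0) * B p q) = c * B i j" for c :: complex and B :: infmat
  proof -
    have "(\<Sum>p<Suc (max i j). \<Sum>q<Suc (max i j). (if p = i \<and> q = j then c else 0) * B p q) =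
      (\<Sum>p\<in>{i}. \<Sum>q<Suc (max i j). (if p = i \<and> q = j then c else 0) * B p q)"
      by (rule sum.mono_neutral_right) auto
    also have "\<dots> = (\<Sum>p\<in>{i}. \<Sum>q\<in>{j}. (if p = i \<and> q = j then c else 0) * B p q)"
      by (rule sum.cong[OF HOL.refl], rule sum.mono_neutral_right) auto
    finally show ?thesis by simp
  qed
  have "(\<lambda>B. Re (c * B i j)) \<in> mat_family" for c
    using mat_familyI[where n = "Suc (max i j)" and c = "\<lambda>p q. if p = i \<and> q = j then c else 0"] unfolding s .
  from this[of 1] this[of "- \<i>"] have "(\<lambda>B. Re (B i j)) \<in> mat_family" "(\<lambda>B. Im (B i j)) \<in> mat_family" by simp_all
  moreover have "Re (x i j) \<noteq> Re (y i j) \<or> Im (x i j) \<noteq> Im (y i j)" using ij by (auto simp: complex_eq_iff)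
  ultimately show "\<exists>l\<in>mat_family. l x \<noteq> l y" by (elim disjE) (rule bexI, assumption, assumption)+
qed

text \<open>On Hermitian matrices a real linear form sees only the Hermitian part of its coefficient
  matrix; the transpose of that part is \<open>A\<close>.\<close>

lemma mat_family_trace:
  assumes "l \<in> mat_family"
  obtains n A where "A \<in> herm n" "\<And>B. B \<in> herm_all \<Longrightarrow> complex_of_real (l B) = inf_trace (inf_mult A B)"
proof -
  obtain n c where l: "l = (\<lambda>B. Re (\<Sum>p<n. \<Sum>q<n. c p q * B p q))" using assms unfolding mat_family_def by blast
  define A where "A = (\<lambda>i k. if i < n \<and> k < n then (c k i + cnj (c i k)) / 2 else 0)"
  have A: "A \<in> herm n" unfolding herm_def by (auto simp: A_def intro!: herm_allI)
  have "complex_of_real (l B) = inf_trace (inf_mult A B)" if B: "B \<in> herm_all" for B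
  proof -
    let ?s = "\<Sum>p<n. \<Sum>q<n. c p q * B p q"
    have "inf_trace (inf_mult A B) = (\<Sum>i<n. \<Sum>k<n. (c k i * B k i) / 2 + (cnj (c i k) * B k i) / 2)"
      unfolding trace_pairing[OF A order_refl] by (intro sum.cong) (auto simp: A_def field_simps)
    also have "\<dots> = (\<Sum>i<n. \<Sum>k<n. c k i * B k i) / 2 + (\<Sum>i<n. \<Sum>k<n. cnj (c i k) * B k i) / 2"
      by (simp only: sum.distrib sum_divide_distrib)
    also have "(\<Sum>i<n. \<Sum>k<n. c k i * B k i) = ?s" by (rule sum.swap)
    also have "(\<Sum>i<n. \<Sum>k<n. cnj (c i k) * B k i) = cnj ?s" by (simp add: herm_all_cnj[OF B])
    also have "?s / 2 + cnj ?s / 2 = of_real (Re ?s)"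
    proof -
      have "z / 2 + cnj z / 2 = of_real (Re z)" for z :: complex by (simp add: complex_eq_iff)
      thus ?thesis .
    qed
    finally show ?thesis unfolding l by (rule HOL.sym)
  qed
  thus thesis using that[OF A] by blast
qed

lemma closed_herm_all: "closed herm_all"
proof -
  have c: "continuous_on UNIV (\<lambda>B :: infmat. B k l)" for k l
    by (rule continuous_on_product_then_coordinatewise[OF continuous_on_product_coordinates])
  have "herm_all = (\<Inter>i. \<Inter>j. {B. cnj (B i j) = B j i})"
    using herm_all_cnj herm_allI by auto
  moreover have "closed (\<Inter>i. \<Inter>j. {B :: infmat. cnj (B i j) = B j i})"
    by (intro closed_INT ballI closed_Collect_eq continuous_intros c)
  ultimately show ?thesis by (simp only:)
qed

lemma sets_borel_herm: "sets borel_herm = sets (restrict_space borel herm_all)" "space borel_herm = herm_all"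
  unfolding borel_herm_def by (auto simp: space_restrict_space)

lemma herm_setsD: "Y \<in> sets borel_herm \<Longrightarrow> Y \<in> sets borel"
  using closed_herm_all unfolding sets_borel_herm by (subst (asm) sets_restrict_space_iff) auto

lemma borel_herm_measurable: "f \<in> measurable borel N \<Longrightarrow> f \<in> measurable borel_herm N"
  unfolding borel_herm_def by (rule measurable_restrict_space1)

locale herm_prob =
  fixes N :: "infmat measure"
  assumes N: "borel_prob_on_H N"
begin

sublocale prob_space N using N unfolding borel_prob_on_H_def by simp

lemma sets_N: "sets N = sets borel_herm" and space_N: "space N = herm_all"
  using N unfolding borel_prob_on_H_def by auto

lemma measurable_N: "f \<in> measurable borel K \<Longrightarrow> f \<in> measurable N K"
  using borel_herm_measurable measurable_cong_sets[OF sets_N HOL.refl] by blast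

text \<open>The space of all infinite matrices is Polish and \<open>herm_all\<close> is closed in
  it. Pushing forward to the whole space makes the results for Polish spaces applicable without
  changing integrals.\<close>

definition ext :: "infmat measure" where "ext = distr N borel (\<lambda>B. B)"

lemma id_measurable: "(\<lambda>B. B) \<in> measurable N borel"
  by (rule measurable_N) simp

lemma ext_prob: "prob_space ext" unfolding ext_def by (rule prob_space_distr[OF id_measurable])

lemma ext_sets: "sets ext = sets borel" unfolding ext_def by simp

lemma ext_integral:
  fixes f :: "infmat \<Rightarrow> 'b::{banach,second_countable_topology}"
  shows "f \<in> borel_measurable borel \<Longrightarrow> (\<integral>B. f B \<partial>ext) = (\<integral>B. f B \<partial>N)"
  unfolding ext_def by (rule integral_distr[OF id_measurable])

lemma ext_emeasure: "Y \<in> sets N \<Longrightarrow> emeasure ext Y = emeasure N Y"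
  unfolding ext_def
  by (subst emeasure_distr[OF id_measurable])
    (auto simp: sets_N herm_setsD intro!: arg_cong[where f = "emeasure N"] dest: sets.sets_into_space)

lemma ext_measure: "Y \<in> sets borel \<Longrightarrow> measure ext Y = measure N (Y \<inter> herm_all)"
  unfolding ext_def by (subst measure_distr[OF id_measurable]) (auto simp: space_N Int_commute)

text \<open>The matrix \<open>A\<close> is extracted from \<open>l\<close> once and then serves
  every measure, so that a sequence of measures and its limit are compared at the same
  \<open>A\<close>.\<close>

lemma family_char:
  assumes l: "l \<in> mat_family"
  obtains n A where "A \<in> herm n" "(\<integral>B. iexp (l B) \<partial>ext) = char_fun N A"
    "\<And>N'. herm_prob N' \<Longrightarrow> (\<integral>B. iexp (l B) \<partial>herm_prob.ext N') = char_fun N' A"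
proof -
  obtain n A where A: "A \<in> herm n" "\<And>B. B \<in> herm_all \<Longrightarrow> complex_of_real (l B) = inf_trace (inf_mult A B)"
    by (rule mat_family_trace[OF l]) (rule that)
  have lm: "(\<lambda>B. iexp (l B)) \<in> borel_measurable borel"
    using separating_family.cont[OF separating_mat_family l]
    by (intro borel_measurable_continuous_onI continuous_intros)
  have *: "(\<integral>B. iexp (l B) \<partial>herm_prob.ext N') = char_fun N' A" if "herm_prob N'" for N'
  proof -
    interpret N': herm_prob N' by fact
    have "(\<integral>B. iexp (l B) \<partial>N'.ext) = (\<integral>B. iexp (l B) \<partial>N')" by (rule N'.ext_integral[OF lm])
    also have "\<dots> = char_fun N' A" unfolding char_fun_def
      by (rule Bochner_Integration.integral_cong[OF HOL.refl]) (simp only: N'.space_N A(2))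
    finally show ?thesis .
  qed
  show thesis by (rule that[OF A(1) *[OF herm_prob_axioms] *])
qed

end

text \<open>The trace forms are the real linear forms in finitely many entries, and these separate
  matrices.\<close>

lemma herm_measure_eqI:
  assumes M: "borel_prob_on_H M" and N: "borel_prob_on_H N"
    and ch: "\<And>n A. A \<in> herm n \<Longrightarrow> char_fun M A = char_fun N A"
  shows "M = N"
proof -
  interpret M: herm_prob M by unfold_locales fact
  interpret N: herm_prob N by unfold_locales fact
  have "M.ext = N.ext"
  proof (rule measure_eq_of_char[OF separating_mat_family M.ext_prob M.ext_sets N.ext_prob N.ext_sets])
    fix l assume l: "l \<in> mat_family"
    obtain n A where "A \<in> herm n" "(\<integral>B. iexp (l B) \<partial>M.ext) = char_fun M A"
      "\<And>N'. herm_prob N' \<Longrightarrow> (\<integral>B. iexp (l B) \<partial>herm_prob.ext N') = char_fun N' A"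
      by (rule M.family_char[OF l]) (rule that)
    thus "(\<integral>B. iexp (l B) \<partial>M.ext) = (\<integral>B. iexp (l B) \<partial>N.ext)" using ch N.herm_prob_axioms by simp
  qed
  thus "M = N"
    by (intro measure_eqI) (simp_all only: M.sets_N N.sets_N M.ext_emeasure[symmetric] N.ext_emeasure[symmetric])
qed

lemma compact_PiE_UNIV:
  fixes S :: "'i \<Rightarrow> 'b::topological_space set"
  assumes "\<And>i. compact (S i)"
  shows "compact (PiE UNIV S)"
proof -
  have "compactin (product_topology (\<lambda>_. euclidean) UNIV) (PiE UNIV S)"
    unfolding compactin_PiE using assms by simp
  thus ?thesis unfolding euclidean_product_topology by simp
qed

lemma compact_entry_bounded: "compact {B :: infmat. \<forall>p q. cmod (B p q) \<le> R p q}"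
proof -
  have "{B :: infmat. \<forall>p q. cmod (B p q) \<le> R p q} = PiE UNIV (\<lambda>p. PiE UNIV (\<lambda>q. cball 0 (R p q)))"
    by (auto simp: PiE_iff)
  thus ?thesis by (simp add: compact_PiE_UNIV)
qed

text \<open>Tails of single entries, weighted geometrically along an enumeration of the index pairs,
  add up to at most \<open>\<epsilon>\<close>. Boxes are compact as products of discs, so tightness
  of each entry yields tightness on the whole space.\<close>

lemma (in herm_prob) tight_box:
  assumes t: "\<And>p q. measure N {B \<in> space N. R p q < cmod (B p q)} \<le> \<epsilon> * (1/2) ^ Suc (prod_encode (p, q))"
    and e: "0 < \<epsilon>"
  shows "measure ext {B. \<forall>p q. cmod (B p q) \<le> R p q} \<ge> 1 - \<epsilon>"
proof -
  interpret E: prob_space ext by (rule ext_prob)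
  let ?K = "{B :: infmat. \<forall>p q. cmod (B p q) \<le> R p q}"
  define S where "S = (\<lambda>k. {B \<in> space N. R (fst (prod_decode k)) (snd (prod_decode k)) < cmod (B (fst (prod_decode k)) (snd (prod_decode k)))})"
  have Sm: "S k \<in> sets N" for k
  proof -
    have "(\<lambda>B. B (fst (prod_decode k)) (snd (prod_decode k))) \<in> borel_measurable N" by (rule measurable_N[OF entry_measurable])
    thus ?thesis unfolding S_def by measurable
  qed
  have Sb: "measure N (S k) \<le> \<epsilon> * (1/2) ^ Suc k" for k
    using t[of "fst (prod_decode k)" "snd (prod_decode k)"] unfolding S_def by simp
  have g: "(\<lambda>k. \<epsilon> * (1/2) ^ Suc k) sums (\<epsilon> * 1)" by (intro sums_mult power_half_series)
  have sm: "summable (\<lambda>k. measure N (S k))"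
    by (rule summable_comparison_test'[OF sums_summable[OF g], of 0]) (use Sb in simp)
  have "measure N (\<Union>k. S k) \<le> (\<Sum>k. measure N (S k))"
    by (rule finite_measure_subadditive_countably[OF _ sm]) (use Sm in auto)
  also have "\<dots> \<le> (\<Sum>k. \<epsilon> * (1/2) ^ Suc k)" by (rule suminf_le[OF Sb sm sums_summable[OF g]])
  also have "\<dots> = \<epsilon>" using sums_unique[OF g] by simp
  finally have u: "measure N (\<Union>k. S k) \<le> \<epsilon>" .
  have Km: "?K \<in> sets borel" using compact_imp_closed[OF compact_entry_bounded] by (rule borel_closed)
  have eq: "?K \<inter> herm_all = space N - (\<Union>k. S k)"
  proof (rule Set.equalityI)
    show "?K \<inter> herm_all \<subseteq> space N - (\<Union>k. S k)"
    proof
      fix B assume B: "B \<in> ?K \<inter> herm_all"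
      have "B \<notin> S k" for k
      proof -
        have "cmod (B (fst (prod_decode k)) (snd (prod_decode k))) \<le> R (fst (prod_decode k)) (snd (prod_decode k))"
          using B by blast
        thus ?thesis unfolding S_def mem_Collect_eq by linarith
      qed
      thus "B \<in> space N - (\<Union>k. S k)" using B unfolding space_N by blast
    qed
    show "space N - (\<Union>k. S k) \<subseteq> ?K \<inter> herm_all"
    proof
      fix B assume B: "B \<in> space N - (\<Union>k. S k)"
      have "cmod (B p q) \<le> R p q" for p q
      proof -
        have "B \<notin> S (prod_encode (p, q))" using B by blast
        thus ?thesis using B unfolding S_def by (simp add: not_less)
      qed
      thus "B \<in> ?K \<inter> herm_all" using B by (simp add: space_N)
    qed
  qed
  have "measure ext ?K = measure N (space N - (\<Union>k. S k))" unfolding ext_measure[OF Km] eq ..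
  also have "\<dots> = 1 - measure N (\<Union>k. S k)" by (rule prob_compl) (use Sm in auto)
  finally show ?thesis using u by simp
qed

lemma weakly_converges_of_char:
  assumes Ms: "\<And>n. n \<ge> 1 \<Longrightarrow> borel_prob_on_H (Ms n)" and N: "borel_prob_on_H N"
    and ch: "\<And>m A. A \<in> herm m \<Longrightarrow> (\<lambda>n. char_fun (Ms n) A) \<longlonglongrightarrow> char_fun N A"
    and tight: "\<And>p q \<epsilon>. 0 < \<epsilon> \<Longrightarrow> \<exists>R. \<forall>n\<ge>1. measure (Ms n) {B \<in> space (Ms n). R < cmod (B p q)} \<le> \<epsilon>"
  shows "weakly_converges Ms N"
  unfolding weakly_converges_def
proof (intro allI impI)
  fix \<psi> :: "infmat \<Rightarrow> real" assume \<psi>: "continuous_on herm_all \<psi> \<and> bounded (\<psi> ` herm_all)"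
  interpret N: herm_prob N by unfold_locales fact
  \<comment> \<open>Nothing is assumed about index 0, so the sequence is shifted by one.\<close>
  have Mn: "herm_prob (Ms (Suc n))" for n by unfold_locales (rule Ms, simp)
  \<comment> \<open>A continuous retraction onto \<open>herm_all\<close>: composing with it extends
    \<open>\<psi>\<close> to a bounded continuous function on all matrices.\<close>
  define sym where "sym = (\<lambda>(B :: infmat) i j. (B i j + cnj (B j i)) / 2)"
  have sH: "sym B \<in> herm_all" for B by (rule herm_allI) (simp add: sym_def add.commute)
  have sid: "sym B = B" if "B \<in> herm_all" for B using herm_all_cnj[OF that] by (simp add: sym_def)
  have c: "continuous_on UNIV (\<lambda>B :: infmat. B k l)" for k l
    by (rule continuous_on_product_then_coordinatewise[OF continuous_on_product_coordinates])
  have sc: "continuous_on UNIV sym" unfolding sym_def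
    by (intro continuous_on_coordinatewise_then_product continuous_intros c) simp
  have pc: "continuous_on UNIV (\<lambda>B. \<psi> (sym B))"
    by (rule continuous_on_compose2[OF conjunct1[OF \<psi>] sc]) (use sH in auto)
  obtain C where C: "\<And>B. B \<in> herm_all \<Longrightarrow> \<bar>\<psi> B\<bar> \<le> C" using \<psi> unfolding bounded_iff by auto
  have pm: "(\<lambda>B. \<psi> (sym B)) \<in> borel_measurable borel" by (rule borel_measurable_continuous_onI[OF pc])
  have red: "(\<integral>B. \<psi> (sym B) \<partial>herm_prob.ext N') = (\<integral>B. \<psi> B \<partial>N')" if "herm_prob N'" for N'
  proof -
    interpret N': herm_prob N' by fact
    have "(\<integral>B. \<psi> (sym B) \<partial>N'.ext) = (\<integral>B. \<psi> (sym B) \<partial>N')" by (rule N'.ext_integral[OF pm])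
    also have "\<dots> = (\<integral>B. \<psi> B \<partial>N')"
      by (rule Bochner_Integration.integral_cong[OF HOL.refl]) (simp only: N'.space_N sid)
    finally show ?thesis .
  qed
  interpret F: separating_family mat_family by (rule separating_mat_family)
  have "(\<lambda>n. \<integral>B. \<psi> (sym B) \<partial>herm_prob.ext (Ms (Suc n))) \<longlonglongrightarrow> (\<integral>B. \<psi> (sym B) \<partial>N.ext)"
  proof (rule F.weak_convergence_of_char[OF _ _ N.ext_prob N.ext_sets _ _ pc C[OF sH]])
    show "prob_space (herm_prob.ext (Ms (Suc n)))" for n by (rule herm_prob.ext_prob[OF Mn])
    show "sets (herm_prob.ext (Ms (Suc n))) = sets borel" for n by (rule herm_prob.ext_sets[OF Mn])
    show "(\<lambda>n. \<integral>x. iexp (l x) \<partial>herm_prob.ext (Ms (Suc n))) \<longlonglongrightarrow> (\<integral>x. iexp (l x) \<partial>N.ext)" if l: "l \<in> mat_family" for l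
    proof -
      obtain m A where A: "A \<in> herm m" "(\<integral>B. iexp (l B) \<partial>N.ext) = char_fun N A"
        "\<And>N'. herm_prob N' \<Longrightarrow> (\<integral>B. iexp (l B) \<partial>herm_prob.ext N') = char_fun N' A"
        by (rule N.family_char[OF l]) (rule that)
      show ?thesis unfolding A(2) A(3)[OF Mn] by (rule LIMSEQ_Suc[OF ch[OF A(1)]])
    qed
    fix \<epsilon> :: real assume e: "0 < \<epsilon>"
    define R where "R = (\<lambda>p q. SOME R. \<forall>n\<ge>1. measure (Ms n) {B \<in> space (Ms n). R < cmod (B p q)} \<le> \<epsilon> * (1/2) ^ Suc (prod_encode (p, q)))"
    have R: "\<forall>n\<ge>1. measure (Ms n) {B \<in> space (Ms n). R p q < cmod (B p q)} \<le> \<epsilon> * (1/2) ^ Suc (prod_encode (p, q))" for p q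
      unfolding R_def by (rule someI_ex, rule tight) (use e in simp)
    let ?K = "{B :: infmat. \<forall>p q. cmod (B p q) \<le> R p q}"
    have K1: "measure (herm_prob.ext (Ms (Suc n))) ?K \<ge> 1 - \<epsilon>" for n
      by (rule herm_prob.tight_box[OF Mn _ e]) (use R in auto)
    obtain K2 where K2: "compact K2" "measure N.ext K2 \<ge> 1 - \<epsilon>" by (rule prob_tight[OF N.ext_prob N.ext_sets e]) (rule that)
    have KK2: "?K \<in> sets borel" by (rule borel_closed[OF compact_imp_closed[OF compact_entry_bounded]])
    have KK3: "K2 \<in> sets borel" by (rule borel_closed[OF compact_imp_closed[OF K2(1)]])
    have KK1: "?K \<union> K2 \<in> sets borel" by (rule sets.Un[OF KK2 KK3])
    have mono: "measure Q X \<le> measure Q (?K \<union> K2)" if Q: "prob_space Q" "sets Q = sets borel" and X: "X = ?K \<or> X = K2" for Q X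
    proof -
      interpret Q: prob_space Q by fact
      show ?thesis by (rule Q.finite_measure_mono) (use X in blast, simp only: Q(2) KK1)
    qed
    have "1 - \<epsilon> \<le> measure (herm_prob.ext (Ms (Suc n))) (?K \<union> K2)" for n
      by (rule order_trans[OF K1 mono[OF herm_prob.ext_prob[OF Mn] herm_prob.ext_sets[OF Mn] disjI1[OF HOL.refl]]])
    moreover have "1 - \<epsilon> \<le> measure N.ext (?K \<union> K2)"
      by (rule order_trans[OF K2(2) mono[OF N.ext_prob N.ext_sets disjI2[OF HOL.refl]]])
    moreover have "compact (?K \<union> K2)" by (rule compact_Un[OF compact_entry_bounded K2(1)])
    ultimately show "\<exists>K. compact K \<and> (\<forall>n. measure (herm_prob.ext (Ms (Suc n))) K \<ge> 1 - \<epsilon>) \<and> measure N.ext K \<ge> 1 - \<epsilon>"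
      by (intro exI[of _ "?K \<union> K2"] conjI allI)
  qed
  hence "(\<lambda>n. \<integral>B. \<psi> B \<partial>Ms (Suc n)) \<longlonglongrightarrow> (\<integral>B. \<psi> B \<partial>N)"
    unfolding red[OF Mn] red[OF N.herm_prob_axioms] .
  thus "(\<lambda>n. \<integral>B. \<psi> B \<partial>Ms n) \<longlonglongrightarrow> (\<integral>B. \<psi> B \<partial>N)" by (rule LIMSEQ_imp_Suc)
qed

section \<open>Realization of the limit measure\<close>

text \<open>Closed under products, since independent summands multiply characteristic functions.
  This allows the limit law to be built factor by factor from explicit random matrices.\<close>

definition realizable :: "(real \<Rightarrow> complex) \<Rightarrow> bool" where
  "realizable f \<longleftrightarrow> (\<exists>N. borel_prob_on_H N \<and>
     (\<forall>n. \<forall>A\<in>herm n. char_fun N A = (\<Prod>a\<in>#spec_mset n A. f a)))"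

lemma entrywise_measurable:
  fixes W :: "'a \<Rightarrow> infmat"
  assumes "\<And>p q. (\<lambda>x. W x p q) \<in> borel_measurable P"
  shows "W \<in> borel_measurable P"
  by (intro measurable_coordinatewise_then_product assms)

lemma herm_measurable:
  assumes "\<And>p q. (\<lambda>x. W x p q) \<in> borel_measurable P" "\<And>x. x \<in> space P \<Longrightarrow> W x \<in> herm_all"
  shows "W \<in> measurable P borel_herm"
  unfolding borel_herm_def
proof (rule measurable_restrict_space2)
  show "W \<in> space P \<rightarrow> herm_all" by (rule Pi_I) (rule assms(2))
  show "W \<in> borel_measurable P" by (rule entrywise_measurable) (rule assms(1))
qed

lemma trace_pairing_measurable:
  assumes A: "A \<in> herm n"
  shows "(\<lambda>B. inf_trace (inf_mult A B)) \<in> borel_measurable borel"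
  unfolding trace_pairing[OF A order_refl]
  by (intro borel_measurable_sum borel_measurable_times borel_measurable_const entry_measurable)

lemma trace_exp_measurable:
  assumes A: "A \<in> herm n"
  shows "(\<lambda>B. exp (\<i> * inf_trace (inf_mult A B))) \<in> borel_measurable borel"
proof -
  have "(\<lambda>z. exp (\<i> * z)) \<in> borel_measurable borel" by (intro borel_measurable_continuous_onI continuous_intros)
  from measurable_compose[OF trace_pairing_measurable[OF A] this] show ?thesis .
qed

lemma distr_herm:
  assumes P: "prob_space P" and W: "\<And>p q. (\<lambda>x. W x p q) \<in> borel_measurable P" "\<And>x. x \<in> space P \<Longrightarrow> W x \<in> herm_all"
  shows "borel_prob_on_H (distr P borel_herm W)"
    "A \<in> herm n \<Longrightarrow> char_fun (distr P borel_herm W) A = (\<integral>x. exp (\<i> * inf_trace (inf_mult A (W x))) \<partial>P)"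
proof -
  note m = herm_measurable[of W P, OF W]
  show "borel_prob_on_H (distr P borel_herm W)"
    unfolding borel_prob_on_H_def using prob_space.prob_space_distr[OF P m] by (simp add: sets_borel_herm(2))
  assume A: "A \<in> herm n"
  show "char_fun (distr P borel_herm W) A = (\<integral>x. exp (\<i> * inf_trace (inf_mult A (W x))) \<partial>P)"
    unfolding char_fun_def
    by (rule integral_distr[OF m borel_herm_measurable[OF trace_exp_measurable[OF A]]])
qed

lemma trace_pairing_real:
  assumes A: "A \<in> herm n" and B: "B \<in> herm_all"
  shows "inf_trace (inf_mult A B) = of_real (Re (inf_trace (inf_mult A B)))"
proof -
  have "cnj (inf_trace (inf_mult A B)) = (\<Sum>i<n. \<Sum>k<n. A k i * B i k)"
    unfolding trace_pairing[OF A order_refl] by (simp add: herm_all_cnj[OF B] herm_all_cnj[OF hermD(1)[OF A]])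
  also have "\<dots> = inf_trace (inf_mult A B)"
    unfolding trace_pairing[OF A order_refl] by (rule sum.swap)
  finally show ?thesis by (metis Reals_cnj_iff of_real_Re)
qed

lemma (in herm_prob) trace_exp_integrable:
  assumes A: "A \<in> herm n"
  shows "integrable N (\<lambda>B. exp (\<i> * inf_trace (inf_mult A B)))"
proof (rule integrable_const_bound[of _ 1])
  show "(\<lambda>B. exp (\<i> * inf_trace (inf_mult A B))) \<in> borel_measurable N"
    by (rule measurable_N[OF trace_exp_measurable[OF A]])
  show "AE B in N. norm (exp (\<i> * inf_trace (inf_mult A B))) \<le> 1"
  proof (rule AE_I2)
    fix B assume "B \<in> space N"
    hence B: "B \<in> herm_all" by (simp only: space_N)
    show "norm (exp (\<i> * inf_trace (inf_mult A B))) \<le> 1"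
      by (subst trace_pairing_real[OF A B], unfold norm_exp_i_times, rule order_refl)
  qed
qed

lemma trace_pairing_add:
  assumes A: "A \<in> herm n"
  shows "inf_trace (inf_mult A (\<lambda>i j. X i j + Y i j)) = inf_trace (inf_mult A X) + inf_trace (inf_mult A Y)"
  unfolding trace_pairing[OF A order_refl] by (simp add: distrib_left sum.distrib)

text \<open>The witness is the law of the sum of two independent matrices.\<close>

lemma realizable_mult:
  assumes f: "realizable f" and g: "realizable g"
  shows "realizable (\<lambda>a. f a * g a)"
proof -
  obtain M where M: "borel_prob_on_H M" "\<And>n A. A \<in> herm n \<Longrightarrow> char_fun M A = (\<Prod>a\<in>#spec_mset n A. f a)"
    using f unfolding realizable_def by blast
  obtain N where N: "borel_prob_on_H N" "\<And>n A. A \<in> herm n \<Longrightarrow> char_fun N A = (\<Prod>a\<in>#spec_mset n A. g a)"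
    using g unfolding realizable_def by blast
  interpret M: herm_prob M by unfold_locales (rule M)
  interpret N: herm_prob N by unfold_locales (rule N)
  interpret P: pair_prob_space M N ..
  \<comment> \<open>the Hermitian part only serves to make the sum Hermitian off the support\<close>
  define h where "h = (\<lambda>(B :: infmat) i j. (B i j + cnj (B j i)) / 2)"
  have hid: "h B = B" if "B \<in> herm_all" for B using herm_all_cnj[OF that] by (simp add: h_def)
  define W where "W = (\<lambda>z i j. h (fst z) i j + h (snd z) i j)"
  have WH: "W z \<in> herm_all" for z by (rule herm_allI) (simp add: W_def h_def add_ac)
  have cm: "cnj \<in> borel_measurable borel" by (intro borel_measurable_continuous_onI continuous_intros)
  have hm: "(\<lambda>B. h B i j) \<in> borel_measurable borel" for i j
    unfolding h_def by (intro borel_measurable_divide borel_measurable_add entry_measurable measurable_compose[OF entry_measurable cm] borel_measurable_const)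
  have Wm: "(\<lambda>z. W z i j) \<in> borel_measurable (M \<Otimes>\<^sub>M N)" for i j
    unfolding W_def by (intro borel_measurable_add measurable_compose[OF measurable_fst M.measurable_N[OF hm]]
        measurable_compose[OF measurable_snd N.measurable_N[OF hm]])
  note d = distr_herm[where W = W, OF P.prob_space_axioms Wm WH]
  have "char_fun (distr (M \<Otimes>\<^sub>M N) borel_herm W) A = (\<Prod>a\<in>#spec_mset n A. f a * g a)" if A: "A \<in> herm n" for n A
  proof -
    let ?e = "\<lambda>B. exp (\<i> * inf_trace (inf_mult A B))"
    have "char_fun (distr (M \<Otimes>\<^sub>M N) borel_herm W) A = (\<integral>z. ?e (W z) \<partial>(M \<Otimes>\<^sub>M N))" by (rule d(2)[OF A])
    also have "\<dots> = (\<integral>z. ?e (fst z) * ?e (snd z) \<partial>(M \<Otimes>\<^sub>M N))"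
    proof (rule Bochner_Integration.integral_cong[OF HOL.refl])
      fix z assume "z \<in> space (M \<Otimes>\<^sub>M N)"
      hence "fst z \<in> herm_all" "snd z \<in> herm_all" by (auto simp: space_pair_measure M.space_N N.space_N)
      hence "W z = (\<lambda>i j. fst z i j + snd z i j)" unfolding W_def by (simp only: hid)
      thus "?e (W z) = ?e (fst z) * ?e (snd z)"
        by (simp only: trace_pairing_add[OF A] distrib_left exp_add)
    qed
    also have "\<dots> = char_fun M A * char_fun N A" unfolding char_fun_def
      by (rule integral_prod_pair(2)[OF M.prob_space_axioms N.prob_space_axioms M.trace_exp_integrable[OF A] N.trace_exp_integrable[OF A]])
    also have "\<dots> = (\<Prod>a\<in>#spec_mset n A. f a * g a)" unfolding M(2)[OF A] N(2)[OF A] prod_mset.distrib ..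
    finally show ?thesis .
  qed
  with d(1) show ?thesis unfolding realizable_def by blast
qed

lemma prod_mset_exp: "(\<Prod>a\<in>#\<sigma>. exp (f a)) = exp (\<Sum>a\<in>#\<sigma>. f a :: complex)"
  by (induction \<sigma>) (simp_all add: exp_add)

lemma realizable_shift: "realizable (\<lambda>a. exp (\<i> * of_real (\<gamma> * a)))"
proof -
  \<comment> \<open>The law is a point mass at a scalar matrix; any probability space can carry
    it.\<close>
  define W where "W = (\<lambda>(_ :: real) i j :: nat. if i = j then complex_of_real \<gamma> else 0)"
  have WH: "W z \<in> herm_all" for z by (rule herm_allI) (simp add: W_def)
  have Wm: "(\<lambda>z. W z i j) \<in> borel_measurable std_normal_distribution" for i j unfolding W_def by simp
  note d = distr_herm[where W = W, OF normal_prob Wm WH]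
  interpret prob_space std_normal_distribution by (rule normal_prob)
  have "char_fun (distr std_normal_distribution borel_herm W) A = (\<Prod>a\<in>#spec_mset n A. exp (\<i> * of_real (\<gamma> * a)))" if A: "A \<in> herm n" for n A
  proof -
    have t: "inf_trace (inf_mult A (W x)) = of_real \<gamma> * inf_trace A" for x
    proof -
      have "inf_trace (inf_mult A (W x)) = (\<Sum>i<n. \<Sum>k<n. if i = k then A i i * of_real \<gamma> else 0)"
        unfolding trace_pairing[OF A order_refl] by (intro sum.cong) (auto simp: W_def)
      also have "\<dots> = (\<Sum>i<n. A i i) * of_real \<gamma>" by (simp add: sum_distrib_right)
      also have "(\<Sum>i<n. A i i) = inf_trace A"
        by (rule inf_trace_eq_sum[symmetric]) (use hermD(2)[OF A] in auto)
      finally show ?thesis by (simp add: mult.commute)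
    qed
    have "char_fun (distr std_normal_distribution borel_herm W) A = exp (\<i> * (of_real \<gamma> * inf_trace A))"
      unfolding d(2)[OF A] t lebesgue_integral_const prob_space by simp
    also have "\<i> * (of_real \<gamma> * inf_trace A) = (\<Sum>a\<in>#spec_mset n A. \<i> * of_real (\<gamma> * a))"
    proof -
      have "\<i> * (of_real \<gamma> * of_real (\<Sum>a\<in>#\<sigma>. a)) = (\<Sum>a\<in>#\<sigma>. \<i> * of_real (\<gamma> * a))" for \<sigma>
        by (induction \<sigma>) (simp_all add: distrib_left)
      thus ?thesis unfolding inf_trace_spec(1)[OF A] by simp
    qed
    finally show ?thesis unfolding prod_mset_exp .
  qed
  with d(1) show ?thesis unfolding realizable_def by blast
qed

lemma gmat_entry_measurable: "(\<lambda>\<omega>. \<omega> i j) \<in> borel_measurable gmat"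
  using entry_measurable[of i j] measurable_cong_sets[OF sets_gmat HOL.refl] by blast

lemma gmat_cnj_entry_measurable: "(\<lambda>\<omega>. cnj (\<omega> i j)) \<in> borel_measurable gmat"
proof -
  have "cnj \<in> borel_measurable borel" by (intro borel_measurable_continuous_onI continuous_intros)
  from measurable_compose[OF gmat_entry_measurable this] show ?thesis .
qed

lemma realizable_gaussian:
  assumes \<gamma>: "0 \<le> \<gamma>"
  shows "realizable (\<lambda>a. exp (- of_real (\<gamma> * a\<^sup>2 / 2)))"
proof -
  \<comment> \<open>The pairing of \<open>A\<close> with \<open>W\<close> is the real part of a
    linear form with coefficients \<open>2 * c * A i k\<close> in the Gaussian entries, so its
    characteristic function has exponent \<open>- c\<^sup>2\<close> times the sum of squared moduli.
    The factor \<open>c\<^sup>2\<close> has to be \<open>\<gamma> / 2\<close>.\<close>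
  define c where "c = sqrt (\<gamma> / 2)"
  have c2: "c\<^sup>2 = \<gamma> / 2" using \<gamma> by (simp add: c_def)
  define W where "W = (\<lambda>(\<omega> :: infmat) i j. of_real c * (\<omega> i j + cnj (\<omega> j i)))"
  have WH: "W \<omega> \<in> herm_all" for \<omega> by (rule herm_allI) (simp add: W_def add.commute)
  have Wm: "(\<lambda>\<omega>. W \<omega> i j) \<in> borel_measurable gmat" for i j
    unfolding W_def by (intro borel_measurable_times borel_measurable_const borel_measurable_add gmat_entry_measurable gmat_cnj_entry_measurable)
  note d = distr_herm[where W = W, OF prob_space_gmat Wm WH]
  have "char_fun (distr gmat borel_herm W) A = (\<Prod>a\<in>#spec_mset n A. exp (- of_real (\<gamma> * a\<^sup>2 / 2)))" if A: "A \<in> herm n" for n A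
  proof -
    have t: "inf_trace (inf_mult A (W \<omega>)) = of_real (\<Sum>k<n. Re (\<Sum>i<n. (of_real (2 * c) * A i k) * \<omega> k i))" for \<omega>
    proof -
      let ?s = "\<Sum>i<n. \<Sum>k<n. A i k * \<omega> k i"
      have "inf_trace (inf_mult A (W \<omega>)) = of_real c * (?s + (\<Sum>i<n. \<Sum>k<n. A i k * cnj (\<omega> i k)))"
      proof -
        have "of_real c * (?s + (\<Sum>i<n. \<Sum>k<n. A i k * cnj (\<omega> i k))) =
          (\<Sum>i<n. \<Sum>k<n. of_real c * (A i k * \<omega> k i + A i k * cnj (\<omega> i k)))"
          by (simp only: sum.distrib sum_distrib_left[symmetric])
        also have "\<dots> = (\<Sum>i<n. \<Sum>k<n. A i k * W \<omega> k i)"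
          unfolding W_def by (intro sum.cong HOL.refl) (simp only: distrib_left mult.left_commute)
        finally show ?thesis unfolding trace_pairing[OF A order_refl] ..
      qed
      also have "(\<Sum>i<n. \<Sum>k<n. A i k * cnj (\<omega> i k)) = cnj ?s"
        by (subst sum.swap) (simp add: herm_all_cnj[OF hermD(1)[OF A]])
      also have "of_real c * (?s + cnj ?s) = of_real (2 * c * Re ?s)" 
      proof -
        have "of_real c * (z + cnj z) = of_real (2 * c * Re z)" for z by (simp add: complex_eq_iff)
        thus ?thesis .
      qed
      also have "2 * c * Re ?s = (\<Sum>k<n. Re (\<Sum>i<n. (of_real (2 * c) * A i k) * \<omega> k i))"
      proof -
        have "(\<Sum>k<n. \<Sum>i<n. (of_real (2 * c) * A i k) * \<omega> k i) = of_real (2 * c) * (\<Sum>k<n. \<Sum>i<n. A i k * \<omega> k i)"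
          by (simp only: sum_distrib_left mult.assoc)
        also have "(\<Sum>k<n. \<Sum>i<n. A i k * \<omega> k i) = ?s" by (rule sum.swap)
        finally have "Re (\<Sum>k<n. \<Sum>i<n. (of_real (2 * c) * A i k) * \<omega> k i) = Re (of_real (2 * c) * ?s)" by (rule arg_cong)
        also have "\<dots> = 2 * c * Re ?s"
        proof -
          have "Re (of_real r * z) = r * Re z" for r z by simp
          thus ?thesis .
        qed
        finally have e: "Re (\<Sum>k<n. \<Sum>i<n. (of_real (2 * c) * A i k) * \<omega> k i) = 2 * c * Re ?s" .
        show ?thesis unfolding e[symmetric] by (rule Re_sum)
      qed
      finally show ?thesis .
    qed
    have ii: "integrable gvec (\<lambda>g. iexp (Re (\<Sum>i<n. (of_real (2 * c) * A i k) * g i)))" for k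
    proof (rule iexp_integrable[OF prob_space_gvec])
      show "(\<lambda>g. Re (\<Sum>i<n. (of_real (2 * c) * A i k) * g i)) \<in> borel_measurable gvec"
        unfolding measurable_gvec
        by (rule borel_measurable_continuous_onI[OF separating_family.cont[OF separating_vec_family vec_familyI]])
    qed
    have "char_fun (distr gmat borel_herm W) A = (\<integral>\<omega>. (\<Prod>k<n. iexp (Re (\<Sum>i<n. (of_real (2 * c) * A i k) * \<omega> k i))) \<partial>gmat)"
      unfolding d(2)[OF A] t of_real_sum[of _ "{..<n}"] sum_distrib_left[of \<i>] exp_sum[OF finite_lessThan] ..
    also have "\<dots> = (\<Prod>k<n. \<integral>g. iexp (Re (\<Sum>i<n. (of_real (2 * c) * A i k) * g i)) \<partial>gvec)"
      unfolding gmat_def by (rule integral_prod_PiM(2)[OF prob_space_gvec finite_lessThan ii])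
    also have "\<dots> = (\<Prod>k<n. of_real (exp (- (\<Sum>i<n. (cmod (of_real (2 * c) * A i k))\<^sup>2) / 4)))"
      unfolding gvec_linear_char ..
    also have "\<dots> = exp (of_real (\<Sum>k<n. - (\<Sum>i<n. (cmod (of_real (2 * c) * A i k))\<^sup>2) / 4))"
      unfolding exp_of_real[symmetric] of_real_sum[of _ "{..<n}"] exp_sum[OF finite_lessThan] ..
    also have "(\<Sum>k<n. - (\<Sum>i<n. (cmod (of_real (2 * c) * A i k))\<^sup>2) / 4) = - (\<gamma> / 2) * (\<Sum>k<n. \<Sum>i<n. (cmod (A i k))\<^sup>2)"
    proof -
      have "(cmod (of_real (2 * c) * z))\<^sup>2 = 2 * \<gamma> * (cmod z)\<^sup>2" for z
        using c2 by (simp add: norm_mult power_mult_distrib)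
      thus ?thesis by (simp add: sum_distrib_left sum_negf sum_divide_distrib)
    qed
    also have "(\<Sum>k<n. \<Sum>i<n. (cmod (A i k))\<^sup>2) = (\<Sum>a\<in>#spec_mset n A. a\<^sup>2)"
    proof -
      have "complex_of_real (\<Sum>k<n. \<Sum>i<n. (cmod (A i k))\<^sup>2) = (\<Sum>k<n. \<Sum>i<n. A i k * A k i)"
        unfolding of_real_sum complex_norm_square herm_all_cnj[OF hermD(1)[OF A]] ..
      also have "\<dots> = inf_trace (inf_mult A A)" unfolding trace_pairing[OF A order_refl] by (rule sum.swap)
      finally show ?thesis unfolding inf_trace_spec(2)[OF A] of_real_eq_iff .
    qed
    also have "complex_of_real (- (\<gamma> / 2) * (\<Sum>a\<in>#spec_mset n A. a\<^sup>2)) = (\<Sum>a\<in>#spec_mset n A. - of_real (\<gamma> * a\<^sup>2 / 2))"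
    proof -
      have "complex_of_real (- (\<gamma> / 2) * (\<Sum>a\<in>#\<sigma>. a\<^sup>2)) = (\<Sum>a\<in>#\<sigma>. - of_real (\<gamma> * a\<^sup>2 / 2))" for \<sigma>
        by (induction \<sigma>) (simp_all add: distrib_left)
      thus ?thesis .
    qed
    finally show ?thesis unfolding prod_mset_exp .
  qed
  with d(1) show ?thesis unfolding realizable_def by blast
qed

section \<open>Series of centered rank one matrices\<close>

definition rank_one :: "infmat \<Rightarrow> nat \<Rightarrow> nat \<Rightarrow> nat \<Rightarrow> complex" where
  "rank_one \<omega> k i j = \<omega> k i * cnj (\<omega> k j) - (if i = j then 1 else 0)"

lemma rank_one_measurable: "(\<lambda>\<omega>. rank_one \<omega> k i j) \<in> borel_measurable gmat"
  unfolding rank_one_def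
  by (intro borel_measurable_diff borel_measurable_times borel_measurable_const gmat_entry_measurable gmat_cnj_entry_measurable)

text \<open>Centering makes the matrices for different \<open>k\<close> orthonormal entry by entry,
  so square summable weights suffice for convergence. It also accounts for the exponential in
  \<open>F_factor\<close>.\<close>

lemma rank_one_orthonormal:
  "integrable gmat (\<lambda>\<omega>. rank_one \<omega> k i j * cnj (rank_one \<omega> l i j))"
  "(\<integral>\<omega>. rank_one \<omega> k i j * cnj (rank_one \<omega> l i j) \<partial>gmat) = (if k = l then 1 else 0)"
proof -
  interpret G: prob_space gvec by (rule prob_space_gvec)
  define h where "h = (\<lambda>g :: nat \<Rightarrow> complex. g i * cnj (g j) - (if i = j then 1 else 0))"
  have hi: "integrable gvec h" unfolding h_def
    by (intro Bochner_Integration.integrable_diff gvec_coordinate_orthonormal(1) G.integrable_const)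
  have h0: "(\<integral>g. h g \<partial>gvec) = 0" unfolding h_def
    by (subst Bochner_Integration.integral_diff[OF gvec_coordinate_orthonormal(1) G.integrable_const])
      (simp only: gvec_coordinate_orthonormal(2) lebesgue_integral_const G.prob_space scaleR_one diff_self)
  have hci: "integrable gvec (\<lambda>g. cnj (h g))" by (rule integrable_cnj[OF hi])
  have hh: "integrable gvec (\<lambda>g. h g * cnj (h g)) \<and> (\<integral>g. h g * cnj (h g) \<partial>gvec) = 1"
  proof (cases "i = j")
    case True
    have e: "h g * cnj (h g) = (of_real ((cmod (g i))\<^sup>2 - 1)) * cnj (of_real ((cmod (g i))\<^sup>2 - 1))" for g
    proof -
      have "h g = of_real ((cmod (g i))\<^sup>2 - 1)"
        using True by (simp add: h_def complex_norm_square del: of_real_power)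
      thus ?thesis by (simp only:)
    qed
    show ?thesis unfolding e using gvec_centered_orthonormal[of i i] by (simp only:) simp
  next
    case False
    have e: "h g * cnj (h g) = complex_of_real ((cmod (g i))\<^sup>2 * (cmod (g j))\<^sup>2)" for g
    proof -
      have "h g * cnj (h g) = of_real ((cmod (h g))\<^sup>2)" by (rule complex_norm_square[symmetric])
      also have "cmod (h g) = cmod (g i) * cmod (g j)" using False by (simp add: h_def norm_mult)
      finally show ?thesis by (simp only: power_mult_distrib)
    qed
    have "integrable gvec (\<lambda>g. (cmod (g i))\<^sup>2 * (cmod (g j))\<^sup>2)" "(\<integral>g. (cmod (g i))\<^sup>2 * (cmod (g j))\<^sup>2 \<partial>gvec) = 1"
      using PiM_two[OF prob_space_cgauss cgauss_moments(3) cgauss_moments(3) False] cgauss_moments(4)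
      unfolding gvec_def by simp_all
    thus ?thesis unfolding e integral_complex_of_real complex_of_real_integrable_eq by simp
  qed
  have "integrable gmat (\<lambda>\<omega>. h (\<omega> k) * cnj (h (\<omega> l))) \<and> (\<integral>\<omega>. h (\<omega> k) * cnj (h (\<omega> l)) \<partial>gmat) = (if k = l then 1 else 0)"
  proof (cases "k = l")
    case True
    thus ?thesis using PiM_one[OF prob_space_gvec conjunct1[OF hh], of l] hh unfolding gmat_def by simp
  next
    case False
    thus ?thesis using PiM_two[OF prob_space_gvec hi hci False] h0 unfolding gmat_def by simp
  qed
  moreover have "rank_one \<omega> k i j = h (\<omega> k)" for \<omega> k by (simp only: rank_one_def h_def)
  ultimately show "integrable gmat (\<lambda>\<omega>. rank_one \<omega> k i j * cnj (rank_one \<omega> l i j))"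
    "(\<integral>\<omega>. rank_one \<omega> k i j * cnj (rank_one \<omega> l i j) \<partial>gmat) = (if k = l then 1 else 0)" by simp_all
qed

text \<open>The second moment of the block is at most \<open>(1/4) ^ p\<close>. The inequality
  between arithmetic and geometric mean, with weight \<open>2 ^ p\<close>, turns this into a first
  moment that is summable in \<open>p\<close>.\<close>

lemma rank_one_block_moment:
  assumes fin: "finite I" and y: "(\<Sum>k\<in>I. (y k)\<^sup>2) \<le> (1/4) ^ p"
  shows "(\<integral>\<^sup>+\<omega>. ennreal (cmod (\<Sum>k\<in>I. of_real (y k) * rank_one \<omega> k i j)) \<partial>gmat) \<le> ennreal ((1/2) ^ p)"
proof -
  interpret G: prob_space gmat by (rule prob_space_gmat)
  let ?X = "\<lambda>\<omega>. cmod (\<Sum>k\<in>I. of_real (y k) * rank_one \<omega> k i j)"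
  note on = orthonormal_sum_square[of I gmat "\<lambda>k \<omega>. rank_one \<omega> k i j" "\<lambda>k. of_real (y k)", OF fin rank_one_orthonormal]
  have v: "(\<integral>\<omega>. (?X \<omega>)\<^sup>2 \<partial>gmat) = (\<Sum>k\<in>I. (y k)\<^sup>2)" unfolding on(2) by simp
  have am: "?X \<omega> \<le> 2 ^ p / 2 * (?X \<omega>)\<^sup>2 + (1/2) ^ p / 2" for \<omega>
  proof -
    have "0 \<le> 2 ^ p / 2 * (?X \<omega> - (1/2) ^ p)\<^sup>2" by simp
    also have "2 ^ p / 2 * (x - (1/2) ^ p)\<^sup>2 = 2 ^ p / 2 * x\<^sup>2 + (1/2) ^ p / 2 - x" for x :: real
    proof -
      have "(2::real) ^ p * (1/2) ^ p = 1" by (simp add: power_mult_distrib[symmetric])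
      hence "(2::real) ^ p * (1/2) ^ p * (1/2) ^ p = (1/2) ^ p" "(2::real) ^ p * (1/2) ^ p * x = x" by simp_all
      thus ?thesis by (simp only: power2_diff) (simp add: algebra_simps power2_eq_square)
    qed
    finally show ?thesis by simp
  qed
  have ri: "integrable gmat (\<lambda>\<omega>. 2 ^ p / 2 * (?X \<omega>)\<^sup>2 + (1/2) ^ p / 2)"
    by (intro Bochner_Integration.integrable_add integrable_mult_right on(1) G.integrable_const)
  have "(\<integral>\<^sup>+\<omega>. ennreal (?X \<omega>) \<partial>gmat) \<le> (\<integral>\<^sup>+\<omega>. ennreal (2 ^ p / 2 * (?X \<omega>)\<^sup>2 + (1/2) ^ p / 2) \<partial>gmat)"
    by (intro nn_integral_mono ennreal_leI am)
  also have "\<dots> = ennreal (\<integral>\<omega>. 2 ^ p / 2 * (?X \<omega>)\<^sup>2 + (1/2) ^ p / 2 \<partial>gmat)"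
    by (rule nn_integral_eq_integral[OF ri]) (rule AE_I2, simp)
  also have "(\<integral>\<omega>. 2 ^ p / 2 * (?X \<omega>)\<^sup>2 + (1/2) ^ p / 2 \<partial>gmat) = 2 ^ p / 2 * (\<Sum>k\<in>I. (y k)\<^sup>2) + (1/2) ^ p / 2"
    unfolding Bochner_Integration.integral_add[OF integrable_mult_right[OF on(1)] G.integrable_const]
      integral_mult_right_zero v lebesgue_integral_const G.prob_space by simp
  also have "\<dots> \<le> (1/2) ^ p"
  proof -
    have "2 ^ p * (\<Sum>k\<in>I. (y k)\<^sup>2) \<le> 2 ^ p * (1/4) ^ p" using y by (intro mult_left_mono) auto
    also have "(2::real) ^ p * (1/4) ^ p = (1/2) ^ p" by (simp add: power_mult_distrib[symmetric])
    finally show ?thesis by simp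
  qed
  finally show ?thesis by (simp only: ennreal_leI order_trans)
qed

lemma tail_subsequence:
  fixes y :: "nat \<Rightarrow> real"
  assumes s: "summable (\<lambda>k. (y k)\<^sup>2)"
  obtains \<kappa> where "strict_mono (\<kappa> :: nat \<Rightarrow> nat)" "\<And>p m. (\<Sum>k\<in>{\<kappa> p..<m}. (y k)\<^sup>2) \<le> (1/4) ^ p"
proof -
  have ex: "\<exists>K0. \<forall>K\<ge>K0. \<forall>m. (\<Sum>k\<in>{K..<m}. (y k)\<^sup>2) < (1/4) ^ p" for p :: nat
  proof -
    have "0 < (1/4 :: real) ^ p" by simp
    then obtain K0 where K0: "\<And>m n. m \<ge> K0 \<Longrightarrow> norm (\<Sum>k\<in>{m..<n}. (y k)\<^sup>2) < (1/4) ^ p"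
      using s unfolding summable_Cauchy by blast
    have "(\<Sum>k\<in>{K..<m}. (y k)\<^sup>2) < (1/4) ^ p" if "K \<ge> K0" for K m
      using K0[OF that, of m] by (simp add: sum_nonneg)
    thus ?thesis by blast
  qed
  define f where "f = (\<lambda>p. SOME K0. \<forall>K\<ge>K0. \<forall>m. (\<Sum>k\<in>{K..<m}. (y k)\<^sup>2) < (1/4) ^ p)"
  have f: "(\<Sum>k\<in>{K..<m}. (y k)\<^sup>2) < (1/4) ^ p" if "K \<ge> f p" for K m p
    using someI_ex[OF ex[of p]] that unfolding f_def by blast
  \<comment> \<open>The sum of all thresholds up to \<open>p\<close> is at least the p-th one, and
    the summand \<open>p\<close> makes the sequence strictly increasing.\<close>
  define \<kappa> where "\<kappa> = (\<lambda>p. p + (\<Sum>q\<le>p. f q))"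
  have "strict_mono \<kappa>" by (rule strict_mono_Suc_iff[THEN iffD2]) (simp add: \<kappa>_def)
  moreover have "f p \<le> \<kappa> p" for p
    unfolding \<kappa>_def using member_le_sum[of p "{..p}" f] by (simp add: trans_le_add2)
  ultimately show thesis using that[of \<kappa>] f less_imp_le by blast
qed

text \<open>The first moments of the blocks between consecutive values of \<open>\<kappa>\<close>
  are summable, so the blocks are almost surely absolutely summable. Convergence along the
  subsequence is enough to obtain a limit matrix with the required characteristic function.\<close>

lemma rank_one_series_converges:
  assumes k: "strict_mono (\<kappa> :: nat \<Rightarrow> nat)" and y: "\<And>p m. (\<Sum>k\<in>{\<kappa> p..<m}. (y k)\<^sup>2) \<le> (1/4) ^ p"
  shows "AE \<omega> in gmat. convergent (\<lambda>p. \<Sum>k<\<kappa> p. of_real (y k) * rank_one \<omega> k i j)"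
proof -
  define \<Delta> where "\<Delta> = (\<lambda>p \<omega>. \<Sum>k\<in>{\<kappa> p..<\<kappa> (Suc p)}. of_real (y k) * rank_one \<omega> k i j)"
  have \<Delta>m: "(\<lambda>\<omega>. ennreal (cmod (\<Delta> p \<omega>))) \<in> borel_measurable gmat" for p
    unfolding \<Delta>_def
    by (intro measurable_compose[OF _ measurable_ennreal] measurable_compose[OF _ borel_measurable_norm]
        borel_measurable_sum borel_measurable_times borel_measurable_const rank_one_measurable)
  have "(\<integral>\<^sup>+\<omega>. (\<Sum>p. ennreal (cmod (\<Delta> p \<omega>))) \<partial>gmat) = (\<Sum>p. \<integral>\<^sup>+\<omega>. ennreal (cmod (\<Delta> p \<omega>)) \<partial>gmat)"
    by (rule nn_integral_suminf[OF \<Delta>m])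
  also have "\<dots> \<le> (\<Sum>p. ennreal ((1/2) ^ p))"
    unfolding \<Delta>_def by (intro suminf_le summableI rank_one_block_moment y) simp
  also have "\<dots> < \<infinity>"
  proof -
    have "summable (\<lambda>p. (1/2 :: real) ^ p)" by (rule summable_geometric) (simp only: norm_divide norm_one norm_numeral)
    hence "(\<Sum>p. ennreal ((1/2) ^ p)) \<noteq> \<infinity>"
      unfolding infinity_ennreal_def by (rule ennreal_suminf_neq_top) (rule zero_le_power, simp)
    thus ?thesis by (simp only: less_top infinity_ennreal_def not_False_eq_True)
  qed
  finally have "(\<integral>\<^sup>+\<omega>. (\<Sum>p. ennreal (cmod (\<Delta> p \<omega>))) \<partial>gmat) \<noteq> \<infinity>" by simp
  hence "AE \<omega> in gmat. (\<Sum>p. ennreal (cmod (\<Delta> p \<omega>))) \<noteq> \<infinity>"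
    by (intro nn_integral_PInf_AE borel_measurable_suminf_order \<Delta>m)
  thus ?thesis
  proof eventually_elim
    case (elim \<omega>)
    have "summable (\<lambda>p. cmod (\<Delta> p \<omega>))" by (rule summable_suminf_not_top) (use elim in auto)
    hence s: "summable (\<lambda>p. \<Delta> p \<omega>)" by (rule summable_norm_cancel)
    have tele: "(\<Sum>k<\<kappa> p. of_real (y k) * rank_one \<omega> k i j) = (\<Sum>k<\<kappa> 0. of_real (y k) * rank_one \<omega> k i j) + (\<Sum>q<p. \<Delta> q \<omega>)" for p
    proof (induction p)
      case (Suc p)
      have le: "\<kappa> p \<le> \<kappa> (Suc p)" using k by (simp add: strict_mono_less_eq)
      have "(\<Sum>k<\<kappa> (Suc p). of_real (y k) * rank_one \<omega> k i j) = (\<Sum>k<\<kappa> p. of_real (y k) * rank_one \<omega> k i j) + \<Delta> p \<omega>"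
        unfolding \<Delta>_def lessThan_atLeast0 by (rule sum.atLeastLessThan_concat[symmetric]) (use le in auto)
      thus ?case using Suc.IH by simp
    qed simp
    have "convergent (\<lambda>p. (\<Sum>k<\<kappa> 0. of_real (y k) * rank_one \<omega> k i j) + (\<Sum>q<p. \<Delta> q \<omega>))"
      by (rule convergent_add[OF convergent_const s[unfolded summable_iff_convergent]])
    thus ?case by (simp only: tele[symmetric])
  qed
qed

lemma tendsto_prod_mset:
  fixes f :: "nat \<Rightarrow> 'a \<Rightarrow> complex"
  assumes "\<And>a. (\<lambda>p. f p a) \<longlonglongrightarrow> g a"
  shows "(\<lambda>p. \<Prod>a\<in>#\<sigma>. f p a) \<longlonglongrightarrow> (\<Prod>a\<in>#\<sigma>. g a)"
  by (induction \<sigma>) (simp_all add: assms tendsto_mult)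

lemma prod_mset_swap: "(\<Prod>k<(K::nat). \<Prod>a\<in>#\<sigma>. f k a) = (\<Prod>a\<in>#\<sigma>. \<Prod>k<K. f k a :: complex)"
  by (induction \<sigma>) (simp_all add: prod.distrib)

text \<open>The pairing of \<open>A\<close> with a centered rank one matrix is a Gaussian quadratic
  form minus the trace of \<open>A\<close>. Writing the trace as a sum over the spectrum places one
  exponential beside each factor of the product for the form.\<close>

lemma rank_one_sum_char:
  assumes A: "A \<in> herm n"
  shows "(\<integral>\<omega>. exp (\<i> * (\<Sum>i<n. \<Sum>j<n. A i j * (\<Sum>k<K. of_real (y k) * rank_one \<omega> k j i))) \<partial>gmat) =
    (\<Prod>a\<in>#spec_mset n A. \<Prod>k<K. F_factor (y k) a)"
proof -
  interpret G: prob_space gvec by (rule prob_space_gvec)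
  define tr where "tr = (\<Sum>a\<in>#spec_mset n A. a)"
  have trA: "(\<Sum>i<n. A i i) = of_real tr"
    unfolding tr_def inf_trace_spec(1)[OF A, symmetric]
    by (rule inf_trace_eq_sum[symmetric]) (use hermD(2)[OF A] in auto)
  have q: "(\<Sum>i<n. \<Sum>j<n. A i j * rank_one \<omega> k j i) = of_real (Re (qf n A (\<omega> k)) - tr)" for \<omega> k
  proof -
    have "(\<Sum>i<n. \<Sum>j<n. A i j * rank_one \<omega> k j i) = (\<Sum>i<n. \<Sum>j<n. cnj (\<omega> k i) * A i j * \<omega> k j - (if i = j then A i i else 0))"
      by (intro sum.cong HOL.refl) (auto simp: rank_one_def algebra_simps)
    also have "\<dots> = qf n A (\<omega> k) - (\<Sum>i<n. A i i)" by (simp add: sum_subtractf qf_def)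
    finally show ?thesis unfolding trA of_real_diff qf_real[OF hermD(1)[OF A], symmetric] .
  qed
  have t: "(\<Sum>i<n. \<Sum>j<n. A i j * (\<Sum>k<K. of_real (y k) * rank_one \<omega> k j i)) = (\<Sum>k<K. of_real (y k * (Re (qf n A (\<omega> k)) - tr)))" for \<omega>
  proof -
    have "(\<Sum>i<n. \<Sum>j<n. A i j * (\<Sum>k<K. of_real (y k) * rank_one \<omega> k j i)) = (\<Sum>i<n. \<Sum>j<n. \<Sum>k<K. of_real (y k) * (A i j * rank_one \<omega> k j i))"
      by (simp add: sum_distrib_left mult_ac)
    also have "\<dots> = (\<Sum>i<n. \<Sum>k<K. \<Sum>j<n. of_real (y k) * (A i j * rank_one \<omega> k j i))"
      by (rule sum.cong[OF HOL.refl], rule sum.swap)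
    also have "\<dots> = (\<Sum>k<K. \<Sum>i<n. \<Sum>j<n. of_real (y k) * (A i j * rank_one \<omega> k j i))" by (rule sum.swap)
    also have "\<dots> = (\<Sum>k<K. of_real (y k * (Re (qf n A (\<omega> k)) - tr)))"
      unfolding sum_distrib_left[symmetric] q of_real_mult ..
    finally show ?thesis .
  qed
  have one: "(\<integral>g. iexp (y k * (Re (qf n A g) - tr)) \<partial>gvec) = (\<Prod>a\<in>#spec_mset n A. F_factor (y k) a)" for k
  proof -
    have "iexp (y k * (Re (qf n A g) - tr)) = exp (- (\<i> * of_real (y k * tr))) * iexp (y k * Re (qf n A g))" for g
      unfolding exp_add[symmetric] by (rule arg_cong[where f = exp]) (simp add: algebra_simps)
    hence "(\<integral>g. iexp (y k * (Re (qf n A g) - tr)) \<partial>gvec) = exp (- (\<i> * of_real (y k * tr))) * (\<integral>g. iexp (y k * Re (qf n A g)) \<partial>gvec)"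
      by (simp only: integral_mult_right_zero)
    also have "\<dots> = exp (- (\<i> * of_real (y k * tr))) * (\<Prod>a\<in>#spec_mset n A. 1 / (1 - \<i> * of_real (y k * a)))"
      unfolding gvec_qf_char[OF A] ..
    also have "\<dots> = (\<Prod>a\<in>#spec_mset n A. F_factor (y k) a)"
    proof -
      have "exp (- (\<i> * of_real (y k * (\<Sum>a\<in>#\<sigma>. a)))) * (\<Prod>a\<in>#\<sigma>. 1 / (1 - \<i> * of_real (y k * a))) = (\<Prod>a\<in>#\<sigma>. F_factor (y k) a)" for \<sigma>
      proof (induction \<sigma>)
        case (add x \<sigma>)
        have "exp (- (\<i> * of_real (y k * (\<Sum>a\<in>#add_mset x \<sigma>. a)))) = exp (- (\<i> * of_real (y k * x))) * exp (- (\<i> * of_real (y k * (\<Sum>a\<in>#\<sigma>. a))))"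
          unfolding exp_add[symmetric] by (rule arg_cong[where f = exp]) (simp add: algebra_simps)
        moreover have "F_factor (y k) x = exp (- (\<i> * of_real (y k * x))) * (1 / (1 - \<i> * of_real (y k * x)))"
          by (simp only: F_factor_def mult_minus_left times_divide_eq_right mult_1_right)
        ultimately show ?case using add by (simp only: image_mset_add_mset prod_mset.add_mset) (simp only: mult_ac)
      qed simp
      thus ?thesis unfolding tr_def .
    qed
    finally show ?thesis .
  qed
  have ii: "integrable gvec (\<lambda>g. iexp (y k * (Re (qf n A g) - tr)))" for k
  proof (rule iexp_integrable[OF prob_space_gvec])
    have "Re \<in> borel_measurable borel" by simp
    from measurable_compose[OF qf_measurable this]
    show "(\<lambda>g. y k * (Re (qf n A g) - tr)) \<in> borel_measurable gvec"
      unfolding measurable_gvec by (intro borel_measurable_times borel_measurable_diff borel_measurable_const)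
  qed
  have es: "exp (\<i> * (\<Sum>k<K. z k)) = (\<Prod>k<K. exp (\<i> * z k))" for z
    by (simp only: sum_distrib_left exp_sum[OF finite_lessThan])
  have "(\<integral>\<omega>. exp (\<i> * (\<Sum>i<n. \<Sum>j<n. A i j * (\<Sum>k<K. of_real (y k) * rank_one \<omega> k j i))) \<partial>gmat) =
    (\<integral>\<omega>. (\<Prod>k<K. iexp (y k * (Re (qf n A (\<omega> k)) - tr))) \<partial>gmat)"
    unfolding t es ..
  also have "\<dots> = (\<Prod>k<K. \<integral>g. iexp (y k * (Re (qf n A g) - tr)) \<partial>gvec)"
    unfolding gmat_def by (rule integral_prod_PiM(2)[OF prob_space_gvec finite_lessThan ii])
  finally show ?thesis unfolding one prod_mset_swap .
qed

text \<open>Dominated convergence carries the characteristic functions of the partial sums to that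
  of their almost sure limit, and the partial products converge along the same subsequence.\<close>

lemma realizable_prodinf:
  assumes y: "summable (\<lambda>k. (y k)\<^sup>2)" and r: "\<And>a. summable (\<lambda>k. log_rem 3 (a * y k))"
  shows "realizable (\<lambda>a. \<Prod>k. F_factor (y k) a)"
proof -
  interpret G: prob_space gmat by (rule prob_space_gmat)
  obtain \<kappa> where k: "strict_mono (\<kappa> :: nat \<Rightarrow> nat)" and yk: "\<And>p m. (\<Sum>k\<in>{\<kappa> p..<m}. (y k)\<^sup>2) \<le> (1/4) ^ p"
    by (rule tail_subsequence[OF y]) (rule that)
  define S where "S = (\<lambda>p \<omega> i j. \<Sum>k<\<kappa> p. of_real (y k) * rank_one \<omega> k i j)"
  have Sm: "(\<lambda>\<omega>. S p \<omega> i j) \<in> borel_measurable gmat" for p i j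
    unfolding S_def by (intro borel_measurable_sum borel_measurable_times borel_measurable_const rank_one_measurable)
  have Sc: "cnj (S p \<omega> i j) = S p \<omega> j i" for p \<omega> i j
    unfolding S_def by (simp add: rank_one_def mult.commute)
  define V where "V = (\<lambda>\<omega> i j. lim (\<lambda>p. S p \<omega> i j))"
  \<comment> \<open>The limit is Hermitian where the partial sums converge. Averaging with the
    adjoint makes it Hermitian everywhere, as the target space demands, and alters it on a null set
    at most.\<close>
  define W where "W = (\<lambda>\<omega> i j. (V \<omega> i j + cnj (V \<omega> j i)) / 2)"
  have WH: "W \<omega> \<in> herm_all" for \<omega> by (rule herm_allI) (simp add: W_def add.commute)
  have Vm: "(\<lambda>\<omega>. V \<omega> i j) \<in> borel_measurable gmat" for i j
    unfolding V_def by (rule borel_measurable_lim_metric[OF Sm])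
  have cm: "cnj \<in> borel_measurable borel" by (intro borel_measurable_continuous_onI continuous_intros)
  have Wm: "(\<lambda>\<omega>. W \<omega> i j) \<in> borel_measurable gmat" for i j
    unfolding W_def by (intro borel_measurable_divide borel_measurable_add Vm measurable_compose[OF Vm cm] borel_measurable_const)
  note d = distr_herm[where W = W, OF prob_space_gmat Wm WH]
  have "AE \<omega> in gmat. \<forall>i j. convergent (\<lambda>p. S p \<omega> i j)"
    unfolding S_def AE_all_countable using rank_one_series_converges[OF k yk] by blast
  hence lim: "AE \<omega> in gmat. \<forall>i j. (\<lambda>p. S p \<omega> i j) \<longlonglongrightarrow> W \<omega> i j"
  proof eventually_elim
    case (elim \<omega>)
    have V: "(\<lambda>p. S p \<omega> i j) \<longlonglongrightarrow> V \<omega> i j" for i j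
      using elim unfolding V_def convergent_LIMSEQ_iff by blast
    have Vc: "V \<omega> i j = cnj (V \<omega> j i)" for i j
    proof (rule LIMSEQ_unique[OF V])
      have "(\<lambda>p. cnj (S p \<omega> j i)) \<longlonglongrightarrow> cnj (V \<omega> j i)" by (intro tendsto_cnj V)
      thus "(\<lambda>p. S p \<omega> i j) \<longlonglongrightarrow> cnj (V \<omega> j i)" unfolding Sc .
    qed
    have "W \<omega> i j = V \<omega> i j" for i j unfolding W_def Vc[of i j, symmetric] by simp
    thus ?case by (intro allI) (simp only: V)
  qed
  have "char_fun (distr gmat borel_herm W) A = (\<Prod>a\<in>#spec_mset n A. \<Prod>k. F_factor (y k) a)" if A: "A \<in> herm n" for n A
  proof -
    define e where "e = (\<lambda>B :: infmat. exp (\<i> * (\<Sum>i<n. \<Sum>j<n. A i j * B j i)))"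
    have ec: "e B = exp (\<i> * inf_trace (inf_mult A B))" for B unfolding e_def trace_pairing[OF A order_refl] ..
    have em: "e \<in> borel_measurable borel" unfolding ec[abs_def] by (rule trace_exp_measurable[OF A])
    have SH: "S p \<omega> \<in> herm_all" for p \<omega> by (rule herm_allI) (rule Sc)
    have "(\<lambda>p. \<integral>\<omega>. e (S p \<omega>) \<partial>gmat) \<longlonglongrightarrow> (\<integral>\<omega>. e (W \<omega>) \<partial>gmat)"
    proof (rule integral_dominated_convergence[where w = "\<lambda>_. 1"])
      show "(\<lambda>\<omega>. e (W \<omega>)) \<in> borel_measurable gmat"
        by (rule measurable_compose[OF entrywise_measurable[OF Wm] em])
      show "(\<lambda>\<omega>. e (S p \<omega>)) \<in> borel_measurable gmat" for p
        by (rule measurable_compose[OF entrywise_measurable[OF Sm] em])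
      show "AE \<omega> in gmat. (\<lambda>p. e (S p \<omega>)) \<longlonglongrightarrow> e (W \<omega>)"
        using lim by eventually_elim (unfold e_def, intro tendsto_intros, blast)
      show "AE \<omega> in gmat. norm (e (S p \<omega>)) \<le> 1" for p
        unfolding ec by (intro AE_I2, subst trace_pairing_real[OF A SH], unfold norm_exp_i_times, rule order_refl)
    qed (rule G.integrable_const)
    moreover have "(\<integral>\<omega>. e (S p \<omega>) \<partial>gmat) = (\<Prod>a\<in>#spec_mset n A. \<Prod>k<\<kappa> p. F_factor (y k) a)" for p
      unfolding e_def S_def by (rule rank_one_sum_char[OF A])
    moreover have "(\<lambda>p. \<Prod>a\<in>#spec_mset n A. \<Prod>k<\<kappa> p. F_factor (y k) a) \<longlonglongrightarrow> (\<Prod>a\<in>#spec_mset n A. \<Prod>k. F_factor (y k) a)"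
      by (rule tendsto_prod_mset) (rule LIMSEQ_subseq_LIMSEQ[OF F_factor_prodinf(3)[OF r y] k, unfolded comp_def])
    ultimately have "(\<integral>\<omega>. e (W \<omega>) \<partial>gmat) = (\<Prod>a\<in>#spec_mset n A. \<Prod>k. F_factor (y k) a)"
      using LIMSEQ_unique by (simp only:) blast
    thus ?thesis unfolding d(2)[OF A] ec .
  qed
  with d(1) show ?thesis unfolding realizable_def by blast
qed

theorem realizable_F_fun:
  assumes g: "0 \<le> \<gamma>2" and x': "summable (\<lambda>k. (x' k)\<^sup>2)" "\<And>a. summable (\<lambda>k. log_rem 3 (a * x' k))"
    and x'': "summable (\<lambda>k. (x'' k)\<^sup>2)" "\<And>a. summable (\<lambda>k. log_rem 3 (a * x'' k))"
  shows "realizable (F_fun \<gamma>1 \<gamma>2 x' x'')"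
proof -
  have "F_fun \<gamma>1 \<gamma>2 x' x'' = (\<lambda>a. exp (\<i> * of_real (\<gamma>1 * a)) * exp (- of_real (\<gamma>2 * a\<^sup>2 / 2)) *
     (\<Prod>k. F_factor (x' k) a) * (\<Prod>k. F_factor (x'' k) a))"
    by (rule ext) (simp only: F_fun_def diff_conv_add_uminus exp_add)
  moreover have "realizable (\<lambda>a. exp (\<i> * of_real (\<gamma>1 * a)) * exp (- of_real (\<gamma>2 * a\<^sup>2 / 2)) *
     (\<Prod>k. F_factor (x' k) a) * (\<Prod>k. F_factor (x'' k) a))"
    by (rule realizable_mult[OF realizable_mult[OF realizable_mult[OF realizable_shift realizable_gaussian[OF g]]
          realizable_prodinf[OF x']] realizable_prodinf[OF x'']])
  ultimately show ?thesis by (simp only:)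
qed

section \<open>Ergodicity\<close>

lemma (in herm_prob) conj_act_N:
  assumes u: "u \<in> unitary_grp n"
  shows "conj_act u \<in> measurable N N"
proof -
  have "conj_act u \<in> measurable N borel_herm" unfolding borel_herm_def
  proof (rule measurable_restrict_space2)
    show "conj_act u \<in> space N \<rightarrow> herm_all" unfolding space_N by (rule Pi_I) (rule conj_act_herm_all[OF u])
    show "conj_act u \<in> borel_measurable N" by (rule measurable_N[OF conj_act_measurable[OF u]])
  qed
  thus ?thesis unfolding measurable_cong_sets[OF HOL.refl sets_N] .
qed

text \<open>Conjugation moves to the argument \<open>A\<close>, whose spectrum it preserves, and the
  characteristic function determines the law.\<close>

lemma (in herm_prob) unitary_invariant_of_char:
  assumes ch: "\<And>n A. A \<in> herm n \<Longrightarrow> char_fun N A = (\<Prod>a\<in>#spec_mset n A. f a)"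
  shows "unitary_invariant N"
  unfolding unitary_invariant_def
proof
  fix u assume "u \<in> unitary_inf"
  then obtain m where u: "u \<in> unitary_grp m" unfolding unitary_inf_def by blast
  have pd: "borel_prob_on_H (distr N N (conj_act u))" unfolding borel_prob_on_H_def
    by (intro conjI prob_space_distr[OF conj_act_N[OF u]]) (simp_all only: space_distr sets_distr sets_N space_N)
  show "distr N N (conj_act u) = N"
  proof (rule herm_measure_eqI[OF pd N])
    fix k A assume A: "A \<in> herm k"
    let ?n = "max m k"
    have A': "A \<in> herm ?n" by (rule subsetD[OF herm_mono A]) simp
    have u': "u \<in> unitary_grp ?n" by (rule subsetD[OF unitary_grp_mono u]) simp
    have em: "(\<lambda>B. exp (\<i> * inf_trace (inf_mult A B))) \<in> borel_measurable N"
      by (rule measurable_N[OF trace_exp_measurable[OF A]])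
    have "char_fun (distr N N (conj_act u)) A = (\<integral>B. exp (\<i> * inf_trace (inf_mult A (conj_act u B))) \<partial>N)"
      unfolding char_fun_def by (rule integral_distr[OF conj_act_N[OF u] em])
    also have "\<dots> = char_fun N (conj_act (inf_adjoint u) A)"
      unfolding char_fun_def trace_pairing_conj_act[OF A' u' order_refl] ..
    also have "\<dots> = (\<Prod>a\<in>#spec_mset ?n (conj_act (inf_adjoint u) A). f a)"
      by (rule ch[OF conj_act_herm[OF inf_adjoint_unitary[OF u'] A']])
    also have "\<dots> = char_fun N A"
      unfolding spec_mset_conj_act[OF inf_adjoint_unitary[OF u']] ch[OF A'] ..
    finally show "char_fun (distr N N (conj_act u)) A = char_fun N A" .
  qed
qed

section \<open>Exchange of two diagonal blocks\<close>

definition swap_index :: "nat \<Rightarrow> nat \<Rightarrow> nat" where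
  "swap_index m i = (if i < m then i + m else if i < 2 * m then i - m else i)"

definition swap_mat :: "nat \<Rightarrow> infmat" where
  "swap_mat m = (\<lambda>i j. if j = swap_index m i then 1 else 0)"

lemma swap_index_swap: "swap_index m (swap_index m i) = i"
  by (auto simp: swap_index_def)

lemma swap_index_eq: "swap_index m i = swap_index m j \<longleftrightarrow> i = j"
  using swap_index_swap[of m i] swap_index_swap[of m j] by metis

lemma swap_index_less: "2 * m \<le> N \<Longrightarrow> i < N \<Longrightarrow> swap_index m i < N"
  by (auto simp: swap_index_def)

lemma swap_mat_sym: "swap_mat m i j = swap_mat m j i"
  unfolding swap_mat_def using swap_index_swap[of m i] swap_index_swap[of m j] by auto

lemma swap_mat_cnj: "cnj (swap_mat m i j) = swap_mat m i j"
  by (simp add: swap_mat_def)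

lemma swap_mat_sum:
  assumes "swap_index m i < N"
  shows "(\<Sum>k<N. swap_mat m i k * g k) = g (swap_index m i)"
proof -
  have "(\<Sum>k<N. swap_mat m i k * g k) = (\<Sum>k\<in>{swap_index m i}. g k)"
    by (rule sum.mono_neutral_cong_right) (use assms in \<open>auto simp: swap_mat_def\<close>)
  thus ?thesis by simp
qed

lemma swap_mat_unitary: "swap_mat m \<in> unitary_grp (2 * m)"
proof (rule unitary_grpI)
  fix i j assume "2 * m \<le> i \<or> 2 * m \<le> j"
  thus "swap_mat m i j = inf_id i j"
    by (auto simp: swap_mat_def inf_id_def swap_index_def split: if_splits)
next
  fix i j N assume N: "2 * m \<le> N" "i < N" "j < N"
  have s: "(\<Sum>k<N. swap_mat m i k * swap_mat m j k) = (if i = j then 1 else 0)"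
    unfolding swap_mat_sum[OF swap_index_less[OF N(1,2)]]
    unfolding swap_mat_def by (simp only: swap_index_eq)
  thus "(\<Sum>k<N. swap_mat m i k * cnj (swap_mat m j k)) = (if i = j then 1 else 0)"
    by (simp only: swap_mat_cnj)
  show "(\<Sum>k<N. cnj (swap_mat m k i) * swap_mat m k j) = (if i = j then 1 else 0)"
    unfolding swap_mat_cnj swap_mat_sym[of m _ i] swap_mat_sym[of m _ j] by (rule s)
qed

lemma conj_act_swap: "conj_act (swap_mat m) B i j = B (swap_index m i) (swap_index m j)"
proof -
  define N where "N = Suc (max (2 * m) (max i j))"
  have N: "2 * m \<le> N" "i < N" "j < N" unfolding N_def by auto
  have "conj_act (swap_mat m) B i j = (\<Sum>l<N. B (swap_index m i) l * swap_mat m j l)"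
    unfolding conj_act_eq[OF swap_mat_unitary N] swap_mat_cnj swap_mat_sum[OF swap_index_less[OF N(1,2)]] ..
  also have "\<dots> = (\<Sum>l<N. swap_mat m j l * B (swap_index m i) l)" by (simp only: mult.commute)
  also have "\<dots> = B (swap_index m i) (swap_index m j)" by (rule swap_mat_sum[OF swap_index_less[OF N(1,3)]])
  finally show ?thesis .
qed

lemma conj_act_swap_swap: "conj_act (swap_mat m) (conj_act (swap_mat m) B) = B"
  by (intro HOL.ext) (simp only: conj_act_swap swap_index_swap)

section \<open>Approximation by cylinder sets\<close>

definition corner_cylinder :: "nat \<Rightarrow> infmat set \<Rightarrow> bool" where
  "corner_cylinder m C \<longleftrightarrow> C \<in> sets borel_herm \<and>
     (\<forall>B\<in>herm_all. \<forall>B'\<in>herm_all. (\<forall>p<m. \<forall>q<m. B p q = B' p q) \<longrightarrow> (B \<in> C \<longleftrightarrow> B' \<in> C))"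

lemma corner_cylinderD:
  assumes "corner_cylinder m C"
  shows "C \<in> sets borel_herm" "C \<subseteq> herm_all"
    "B \<in> herm_all \<Longrightarrow> B' \<in> herm_all \<Longrightarrow> (\<And>p q. p < m \<Longrightarrow> q < m \<Longrightarrow> B p q = B' p q) \<Longrightarrow> B \<in> C \<longleftrightarrow> B' \<in> C"
proof -
  show C: "C \<in> sets borel_herm" using assms unfolding corner_cylinder_def by blast
  show "C \<subseteq> herm_all" using sets.sets_into_space[OF C] unfolding sets_borel_herm(2) .
  show "B \<in> C \<longleftrightarrow> B' \<in> C" if "B \<in> herm_all" "B' \<in> herm_all" "\<And>p q. p < m \<Longrightarrow> q < m \<Longrightarrow> B p q = B' p q"
    using assms that unfolding corner_cylinder_def by blast
qed

lemma corner_cylinderI: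
  assumes "C \<in> sets borel_herm"
    "\<And>B B'. B \<in> herm_all \<Longrightarrow> B' \<in> herm_all \<Longrightarrow> (\<And>p q. p < m \<Longrightarrow> q < m \<Longrightarrow> B p q = B' p q) \<Longrightarrow> B \<in> C \<longleftrightarrow> B' \<in> C"
  shows "corner_cylinder m C"
  unfolding corner_cylinder_def
proof (intro conjI ballI impI)
  show "C \<in> sets borel_herm" by (rule assms(1))
  fix B B' assume B: "B \<in> herm_all" "B' \<in> herm_all" and e: "\<forall>p<m. \<forall>q<m. B p q = B' p q"
  show "B \<in> C \<longleftrightarrow> B' \<in> C" by (rule assms(2)[OF B]) (use e in blast)
qed

lemma corner_cylinder_Un:
  assumes C: "corner_cylinder m C" and D: "corner_cylinder k D"
  shows "corner_cylinder (max m k) (C \<union> D)"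
proof (rule corner_cylinderI)
  show "C \<union> D \<in> sets borel_herm" by (rule sets.Un[OF corner_cylinderD(1)[OF C] corner_cylinderD(1)[OF D]])
  fix B B' assume B: "B \<in> herm_all" "B' \<in> herm_all" and e: "\<And>p q. p < max m k \<Longrightarrow> q < max m k \<Longrightarrow> B p q = B' p q"
  have "B \<in> C \<longleftrightarrow> B' \<in> C" by (rule corner_cylinderD(3)[OF C B]) (rule e, simp_all)
  moreover have "B \<in> D \<longleftrightarrow> B' \<in> D" by (rule corner_cylinderD(3)[OF D B]) (rule e, simp_all)
  ultimately show "B \<in> C \<union> D \<longleftrightarrow> B' \<in> C \<union> D" by blast
qed

lemma corner_cylinder_Compl:
  assumes C: "corner_cylinder m C"
  shows "corner_cylinder m (herm_all - C)"
proof (rule corner_cylinderI)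
  show "herm_all - C \<in> sets borel_herm"
    using sets.compl_sets[OF corner_cylinderD(1)[OF C]] unfolding sets_borel_herm(2) .
  fix B B' assume B: "B \<in> herm_all" "B' \<in> herm_all" and e: "\<And>p q. p < m \<Longrightarrow> q < m \<Longrightarrow> B p q = B' p q"
  have "B \<in> C \<longleftrightarrow> B' \<in> C" by (rule corner_cylinderD(3)[OF C B e])
  thus "B \<in> herm_all - C \<longleftrightarrow> B' \<in> herm_all - C" using B by blast
qed

lemma corner_cylinder_empty: "corner_cylinder m {}"
  by (rule corner_cylinderI) (rule sets.empty_sets, simp only: empty_iff)

context herm_prob
begin

definition approximable :: "infmat set \<Rightarrow> bool" where
  "approximable Y \<longleftrightarrow> Y \<in> sets N \<and> (\<forall>\<epsilon>>0. \<exists>m C. corner_cylinder m C \<and> measure N (sym_diff Y C) < \<epsilon>)"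

lemma approximableD:
  assumes "approximable Y" "0 < \<epsilon>"
  obtains m C where "corner_cylinder m C" "C \<in> sets N" "measure N (sym_diff Y C) < \<epsilon>"
proof -
  obtain m C where C: "corner_cylinder m C" "measure N (sym_diff Y C) < \<epsilon>"
    using assms unfolding approximable_def by blast
  show thesis by (rule that[OF C(1) _ C(2)]) (simp only: sets_N corner_cylinderD(1)[OF C(1)])
qed

lemma measure_cover2:
  assumes "S \<subseteq> S1 \<union> S2" "S1 \<in> sets N" "S2 \<in> sets N"
  shows "measure N S \<le> measure N S1 + measure N S2"
  by (rule order_trans[OF finite_measure_mono[OF assms(1) sets.Un[OF assms(2,3)]] measure_Un_le[OF assms(2,3)]])

lemma approximable_Un:
  assumes Y: "approximable Y" and Z: "approximable Z"
  shows "approximable (Y \<union> Z)"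
  unfolding approximable_def
proof (intro conjI allI impI)
  have YZ: "Y \<in> sets N" "Z \<in> sets N" using Y Z unfolding approximable_def by blast+
  show "Y \<union> Z \<in> sets N" by (rule sets.Un[OF YZ])
  fix \<epsilon> :: real assume e: "0 < \<epsilon>"
  hence e2: "0 < \<epsilon> / 2" by simp
  obtain m C where C: "corner_cylinder m C" "C \<in> sets N" "measure N (sym_diff Y C) < \<epsilon> / 2" by (rule approximableD[OF Y e2])
  obtain k D where D: "corner_cylinder k D" "D \<in> sets N" "measure N (sym_diff Z D) < \<epsilon> / 2" by (rule approximableD[OF Z e2])
  have "measure N (sym_diff (Y \<union> Z) (C \<union> D)) \<le> measure N (sym_diff Y C) + measure N (sym_diff Z D)"
    by (rule measure_cover2[OF _ sets.Un[OF sets.Diff sets.Diff] sets.Un[OF sets.Diff sets.Diff], OF _ YZ(1) C(2) C(2) YZ(1) YZ(2) D(2) D(2) YZ(2)]) blast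
  hence "measure N (sym_diff (Y \<union> Z) (C \<union> D)) < \<epsilon>" using C(3) D(3) by linarith
  with corner_cylinder_Un[OF C(1) D(1)]
  show "\<exists>m C. corner_cylinder m C \<and> measure N (sym_diff (Y \<union> Z) C) < \<epsilon>" by blast
qed

lemma approximable_Compl:
  assumes Y: "approximable Y"
  shows "approximable (herm_all - Y)"
  unfolding approximable_def
proof (intro conjI allI impI)
  have YN: "Y \<in> sets N" using Y unfolding approximable_def by blast
  show "herm_all - Y \<in> sets N" using sets.compl_sets[OF YN] unfolding space_N .
  fix \<epsilon> :: real assume e: "0 < \<epsilon>"
  obtain m C where C: "corner_cylinder m C" "C \<in> sets N" "measure N (sym_diff Y C) < \<epsilon>" by (rule approximableD[OF Y e])
  have "Y \<subseteq> herm_all" using sets.sets_into_space[OF YN] unfolding space_N .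
  hence "sym_diff (herm_all - Y) (herm_all - C) = sym_diff Y C" using corner_cylinderD(2)[OF C(1)] by blast
  hence "measure N (sym_diff (herm_all - Y) (herm_all - C)) < \<epsilon>" using C(3) by (simp only:)
  with corner_cylinder_Compl[OF C(1)]
  show "\<exists>m C. corner_cylinder m C \<and> measure N (sym_diff (herm_all - Y) C) < \<epsilon>" by blast
qed

lemma approximable_cylinder:
  assumes "corner_cylinder m C"
  shows "approximable C"
  unfolding approximable_def
proof (intro conjI allI impI)
  show "C \<in> sets N" unfolding sets_N by (rule corner_cylinderD(1)[OF assms])
  fix \<epsilon> :: real assume "0 < \<epsilon>"
  hence "measure N (sym_diff C C) < \<epsilon>" by simp
  with assms show "\<exists>m D. corner_cylinder m D \<and> measure N (sym_diff C D) < \<epsilon>" by blast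
qed

text \<open>Continuity from below replaces the countable union by a finite one at the cost of half
  of \<open>\<epsilon>\<close>.\<close>

lemma approximable_UN:
  assumes Y: "\<And>i :: nat. approximable (Y i)"
  shows "approximable (\<Union>i. Y i)"
  unfolding approximable_def
proof (intro conjI allI impI)
  have YN: "Y i \<in> sets N" for i using Y[of i] unfolding approximable_def by blast
  show UN: "(\<Union>i. Y i) \<in> sets N" by (rule sets.countable_UN) (use YN in blast)
  fix \<epsilon> :: real assume e: "0 < \<epsilon>"
  hence e2: "0 < \<epsilon> / 2" by simp
  define A where "A = (\<lambda>k. \<Union>i\<le>k. Y i)"
  have A: "approximable (A k)" for k
  proof (induction k)
    case 0 show ?case using Y[of 0] unfolding A_def by simp
  next
    case (Suc k)
    have "A (Suc k) = A k \<union> Y (Suc k)" unfolding A_def atMost_Suc by blast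
    thus ?case using approximable_Un[OF Suc Y[of "Suc k"]] by (simp only:)
  qed
  have AN: "A k \<in> sets N" for k using A[of k] unfolding approximable_def by blast
  have inc: "incseq A" unfolding A_def by (rule incseq_SucI) (auto simp: atMost_Suc)
  have UA: "(\<Union>k. A k) = (\<Union>i. Y i)" unfolding A_def by blast
  have "(\<lambda>k. measure N (A k)) \<longlonglongrightarrow> measure N (\<Union>i. Y i)"
    unfolding UA[symmetric] by (rule finite_Lim_measure_incseq[OF _ inc]) (use AN in blast)
  from LIMSEQ_D[OF this e2] obtain k where "norm (measure N (A k) - measure N (\<Union>i. Y i)) < \<epsilon> / 2" by blast
  moreover have Ak: "A k \<subseteq> (\<Union>i. Y i)" unfolding UA[symmetric] by blast
  ultimately have d: "measure N ((\<Union>i. Y i) - A k) < \<epsilon> / 2"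
    unfolding finite_measure_Diff[OF UN AN Ak] by (simp only: real_norm_def)
  obtain m C where C: "corner_cylinder m C" "C \<in> sets N" "measure N (sym_diff (A k) C) < \<epsilon> / 2" by (rule approximableD[OF A e2])
  have "sym_diff (\<Union>i. Y i) C \<subseteq> ((\<Union>i. Y i) - A k) \<union> sym_diff (A k) C" using Ak by blast
  from measure_cover2[OF this]
  have "measure N (sym_diff (\<Union>i. Y i) C) \<le> measure N ((\<Union>i. Y i) - A k) + measure N (sym_diff (A k) C)"
    by (simp only: sets.Un sets.Diff UN AN C(2))
  hence "measure N (sym_diff (\<Union>i. Y i) C) < \<epsilon>" using d C(3) by linarith
  with C(1) show "\<exists>m C. corner_cylinder m C \<and> measure N (sym_diff (\<Union>i. Y i) C) < \<epsilon>" by blast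
qed

text \<open>The approximable sets form a sigma-algebra for which every entry is measurable, hence
  one that contains all Borel sets.\<close>

lemma approximable_sets:
  assumes Y: "Y \<in> sets N"
  shows "approximable Y"
proof -
  have sub: "Z \<subseteq> herm_all" if "approximable Z" for Z
    using that sets.sets_into_space unfolding approximable_def space_N[symmetric] by blast
  have sa: "sigma_algebra herm_all {Z. approximable Z}"
    unfolding sigma_algebra_iff2
  proof (intro conjI ballI allI impI)
    show "{Z. approximable Z} \<subseteq> Pow herm_all" using sub by blast
    show "{} \<in> {Z. approximable Z}" using approximable_cylinder[OF corner_cylinder_empty] by blast
    show "herm_all - Z \<in> {Z. approximable Z}" if "Z \<in> {Z. approximable Z}" for Z
      using approximable_Compl that by blast
    show "(\<Union>i. A i) \<in> {Z. approximable Z}" if "range A \<subseteq> {Z. approximable Z}" for A :: "nat \<Rightarrow> infmat set"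
      using approximable_UN[of A] that by blast
  qed
  \<comment> \<open>\<open>Q\<close> only presents the approximable sets as a measurable space; the
    measure it carries is zero.\<close>
  define Q where "Q = measure_of herm_all {Z. approximable Z} (\<lambda>_. 0)"
  have sQ: "sets Q = {Z. approximable Z}" unfolding Q_def by (rule sigma_algebra.sets_measure_of_eq[OF sa])
  have pQ: "space Q = herm_all" unfolding Q_def by (rule sigma_algebra.space_measure_of_eq[OF sa])
  have "(\<lambda>B. B p q) \<in> borel_measurable Q" for p q
  proof (rule measurableI)
    fix S :: "complex set" assume S: "S \<in> sets borel"
    have "corner_cylinder (Suc (max p q)) ((\<lambda>B. B p q) -` S \<inter> herm_all)"
    proof (rule corner_cylinderI)
      show "(\<lambda>B. B p q) -` S \<inter> herm_all \<in> sets borel_herm"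
        using measurable_sets[OF borel_herm_measurable[OF entry_measurable] S] unfolding sets_borel_herm(2) .
      fix B B' :: infmat assume B: "B \<in> herm_all" "B' \<in> herm_all"
        and e: "\<And>i j. i < Suc (max p q) \<Longrightarrow> j < Suc (max p q) \<Longrightarrow> B i j = B' i j"
      have "B p q = B' p q" by (rule e) simp_all
      thus "B \<in> (\<lambda>B. B p q) -` S \<inter> herm_all \<longleftrightarrow> B' \<in> (\<lambda>B. B p q) -` S \<inter> herm_all" using B by simp
    qed
    thus "(\<lambda>B. B p q) -` S \<inter> space Q \<in> sets Q" unfolding sQ pQ by (intro CollectI approximable_cylinder)
  qed simp
  hence "(\<lambda>B. B) \<in> borel_measurable Q" by (rule entrywise_measurable)
  from measurable_sets[OF this herm_setsD[OF Y[unfolded sets_N]]]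
  have "(\<lambda>B. B) -` Y \<inter> herm_all \<in> {Z. approximable Z}" unfolding sQ pQ .
  moreover have "(\<lambda>B. B) -` Y \<inter> herm_all = Y" using sets.sets_into_space[OF Y] unfolding space_N by blast
  ultimately show ?thesis by (simp only: mem_Collect_eq)
qed

end

section \<open>Spectrum and trace of a matrix with two diagonal blocks\<close>

definition block_part :: "nat \<Rightarrow> infmat \<Rightarrow> infmat" where
  "block_part m B = (\<lambda>i j. if i < m \<and> j < m \<or> m \<le> i \<and> i < 2 * m \<and> m \<le> j \<and> j < 2 * m then B i j else 0)"

definition top_block :: "nat \<Rightarrow> infmat \<Rightarrow> infmat" where
  "top_block m B = (\<lambda>i j. if i < m \<and> j < m then B i j else 0)"

definition low_block :: "nat \<Rightarrow> infmat \<Rightarrow> infmat" where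
  "low_block m B = (\<lambda>i j. if i < m \<and> j < m then B (i + m) (j + m) else 0)"

definition block_join :: "nat \<Rightarrow> infmat \<Rightarrow> infmat \<Rightarrow> infmat" where
  "block_join m B B' = (\<lambda>i j. if i < m \<and> j < m then B i j
     else if m \<le> i \<and> i < 2 * m \<and> m \<le> j \<and> j < 2 * m then B' (i - m) (j - m) else 0)"

lemma block_herm:
  assumes "A \<in> herm_all"
  shows "block_part m A \<in> herm (2 * m)" "top_block m A \<in> herm m" "low_block m A \<in> herm m"
  unfolding herm_def mem_Collect_eq
  by (intro conjI herm_allI; auto simp: block_part_def top_block_def low_block_def herm_all_cnj[OF assms])+

lemma block_join_herm:
  assumes "A \<in> herm_all" "B \<in> herm_all"
  shows "block_join m A B \<in> herm_all"
  by (rule herm_allI) (auto simp: block_join_def herm_all_cnj[OF assms(1)] herm_all_cnj[OF assms(2)])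

text \<open>The characteristic matrix is block diagonal, so the characteristic polynomial factors
  and the multisets of roots add up.\<close>

lemma spec_mset_block: "spec_mset (2 * m) (block_part m A) = spec_mset m (top_block m A) + spec_mset m (low_block m A)"
proof -
  let ?B = "mat m m (\<lambda>(i, j). top_block m A i j)" and ?D = "mat m m (\<lambda>(i, j). low_block m A i j)"
  let ?E = "mat (2 * m) (2 * m) (\<lambda>(i, j). block_part m A i j)"
  have BD: "?B \<in> carrier_mat m m" "?D \<in> carrier_mat m m" "?E \<in> carrier_mat (2 * m) (2 * m)" by simp_all
  have "char_poly_matrix ?E = four_block_mat (char_poly_matrix ?B) (0\<^sub>m m m) (0\<^sub>m m m) (char_poly_matrix ?D)" (is "_ = ?F")
  proof (rule eq_matI)
    show "dim_row (char_poly_matrix ?E) = dim_row ?F" "dim_col (char_poly_matrix ?E) = dim_col ?F"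
      by (simp_all add: char_poly_matrix_def)
    fix i j assume "i < dim_row ?F" "j < dim_col ?F"
    hence ij: "i < m + m" "j < m + m" by (simp_all add: char_poly_matrix_def)
    consider "i < m" "j < m" | "i < m" "\<not> j < m" | "\<not> i < m" "j < m" | "\<not> i < m" "\<not> j < m" by blast
    thus "char_poly_matrix ?E $$ (i, j) = ?F $$ (i, j)"
      by cases (use ij in \<open>auto simp: char_poly_matrix_def block_part_def top_block_def low_block_def\<close>)
  qed
  hence "char_poly ?E = char_poly ?B * char_poly ?D"
    unfolding char_poly_def
    by (simp only:) (rule det_four_block_mat_upper_right_zero[OF char_poly_matrix_closed[OF BD(1)] HOL.refl _ char_poly_matrix_closed[OF BD(2)]], simp)
  moreover have nz: "char_poly ?B \<noteq> 0" "char_poly ?D \<noteq> 0"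
    using degree_monic_char_poly[OF BD(1)] degree_monic_char_poly[OF BD(2)] by auto
  ultimately show ?thesis unfolding spec_mset_def by (simp only: proots_mult[OF nz] image_mset_union)
qed

lemma trace_block_part:
  assumes A: "A \<in> herm n" and mn: "2 * m \<le> n"
  shows "inf_trace (inf_mult A (block_part m B)) = inf_trace (inf_mult (block_part m A) B)"
  unfolding trace_pairing[OF A order_refl] trace_pairing[OF block_herm(1)[OF hermD(1)[OF A]] mn]
  by (intro sum.cong HOL.refl) (auto simp: block_part_def)

lemma trace_block_join:
  assumes A: "A \<in> herm n" and mn: "2 * m \<le> n"
  shows "inf_trace (inf_mult A (block_join m B B')) =
    inf_trace (inf_mult (top_block m A) B) + inf_trace (inf_mult (low_block m A) B')"
proof -
  have in1: "(\<Sum>k<n. if P \<and> k < m then h k else 0) = (if P then \<Sum>k<m. h k else 0)" for P and h :: "nat \<Rightarrow> complex"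
  proof -
    have "(\<Sum>k<n. if k < m then h k else 0) = (\<Sum>k<m. h k)"
      by (rule sum.mono_neutral_cong_right) (use mn in auto)
    thus ?thesis by (cases P) simp_all
  qed
  have in2: "(\<Sum>k<n. if P \<and> m \<le> k \<and> k < 2 * m then h k else 0) = (if P then \<Sum>k<m. h (k + m) else 0)" for P and h :: "nat \<Rightarrow> complex"
  proof -
    have "(\<Sum>k<n. if m \<le> k \<and> k < 2 * m then h k else 0) = (\<Sum>k\<in>{m..<2 * m}. h k)"
      by (rule sum.mono_neutral_cong_right) (use mn in auto)
    also have "\<dots> = (\<Sum>k<m. h (k + m))"
      by (rule sum.reindex_bij_witness[of _ "\<lambda>i. i + m" "\<lambda>i. i - m"]) auto
    finally show ?thesis by (cases P) simp_all
  qed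
  have "inf_trace (inf_mult A (block_join m B B')) =
    (\<Sum>i<n. \<Sum>k<n. (if i < m \<and> k < m then A i k * B k i else 0) +
      (if (m \<le> i \<and> i < 2 * m) \<and> m \<le> k \<and> k < 2 * m then A i k * B' (k - m) (i - m) else 0))"
    unfolding trace_pairing[OF A order_refl]
    by (intro sum.cong HOL.refl) (auto simp: block_join_def)
  also have "\<dots> = (\<Sum>i<n. if i < m then \<Sum>k<m. A i k * B k i else 0) +
      (\<Sum>i<n. if m \<le> i \<and> i < 2 * m then \<Sum>k<m. A i (k + m) * B' (k + m - m) (i - m) else 0)"
    by (simp only: sum.distrib in1 in2)
  also have "\<dots> = (\<Sum>i<m. \<Sum>k<m. A i k * B k i) + (\<Sum>i<m. \<Sum>k<m. A (i + m) (k + m) * B' (k + m - m) (i + m - m))"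
    using in1[of True] in2[of True] by (simp only: simp_thms if_True)
  also have "\<dots> = inf_trace (inf_mult (top_block m A) B) + inf_trace (inf_mult (low_block m A) B')"
    unfolding trace_pairing[OF block_herm(2)[OF hermD(1)[OF A]] order_refl] trace_pairing[OF block_herm(3)[OF hermD(1)[OF A]] order_refl]
    by (intro arg_cong2[where f = "(+)"] sum.cong HOL.refl) (auto simp: top_block_def low_block_def)
  finally show ?thesis .
qed

context herm_prob
begin

text \<open>The characteristic function factorizes over diagonal blocks, so two disjoint corners are independent.\<close>

lemma corner_swap_independent:
  assumes ch: "\<And>n A. A \<in> herm n \<Longrightarrow> char_fun N A = (\<Prod>a\<in>#spec_mset n A. f a)"
    and C: "corner_cylinder m C"
  shows "C \<inter> (conj_act (swap_mat m) -` C \<inter> space N) \<in> sets N"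
    "measure N (C \<inter> (conj_act (swap_mat m) -` C \<inter> space N)) = (measure N C)\<^sup>2"
proof -
  let ?u = "conj_act (swap_mat m)"
  define D where "D = C \<inter> (?u -` C \<inter> space N)"
  have CN: "C \<in> sets N" unfolding sets_N by (rule corner_cylinderD(1)[OF C])
  have DN: "D \<in> sets N" unfolding D_def by (rule sets.Int[OF CN measurable_sets[OF conj_act_N[OF swap_mat_unitary] CN]])
  hence DB: "D \<in> sets borel_herm" by (simp only: sets_N)
  have uH: "?u B \<in> herm_all" if "B \<in> herm_all" for B by (rule conj_act_herm_all[OF swap_mat_unitary that])
  have low: "?u B p q = B (p + m) (q + m)" if "p < m" "q < m" for B p q
    unfolding conj_act_swap using that by (simp add: swap_index_def)
  interpret P: pair_prob_space N N ..
  let ?T = "\<lambda>z. block_join m (fst z) (snd z)"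
  have Rm: "(\<lambda>B. block_part m B i j) \<in> borel_measurable N" for i j
    by (cases "i < m \<and> j < m \<or> m \<le> i \<and> i < 2 * m \<and> m \<le> j \<and> j < 2 * m")
      (simp_all only: block_part_def if_True if_False borel_measurable_const measurable_N[OF entry_measurable])
  have Tm: "(\<lambda>z. ?T z i j) \<in> borel_measurable (N \<Otimes>\<^sub>M N)" for i j
  proof -
    have "(\<lambda>z. fst z i j) \<in> borel_measurable (N \<Otimes>\<^sub>M N)" "(\<lambda>z. snd z (i - m) (j - m)) \<in> borel_measurable (N \<Otimes>\<^sub>M N)"
      by (rule measurable_compose[OF measurable_fst measurable_N[OF entry_measurable]],
          rule measurable_compose[OF measurable_snd measurable_N[OF entry_measurable]])
    thus ?thesis
      by (cases "i < m \<and> j < m"; cases "m \<le> i \<and> i < 2 * m \<and> m \<le> j \<and> j < 2 * m")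
        (simp_all only: block_join_def if_True if_False simp_thms borel_measurable_const)
  qed
  have sP: "fst z \<in> herm_all" "snd z \<in> herm_all" if "z \<in> space (N \<Otimes>\<^sub>M N)" for z
    using that by (auto simp: space_pair_measure space_N)
  have RH: "block_part m B \<in> herm_all" if "B \<in> herm_all" for B by (rule hermD(1)[OF block_herm(1)[OF that]])
  have RH': "block_part m B \<in> herm_all" if "B \<in> space N" for B using that unfolding space_N by (rule RH)
  have TH: "?T z \<in> herm_all" if "z \<in> space (N \<Otimes>\<^sub>M N)" for z by (rule block_join_herm[OF sP[OF that]])
  have hR: "block_part m \<in> measurable N borel_herm" by (rule herm_measurable[OF Rm RH'])
  have hT: "?T \<in> measurable (N \<Otimes>\<^sub>M N) borel_herm" by (rule herm_measurable[where W = ?T, OF Tm TH])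
  have d1: "borel_prob_on_H (distr N borel_herm (block_part m))"
    by (rule distr_herm(1)[where W = "block_part m", OF prob_space_axioms Rm RH'])
  have d2: "borel_prob_on_H (distr (N \<Otimes>\<^sub>M N) borel_herm ?T)"
    by (rule distr_herm(1)[where W = ?T, OF P.prob_space_axioms Tm TH])
  have c1: "char_fun (distr N borel_herm (block_part m)) A = (\<integral>B. exp (\<i> * inf_trace (inf_mult A (block_part m B))) \<partial>N)"
    if "A \<in> herm n" for A n
    by (rule distr_herm(2)[where W = "block_part m", OF prob_space_axioms Rm RH' that])
  have c2: "char_fun (distr (N \<Otimes>\<^sub>M N) borel_herm ?T) A = (\<integral>z. exp (\<i> * inf_trace (inf_mult A (?T z))) \<partial>(N \<Otimes>\<^sub>M N))"
    if "A \<in> herm n" for A n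
    by (rule distr_herm(2)[where W = ?T, OF P.prob_space_axioms Tm TH that])
  \<comment> \<open>The two diagonal blocks of one random matrix have the joint law of the corners
    of two independent copies: one characteristic function factors over the blocks because the
    spectrum splits, the other by independence.\<close>
  have eq: "distr N borel_herm (block_part m) = distr (N \<Otimes>\<^sub>M N) borel_herm ?T"
  proof (rule herm_measure_eqI[OF d1 d2])
    fix k A assume "A \<in> herm k"
    hence A: "A \<in> herm (max k (2 * m))" by (rule subsetD[OF herm_mono, rotated]) simp
    note AH = hermD(1)[OF A]
    have mk: "2 * m \<le> max k (2 * m)" by simp
    have "char_fun (distr N borel_herm (block_part m)) A = char_fun N (block_part m A)"
      unfolding c1[OF A] trace_block_part[OF A mk] unfolding char_fun_def ..
    also have "\<dots> = (\<Prod>a\<in>#spec_mset m (top_block m A). f a) * (\<Prod>a\<in>#spec_mset m (low_block m A). f a)"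
      unfolding ch[OF block_herm(1)[OF AH]] spec_mset_block by simp
    also have "\<dots> = char_fun N (top_block m A) * char_fun N (low_block m A)"
      unfolding ch[OF block_herm(2)[OF AH]] ch[OF block_herm(3)[OF AH]] ..
    also have "\<dots> = (\<integral>z. exp (\<i> * inf_trace (inf_mult (top_block m A) (fst z))) * exp (\<i> * inf_trace (inf_mult (low_block m A) (snd z))) \<partial>(N \<Otimes>\<^sub>M N))"
      unfolding char_fun_def
      by (rule integral_prod_pair(2)[OF prob_space_axioms prob_space_axioms trace_exp_integrable[OF block_herm(2)[OF AH]] trace_exp_integrable[OF block_herm(3)[OF AH]], symmetric])
    also have "\<dots> = char_fun (distr (N \<Otimes>\<^sub>M N) borel_herm ?T) A"
      unfolding c2[OF A] trace_block_join[OF A mk] distrib_left exp_add ..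
    finally show "char_fun (distr N borel_herm (block_part m)) A = char_fun (distr (N \<Otimes>\<^sub>M N) borel_herm ?T) A" .
  qed
  \<comment> \<open>\<open>D\<close> depends only on the first two diagonal blocks, so erasing all
    other entries does not affect membership.\<close>
  have R: "block_part m -` D \<inter> space N = D"
  proof -
    have "block_part m B \<in> D \<longleftrightarrow> B \<in> D" if B: "B \<in> herm_all" for B
    proof -
      have "block_part m B \<in> C \<longleftrightarrow> B \<in> C"
        by (rule corner_cylinderD(3)[OF C RH[OF B] B]) (simp add: block_part_def)
      moreover have "?u (block_part m B) \<in> C \<longleftrightarrow> ?u B \<in> C"
        by (rule corner_cylinderD(3)[OF C uH[OF RH[OF B]] uH[OF B]]) (simp add: low block_part_def)
      ultimately show ?thesis using B RH[OF B] unfolding D_def space_N by blast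
    qed
    thus ?thesis using sets.sets_into_space[OF DN] unfolding space_N by blast
  qed
  have T: "?T -` D \<inter> space (N \<Otimes>\<^sub>M N) = C \<times> C"
  proof -
    have *: "?T (B, B') \<in> D \<longleftrightarrow> B \<in> C \<and> B' \<in> C" if B: "B \<in> herm_all" "B' \<in> herm_all" for B B'
    proof -
      note TB = block_join_herm[OF B, of m]
      have "block_join m B B' \<in> C \<longleftrightarrow> B \<in> C"
        by (rule corner_cylinderD(3)[OF C TB B(1)]) (simp add: block_join_def)
      moreover have "?u (block_join m B B') \<in> C \<longleftrightarrow> B' \<in> C"
        by (rule corner_cylinderD(3)[OF C uH[OF TB] B(2)]) (simp add: low block_join_def)
      ultimately show ?thesis using TB unfolding D_def space_N fst_conv snd_conv by blast
    qed
    show ?thesis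
    proof (rule Set.set_eqI)
      fix z :: "infmat \<times> infmat"
      obtain B B' where z: "z = (B, B')" by (cases z)
      have "z \<in> ?T -` D \<inter> space (N \<Otimes>\<^sub>M N) \<longleftrightarrow> ?T (B, B') \<in> D \<and> B \<in> herm_all \<and> B' \<in> herm_all"
        unfolding z space_pair_measure space_N by blast
      also have "\<dots> \<longleftrightarrow> z \<in> C \<times> C" using * corner_cylinderD(2)[OF C] unfolding z by blast
      finally show "z \<in> ?T -` D \<inter> space (N \<Otimes>\<^sub>M N) \<longleftrightarrow> z \<in> C \<times> C" .
    qed
  qed
  have "measure N D = measure (distr N borel_herm (block_part m)) D"
    by (subst measure_distr[OF hR DB]) (simp_all only: R)
  also have "\<dots> = measure (N \<Otimes>\<^sub>M N) (C \<times> C)"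
    unfolding eq by (subst measure_distr[OF hT DB]) (simp_all only: T)
  also have "\<dots> = (measure N C)\<^sup>2"
    unfolding measure_def emeasure_pair_measure_Times[OF CN CN] enn2real_mult power2_eq_square ..
  finally show "measure N (C \<inter> (?u -` C \<inter> space N)) = (measure N C)\<^sup>2" unfolding D_def .
  show "C \<inter> (?u -` C \<inter> space N) \<in> sets N" using DN unfolding D_def .
qed

text \<open>Let \<open>C\<close> be a cylinder set close to \<open>Y\<close>. Up to null sets
  \<open>Y\<close> is invariant under the block exchange, so it is also close to the exchanged copy
  of \<open>C\<close> and to the intersection of both, whose measure is the square of that of
  \<open>C\<close> by independence. Hence the measure of \<open>Y\<close> equals its own
  square.\<close>

theorem ergodic_of_char:
  assumes ch: "\<And>n A. A \<in> herm n \<Longrightarrow> char_fun N A = (\<Prod>a\<in>#spec_mset n A. f a)"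
  shows "ergodic_measure N"
  unfolding ergodic_measure_def
proof (intro conjI ballI impI)
  show inv: "unitary_invariant N" by (rule unitary_invariant_of_char[OF ch])
  show "borel_prob_on_H N" by (rule N)
  fix Y assume Y: "Y \<in> sets N" and null: "\<forall>u\<in>unitary_inf. measure N (sym_diff (conj_act u ` Y) Y) = 0"
  let ?p = "measure N Y"
  have near: "\<bar>measure N S - measure N S'\<bar> \<le> measure N (sym_diff S S')" if "S \<in> sets N" "S' \<in> sets N" for S S'
  proof -
    have "sym_diff S S' \<in> sets N" by (intro sets.Un sets.Diff that)
    hence "measure N S \<le> measure N S' + measure N (sym_diff S S')" "measure N S' \<le> measure N S + measure N (sym_diff S S')"
      using that by (auto intro!: measure_cover2)
    thus ?thesis by linarith
  qed
  \<comment> \<open>The intersection is within \<open>2 * \<epsilon>\<close> of \<open>Y\<close>.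
    Passing from the squared measure of \<open>C\<close> to that of \<open>Y\<close> costs another
    \<open>2 * \<epsilon>\<close>, since both measures are at most 1.\<close>
  have small: "\<bar>?p - ?p\<^sup>2\<bar> \<le> 4 * \<epsilon>" if e: "0 < \<epsilon>" for \<epsilon>
  proof -
    obtain m C where C: "corner_cylinder m C" "C \<in> sets N" "measure N (sym_diff Y C) < \<epsilon>"
      by (rule approximableD[OF approximable_sets[OF Y] e])
    let ?u = "conj_act (swap_mat m)"
    let ?v = "\<lambda>S. ?u -` S \<inter> space N"
    have ui: "swap_mat m \<in> unitary_inf" using swap_mat_unitary unfolding unitary_inf_def by blast
    have vN: "?v S \<in> sets N" if "S \<in> sets N" for S by (rule measurable_sets[OF conj_act_N[OF swap_mat_unitary] that])
    have vm: "measure N (?v S) = measure N S" if "S \<in> sets N" for S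
    proof -
      have "measure N S = measure (distr N N ?u) S" using inv ui unfolding unitary_invariant_def by simp
      also have "\<dots> = measure N (?v S)" by (rule measure_distr[OF conj_act_N[OF swap_mat_unitary] that])
      finally show ?thesis ..
    qed
    have YH: "Y \<subseteq> herm_all" using sets.sets_into_space[OF Y] unfolding space_N .
    \<comment> \<open>The exchange is an involution, which turns the image in the definition of
      ergodicity into a measurable preimage.\<close>
    have img: "?u ` Y = ?v Y"
    proof (rule Set.set_eqI)
      fix B
      have uu: "?u (?u B) = B" by (rule conj_act_swap_swap)
      show "B \<in> ?u ` Y \<longleftrightarrow> B \<in> ?v Y"
      proof
        assume "B \<in> ?u ` Y"
        then obtain Z where Z: "Z \<in> Y" "B = ?u Z" by blast
        have "?u B = Z" unfolding Z(2) by (rule conj_act_swap_swap)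
        moreover have "B \<in> herm_all" unfolding Z(2) by (rule conj_act_herm_all[OF swap_mat_unitary subsetD[OF YH Z(1)]])
        ultimately show "B \<in> ?v Y" using Z(1) by (simp only: vimage_eq Int_iff space_N simp_thms)
      next
        assume "B \<in> ?v Y"
        hence "?u B \<in> Y" by blast
        from imageI[OF this, of ?u] show "B \<in> ?u ` Y" unfolding uu .
      qed
    qed
    have n0: "measure N (sym_diff (?v Y) Y) = 0" using null ui unfolding img[symmetric] by blast
    define D where "D = C \<inter> ?v C"
    have D: "D \<in> sets N" "measure N D = (measure N C)\<^sup>2"
      unfolding D_def by (rule corner_swap_independent[OF ch C(1)], assumption)+
    note S = sets.Un[OF sets.Diff sets.Diff]
    have SC: "sym_diff Y C \<in> sets N" by (rule S[OF Y C(2) C(2) Y])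
    have "measure N (sym_diff Y (?v C)) \<le> measure N (sym_diff (?v Y) Y) + measure N (?v (sym_diff Y C))"
      by (rule measure_cover2[OF _ S[OF vN[OF Y] Y Y vN[OF Y]] vN[OF SC]]) (use YH in \<open>auto simp: space_N\<close>)
    hence "measure N (sym_diff Y (?v C)) < \<epsilon>" using C(3) unfolding vm[OF SC] n0 by linarith
    moreover have "measure N (sym_diff Y D) \<le> measure N (sym_diff Y C) + measure N (sym_diff Y (?v C))"
      unfolding D_def by (rule measure_cover2[OF _ SC S[OF Y vN[OF C(2)] vN[OF C(2)] Y]]) blast
    ultimately have pd: "\<bar>?p - (measure N C)\<^sup>2\<bar> \<le> 2 * \<epsilon>"
      using C(3) near[OF Y D(1)] unfolding D(2) by linarith
    have pc: "\<bar>?p - measure N C\<bar> \<le> \<epsilon>" using near[OF Y C(2)] C(3) by linarith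
    have "(measure N C)\<^sup>2 - ?p\<^sup>2 = (measure N C + ?p) * (measure N C - ?p)" by (simp add: power2_eq_square algebra_simps)
    hence "\<bar>(measure N C)\<^sup>2 - ?p\<^sup>2\<bar> = (measure N C + ?p) * \<bar>?p - measure N C\<bar>"
      by (simp add: abs_mult abs_minus_commute)
    also have "\<dots> \<le> 2 * \<epsilon>"
    proof (rule mult_mono[OF _ pc])
      show "measure N C + ?p \<le> 2" using prob_le_1[of C] prob_le_1[of Y] by linarith
    qed simp_all
    finally show ?thesis using pd by linarith
  qed
  have "?p = ?p\<^sup>2"
  proof (rule ccontr)
    assume "?p \<noteq> ?p\<^sup>2"
    hence "0 < \<bar>?p - ?p\<^sup>2\<bar> / 8" by simp
    moreover have "\<not> x \<le> 4 * (x / 8)" if "0 < x / 8" for x :: real using that by simp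
    ultimately show False using small by blast
  qed
  hence "?p * (1 - ?p) = 0" by (simp add: power2_eq_square algebra_simps)
  thus "measure N Y = 0 \<or> measure N Y = 1" by simp
qed

end

section \<open>Convergence of orbital measures\<close>

context orbital
begin

lemma space_herm: "C \<in> space M \<Longrightarrow> C \<in> herm_all"
  unfolding space_M by (rule hermD(1))

lemma embed_measurable: "(\<lambda>C. C) \<in> measurable M borel_herm"
  by (rule herm_measurable[where W = "\<lambda>C. C", OF measurable_M[OF entry_measurable] space_herm])

lemma embed_herm:
  shows "borel_prob_on_H (embed_measure_H M)"
    and "A \<in> herm k \<Longrightarrow> char_fun (embed_measure_H M) A = (\<integral>C. exp (\<i> * inf_trace (inf_mult A C)) \<partial>M)"
  unfolding embed_measure_H_def
  by (rule distr_herm[where W = "\<lambda>C. C", OF prob_space_axioms measurable_M[OF entry_measurable] space_herm], assumption+)+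

lemma embed_tail:
  "measure (embed_measure_H M) {B \<in> space (embed_measure_H M). R < cmod (B p q)} = prob {C \<in> space M. R < cmod (C p q)}"
proof -
  have "(\<lambda>B. cmod (B p q)) \<in> borel_measurable borel_herm"
    by (rule measurable_compose[OF borel_herm_measurable[OF entry_measurable] borel_measurable_norm])
  from borel_measurable_less[OF borel_measurable_const this]
  have m: "{B \<in> space borel_herm. R < cmod (B p q)} \<in> sets borel_herm" .
  have "measure (embed_measure_H M) {B \<in> space (embed_measure_H M). R < cmod (B p q)} =
    prob ((\<lambda>C. C) -` {B \<in> space borel_herm. R < cmod (B p q)} \<inter> space M)"
    unfolding embed_measure_H_def space_distr by (rule measure_distr[OF embed_measurable m])
  also have "(\<lambda>C. C) -` {B \<in> space borel_herm. R < cmod (B p q)} \<inter> space M = {C \<in> space M. R < cmod (C p q)}"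
    using space_herm unfolding sets_borel_herm(2) by blast
  finally show ?thesis .
qed

lemma embed_integral:
  fixes \<psi> :: "infmat \<Rightarrow> real"
  assumes "continuous_on herm_all \<psi>"
  shows "(\<integral>B. \<psi> B \<partial>embed_measure_H M) = (\<integral>C. \<psi> C \<partial>M)"
  unfolding embed_measure_H_def
proof (rule integral_distr[OF embed_measurable])
  show "\<psi> \<in> borel_measurable borel_herm" unfolding borel_herm_def
    by (rule borel_measurable_continuous_on_restrict[OF assms])
qed

text \<open>Invariance of the orbital measure under U(n) lets the argument of the characteristic
  function be diagonalized, provided that it lives in a corner of size at most
  \<open>n\<close>.\<close>

lemma ucong_integral:
  assumes "ucong m A D" "A \<in> herm m" and mn: "m \<le> n"
  shows "(\<integral>C. exp (\<i> * inf_trace (inf_mult D C)) \<partial>M) = (\<integral>C. exp (\<i> * inf_trace (inf_mult A C)) \<partial>M)"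
  using assms(1)
proof (induction rule: ucong.induct)
  case (ucong_step C' u)
  have C': "C' \<in> herm m" by (rule ucong_herm[OF ucong_step.hyps(1) assms(2)])
  have w: "inf_adjoint u \<in> unitary_grp n"
    by (rule subsetD[OF unitary_grp_mono[OF mn] inf_adjoint_unitary[OF ucong_step.hyps(2)]])
  have "C' \<in> herm n" by (rule subsetD[OF herm_mono[OF mn] C'])
  from trace_pairing_conj_act[OF this w order_refl]
  have e: "inf_trace (inf_mult (conj_act u C') C) = inf_trace (inf_mult C' (conj_act (inf_adjoint u) C))" for C
    unfolding inf_adjoint_adjoint .
  have "(\<integral>C. exp (\<i> * inf_trace (inf_mult C' (conj_act (inf_adjoint u) C))) \<partial>M) = (\<integral>C. exp (\<i> * inf_trace (inf_mult C' C)) \<partial>M)"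
    by (rule integral_invariant[OF w trace_exp_measurable[OF C']])
  thus ?case unfolding e ucong_step.IH .
qed simp

lemma embed_char_diagonal:
  assumes A: "A \<in> herm m" and d: "ucong m A (diagm m d)" and mn: "m \<le> n"
  shows "char_fun (embed_measure_H M) A = (\<integral>C. iexp (\<Sum>j<m. d j * Re (C j j)) \<partial>M)"
proof -
  have "char_fun (embed_measure_H M) A = (\<integral>C. exp (\<i> * inf_trace (inf_mult (diagm m d) C)) \<partial>M)"
    unfolding embed_herm(2)[OF A] ucong_integral[OF d A mn] ..
  also have "\<dots> = (\<integral>C. iexp (\<Sum>j<m. d j * Re (C j j)) \<partial>M)"
  proof (rule Bochner_Integration.integral_cong[OF HOL.refl])
    fix C assume "C \<in> space M"
    hence C: "C \<in> herm_all" by (rule space_herm)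
    have r: "C j j = of_real (Re (C j j))" for j
      using herm_all_cnj[OF C, of j j] by (simp add: complex_eq_iff)
    have "inf_trace (inf_mult (diagm m d) C) = (\<Sum>i<m. \<Sum>k<m. diagm m d i k * C k i)"
      by (rule trace_pairing[OF diagm_herm order_refl])
    also have "\<dots> = (\<Sum>i<m. \<Sum>k\<in>{i}. diagm m d i k * C k i)"
      by (rule sum.cong[OF HOL.refl], rule sum.mono_neutral_right) (auto simp: diagm_def)
    also have "\<dots> = (\<Sum>i<m. of_real (d i) * C i i)" by (simp add: diagm_def)
    also have "\<dots> = (\<Sum>i<m. of_real (d i * Re (C i i)))"
      by (rule sum.cong[OF HOL.refl]) (subst r, simp only: of_real_mult)
    finally show "exp (\<i> * inf_trace (inf_mult (diagm m d) C)) = iexp (\<Sum>j<m. d j * Re (C j j))"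
      by (simp only: of_real_sum)
  qed
  finally show ?thesis .
qed

end

lemma tail_bound_uniform:
  assumes orb: "\<And>n. n \<ge> 1 \<Longrightarrow> orbital n (\<Omega> n) (M n) (B n)" and K0: "0 \<le> K"
    and K: "\<And>n. 9 * psum 2 (scaled_spec n (B n)) + 2 * (psum 1 (scaled_spec n (B n)))\<^sup>2 \<le> K"
    and e: "0 < \<epsilon>"
  shows "\<exists>R. \<forall>n\<ge>1. measure (M n) {C \<in> space (M n). R < cmod (C p q)} \<le> \<epsilon>"
proof (intro exI allI impI)
  fix n :: nat assume "1 \<le> n"
  then interpret O: orbital n "\<Omega> n" "M n" "B n" by (rule orb)
  \<comment> \<open>The threshold \<open>K / \<epsilon> + 1\<close> is at least 1, so its square is
    at least \<open>K / \<epsilon>\<close>, as Chebyshev's bound demands.\<close>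
  have R: "1 \<le> K / \<epsilon> + 1" using K0 e by simp
  have "K / \<epsilon> \<le> (K / \<epsilon> + 1)\<^sup>2" using self_le_power[OF R, of 2] by simp
  hence "K \<le> \<epsilon> * (K / \<epsilon> + 1)\<^sup>2" using e by (simp add: pos_divide_le_eq mult.commute)
  moreover have "0 < (K / \<epsilon> + 1)\<^sup>2" using R by simp
  ultimately have "K / (K / \<epsilon> + 1)\<^sup>2 \<le> \<epsilon>" by (simp only: pos_divide_le_eq)
  moreover have "measure (M n) {C \<in> space (M n). K / \<epsilon> + 1 < cmod (C p q)} \<le> K / (K / \<epsilon> + 1)\<^sup>2"
    by (rule O.entry_tail[OF K K0]) (use R in linarith)
  ultimately show "measure (M n) {C \<in> space (M n). K / \<epsilon> + 1 < cmod (C p q)} \<le> \<epsilon>" by linarith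
qed

text \<open>Once \<open>A\<close> is diagonalized, only diagonal entries of the corner enter, and
  the comparison with Gaussian vectors identifies the limit. The reduction is valid from
  \<open>n \<ge> m\<close> on, hence eventually.\<close>

lemma embed_char_limit:
  assumes orb: "\<And>n. n \<ge> 1 \<Longrightarrow> orbital n (\<Omega> n) (M n) (B n)"
    and tight: "\<And>p q \<eta>. 0 < \<eta> \<Longrightarrow> \<exists>R. \<forall>n\<ge>1. measure (M n) {C \<in> space (M n). R < cmod (C p q)} \<le> \<eta>"
    and f: "\<And>a. (\<lambda>n. char_mset (scaled_spec n (B n)) a) \<longlonglongrightarrow> f a"
    and A: "A \<in> herm m"
  shows "(\<lambda>n. char_fun (embed_measure_H (M n)) A) \<longlonglongrightarrow> (\<Prod>a\<in>#spec_mset m A. f a)"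
proof -
  obtain d where d: "ucong m A (diagm m d)" by (rule ucong_diagonal[OF A])
  have t: "\<exists>R. \<forall>\<^sub>F n in sequentially. measure (M n) {C \<in> space (M n). R < cmod (C p q)} \<le> \<eta>" if e: "0 < \<eta>" for p q \<eta>
  proof -
    obtain R where "\<forall>n\<ge>1. measure (M n) {C \<in> space (M n). R < cmod (C p q)} \<le> \<eta>" using tight[OF e] by blast
    thus ?thesis unfolding eventually_sequentially by blast
  qed
  have "(\<lambda>n. (\<integral>C. iexp (\<Sum>j<m. d j * Re (C j j)) \<partial>M n) - (\<Prod>j<m. char_mset (scaled_spec n (B n)) (d j))) \<longlonglongrightarrow> 0"
    by (rule orbital_char_limit[OF orb t])
  moreover have "(\<lambda>n. \<Prod>j<m. char_mset (scaled_spec n (B n)) (d j)) \<longlonglongrightarrow> (\<Prod>j<m. f (d j))"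
    by (intro tendsto_prod f)
  ultimately
  have "(\<lambda>n. ((\<integral>C. iexp (\<Sum>j<m. d j * Re (C j j)) \<partial>M n) - (\<Prod>j<m. char_mset (scaled_spec n (B n)) (d j))) +
    (\<Prod>j<m. char_mset (scaled_spec n (B n)) (d j))) \<longlonglongrightarrow> 0 + (\<Prod>j<m. f (d j))"
    by (rule tendsto_add)
  hence
  "(\<lambda>n. \<integral>C. iexp (\<Sum>j<m. d j * Re (C j j)) \<partial>M n) \<longlonglongrightarrow> (\<Prod>j<m. f (d j))"
    by (simp only: diff_add_cancel add_0)
  moreover have "(\<Prod>a\<in>#spec_mset m A. f a) = (\<Prod>j<m. f (d j))"
    unfolding ucong_spec_mset[OF d, symmetric] spec_mset_diagm prod_unfold_prod_mset image_mset.compositionality comp_def ..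
  moreover have "\<forall>\<^sub>F n in sequentially. (\<integral>C. iexp (\<Sum>j<m. d j * Re (C j j)) \<partial>M n) = char_fun (embed_measure_H (M n)) A"
    unfolding eventually_sequentially
  proof (intro exI allI impI)
    fix n assume n: "max 1 m \<le> n"
    then interpret O: orbital n "\<Omega> n" "M n" "B n" by (intro orb) simp
    show "(\<integral>C. iexp (\<Sum>j<m. d j * Re (C j j)) \<partial>M n) = char_fun (embed_measure_H (M n)) A"
      by (rule O.embed_char_diagonal[OF A d, symmetric]) (use n in simp)
  qed
  ultimately show ?thesis by (simp only:) (rule Lim_transform_eventually)
qed

text \<open>Convergent power sums are bounded, and bounded power sums make every entry tight
  uniformly in \<open>n\<close>; this feeds both the comparison with Gaussian vectors and the
  criterion for weak convergence.\<close>

lemma orbital_realization: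
  assumes orb: "\<And>n. n \<ge> 1 \<Longrightarrow> orbital n (\<Omega> n) (M n) (B n)"
    and x': "\<And>k. (\<lambda>n. pos_eigs n (B n) k / real n) \<longlonglongrightarrow> x' k"
    and x'': "\<And>k. (\<lambda>n. neg_eigs n (B n) k / real n) \<longlonglongrightarrow> x'' k"
    and g1: "(\<lambda>n. psum 1 (scaled_spec n (B n))) \<longlonglongrightarrow> \<gamma>1"
    and g2: "(\<lambda>n. psum 2 (scaled_spec n (B n))) \<longlonglongrightarrow> \<gamma>2t"
  shows "\<exists>N. ergodic_measure N \<and> weakly_converges (\<lambda>n. embed_measure_H (M n)) N \<and>
    (\<forall>n. \<forall>A\<in>herm n. char_fun N A =
       (\<Prod>a\<in>#spec_mset n A. F_fun \<gamma>1 (\<gamma>2t - (\<Sum>k. (x' k)\<^sup>2 + (x'' k)\<^sup>2)) x' x'' a))"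
proof -
  note lim = char_mset_limit[OF x' x'' g1 g2]
  let ?F = "F_fun \<gamma>1 (\<gamma>2t - (\<Sum>k. (x' k)\<^sup>2 + (x'' k)\<^sup>2)) x' x''"
  obtain c1 where c1: "\<And>n. \<bar>psum 1 (scaled_spec n (B n))\<bar> \<le> c1"
    using convergent_imp_Bseq[OF convergentI[OF g1]] unfolding Bseq_def real_norm_def by blast
  obtain c2 where c2: "\<And>n. \<bar>psum 2 (scaled_spec n (B n))\<bar> \<le> c2"
    using convergent_imp_Bseq[OF convergentI[OF g2]] unfolding Bseq_def real_norm_def by blast
  have c20: "0 \<le> c2" using c2[of 0] by linarith
  have K: "9 * psum 2 (scaled_spec n (B n)) + 2 * (psum 1 (scaled_spec n (B n)))\<^sup>2 \<le> 9 * c2 + 2 * c1\<^sup>2" for n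
  proof -
    have "(psum 1 (scaled_spec n (B n)))\<^sup>2 \<le> c1\<^sup>2" by (rule abs_le_square_iff[THEN iffD1]) (use c1[of n] in linarith)
    thus ?thesis using c2[of n] by linarith
  qed
  have K0: "0 \<le> 9 * c2 + 2 * c1\<^sup>2" using c20 by simp
  have tight: "\<exists>R. \<forall>n\<ge>1. measure (M n) {C \<in> space (M n). R < cmod (C p q)} \<le> \<epsilon>" if "0 < \<epsilon>" for p q \<epsilon>
    by (rule tail_bound_uniform[OF orb K0 K that])
  have "realizable ?F"
    by (rule realizable_F_fun) (use lim in \<open>simp_all only: diff_ge_0_iff_ge\<close>)
  then obtain N where N: "borel_prob_on_H N" "\<And>n A. A \<in> herm n \<Longrightarrow> char_fun N A = (\<Prod>a\<in>#spec_mset n A. ?F a)"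
    unfolding realizable_def by blast
  interpret N: herm_prob N by unfold_locales (rule N)
  have "ergodic_measure N" by (rule N.ergodic_of_char[OF N(2)])
  moreover have "weakly_converges (\<lambda>n. embed_measure_H (M n)) N"
  proof (rule weakly_converges_of_char[OF _ N(1)])
    show "borel_prob_on_H (embed_measure_H (M n))" if "1 \<le> n" for n
      by (rule orbital.embed_herm(1)[OF orb[OF that]])
    show "(\<lambda>n. char_fun (embed_measure_H (M n)) A) \<longlonglongrightarrow> char_fun N A" if A: "A \<in> herm m" for m A
      unfolding N(2)[OF A] by (rule embed_char_limit[OF orb tight lim(7) A])
    show "\<exists>R. \<forall>n\<ge>1. measure (embed_measure_H (M n)) {B \<in> space (embed_measure_H (M n)). R < cmod (B p q)} \<le> \<epsilon>"
      if e: "0 < \<epsilon>" for p q \<epsilon>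
    proof -
      obtain R where R: "\<forall>n\<ge>1. measure (M n) {C \<in> space (M n). R < cmod (C p q)} \<le> \<epsilon>" using tight[OF e] by blast
      have "measure (embed_measure_H (M n)) {B \<in> space (embed_measure_H (M n)). R < cmod (B p q)} \<le> \<epsilon>" if n: "1 \<le> n" for n
        unfolding orbital.embed_tail[OF orb[OF n]] using R n by blast
      thus ?thesis by blast
    qed
  qed
  ultimately show ?thesis using N(2) by blast
qed

text \<open>The inverse squared modulus is the product of the factors
  \<open>1 + (a * x)\<^sup>2\<close>, which is at least 1 plus their quadratic terms. A product
  bounded away from 0 at one nonzero \<open>a\<close> thus controls the second power sum.\<close>

lemma char_mset_psum_bound: "(cmod (char_mset \<sigma> a))\<^sup>2 * (1 + a\<^sup>2 * psum 2 \<sigma>) \<le> 1"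
proof (induction \<sigma>)
  case empty show ?case by (simp add: char_mset_def psum_def)
next
  case (add x \<sigma>)
  let ?c = "(cmod (char_mset \<sigma> a))\<^sup>2" and ?s = "a\<^sup>2 * psum 2 \<sigma>" and ?y = "(a * x)\<^sup>2"
  have "(cmod (1 - \<i> * of_real (a * x)))\<^sup>2 = 1 + ?y" by (simp add: cmod_power2)
  hence "(cmod (1 / (1 - \<i> * of_real (a * x))))\<^sup>2 = 1 / (1 + ?y)" by (simp only: norm_divide norm_one power_divide power_one)
  moreover have "char_mset (add_mset x \<sigma>) a = 1 / (1 - \<i> * of_real (a * x)) * char_mset \<sigma> a"
    unfolding char_mset_def by simp
  ultimately have c: "(cmod (char_mset (add_mset x \<sigma>) a))\<^sup>2 = 1 / (1 + ?y) * ?c"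
    by (simp only: norm_mult power_mult_distrib)
  have p: "a\<^sup>2 * psum 2 (add_mset x \<sigma>) = ?y + ?s" unfolding psum_def by (simp add: algebra_simps power_mult_distrib)
  have s0: "0 \<le> ?s" by (intro mult_nonneg_nonneg psum_2_nonneg) simp
  have y0: "0 \<le> ?y" by simp
  have y1: "0 < 1 + ?y" using y0 by linarith
  have "(1 + ?s) * (1 + ?y) = 1 + (?y + ?s) + ?s * ?y" by (simp only: distrib_left distrib_right mult_1 mult_1_right add_ac)
  hence "1 + (?y + ?s) \<le> (1 + ?s) * (1 + ?y)" using mult_nonneg_nonneg[OF s0 y0] by linarith
  hence "1 / (1 + ?y) * (1 + (?y + ?s)) \<le> 1 + ?s" by (simp only: times_divide_eq_left mult_1 pos_divide_le_eq[OF y1])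
  hence "?c * (1 / (1 + ?y) * (1 + (?y + ?s))) \<le> ?c * (1 + ?s)" by (rule mult_left_mono) simp
  also have "\<dots> \<le> 1" by (rule add.IH)
  finally show ?case unfolding c p by (simp only: mult_ac)
qed

lemma eventually_le_bounded:
  fixes f :: "nat \<Rightarrow> real"
  assumes "\<forall>\<^sub>F n in sequentially. f n \<le> c"
  shows "\<exists>C. \<forall>n. f n \<le> C"
proof -
  obtain n0 where n0: "\<And>n. n0 \<le> n \<Longrightarrow> f n \<le> c" using assms unfolding eventually_sequentially by blast
  have "f n \<le> max c (Max (f ` {..n0}))" for n
  proof (cases "n0 \<le> n")
    case True thus ?thesis using n0[of n] by simp
  next
    case False
    hence "f n \<le> Max (f ` {..n0})" by (intro Max_ge) auto
    thus ?thesis by simp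
  qed
  thus ?thesis by blast
qed

lemma herm_entry_continuous: "continuous_on S (\<lambda>B :: infmat. B k l)"
  by (rule continuous_on_subset[OF continuous_on_product_then_coordinatewise[OF continuous_on_product_coordinates] subset_UNIV])

text \<open>A converging sequence of orbital measures has a tight corner entry; its limiting
  characteristic function does not vanish near 0, which bounds the scaled second power sums,
  and the variance of the corner entry then bounds the scaled traces.\<close>

lemma orbital_limits_exist:
  assumes orb: "\<And>n. n \<ge> 1 \<Longrightarrow> orbital n (\<Omega> n) (M n) (B n)"
    and N: "borel_prob_on_H N" and w: "weakly_converges (\<lambda>n. embed_measure_H (M n)) N"
  shows "convergent (\<lambda>n. pos_eigs n (B n) k / real n)" "convergent (\<lambda>n. neg_eigs n (B n) k / real n)"
    "convergent (\<lambda>n. psum 1 (scaled_spec n (B n)))" "convergent (\<lambda>n. psum 2 (scaled_spec n (B n)))"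
proof -
  interpret N: herm_prob N by unfold_locales (rule N)
  define \<sigma> where "\<sigma> = (\<lambda>n. scaled_spec n (B n))"
  have test: "(\<lambda>n. \<integral>C. \<psi> C \<partial>M n) \<longlonglongrightarrow> (\<integral>B. \<psi> B \<partial>N)"
    if c: "continuous_on herm_all \<psi>" and b: "\<And>B. \<bar>\<psi> B\<bar> \<le> 1" for \<psi> :: "infmat \<Rightarrow> real"
  proof (rule Lim_transform_eventually)
    have "bounded (\<psi> ` herm_all)" by (rule boundedI[of _ 1]) (use b in auto)
    thus "(\<lambda>n. \<integral>B. \<psi> B \<partial>embed_measure_H (M n)) \<longlonglongrightarrow> (\<integral>B. \<psi> B \<partial>N)"
      using w c unfolding weakly_converges_def by blast
    have "(\<integral>B. \<psi> B \<partial>embed_measure_H (M n)) = (\<integral>C. \<psi> C \<partial>M n)" if "1 \<le> n" for n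
      by (rule orbital.embed_integral[OF orb[OF that] c])
    thus "\<forall>\<^sub>F n in sequentially. (\<integral>B. \<psi> B \<partial>embed_measure_H (M n)) = (\<integral>C. \<psi> C \<partial>M n)"
      unfolding eventually_sequentially by blast
  qed
  \<comment> \<open>A continuous substitute for an indicator: \<open>\<psi> j\<close> lies between
    the indicators of \<open>cmod (B 0 0)\<close> exceeding \<open>j + 1\<close> and exceeding
    \<open>j\<close>.\<close>
  define \<psi> where "\<psi> = (\<lambda>(j :: nat) (B :: infmat). max 0 (min 1 (cmod (B 0 0) - real j)))"
  have \<psi>c: "continuous_on S (\<psi> j)" for j S unfolding \<psi>_def by (intro continuous_intros herm_entry_continuous)
  have \<psi>b: "\<bar>\<psi> j B\<bar> \<le> 1" "0 \<le> \<psi> j B" for j B unfolding \<psi>_def by auto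
  have \<psi>m: "\<psi> j \<in> borel_measurable borel" for j by (rule borel_measurable_continuous_onI[OF \<psi>c])
  have \<psi>0: "(\<lambda>j. \<integral>B. \<psi> j B \<partial>N) \<longlonglongrightarrow> (\<integral>B. 0 \<partial>N)"
  proof (rule integral_dominated_convergence[where w = "\<lambda>_. 1"])
    show "AE B in N. (\<lambda>j. \<psi> j B) \<longlonglongrightarrow> 0"
    proof (rule AE_I2)
      fix B :: infmat
      obtain j0 :: nat where "cmod (B 0 0) \<le> real j0" using real_arch_simple by blast
      hence "\<psi> j B = 0" if "j0 \<le> j" for j using that unfolding \<psi>_def by simp
      hence "\<forall>\<^sub>F j in sequentially. 0 = \<psi> j B" unfolding eventually_sequentially by metis
      from Lim_transform_eventually[OF tendsto_const this] show "(\<lambda>j. \<psi> j B) \<longlonglongrightarrow> 0" .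
    qed
    show "\<psi> j \<in> borel_measurable N" for j by (rule N.measurable_N[OF \<psi>m])
    show "integrable N (\<lambda>_. 1 :: real)" by (rule N.integrable_const)
    show "AE B in N. norm (\<psi> j B) \<le> 1" for j by (rule AE_I2) (simp only: real_norm_def \<psi>b(1))
    show "(\<lambda>_. 0) \<in> borel_measurable N" by (rule borel_measurable_const)
  qed
  have tight: "\<exists>R. \<forall>\<^sub>F n in sequentially. measure (M n) {C \<in> space (M n). R < cmod (C 0 0)} \<le> \<eta>" if e: "0 < \<eta>" for \<eta>
  proof -
    have "(\<lambda>j. \<integral>B. \<psi> j B \<partial>N) \<longlonglongrightarrow> 0" using \<psi>0 by simp
    from order_tendstoD(2)[OF this e] obtain j where j: "(\<integral>B. \<psi> j B \<partial>N) < \<eta>" unfolding eventually_sequentially by blast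
    have "\<forall>\<^sub>F n in sequentially. (\<integral>C. \<psi> j C \<partial>M n) < \<eta>" by (rule order_tendstoD(2)[OF test[OF \<psi>c \<psi>b(1)] j])
    moreover have "\<forall>\<^sub>F n in sequentially. (1::nat) \<le> n" by (rule eventually_ge_at_top)
    ultimately have "\<forall>\<^sub>F n in sequentially. measure (M n) {C \<in> space (M n). real j + 1 < cmod (C 0 0)} \<le> \<eta>"
    proof eventually_elim
      case (elim n)
      interpret O: orbital n "\<Omega> n" "M n" "B n" by (rule orb) (use elim in simp)
      let ?S = "{C \<in> space (M n). real j + 1 < cmod (C 0 0)}"
      have "(\<lambda>C. cmod (C 0 0)) \<in> borel_measurable (M n)"
        by (rule measurable_compose[OF O.measurable_M[OF entry_measurable] borel_measurable_norm])
      from borel_measurable_less[OF borel_measurable_const this] have S: "?S \<in> sets (M n)" .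
      have \<psi>i: "integrable (M n) (\<psi> j)"
        by (rule O.integrable_const_bound[OF _ O.measurable_M[OF \<psi>m], of _ 1]) (rule AE_I2, simp only: real_norm_def \<psi>b(1))
      have "measure (M n) ?S = (\<integral>C. indicator ?S C \<partial>M n)"
        unfolding Bochner_Integration.integral_indicator by (simp add: Int_absorb2)
      also have "\<dots> \<le> (\<integral>C. \<psi> j C \<partial>M n)"
      proof (rule Bochner_Integration.integral_mono[OF _ \<psi>i])
        show "integrable (M n) (indicator ?S :: infmat \<Rightarrow> real)"
          by (rule integrable_real_indicator[OF S])
            (unfold infinity_ennreal_def less_top[symmetric], rule O.emeasure_finite[unfolded infinity_ennreal_def])
        show "indicator ?S C \<le> \<psi> j C" for C by (auto simp: indicator_def \<psi>_def)
      qed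
      finally show ?case using elim by linarith
    qed
    thus ?thesis by blast
  qed
  define g where "g = (\<lambda>a. \<integral>B. iexp (a * Re (B 0 0)) \<partial>N)"
  have hm: "(\<lambda>B :: infmat. a * Re (B 0 0)) \<in> borel_measurable borel" for a
    by (rule borel_measurable_continuous_onI) (intro continuous_intros herm_entry_continuous)
  have im: "(\<lambda>B :: infmat. iexp (a * Re (B 0 0))) \<in> borel_measurable borel" for a
    by (rule measurable_compose[OF hm iexp_measurable])
  have ri: "Re (\<integral>C. iexp (a * Re (C 0 0)) \<partial>Q) = (\<integral>C. cos (a * Re (C 0 0)) \<partial>Q)"
      "Im (\<integral>C. iexp (a * Re (C 0 0)) \<partial>Q) = (\<integral>C. sin (a * Re (C 0 0)) \<partial>Q)"
    if Q: "prob_space Q" "(\<lambda>C :: infmat. a * Re (C 0 0)) \<in> borel_measurable Q" for Q a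
  proof -
    note i = iexp_integrable[OF Q]
    show "Re (\<integral>C. iexp (a * Re (C 0 0)) \<partial>Q) = (\<integral>C. cos (a * Re (C 0 0)) \<partial>Q)"
    proof -
      have "Re (\<integral>C. iexp (a * Re (C 0 0)) \<partial>Q) = (\<integral>C. Re (iexp (a * Re (C 0 0))) \<partial>Q)"
        by (rule integral_Re[OF i, symmetric])
      thus ?thesis by (simp only: cis_conv_exp[symmetric] cis.sel)
    qed
    show "Im (\<integral>C. iexp (a * Re (C 0 0)) \<partial>Q) = (\<integral>C. sin (a * Re (C 0 0)) \<partial>Q)"
    proof -
      have "Im (\<integral>C. iexp (a * Re (C 0 0)) \<partial>Q) = (\<integral>C. Im (iexp (a * Re (C 0 0))) \<partial>Q)"
        by (rule integral_Im[OF i, symmetric])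
      thus ?thesis by (simp only: cis_conv_exp[symmetric] cis.sel)
    qed
  qed
  have gl: "(\<lambda>n. \<integral>C. iexp (a * Re (C 0 0)) \<partial>M n) \<longlonglongrightarrow> g a" for a
  proof -
    have cc: "continuous_on herm_all (\<lambda>B :: infmat. cos (a * Re (B 0 0)))" "continuous_on herm_all (\<lambda>B :: infmat. sin (a * Re (B 0 0)))"
      by (intro continuous_intros herm_entry_continuous)+
    note rn = ri[OF N.prob_space_axioms N.measurable_N[OF hm]]
    have ev: "\<forall>\<^sub>F n in sequentially. (1::nat) \<le> n" by (rule eventually_ge_at_top)
    have rM: "(\<integral>C. cos (a * Re (C 0 0)) \<partial>M n) = Re (\<integral>C. iexp (a * Re (C 0 0)) \<partial>M n)"
        "(\<integral>C. sin (a * Re (C 0 0)) \<partial>M n) = Im (\<integral>C. iexp (a * Re (C 0 0)) \<partial>M n)" if "1 \<le> n" for n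
    proof -
      interpret O: orbital n "\<Omega> n" "M n" "B n" by (rule orb[OF that])
      show "(\<integral>C. cos (a * Re (C 0 0)) \<partial>M n) = Re (\<integral>C. iexp (a * Re (C 0 0)) \<partial>M n)"
        "(\<integral>C. sin (a * Re (C 0 0)) \<partial>M n) = Im (\<integral>C. iexp (a * Re (C 0 0)) \<partial>M n)"
        by (rule ri[OF O.prob_space_axioms O.measurable_M[OF hm], symmetric])+
    qed
    have "(\<lambda>n. Re (\<integral>C. iexp (a * Re (C 0 0)) \<partial>M n)) \<longlonglongrightarrow> Re (g a)" unfolding g_def rn
      by (rule Lim_transform_eventually[OF test[OF cc(1) abs_cos_le_one] eventually_mono[OF ev rM(1)]])
    moreover have "(\<lambda>n. Im (\<integral>C. iexp (a * Re (C 0 0)) \<partial>M n)) \<longlonglongrightarrow> Im (g a)" unfolding g_def rn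
      by (rule Lim_transform_eventually[OF test[OF cc(2) abs_sin_le_one] eventually_mono[OF ev rM(2)]])
    ultimately show ?thesis unfolding tendsto_complex_iff by blast
  qed
  \<comment> \<open>Only the entry \<open>C 0 0\<close> is known to be tight at this point, so the
    comparison with Gaussian vectors is used for \<open>m = 1\<close>.\<close>
  have cl: "(\<lambda>n. char_mset (\<sigma> n) a) \<longlonglongrightarrow> g a" for a
  proof -
    have tp: "\<exists>R. \<forall>\<^sub>F n in sequentially. measure (M n) {C \<in> space (M n). R < cmod (C p q)} \<le> \<eta>"
      if "p < 1" "q < 1" "0 < \<eta>" for p q :: nat and \<eta>
      using tight[OF that(3)] that(1,2) by (simp only: less_one)
    have l: "(\<lambda>n. (\<integral>C. iexp (\<Sum>j<(1::nat). a * Re (C j j)) \<partial>M n) - (\<Prod>j<(1::nat). char_mset (scaled_spec n (B n)) a)) \<longlonglongrightarrow> 0"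
      by (rule orbital_char_limit[of \<Omega> M B 1 "\<lambda>_. a", OF orb tp])
    have "(\<Sum>j<(1::nat). a * Re (C j j)) = a * Re (C 0 0)" for C :: infmat by simp
    moreover have "(\<Prod>j<(1::nat). z) = z" for z :: complex by simp
    ultimately have "(\<lambda>n. (\<integral>C. iexp (a * Re (C 0 0)) \<partial>M n) - char_mset (\<sigma> n) a) \<longlonglongrightarrow> 0"
      using l by (simp only: \<sigma>_def)
    from tendsto_diff[OF gl[of a] this] show ?thesis by (simp only: diff_diff_eq2 add_diff_cancel_left' diff_0_right)
  qed
  \<comment> \<open>Continuity of the limit characteristic function at 0, along
    \<open>1 / (j + 1)\<close>, provides a positive \<open>a\<close> where its modulus exceeds 1/2.
    The second power sums are then eventually at most \<open>3 / a\<^sup>2\<close>, because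
    \<open>1/4 * (1 + a\<^sup>2 * psum 2 (\<sigma> n)) \<le> 1\<close>.\<close>
  have "(\<lambda>j. g (1 / real (Suc j))) \<longlonglongrightarrow> (\<integral>B. iexp (0 * Re (B 0 0)) \<partial>N)"
    unfolding g_def
  proof (rule integral_dominated_convergence[where w = "\<lambda>_. 1"])
    have z: "(\<lambda>j. 1 / real (Suc j)) \<longlonglongrightarrow> 0" using LIMSEQ_inverse_real_of_nat by (simp only: inverse_eq_divide)
    have "(\<lambda>j. iexp (1 / real (Suc j) * t)) \<longlonglongrightarrow> iexp (0 * t)" for t
      by (intro tendsto_exp tendsto_mult tendsto_const tendsto_of_real z)
    thus "AE B in N. (\<lambda>j. iexp (1 / real (Suc j) * Re (B 0 0))) \<longlonglongrightarrow> iexp (0 * Re (B 0 0))" by (intro AE_I2)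
    show "(\<lambda>B. iexp (0 * Re (B 0 0))) \<in> borel_measurable N" "(\<lambda>B. iexp (1 / real (Suc j) * Re (B 0 0))) \<in> borel_measurable N" for j
      by (rule N.measurable_N[OF im])+
    show "AE B in N. norm (iexp (1 / real (Suc j) * Re (B 0 0))) \<le> 1" for j
      by (intro AE_I2) (simp only: norm_exp_i_times order_refl)
    show "integrable N (\<lambda>_. 1 :: real)" by (rule N.integrable_const)
  qed
  moreover have "(\<integral>B. iexp (0 * Re (B 0 0)) \<partial>N) = 1" by (simp add: N.prob_space)
  ultimately have "(\<lambda>j. cmod (g (1 / real (Suc j)))) \<longlonglongrightarrow> 1" using tendsto_norm by fastforce
  from order_tendstoD(1)[OF this, of "1/2"] obtain j where "1/2 < cmod (g (1 / real (Suc j)))"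
    unfolding eventually_sequentially by auto
  then obtain a where a: "0 < a" "1/2 < cmod (g a)" using that[of "1 / real (Suc j)"] by simp
  have "\<forall>\<^sub>F n in sequentially. 1/2 < cmod (char_mset (\<sigma> n) a)"
    by (rule order_tendstoD(1)[OF tendsto_norm[OF cl] a(2)])
  hence "\<forall>\<^sub>F n in sequentially. psum 2 (\<sigma> n) \<le> 3 / a\<^sup>2"
  proof eventually_elim
    case (elim n)
    have s0: "0 \<le> a\<^sup>2 * psum 2 (\<sigma> n)" by (intro mult_nonneg_nonneg psum_2_nonneg) simp
    have "(1/2)\<^sup>2 \<le> (cmod (char_mset (\<sigma> n) a))\<^sup>2" by (rule power_mono) (use elim in auto)
    hence "(1/2)\<^sup>2 * (1 + a\<^sup>2 * psum 2 (\<sigma> n)) \<le> (cmod (char_mset (\<sigma> n) a))\<^sup>2 * (1 + a\<^sup>2 * psum 2 (\<sigma> n))"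
      by (rule mult_right_mono) (use s0 in linarith)
    also have "\<dots> \<le> 1" by (rule char_mset_psum_bound)
    finally have "a\<^sup>2 * psum 2 (\<sigma> n) \<le> 3" by (simp add: power2_eq_square)
    thus ?case using a(1) by (simp add: pos_le_divide_eq mult.commute)
  qed
  hence "\<exists>C2. \<forall>n. psum 2 (\<sigma> n) \<le> C2" by (rule eventually_le_bounded)
  then obtain C2 where C2: "\<And>n. psum 2 (\<sigma> n) \<le> C2" by blast
  have C20: "0 \<le> C2" using C2[of 0] psum_2_nonneg[of "\<sigma> 0"] by linarith
  have "0 < (1/4 :: real)" by simp
  from tight[OF this] obtain R where R: "\<forall>\<^sub>F n in sequentially. measure (M n) {C \<in> space (M n). R < cmod (C 0 0)} \<le> 1/4"
    by blast
  \<comment> \<open>Large enough for Chebyshev's bound to give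
    \<open>C2 / T\<^sup>2 \<le> 1/4\<close>.\<close>
  define T where "T = 4 * C2 + 1"
  have T: "1 \<le> T" using C20 unfolding T_def by simp
  have "T \<le> T\<^sup>2" using self_le_power[OF T, of 2] by simp
  hence "C2 \<le> 1/4 * T\<^sup>2" unfolding T_def by linarith
  hence CT: "C2 / T\<^sup>2 \<le> 1/4" using T by (simp add: pos_divide_le_eq)
  have "\<forall>\<^sub>F n in sequentially. (1::nat) \<le> n" by (rule eventually_ge_at_top)
  with R have "\<forall>\<^sub>F n in sequentially. \<bar>psum 1 (\<sigma> n)\<bar> \<le> R + T"
  proof eventually_elim
    case (elim n)
    interpret O: orbital n "\<Omega> n" "M n" "B n" by (rule orb) (use elim in simp)
    let ?h = "\<lambda>C :: infmat. \<bar>Re (C 0 0) - psum 1 (\<sigma> n)\<bar>"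
    have hb: "?h \<in> borel_measurable borel"
      by (rule borel_measurable_continuous_onI) (intro continuous_intros herm_entry_continuous)
    have nb: "(\<lambda>C :: infmat. cmod (C 0 0)) \<in> borel_measurable borel"
      by (rule borel_measurable_continuous_onI) (intro continuous_intros herm_entry_continuous)
    note S1 = borel_measurable_less[OF borel_measurable_const[of T] O.measurable_M[OF hb]]
    note S2 = borel_measurable_less[OF borel_measurable_const[of R] O.measurable_M[OF nb]]
    have "(\<integral>\<^sup>+C. ennreal ((?h C)\<^sup>2) \<partial>M n) \<le> ennreal C2"
      unfolding power2_abs \<sigma>_def by (rule order_trans[OF O.diagonal_variance ennreal_leI[OF C2[unfolded \<sigma>_def]]])
    from O.markov_second_moment[OF O.measurable_M[OF hb] this C20, of T]
    have v: "measure (M n) {C \<in> space (M n). T < ?h C} \<le> 1/4" using CT T by linarith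
    show ?case
    proof (rule ccontr)
      assume p: "\<not> \<bar>psum 1 (\<sigma> n)\<bar> \<le> R + T"
      \<comment> \<open>If the scaled trace were larger than \<open>R + T\<close> in modulus, every
        matrix would either have its corner entry farther than \<open>T\<close> from the mean or
        have a corner entry above \<open>R\<close>. Both events have probability at most
        1/4.\<close>
      have cov: "space (M n) \<subseteq> {C \<in> space (M n). T < ?h C} \<union> {C \<in> space (M n). R < cmod (C 0 0)}"
      proof
        fix C assume C: "C \<in> space (M n)"
        have "T < ?h C \<or> R < cmod (C 0 0)" using p abs_Re_le_cmod[of "C 0 0"] by linarith
        thus "C \<in> {C \<in> space (M n). T < ?h C} \<union> {C \<in> space (M n). R < cmod (C 0 0)}" using C by blast
      qed
      have "1 = measure (M n) (space (M n))" by (rule O.prob_space[symmetric])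
      also have "\<dots> \<le> measure (M n) ({C \<in> space (M n). T < ?h C} \<union> {C \<in> space (M n). R < cmod (C 0 0)})"
        by (rule O.finite_measure_mono[OF cov sets.Un[OF S1 S2]])
      also have "\<dots> \<le> measure (M n) {C \<in> space (M n). T < ?h C} + measure (M n) {C \<in> space (M n). R < cmod (C 0 0)}"
        by (rule measure_Un_le[OF S1 S2])
      finally show False using v elim(1) by linarith
    qed
  qed
  hence "\<exists>C1. \<forall>n. \<bar>psum 1 (\<sigma> n)\<bar> \<le> C1" by (rule eventually_le_bounded)
  then obtain C1 where C1: "\<And>n. \<bar>psum 1 (\<sigma> n)\<bar> \<le> C1" by blast
  define K where "K = max 1 (max C1 C2)"
  have "psum 2 (scaled_spec n (B n)) \<le> K" "\<bar>psum 1 (scaled_spec n (B n))\<bar> \<le> K" for n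
    using C1[of n] C2[of n] unfolding K_def \<sigma>_def by (auto simp: le_max_iff_disj)
  moreover have "1 \<le> K" unfolding K_def by simp
  moreover have "convergent (\<lambda>n. char_mset (scaled_spec n (B n)) a)" for a
    by (rule convergentI[OF cl[unfolded \<sigma>_def]])
  ultimately have H: "\<And>n. psum 2 (scaled_spec n (B n)) \<le> K" "1 \<le> K" "\<And>n. \<bar>psum 1 (scaled_spec n (B n))\<bar> \<le> K"
    "\<And>a. convergent (\<lambda>n. char_mset (scaled_spec n (B n)) a)" by blast+
  show "convergent (\<lambda>n. pos_eigs n (B n) k / real n)" "convergent (\<lambda>n. neg_eigs n (B n) k / real n)"
    "convergent (\<lambda>n. psum 1 (scaled_spec n (B n)))" "convergent (\<lambda>n. psum 2 (scaled_spec n (B n)))"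
    by (rule eigenvalue_limits_of_char[where C = K, OF H])+
qed

lemma convergent_of_real_eventually:
  fixes f :: "nat \<Rightarrow> real" and h :: "nat \<Rightarrow> complex"
  assumes f: "convergent f" and e: "\<And>n. n \<ge> 1 \<Longrightarrow> of_real (f n) = h n"
  shows "convergent h"
proof -
  obtain l where "f \<longlonglongrightarrow> l" using f unfolding convergent_def by blast
  hence "(\<lambda>n. complex_of_real (f n)) \<longlonglongrightarrow> of_real l" by (rule tendsto_of_real)
  moreover have "\<forall>\<^sub>F n in sequentially. of_real (f n) = h n" using e unfolding eventually_sequentially by blast
  ultimately have "h \<longlonglongrightarrow> of_real l" by (rule Lim_transform_eventually)
  thus ?thesis by (rule convergentI)
qed

text \<open>The conclusion of (i) includes convergence of the infinite products, since
  \<open>\<Prod>k\<close> alone would not guarantee a meaningful value. The identities for the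
  eigenvalue sums link the two forms in which the limits of the traces are written.\<close>

theorem theorem4p1:
  fixes M :: "nat \<Rightarrow> infmat measure"
    and \<Omega> :: "nat \<Rightarrow> infmat set"
    and B :: "nat \<Rightarrow> infmat"
  assumes orbital: "\<And>n. n \<ge> 1 \<Longrightarrow> orbital_measure n (\<Omega> n) (M n)"
    and pick: "\<And>n. n \<ge> 1 \<Longrightarrow> B n \<in> \<Omega> n"
  shows
    "(\<forall>n\<ge>1.
        (\<forall>C\<in>\<Omega> n. spec_mset n C = spec_mset n (B n)) \<and>
        of_real (\<Sum>k. pos_eigs n (B n) k + neg_eigs n (B n) k) = inf_trace (B n) \<and>
        of_real (\<Sum>k. (pos_eigs n (B n) k)\<^sup>2 + (neg_eigs n (B n) k)\<^sup>2) =
          inf_trace (inf_mult (B n) (B n))) \<and>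
     (\<forall>(x' :: nat \<Rightarrow> real) (x'' :: nat \<Rightarrow> real) (\<gamma>1 :: real) (\<gamma>2t :: real).
        (\<forall>k. (\<lambda>n. pos_eigs n (B n) k / real n) \<longlonglongrightarrow> x' k) \<and>
        (\<forall>k. (\<lambda>n. neg_eigs n (B n) k / real n) \<longlonglongrightarrow> x'' k) \<and>
        (\<lambda>n. (\<Sum>k. pos_eigs n (B n) k + neg_eigs n (B n) k) / real n) \<longlonglongrightarrow> \<gamma>1 \<and>
        (\<lambda>n. (\<Sum>k. (pos_eigs n (B n) k)\<^sup>2 + (neg_eigs n (B n) k)\<^sup>2) / (real n)\<^sup>2) \<longlonglongrightarrow> \<gamma>2t
        \<longrightarrow>
        (\<forall>k. x' k \<ge> 0 \<and> x'' k \<le> 0) \<and>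
        summable (\<lambda>k. (x' k)\<^sup>2 + (x'' k)\<^sup>2) \<and>
        (\<forall>a. convergent_prod (\<lambda>k. F_factor (x' k) a) \<and>
             convergent_prod (\<lambda>k. F_factor (x'' k) a)) \<and>
        (\<exists>N. ergodic_measure N \<and>
             weakly_converges (\<lambda>n. embed_measure_H (M n)) N \<and>
             (\<forall>n. \<forall>A\<in>herm n. char_fun N A =
                (\<Prod>a\<in>#spec_mset n A.
                   F_fun \<gamma>1 (\<gamma>2t - (\<Sum>k. (x' k)\<^sup>2 + (x'' k)\<^sup>2)) x' x'' a)))) \<and>
     ((\<exists>N. borel_prob_on_H N \<and> weakly_converges (\<lambda>n. embed_measure_H (M n)) N) \<longrightarrow>
        (\<forall>k. convergent (\<lambda>n. pos_eigs n (B n) k / real n)) \<and>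
        (\<forall>k. convergent (\<lambda>n. neg_eigs n (B n) k / real n)) \<and>
        convergent (\<lambda>n. inf_trace (B n) / of_nat n) \<and>
        convergent (\<lambda>n. inf_trace (inf_mult (B n) (B n)) / (of_nat n)\<^sup>2))"
proof -
  have orb: "orbital n (\<Omega> n) (M n) (B n)" if "n \<ge> 1" for n
    by (rule orbital.intro[OF that orbital[OF that] pick[OF that]])
  have herm: "B n \<in> herm n" if "n \<ge> 1" for n by (rule orbital.orbit_spec(1)[OF orb[OF that] pick[OF that]])
  \<comment> \<open>This includes \<open>n = 0\<close>, where division by zero makes both sides
    0.\<close>
  have p1: "psum 1 (scaled_spec n (B n)) = (\<Sum>k. pos_eigs n (B n) k + neg_eigs n (B n) k) / real n" for n
    using psum_scaled[of 1 n "B n"] by (simp only: power_one_right order_refl)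
  have p2: "psum 2 (scaled_spec n (B n)) = (\<Sum>k. (pos_eigs n (B n) k)\<^sup>2 + (neg_eigs n (B n) k)\<^sup>2) / (real n)\<^sup>2" for n
    by (rule psum_scaled) simp
  show ?thesis
  proof (intro conjI allI impI)
    fix n :: nat assume n: "1 \<le> n"
    show "\<forall>C\<in>\<Omega> n. spec_mset n C = spec_mset n (B n)" using orbital.orbit_spec(2)[OF orb[OF n]] by blast
    show "of_real (\<Sum>k. pos_eigs n (B n) k + neg_eigs n (B n) k) = inf_trace (B n)"
      using psum_scaled_trace(1)[OF herm[OF n]] n unfolding p1 by (simp add: field_simps)
    show "of_real (\<Sum>k. (pos_eigs n (B n) k)\<^sup>2 + (neg_eigs n (B n) k)\<^sup>2) = inf_trace (inf_mult (B n) (B n))"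
      using psum_scaled_trace(2)[OF herm[OF n]] n unfolding p2 by (simp only: of_real_divide of_real_power of_real_of_nat_eq) simp
  next
    fix x' x'' :: "nat \<Rightarrow> real" and \<gamma>1 \<gamma>2t :: real
    assume h: "(\<forall>k. (\<lambda>n. pos_eigs n (B n) k / real n) \<longlonglongrightarrow> x' k) \<and>
      (\<forall>k. (\<lambda>n. neg_eigs n (B n) k / real n) \<longlonglongrightarrow> x'' k) \<and>
      (\<lambda>n. (\<Sum>k. pos_eigs n (B n) k + neg_eigs n (B n) k) / real n) \<longlonglongrightarrow> \<gamma>1 \<and>
      (\<lambda>n. (\<Sum>k. (pos_eigs n (B n) k)\<^sup>2 + (neg_eigs n (B n) k)\<^sup>2) / (real n)\<^sup>2) \<longlonglongrightarrow> \<gamma>2t"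
    have x: "\<And>k. (\<lambda>n. pos_eigs n (B n) k / real n) \<longlonglongrightarrow> x' k" "\<And>k. (\<lambda>n. neg_eigs n (B n) k / real n) \<longlonglongrightarrow> x'' k"
      using h by blast+
    have g: "(\<lambda>n. psum 1 (scaled_spec n (B n))) \<longlonglongrightarrow> \<gamma>1" "(\<lambda>n. psum 2 (scaled_spec n (B n))) \<longlonglongrightarrow> \<gamma>2t"
      unfolding p1 p2 using h by blast+
    note lim = char_mset_limit[OF x g]
    show "x' k \<ge> 0" "x'' k \<le> 0" for k by (rule lim)+
    show "summable (\<lambda>k. (x' k)\<^sup>2 + (x'' k)\<^sup>2)" by (rule summable_add[OF lim(3,4)])
    show "convergent_prod (\<lambda>k. F_factor (x' k) a)" for a by (rule F_factor_prodinf(1)[OF lim(5) lim(3)])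
    show "convergent_prod (\<lambda>k. F_factor (x'' k) a)" for a by (rule F_factor_prodinf(1)[OF lim(6) lim(4)])
    show "\<exists>N. ergodic_measure N \<and> weakly_converges (\<lambda>n. embed_measure_H (M n)) N \<and>
      (\<forall>n. \<forall>A\<in>herm n. char_fun N A =
        (\<Prod>a\<in>#spec_mset n A. F_fun \<gamma>1 (\<gamma>2t - (\<Sum>k. (x' k)\<^sup>2 + (x'' k)\<^sup>2)) x' x'' a))"
      by (rule orbital_realization[OF orb x g])
  next
    assume "\<exists>N. borel_prob_on_H N \<and> weakly_converges (\<lambda>n. embed_measure_H (M n)) N"
    then obtain N where N: "borel_prob_on_H N" "weakly_converges (\<lambda>n. embed_measure_H (M n)) N" by blast
    have lim: "convergent (\<lambda>n. pos_eigs n (B n) k / real n)" "convergent (\<lambda>n. neg_eigs n (B n) k / real n)"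
      "convergent (\<lambda>n. psum 1 (scaled_spec n (B n)))" "convergent (\<lambda>n. psum 2 (scaled_spec n (B n)))" for k
      by (rule orbital_limits_exist[OF orb N], assumption)+
    show "convergent (\<lambda>n. pos_eigs n (B n) k / real n)" "convergent (\<lambda>n. neg_eigs n (B n) k / real n)" for k
      by (rule lim)+
    show "convergent (\<lambda>n. inf_trace (B n) / of_nat n)"
      by (rule convergent_of_real_eventually[OF lim(3) psum_scaled_trace(1)[OF herm]])
    show "convergent (\<lambda>n. inf_trace (inf_mult (B n) (B n)) / (of_nat n)\<^sup>2)"
      by (rule convergent_of_real_eventually[OF lim(4) psum_scaled_trace(2)[OF herm]])
  qed
qed

end
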